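(* If $\Gamma\subset\mathsf{PSL}(2,\mathbb R)$ is a geometrically finite Fuchsian group, $\phi\in(\mathfrak a^* )^+$ and $\rho:\Gamma\to\mathsf{PSL}(d,\mathbb R)$ is a Hitchin representation, then $$\delta^\phi(\rho)=h^\phi(\rho).$$
   Context: A Fuchsian group is a discrete (non-elementary) subgroup $\Gamma\subset\mathsf{PSL}(2,\mathbb R)$, with limit set $\Lambda(\Gamma)\subset\partial\mathbb H^2$; it is geometrically finite iff it is finitely generated. Lie theory. $\mathfrak a=\{\mathrm{diag}(A_1,\dots,A_d):A_i\in\mathbb R,\ \sum A_i=0\}$, $\alpha_i(A)=A_i-A_{i+1}$, and $(\mathfrak a^* )^+=\{\phi=\sum_{j}c_j\alpha_j:\phi\ne0,\ c_j\ge0\ \forall j\}$. For $g\in\mathsf{PGL}(d,\mathbb R)$ and a lift of determinant $\pm1$, let $\sigma_1(g)\ge\dots\ge\sigma_d(g)$ be its singular values and $\lambda_1(g)\ge\dots\ge\lambda_d(g)$ the moduli of its generalized eigenvalues; $\kappa(g)=\mathrm{diag}(\log\sigma_i(g))$ and $\nu(g)=\mathrm{diag}(\log\lambda_i(g))$. Then $\delta^\phi(\rho)=\inf\{s:\sum_{g\in\rho(\Gamma)}e^{-s\phi(\kappa(g))}<\infty\}$ and $$h^\phi(\rho)=\limsup_{T\to\infty}\frac1T\log\#\{[\gamma]\in[\Gamma_{hyp}]:\phi(\nu(\rho(\gamma)))\le T\},$$ where $[\Gamma_{hyp}]$ is the set of $\Gamma$-conjugacy classes of hyperbolic elements of $\Gamma$.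 Hitchin representations. $\mathcal F$ is the space of complete flags in $\mathbb R^d$. For a transverse pair of flags $(F_1,F_2)$, an ordered basis $\mathcal B=(b_1,\dots,b_d)$ of $\mathbb R^d$ is compatible with $(F_1,F_2)$ if $b_i\in F_1^i\cap F_2^{d-i+1}$ for all $i$. $U_{>0}(\mathcal B)\subset\mathsf{SL}(d,\mathbb R)$ is the set of unipotent elements which in the basis $\mathcal B$ are upper triangular with all minors, except those forced to be $0$ by upper triangularity, strictly positive. A tuple $(F_1,\dots,F_k)$ in $\mathcal F$ is positive if there are an ordered basis $\mathcal B$ compatible with $(F_1,F_k)$ and $u_2,\dots,u_{k-1}\in U_{>0}(\mathcal B)$ with $F_i=u_{k-1}\cdots u_iF_k$ for $i=2,\dots,k-1$. A map $\xi:X\to\mathcal F$ with $X\subset\partial\mathbb H^2$ is positive if $(\xi(x_1),\dots,\xi(x_n))$ is positive for every cyclically ordered tuple of distinct points of $X$. $\rho:\Gamma\to\mathsf{PSL}(d,\mathbb R)$ is Hitchin if there is a continuous, positive, $\rho$-equivariant map $\xi:\Lambda(\Gamma)\to\mathcal F$. *)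

theory Defs
  imports
    "Jordan_Normal_Form.DL_Submatrix"
    "Jordan_Normal_Form.Determinant"
    "HOL-Algebra.Generated_Groups"
    "HOL-Analysis.Analysis"
begin

text \<open>
  Matrices are elements of \<open>real^'n^'n\<close>, so the dimension \<open>d\<close> is \<open>CARD('n)\<close>.
  Everything indexed by \<open>1, \<dots>, d\<close> in the mathematics is indexed here by \<open>0, \<dots>, d - 1\<close>, except
  for the members \<open>F i\<close> of a flag, whose index is their dimension.  \<open>Jordan_Normal_Form\<close> matrices
  are used only for minors; unqualified \<open>det\<close> and \<open>mat\<close> are the ones of \<open>HOL-Analysis\<close>.
\<close>

no_notation vec_index (infixl "$" 100)

subsection \<open>Quotient topologies\<close>

definition quotient_topology :: "'a topology \<Rightarrow> ('a \<Rightarrow> 'b) \<Rightarrow> 'b topology" where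
  "quotient_topology X f =
     topology (\<lambda>U. U \<subseteq> f ` topspace X \<and> openin X {x \<in> topspace X. f x \<in> U})"

lemma openin_quotient_topology:
  "openin (quotient_topology X f) U \<longleftrightarrow>
     U \<subseteq> f ` topspace X \<and> openin X {x \<in> topspace X. f x \<in> U}"
proof -
  let ?P = "\<lambda>U. U \<subseteq> f ` topspace X \<and> openin X {x \<in> topspace X. f x \<in> U}"
  have "istopology ?P"
    unfolding istopology_def
  proof (intro conjI allI impI)
    fix S T assume ST: "?P S" "?P T"
    then show "S \<inter> T \<subseteq> f ` topspace X" by blast
    have "{x \<in> topspace X. f x \<in> S \<inter> T} =
          {x \<in> topspace X. f x \<in> S} \<inter> {x \<in> topspace X. f x \<in> T}" by blast
    then show "openin X {x \<in> topspace X. f x \<in> S \<inter> T}"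
      using ST by (simp only:) (blast intro: openin_Int)
  next
    fix K assume K: "\<forall>S\<in>K. ?P S"
    then show "\<Union>K \<subseteq> f ` topspace X" by blast
    have "{x \<in> topspace X. f x \<in> \<Union>K} = \<Union>((\<lambda>S. {x \<in> topspace X. f x \<in> S}) ` K)" by blast
    then show "openin X {x \<in> topspace X. f x \<in> \<Union>K}"
      using K by (simp only:) (blast intro: openin_Union)
  qed
  then show ?thesis
    by (simp add: quotient_topology_def topology_inverse')
qed

subsection \<open>The groups \<open>PSL(d,\<real>)\<close>\<close>

definition SL :: "(real^'n^'n) monoid" where
  "SL = \<lparr>carrier = {A. det A = 1}, mult = (**), one = mat 1\<rparr>"

definition SL_center :: "(real^'n^'n) set" where
  "SL_center = {A \<in> carrier SL. A = mat 1 \<or> A = - mat 1}"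

text \<open>The elements of \<open>PSL\<close> are cosets, i.e. sets of matrices: the lifts of \<open>g\<close> are its elements.\<close>

definition PSL :: "(real^'n^'n) set monoid" where
  "PSL = SL Mod SL_center"

definition psl_lift :: "(real^'n^'n) set \<Rightarrow> real^'n^'n" where
  "psl_lift g = (SOME A. A \<in> g)"

definition PSL_topology :: "(real^'n^'n) set topology" where
  "PSL_topology = quotient_topology (top_of_set (carrier SL)) (\<lambda>A. SL_center #>\<^bsub>SL\<^esub> A)"

subsection \<open>Fuchsian groups\<close>

text \<open>
  The hyperbolic plane is \<open>ball 0 1\<close> in \<open>\<complex>\<close>, its boundary is \<open>sphere 0 1\<close>.  A real matrix of
  determinant 1 acts on the upper half plane by its Moebius transformation, hence on the closed
  disc after conjugation by the Cayley transform \<open>z \<mapsto> (z - \<i>) / (z + \<i>)\<close>.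
\<close>

definition moebius :: "complex^2^2 \<Rightarrow> complex \<Rightarrow> complex" where
  "moebius M z = (M $ 1 $ 1 * z + M $ 1 $ 2) / (M $ 2 $ 1 * z + M $ 2 $ 2)"

definition cayley :: "complex^2^2" where
  "cayley = vector [vector [1, - \<i>], vector [1, \<i>]]"

definition disc_act :: "(real^2^2) set \<Rightarrow> complex \<Rightarrow> complex" where
  "disc_act g = moebius (cayley ** (\<chi> i j. complex_of_real (psl_lift g $ i $ j)) ** matrix_inv cayley)"

definition limit_set :: "(real^2^2) set set \<Rightarrow> complex set" where
  "limit_set \<Gamma> = {x \<in> sphere 0 1. x islimpt (\<lambda>g. disc_act g 0) ` \<Gamma>}"

definition elementary :: "(real^2^2) set set \<Rightarrow> bool" where
  "elementary \<Gamma> \<longleftrightarrow> (\<exists>z\<in>cball 0 1. finite ((\<lambda>g. disc_act g z) ` \<Gamma>))"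

definition fuchsian :: "(real^2^2) set set \<Rightarrow> bool" where
  "fuchsian \<Gamma> \<longleftrightarrow>
     subgroup \<Gamma> PSL \<and> subtopology PSL_topology \<Gamma> = discrete_topology \<Gamma> \<and> \<not> elementary \<Gamma>"

text \<open>For Fuchsian groups, geometric finiteness is the same as finite generation.\<close>

definition geometrically_finite :: "(real^2^2) set set \<Rightarrow> bool" where
  "geometrically_finite \<Gamma> \<longleftrightarrow> (\<exists>S. finite S \<and> S \<subseteq> carrier PSL \<and> \<Gamma> = generate PSL S)"

definition hyperbolic :: "(real^2^2) set \<Rightarrow> bool" where
  "hyperbolic g \<longleftrightarrow> \<bar>trace (psl_lift g)\<bar> > 2"

definition conj_class :: "(real^2^2) set set \<Rightarrow> (real^2^2) set \<Rightarrow> (real^2^2) set set" where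
  "conj_class \<Gamma> g = (\<lambda>h. h \<otimes>\<^bsub>PSL\<^esub> g \<otimes>\<^bsub>PSL\<^esub> inv\<^bsub>PSL\<^esub> h) ` \<Gamma>"

subsection \<open>Cartan and Jordan projections\<close>

text \<open>A diagonal matrix is given by the sequence of its diagonal entries, extended by 0.\<close>

definition cartan_subspace :: "nat \<Rightarrow> (nat \<Rightarrow> real) set" where
  "cartan_subspace d = {A. (\<forall>i\<ge>d. A i = 0) \<and> (\<Sum>i<d. A i) = 0}"

definition simple_root :: "nat \<Rightarrow> (nat \<Rightarrow> real) \<Rightarrow> real" where
  "simple_root i A = A i - A (Suc i)"

text \<open>Only the values of a functional on \<^const>\<open>cartan_subspace\<close> matter.\<close>

definition positive_functionals :: "nat \<Rightarrow> ((nat \<Rightarrow> real) \<Rightarrow> real) set" where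
  "positive_functionals d = {\<phi>.
     (\<exists>c. (\<forall>j<d - 1. c j \<ge> 0) \<and>
        (\<forall>A\<in>cartan_subspace d. \<phi> A = (\<Sum>j<d - 1. c j * simple_root j A))) \<and>
     (\<exists>A\<in>cartan_subspace d. \<phi> A \<noteq> 0)}"

definition charpoly :: "'a::comm_ring_1^'n^'n \<Rightarrow> 'a poly" where
  "charpoly A = det (\<chi> i j. (if i = j then [:0, 1:] else 0) - [:A $ i $ j:])"

text \<open>
  Eigenvalues are counted with algebraic multiplicity, as the multiset of roots of the
  characteristic polynomial; the lists below have length \<open>CARD('n)\<close> and are decreasing.
\<close>

definition singular_values :: "real^'n^'n \<Rightarrow> real list" where
  "singular_values A =
     rev (sorted_list_of_multiset (image_mset sqrt (proots (charpoly (transpose A ** A)))))"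

definition eigenvalue_moduli :: "real^'n^'n \<Rightarrow> real list" where
  "eigenvalue_moduli A =
     rev (sorted_list_of_multiset
       (image_mset cmod (proots (charpoly (\<chi> i j. complex_of_real (A $ i $ j))))))"

definition cartan_proj :: "(real^'n^'n) set \<Rightarrow> nat \<Rightarrow> real" where
  "cartan_proj g i = (if i < CARD('n) then ln (singular_values (psl_lift g) ! i) else 0)"

definition jordan_proj :: "(real^'n^'n) set \<Rightarrow> nat \<Rightarrow> real" where
  "jordan_proj g i = (if i < CARD('n) then ln (eigenvalue_moduli (psl_lift g) ! i) else 0)"

subsection \<open>Flags and positivity\<close>

type_synonym 'n flag = "nat \<Rightarrow> (real^'n) set"

text \<open>\<open>F i = UNIV\<close> for all \<open>i \<ge> CARD('n)\<close>, so that a flag is a unique such function.\<close>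

definition flags :: "'n::finite flag set" where
  "flags = {F. (\<forall>i. subspace (F i) \<and> dim (F i) = min i CARD('n)) \<and> mono F}"

definition flag_act :: "real^'n^'n \<Rightarrow> 'n flag \<Rightarrow> 'n flag" where
  "flag_act A F = (\<lambda>i. (\<lambda>v. A *v v) ` F i)"

definition ordered_basis :: "(nat \<Rightarrow> real^'n) \<Rightarrow> bool" where
  "ordered_basis b \<longleftrightarrow> inj_on b {..<CARD('n)} \<and> independent (b ` {..<CARD('n)})"

definition flag_of_basis :: "(nat \<Rightarrow> real^'n) \<Rightarrow> 'n flag" where
  "flag_of_basis b = (\<lambda>i. span (b ` {..<min i CARD('n)}))"

text \<open>
  The manifold topology of the flag variety \<open>GL(d,\<real>)/B\<close>, as a quotient of the space of ordered
  bases.  The entries \<open>b i\<close> with \<open>i \<ge> CARD('n)\<close> are unconstrained and do not affect the quotient.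
\<close>

definition flag_topology :: "'n::finite flag topology" where
  "flag_topology = quotient_topology (top_of_set {b. ordered_basis b}) flag_of_basis"

definition transverse :: "'n::finite flag \<Rightarrow> 'n flag \<Rightarrow> bool" where
  "transverse F1 F2 \<longleftrightarrow> (\<forall>i\<le>CARD('n). F1 i \<inter> F2 (CARD('n) - i) = {0})"

definition compatible :: "(nat \<Rightarrow> real^'n) \<Rightarrow> 'n flag \<Rightarrow> 'n flag \<Rightarrow> bool" where
  "compatible b F1 F2 \<longleftrightarrow> transverse F1 F2 \<and> ordered_basis b \<and>
     (\<forall>i<CARD('n). b i \<in> F1 (Suc i) \<inter> F2 (CARD('n) - i))"

definition matrix_in_basis :: "(nat \<Rightarrow> real^'n) \<Rightarrow> real^'n^'n \<Rightarrow> real mat" where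
  "matrix_in_basis b A = Matrix.mat CARD('n) CARD('n)
     (\<lambda>(i, j). representation (b ` {..<CARD('n)}) (A *v b j) (b i))"

definition unipotent :: "real^'n^'n \<Rightarrow> bool" where
  "unipotent A \<longleftrightarrow> (\<exists>k. ((\<lambda>v. (A - mat 1) *v v) ^^ k) = (\<lambda>v. 0))"

definition minor :: "real mat \<Rightarrow> nat set \<Rightarrow> nat set \<Rightarrow> real" where
  "minor M I J = Determinant.det (submatrix M I J)"

text \<open>The minors which vanish on all upper triangular matrices.\<close>

definition forced_zero :: "nat \<Rightarrow> nat set \<Rightarrow> nat set \<Rightarrow> bool" where
  "forced_zero d I J \<longleftrightarrow> (\<forall>N\<in>carrier_mat d d. upper_triangular N \<longrightarrow> minor N I J = 0)"

definition U_pos :: "(nat \<Rightarrow> real^'n) \<Rightarrow> (real^'n^'n) set" where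
  "U_pos b = {u \<in> carrier SL. unipotent u \<and> upper_triangular (matrix_in_basis b u) \<and>
     (\<forall>I J. I \<subseteq> {..<CARD('n)} \<and> J \<subseteq> {..<CARD('n)} \<and> card I = card J \<and> \<not> forced_zero CARD('n) I J
        \<longrightarrow> minor (matrix_in_basis b u) I J > 0)}"

text \<open>
  For \<open>k\<close> flags \<open>F\<^sub>0, \<dots>, F\<^sub>k\<^sub>-\<^sub>1\<close> the fold expresses \<open>F\<^sub>i = u\<^sub>k\<^sub>-\<^sub>2 \<cdots> u\<^sub>i F\<^sub>k\<^sub>-\<^sub>1\<close>.
\<close>

definition positive_tuple :: "'n::finite flag list \<Rightarrow> bool" where
  "positive_tuple Fs \<longleftrightarrow> (let k = length Fs in k \<ge> 2 \<and> set Fs \<subseteq> flags \<and>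
     (\<exists>b u. compatible b (Fs ! 0) (Fs ! (k - 1)) \<and>
        (\<forall>i\<in>{1..<k - 1}. u i \<in> U_pos b) \<and>
        (\<forall>i\<in>{1..<k - 1}. Fs ! i = fold (\<lambda>j. flag_act (u j)) [i..<k - 1] (Fs ! (k - 1)))))"

definition cyclically_ordered :: "complex list \<Rightarrow> bool" where
  "cyclically_ordered xs \<longleftrightarrow> (\<exists>ts. xs = map cis ts \<and> sorted_wrt (<) ts \<and>
     (\<forall>s\<in>set ts. \<forall>t\<in>set ts. t < s + 2 * pi))"

definition positive_map :: "complex set \<Rightarrow> (complex \<Rightarrow> 'n::finite flag) \<Rightarrow> bool" where
  "positive_map X \<xi> \<longleftrightarrow>
     (\<forall>xs. length xs \<ge> 2 \<and> set xs \<subseteq> X \<and> cyclically_ordered xs \<longrightarrow> positive_tuple (map \<xi> xs))"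

definition hitchin :: "(real^2^2) set set \<Rightarrow> ((real^2^2) set \<Rightarrow> (real^'n^'n) set) \<Rightarrow> bool" where
  "hitchin \<Gamma> \<rho> \<longleftrightarrow> \<rho> \<in> hom (PSL\<lparr>carrier := \<Gamma>\<rparr>) PSL \<and>
     (\<exists>\<xi> :: complex \<Rightarrow> 'n flag.
        continuous_map (top_of_set (limit_set \<Gamma>)) flag_topology \<xi> \<and>
        positive_map (limit_set \<Gamma>) \<xi> \<and>
        (\<forall>g\<in>\<Gamma>. \<forall>x\<in>limit_set \<Gamma>. \<xi> (disc_act g x) = flag_act (psl_lift (\<rho> g)) (\<xi> x)))"

subsection \<open>Critical exponent and entropy\<close>

definition critical_exponent ::
  "((nat \<Rightarrow> real) \<Rightarrow> real) \<Rightarrow> (real^2^2) set set \<Rightarrow> ((real^2^2) set \<Rightarrow> (real^'n^'n) set) \<Rightarrow> ereal" where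
  "critical_exponent \<phi> \<Gamma> \<rho> =
     Inf (ereal ` {s. (\<lambda>g. exp (- s * \<phi> (cartan_proj g))) summable_on (\<rho> ` \<Gamma>)})"

text \<open>The logarithm of the number of elements of a set, with \<open>log 0 = -\<infinity>\<close> and \<open>log \<infinity> = \<infinity>\<close>.\<close>

definition log_card :: "'a set \<Rightarrow> ereal" where
  "log_card S = (if infinite S then \<infinity> else if S = {} then -\<infinity> else ereal (ln (card S)))"

definition entropy ::
  "((nat \<Rightarrow> real) \<Rightarrow> real) \<Rightarrow> (real^2^2) set set \<Rightarrow> ((real^2^2) set \<Rightarrow> (real^'n^'n) set) \<Rightarrow> ereal" where
  "entropy \<phi> \<Gamma> \<rho> = Limsup at_top (\<lambda>T::real.
     log_card (conj_class \<Gamma> ` {g \<in> \<Gamma>. hyperbolic g \<and> \<phi> (jordan_proj (\<rho> g)) \<le> T}) / ereal T)"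

end

theory Submission
  imports Defs
begin

text \<open>
  Call a hyperbolic element of \<open>\<Gamma>\<close> separated if its axis passes within a fixed distance of the base
  point. For separated \<open>\<gamma>\<close> the flags at its two fixed points form a transverse pair in a compact set,
  hence have a compatible basis of bounded distortion, which diagonalizes \<open>\<rho>(\<gamma>)\<close>. So
  \<open>\<phi>(\<kappa>(\<rho>(\<gamma>)))\<close> and \<open>\<phi>(\<nu>(\<rho>(\<gamma>)))\<close> differ by a bounded amount. Right multiplication by an element of a
  finite set makes every element of \<open>\<Gamma>\<close> separated and changes \<open>\<phi>(\<kappa>(\<rho>(\<gamma>)))\<close> by a bounded amount. As \<open>\<Gamma>\<close> is
  finitely generated, every hyperbolic element is conjugate to a separated one.

  It remains to bound the number of separated elements in the conjugacy class of \<open>\<gamma>\<close>. They correspond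
  to the translates of a pair of fixed points which lie well inside one period of \<open>\<gamma>\<close> on an arc between its
  fixed points. For flags along this arc, the \<open>j\<close>-th superdiagonal entry of the unipotent matrix given by
  positivity is increasing. It is multiplied by \<open>\<lambda>\<^sub>j / \<lambda>\<^sub>j\<^sub>+\<^sub>1\<close> along a period, and by a factor bounded away from 1
  between the points of each translated pair. So there are at most \<open>N (1 + \<alpha>\<^sub>j(\<nu>(\<rho>(\<gamma>))))\<close> separated conjugates.
  Choosing \<open>j\<close> such that \<open>\<alpha>\<^sub>j\<close> has a positive coefficient in \<open>\<phi>\<close>, this is at most linear in \<open>\<phi>(\<nu>(\<rho>(\<gamma>)))\<close>,
  and such a factor does not affect exponents.
\<close>

text \<open>The group may contain parabolic elements, so its action need not be cocompact, and for a
  general element \<open>\<phi>(\<kappa>)\<close> and \<open>\<phi>(\<nu>)\<close> are not close.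
  Compactness is available only for pairs of boundary points whose geodesic passes near the base
  point, up to scaling of their representatives. This is why every estimate is routed through
  separated elements.

  A conjugacy class contains roughly as many separated elements as its axis is long. No comparison
  between translation length and \<open>\<phi>(\<nu>)\<close> is established, so the multiplicity is
  measured by the representation itself: the logarithm of the superdiagonal entry is a coordinate
  along the axis in which one period has length \<open>\<alpha>\<^sub>j(\<nu>)\<close>.

  Finite generation enters where an axis has the whole orbit of the base point on one side, so that
  no translate of the axis is forced to come near the base point. Such axes are finite in number up
  to the group because they produce independent homomorphisms to the reals.

  Boundary points are represented by nonzero plane vectors and angles by \<open>det2\<close>. Lifts
  to matrices are determined only up to sign, so the notions used are insensitive to signs.\<close>

subsection \<open>Singular values and eigenvalue moduli\<close>

no_notation Matrix.scalar_prod (infix "\<bullet>" 70)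

definition diagm :: "('n \<Rightarrow> 'a::zero) \<Rightarrow> 'a^'n^'n" where
  "diagm l = (\<chi> i j. if i = j then l i else 0)"

text \<open>The intertwining relation lifts to polynomial matrices as
  \<open>(X - c A) ** c P = c P ** (X - c D)\<close>, and \<open>det (c P)\<close> is a unit with
  inverse \<open>det (c Q)\<close>. Multiplying by this unit avoids division in
  \<open>'a poly\<close>, so the real and the complex case are one lemma.\<close>

lemma charpoly_similar:
  fixes A D P Q :: "'a::comm_ring_1^'n^'n"
  assumes "A ** P = P ** D" "P ** Q = mat 1"
  shows "charpoly A = charpoly D"
proof -
  define c :: "'a^'n^'n \<Rightarrow> 'a poly^'n^'n" where "c = (\<lambda>X. \<chi> i j. [:X $ i $ j:])"
  define X :: "'a poly^'n^'n" where "X = mat [:0, 1:]"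
  have const_sum: "[:sum f S:] = (\<Sum>k\<in>S. [:f k:])" for f :: "'n \<Rightarrow> 'a" and S
  proof (induction S rule: infinite_finite_induct)
    case (insert x F)
    have "[:sum f (insert x F):] = [:f x:] + [:sum f F:]"
      unfolding sum.insert[OF insert.hyps] by simp
    then show ?case unfolding sum.insert[OF insert.hyps] insert.IH .
  qed auto
  have c_mult: "c (M ** N) = c M ** c N" for M N
    by (simp add: c_def matrix_matrix_mult_def vec_eq_iff const_sum mult.commute)
  have ch: "charpoly M = det (X - c M)" for M
    unfolding charpoly_def
    by (rule arg_cong[of _ _ det]) (auto simp: X_def c_def mat_def vec_eq_iff)
  have X_comm: "X ** M = M ** X" for M
    by (simp add: X_def matrix_matrix_mult_def mat_def vec_eq_iff if_distrib if_distribR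
        sum.delta sum.delta' mult.commute cong: if_cong)
  have diff_l: "(M - N) ** K = M ** K - N ** K" and diff_r: "K ** (M - N) = K ** M - K ** N"
    for M N K :: "'a poly^'n^'n"
    by (simp_all add: matrix_matrix_mult_def vec_eq_iff left_diff_distrib right_diff_distrib sum_subtractf)
  have "(X - c A) ** c P = c P ** (X - c D)"
    using X_comm[of "c P"] c_mult[of A P] c_mult[of P D] assms(1)
    by (simp add: diff_l diff_r)
  then have eq: "det (X - c A) * det (c P) = det (c P) * det (X - c D)"
    by (metis det_mul)
  have "c (mat 1) = mat 1"
    by (auto simp: c_def mat_def vec_eq_iff one_pCons)
  then have one: "det (c P) * det (c Q) = 1"
    by (metis assms(2) c_mult det_I det_mul)
  have "charpoly A = det (X - c A) * (det (c P) * det (c Q))" by (simp add: ch one)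
  also have "\<dots> = (det (c P) * det (c Q)) * det (X - c D)"
    by (simp add: mult.assoc[symmetric] eq)
  finally show ?thesis by (simp add: ch one)
qed

lemma charpoly_diagm: "charpoly (diagm l :: 'a::comm_ring_1^'n^'n) = (\<Prod>i\<in>UNIV. [:- l i, 1:])"
proof -
  have "charpoly (diagm l) = (\<Prod>i\<in>UNIV. ((\<chi> i j. (if i = j then [:0, 1:] else 0) - [:diagm l $ i $ j:]) :: 'a poly^'n^'n) $ i $ i)"
    unfolding charpoly_def by (rule det_diagonal) (simp add: diagm_def)
  then show ?thesis by (simp add: diagm_def)
qed

lemma proots_charpoly_similar:
  fixes A P Q :: "'a::idom^'n^'n"
  assumes "A ** P = P ** diagm l" "P ** Q = mat 1"
  shows "proots (charpoly A) = image_mset l (mset_set UNIV)"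
proof -
  have "proots (charpoly A) = (\<Sum>i\<in>UNIV. {#l i#})"
    unfolding charpoly_similar[OF assms] charpoly_diagm by (subst proots_prod) auto
  also have "\<dots> = image_mset l (mset_set UNIV)"
    using sum_unfold_sum_mset by (metis image_mset.compositionality sum_mset_singleton_mset) 
  finally show ?thesis .
qed

text \<open>Rayleigh's argument: a unit vector of \<open>W\<close> maximizing
  \<open>x \<bullet> (A *v x)\<close> is an eigenvector, and its orthogonal complement in
  \<open>W\<close> is again invariant. Arbitrary invariant subspaces are allowed so that the
  induction on the dimension can pass to this complement.\<close>

lemma symmetric_eigenbasis_subspace:
  fixes A :: "real^'n^'n"
  assumes sym: "transpose A = A"
  assumes "subspace W" "\<And>x. x \<in> W \<Longrightarrow> A *v x \<in> W" "dim W = k"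
  shows "\<exists>B. B \<subseteq> W \<and> finite B \<and> card B = k \<and> (\<forall>v\<in>B. norm v = 1 \<and> (\<exists>m. A *v v = m *\<^sub>R v)) \<and>
     pairwise orthogonal B"
  using assms(2-)
proof (induction k arbitrary: W)
  case 0
  then show ?case by (intro exI[of _ "{}"]) auto
next
  case (Suc k)
  have selfadj: "(A *v x) \<bullet> y = x \<bullet> (A *v y)" for x y
    by (metis dot_lmul_matrix inner_commute sym transpose_matrix_vector)
  let ?S = "sphere 0 1 \<inter> W"
  have "compact ?S" using closed_subspace[OF Suc.prems(1)] by (simp add: compact_Int_closed)
  moreover have "?S \<noteq> {}"
  proof -
    from Suc.prems(3) obtain x where "x \<in> W" "x \<noteq> 0"
      by (metis dim_eq_0 nat.distinct(1) subsetI singleton_iff)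
    then have "(1 / norm x) *\<^sub>R x \<in> ?S" using Suc.prems(1) by (simp add: subspace_scale)
    then show ?thesis by blast
  qed
  moreover have "continuous_on ?S (\<lambda>x. x \<bullet> (A *v x))" by (intro continuous_intros matrix_vector_mult_linear_continuous_on)
  ultimately obtain v where v: "v \<in> ?S" "\<And>x. x \<in> ?S \<Longrightarrow> x \<bullet> (A *v x) \<le> v \<bullet> (A *v v)"
    using continuous_attains_sup[of ?S "\<lambda>x. x \<bullet> (A *v x)"] by blast
  define m where "m = v \<bullet> (A *v v)"
  have psd: "0 \<le> m * (x \<bullet> x) - x \<bullet> (A *v x)" if "x \<in> W" for x
  proof (cases "x = 0")
    case False
    let ?y = "(1 / norm x) *\<^sub>R x"
    have "?y \<in> ?S" using Suc.prems(1) False that by (simp add: subspace_scale)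
    from v(2)[OF this] have "(x \<bullet> (A *v x)) / (norm x)\<^sup>2 \<le> m"
      by (simp add: m_def matrix_vector_mult_scaleR power2_eq_square)
    then show ?thesis using False by (simp add: divide_simps power2_norm_eq_inner algebra_simps split: if_splits)
  qed simp
  have vn: "v \<bullet> v = 1" using v(1) by (simp add: norm_eq_1)
  \<comment> \<open>Half the gradient at \<open>v\<close> of the form
    \<open>m * (x \<bullet> x) - x \<bullet> (A *v x)\<close>. This form is nonnegative on
    \<open>W\<close> and vanishes at \<open>v\<close>, so its gradient there must vanish.\<close>
  define g where "g = m *\<^sub>R v - A *v v"
  have gW: "g \<in> W" unfolding g_def using v(1) Suc.prems(1,2) by (simp add: subspace_diff subspace_scale)
  have "g \<bullet> g = 0"
  proof (rule ccontr)
    assume gn: "g \<bullet> g \<noteq> 0"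
    have key: "0 \<le> 2 * t * (g \<bullet> g) + t\<^sup>2 * (m * (g \<bullet> g) - g \<bullet> (A *v g))" for t
    proof -
      have "v + t *\<^sub>R g \<in> W" using gW v(1) Suc.prems(1) by (simp add: subspace_add subspace_scale)
      from psd[OF this]
      have "0 \<le> m * (v \<bullet> v) - v \<bullet> (A *v v) + 2 * t * (m * (v \<bullet> g) - g \<bullet> (A *v v))
          + t\<^sup>2 * (m * (g \<bullet> g) - g \<bullet> (A *v g))"
        using selfadj[of v g]
        by (simp add: algebra_simps inner_commute power2_eq_square inner_add_left inner_add_right
            matrix_vector_right_distrib)
      moreover have "m * (v \<bullet> v) - v \<bullet> (A *v v) = 0" by (simp add: vn m_def)
      moreover have "m * (v \<bullet> g) - g \<bullet> (A *v v) = g \<bullet> g"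
        by (subst (3) g_def) (simp add: inner_diff_right inner_commute)
      ultimately show ?thesis by (simp add: algebra_simps)
    qed
    define q where "q = m * (g \<bullet> g) - g \<bullet> (A *v g)"
    have gp: "g \<bullet> g > 0" using gn by simp
    have q0: "q \<ge> 0" unfolding q_def using psd[OF gW] .
    have "0 \<le> 2 * t * (g \<bullet> g) + t\<^sup>2 * q" for t using key[of t] by (simp add: q_def)
    \<comment> \<open>The minimum of the quadratic in \<open>t\<close> would need a division by
      \<open>q\<close>, which may be 0. With \<open>q + 1\<close> instead, the bracket
      \<open>2 - q / (q + 1)\<close> is still positive.\<close>
    from this[of "- (g \<bullet> g) / (q + 1)"]
    have "0 \<le> (- (g \<bullet> g) / (q + 1)) * ((g \<bullet> g) * (2 - q / (q + 1)))"
      by (simp add: algebra_simps power2_eq_square)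
    moreover have "(- (g \<bullet> g) / (q + 1)) * ((g \<bullet> g) * (2 - q / (q + 1))) < 0"
    proof (intro mult_neg_pos mult_pos_pos)
      show "- (g \<bullet> g) / (q + 1) < 0" using gp q0 by (intro divide_neg_pos) auto
      have "q / (q + 1) \<le> 1" using q0 by simp
      then show "0 < 2 - q / (q + 1)" by linarith
    qed (rule gp)
    ultimately show False by linarith
  qed
  then have Av: "A *v v = m *\<^sub>R v" by (simp add: g_def)
  let ?W = "W \<inter> {x. v \<bullet> x = 0}"
  have sub: "subspace ?W" using Suc.prems(1) subspace_hyperplane[of v] by (intro subspace_inter)
  have inv: "A *v x \<in> ?W" if "x \<in> ?W" for x
    using that Suc.prems(2) selfadj[of v x] Av by simp
  have "dim ?W = k"
  proof -
    have vW: "v \<in> W" using v(1) by simp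
    have "dim {x + y |x y. x \<in> W \<and> y \<in> {x. v \<bullet> x = 0}} + dim ?W = dim W + dim {x. v \<bullet> x = 0}"
      using dim_sums_Int[OF Suc.prems(1) subspace_hyperplane[of v]] .
    moreover have "{x + y |x y. x \<in> W \<and> y \<in> {x. v \<bullet> x = 0}} = UNIV"
    proof -
      have "z \<in> {x + y |x y. x \<in> W \<and> y \<in> {x. v \<bullet> x = 0}}" for z
      proof -
      have "(v \<bullet> z) *\<^sub>R v \<in> W" using vW Suc.prems(1) by (simp add: subspace_scale)
      moreover have "z - (v \<bullet> z) *\<^sub>R v \<in> {x. v \<bullet> x = 0}" by (simp add: inner_diff_right vn)
      moreover have "z = (v \<bullet> z) *\<^sub>R v + (z - (v \<bullet> z) *\<^sub>R v)" by simp
      ultimately show ?thesis by blast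
      qed
      then show ?thesis by blast
    qed
    moreover have "dim {x. v \<bullet> x = 0} = DIM(real^'n) - 1"
      using dim_hyperplane[of v] vn by force
    ultimately show ?thesis using Suc.prems(3) DIM_positive[where 'a="real^'n"]
      by (simp del: DIM_cart)
  qed
  from Suc.IH[OF sub inv this] obtain B where B: "B \<subseteq> ?W" "finite B" "card B = k"
     "\<forall>v\<in>B. norm v = 1 \<and> (\<exists>m. A *v v = m *\<^sub>R v)" "pairwise orthogonal B" by blast
  have "v \<notin> B" using B(1) vn by force
  then show ?case using B v(1) Av
    by (intro exI[of _ "insert v B"]) (auto simp: pairwise_insert orthogonal_commute, auto simp: orthogonal_def inner_commute)
qed

lemma symmetric_eigenbasis:
  fixes A :: "real^'n^'n"
  assumes sym: "transpose A = A"
  shows "\<exists>(v::'n \<Rightarrow> real^'n) m. (\<forall>i. A *v v i = m i *\<^sub>R v i) \<and> (\<forall>i j. v i \<bullet> v j = (if i = j then 1 else 0))"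
proof -
  from symmetric_eigenbasis_subspace[OF sym, of UNIV "CARD('n)"] obtain B
    where B: "finite B" "card B = CARD('n)" "\<forall>v\<in>B. norm v = 1 \<and> (\<exists>m. A *v v = m *\<^sub>R v)"
      "pairwise orthogonal B"
    by (auto simp: dim_UNIV)
  obtain v where v: "bij_betw v (UNIV :: 'n set) B"
    using finite_same_card_bij[of "UNIV::'n set" B] B(1,2) by auto
  have vB: "v i \<in> B" for i using v by (auto simp: bij_betw_def)
  then have "\<exists>m. \<forall>i. A *v v i = m i *\<^sub>R v i"
    using B(3) by (intro choice) blast
  then obtain m where "\<And>i. A *v v i = m i *\<^sub>R v i" by blast
  moreover have "v i \<bullet> v j = (if i = j then 1 else 0)" for i j
  proof (cases "i = j")
    case True
    then show ?thesis using B(3) vB by (simp add: norm_eq_1)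
  next
    case False
    then have "v i \<noteq> v j" using v by (auto simp: bij_betw_def inj_eq)
    then show ?thesis using False B(4) vB[of i] vB[of j] by (simp add: pairwise_def orthogonal_def)
  qed
  ultimately show ?thesis by blast
qed

lemma orthonormal_basis_expansion:
  fixes v :: "'n \<Rightarrow> real^'n"
  assumes v: "\<And>i j. v i \<bullet> v j = (if i = j then 1 else 0)"
  shows "x = (\<Sum>i\<in>UNIV. (x \<bullet> v i) *\<^sub>R v i)"
    and "x \<bullet> x = (\<Sum>i\<in>UNIV. (x \<bullet> v i)\<^sup>2)"
    and "inj v" and "independent (range v)"
proof -
  show inj: "inj v"
    by (rule injI) (metis v zero_neq_one)
  show ind: "independent (range v)"
  proof (rule pairwise_orthogonal_independent)
    show "pairwise orthogonal (range v)"
      using inj by (auto simp: pairwise_def orthogonal_def v inj_eq)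
    show "0 \<notin> range v" by (metis (full_types) v imageE inner_zero_left zero_neq_one)
  qed
  have "card (range v) = CARD('n)" using inj by (simp add: card_image)
  then have "span (range v) = UNIV"
    using card_ge_dim_independent[OF subset_UNIV ind] by auto
  then have "x \<in> span (range v)" by blast
  then obtain u where "x = (\<Sum>b\<in>range v. u b *\<^sub>R b)"
    by (auto simp: span_finite)
  then have u: "x = (\<Sum>i\<in>UNIV. u (v i) *\<^sub>R v i)"
    using sum.reindex[OF inj] by (simp add: o_def)
  have "x \<bullet> v i = u (v i)" for i
    by (subst u) (simp add: inner_sum_left v if_distrib sum.delta cong: if_cong)
  then show eq: "x = (\<Sum>i\<in>UNIV. (x \<bullet> v i) *\<^sub>R v i)" using u by simp
  have "x \<bullet> x = x \<bullet> (\<Sum>i\<in>UNIV. (x \<bullet> v i) *\<^sub>R v i)" using eq by simp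
  then show "x \<bullet> x = (\<Sum>i\<in>UNIV. (x \<bullet> v i)\<^sup>2)"
    by (simp add: inner_sum_right power2_eq_square)
qed

lemma singular_basis:
  fixes A :: "real^'n^'n"
  shows "\<exists>(v::'n \<Rightarrow> real^'n) m. (\<forall>i j. v i \<bullet> v j = (if i = j then 1 else 0)) \<and> (\<forall>i. m i \<ge> 0) \<and>
    (\<forall>x. (norm (A *v x))\<^sup>2 = (\<Sum>i\<in>UNIV. m i * (x \<bullet> v i)\<^sup>2)) \<and>
    singular_values A = rev (sorted_list_of_multiset (image_mset (\<lambda>i. sqrt (m i)) (mset_set UNIV))) \<and>
    (det A)\<^sup>2 = prod m UNIV"
proof -
  let ?G = "transpose A ** A"
  have "transpose ?G = ?G" by (simp add: matrix_transpose_mul)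
  from symmetric_eigenbasis[OF this] obtain v m where
    v: "\<And>i::'n. ?G *v v i = m i *\<^sub>R v i" "\<And>i j. v i \<bullet> v j = (if i = j then 1 else 0)"
    by blast
  have GA: "(A *v x) \<bullet> (A *v y) = x \<bullet> (?G *v y)" for x y
    by (metis dot_lmul_matrix matrix_vector_mul_assoc transpose_matrix_vector transpose_transpose)
  have m0: "m i \<ge> 0" for i
    using GA[of "v i" "v i"] v(2)[of i i] by (simp add: v(1)) (metis inner_ge_zero)
  have n: "(norm (A *v x))\<^sup>2 = (\<Sum>i\<in>UNIV. m i * (x \<bullet> v i)\<^sup>2)" for x
  proof -
    have "?G *v x = (\<Sum>i\<in>UNIV. (x \<bullet> v i) *\<^sub>R (?G *v v i))"
      by (subst orthonormal_basis_expansion(1)[OF v(2), of x])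
        (simp add: linear_sum[OF matrix_vector_mul_linear] matrix_vector_mult_scaleR)
    then have "x \<bullet> (?G *v x) = (\<Sum>i\<in>UNIV. m i * (x \<bullet> v i)\<^sup>2)"
      by (simp add: v(1) inner_sum_right power2_eq_square algebra_simps)
    then show ?thesis using GA[of x x] by (simp add: power2_norm_eq_inner)
  qed
  define P :: "real^'n^'n" where "P = (\<chi> i j. v j $ i)"
  have PP: "transpose P ** P = mat 1"
    using v(2) by (simp add: P_def vec_eq_iff matrix_matrix_mult_def transpose_def mat_def inner_vec_def)
  then have PP': "P ** transpose P = mat 1" by (simp add: matrix_left_right_inverse)
  have GP: "?G ** P = P ** diagm m"
  proof -
    have "(?G ** P) $ a $ j = (P ** diagm m) $ a $ j" for a j
    proof -
      have "(?G ** P) $ a $ j = (?G *v v j) $ a"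
        by (simp add: P_def matrix_matrix_mult_def matrix_vector_mult_def)
      also have "\<dots> = m j * v j $ a" by (simp add: v(1))
      also have "\<dots> = (P ** diagm m) $ a $ j"
        by (simp add: P_def diagm_def matrix_matrix_mult_def if_distrib cong: if_cong)
      finally show ?thesis .
    qed
    then show ?thesis by (simp add: vec_eq_iff)
  qed
  have "(det A)\<^sup>2 = det ?G" by (simp add: det_mul power2_eq_square)
  moreover have "det ?G * det P = det P * det (diagm m)" using GP by (metis det_mul)
  moreover have "det P \<noteq> 0" using PP by (metis det_I det_mul mult_zero_right zero_neq_one)
  moreover have "det (diagm m) = prod m UNIV" by (subst det_diagonal) (auto simp: diagm_def)
  ultimately have "(det A)\<^sup>2 = prod m UNIV" by simp
  moreover have "singular_values A = rev (sorted_list_of_multiset (image_mset (\<lambda>i. sqrt (m i)) (mset_set UNIV)))"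
    unfolding singular_values_def proots_charpoly_similar[OF GP PP'] by (simp add: image_mset.compositionality o_def)
  ultimately show ?thesis using v(2) m0 n by blast
qed

text \<open>Turns a position in a decreasing list into a count of elements above a level, which can
  then be compared with dimensions of subspaces.\<close>

lemma nth_rev_sorted_ge_iff:
  fixes M :: "'a::linorder multiset"
  assumes "k < size M"
  shows "t \<le> rev (sorted_list_of_multiset M) ! k \<longleftrightarrow> k < size (filter_mset (\<lambda>x. t \<le> x) M)"
proof -
  define xs where "xs = rev (sorted_list_of_multiset M)"
  have mx: "mset xs = M" by (simp add: xs_def)
  have len: "length xs = size M" using mx by (metis size_mset)
  have desc: "sorted_wrt (\<ge>) xs" by (simp add: xs_def sorted_wrt_rev)
  have "size (filter_mset (\<lambda>x. t \<le> x) M) = length (filter (\<lambda>x. t \<le> x) xs)"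
    by (metis mx mset_filter size_mset)
  also have "\<dots> = card {i. i < length xs \<and> t \<le> xs ! i}" by (rule length_filter_conv_card)
  finally have sz: "size (filter_mset (\<lambda>x. t \<le> x) M) = card {i. i < length xs \<and> t \<le> xs ! i}" .
  have mono: "xs ! j \<le> xs ! i" if "i \<le> j" "j < length xs" for i j
    using desc that by (cases "i = j") (auto simp: sorted_wrt_iff_nth_less)
  show ?thesis
  proof
    assume "t \<le> rev (sorted_list_of_multiset M) ! k"
    then have "{..k} \<subseteq> {i. i < length xs \<and> t \<le> xs ! i}"
      using mono assms len unfolding xs_def[symmetric] by (auto intro: order_trans)
    then have "card {..k} \<le> card {i. i < length xs \<and> t \<le> xs ! i}" by (intro card_mono) auto
    then show "k < size (filter_mset (\<lambda>x. t \<le> x) M)" by (simp add: sz)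
  next
    assume k: "k < size (filter_mset (\<lambda>x. t \<le> x) M)"
    show "t \<le> rev (sorted_list_of_multiset M) ! k"
    proof (rule ccontr)
      assume "\<not> t \<le> rev (sorted_list_of_multiset M) ! k"
      then have "xs ! k < t" by (simp add: xs_def)
      then have "{i. i < length xs \<and> t \<le> xs ! i} \<subseteq> {..<k}"
        using mono by (auto simp: not_le[symmetric]) (meson leD le_less_trans nat_le_linear not_le)
      then have "card {i. i < length xs \<and> t \<le> xs ! i} \<le> card {..<k}" by (intro card_mono) auto
      then show False using k sz by simp
    qed
  qed
qed

text \<open>Courant-Fischer. The right singular vectors with values at least \<open>t\<close> span a
  suitable \<open>V\<close>; conversely, a \<open>V\<close> of dimension \<open>k + 1\<close> meets
  the span of the remaining ones if these are at least \<open>CARD('n) - k\<close> many. The form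
  with a level \<open>t\<close> and an existential \<open>V\<close> is chosen because such a
  \<open>V\<close> can be transported by an invertible map.\<close>

lemma singular_values_ge_iff:
  fixes A :: "real^'n^'n"
  assumes k: "k < CARD('n)" and t: "t > 0"
  shows "t \<le> singular_values A ! k \<longleftrightarrow>
    (\<exists>V. subspace V \<and> dim V = Suc k \<and> (\<forall>x\<in>V. t * norm x \<le> norm (A *v x)))"
proof -
  obtain v :: "'n \<Rightarrow> real^'n" and m where v: "\<And>i j. v i \<bullet> v j = (if i = j then 1 else (0::real))"
    and m0: "\<And>i. m i \<ge> 0"
    and n: "\<And>x. (norm (A *v x))\<^sup>2 = (\<Sum>i\<in>UNIV. m i * (x \<bullet> v i)\<^sup>2)"
    and sv: "singular_values A = rev (sorted_list_of_multiset (image_mset (\<lambda>i. sqrt (m i)) (mset_set UNIV)))"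
    using singular_basis[of A] by blast
  define S where "S = {i. t \<le> sqrt (m i)}"
  have S: "i \<in> S \<longleftrightarrow> t\<^sup>2 \<le> m i" for i
    using t by (simp add: S_def real_le_rsqrt real_le_lsqrt) (metis less_imp_le m0 real_sqrt_le_iff real_sqrt_unique)
  note exp = orthonormal_basis_expansion[OF v]
  have dimv: "dim (span (v ` T)) = card T" for T
  proof -
    have "independent (v ` T)" using exp(4) by (rule independent_mono) auto
    moreover have "card (v ` T) = card T" using exp(3) by (intro card_image) (rule inj_on_subset, auto)
    ultimately show ?thesis by (simp add: dim_eq_card_independent)
  qed
  have coef: "x \<bullet> v j = 0" if xs: "x \<in> span (v ` T)" and jT: "j \<notin> T" for x j T
    using xs
  proof (induction rule: span_induct_alt)
    case (step c x y)
    then obtain i where "x = v i" "i \<noteq> j" using jT by blast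
    then show ?case using step v by (simp add: inner_add_left)
  qed simp
  have "t \<le> singular_values A ! k \<longleftrightarrow> k < card S"
    unfolding sv
    by (subst nth_rev_sorted_ge_iff) (use k in \<open>auto simp: S_def filter_mset_image_mset filter_mset_mset_set size_image_mset\<close>)
  also have "\<dots> \<longleftrightarrow> (\<exists>V. subspace V \<and> dim V = Suc k \<and> (\<forall>x\<in>V. t * norm x \<le> norm (A *v x)))"
  proof
    assume "k < card S"
    then obtain T where T: "T \<subseteq> S" "card T = Suc k" by (meson Suc_leI obtain_subset_with_card_n)
    have "t * norm x \<le> norm (A *v x)" if x: "x \<in> span (v ` T)" for x
    proof (rule power2_le_imp_le)
      have "t\<^sup>2 * (x \<bullet> v i)\<^sup>2 \<le> m i * (x \<bullet> v i)\<^sup>2" for i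
      proof (cases "i \<in> T")
        case True
        then have "t\<^sup>2 \<le> m i" using T S by auto
        then show ?thesis by (intro mult_right_mono) auto
      next
        case False
        then show ?thesis using coef[OF x] by simp
      qed
      then have "(\<Sum>i\<in>UNIV. t\<^sup>2 * (x \<bullet> v i)\<^sup>2) \<le> (norm (A *v x))\<^sup>2"
        unfolding n by (intro sum_mono)
      then show "(t * norm x)\<^sup>2 \<le> (norm (A *v x))\<^sup>2"
        by (simp add: power_mult_distrib power2_norm_eq_inner exp(2)[of x] sum_distrib_left)
    qed simp
    then show "\<exists>V. subspace V \<and> dim V = Suc k \<and> (\<forall>x\<in>V. t * norm x \<le> norm (A *v x))"
      using T(2) dimv by (intro exI[of _ "span (v ` T)"]) auto
  next
    assume "\<exists>V. subspace V \<and> dim V = Suc k \<and> (\<forall>x\<in>V. t * norm x \<le> norm (A *v x))"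
    then obtain V where V: "subspace V" "dim V = Suc k" "\<And>x. x \<in> V \<Longrightarrow> t * norm x \<le> norm (A *v x)" by blast
    show "k < card S"
    proof (rule ccontr)
      assume "\<not> k < card S"
      then have "dim (span (v ` (- S))) \<ge> CARD('n) - k"
        unfolding dimv by (simp add: Compl_eq_Diff_UNIV card_Diff_subset)
      moreover have "dim {x + y |x y. x \<in> V \<and> y \<in> span (v ` (- S))} + dim (V \<inter> span (v ` (- S))) = dim V + dim (span (v ` (- S)))"
        by (rule dim_sums_Int[OF V(1) subspace_span])
      moreover have "dim {x + y |x y. x \<in> V \<and> y \<in> span (v ` (- S))} \<le> CARD('n)" by (rule dim_subset_UNIV_cart)
      ultimately have "dim (V \<inter> span (v ` (- S))) > 0" using V(2) k by linarith
      then have "\<not> V \<inter> span (v ` (- S)) \<subseteq> {0}" using dim_eq_0 by (metis less_irrefl)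
      then obtain x where x: "x \<in> V" "x \<in> span (v ` (- S))" "x \<noteq> 0" by blast
      have le: "m i * (x \<bullet> v i)\<^sup>2 \<le> t\<^sup>2 * (x \<bullet> v i)\<^sup>2" for i
      proof (cases "i \<in> S")
        case True
        then show ?thesis using coef[OF x(2)] by simp
      next
        case False
        then have "m i \<le> t\<^sup>2" using S by force
        then show ?thesis by (intro mult_right_mono) auto
      qed
      have "\<exists>i. x \<bullet> v i \<noteq> 0"
      proof (rule ccontr)
        assume "\<nexists>i. x \<bullet> v i \<noteq> 0"
        then have "(\<Sum>i\<in>UNIV. (x \<bullet> v i) *\<^sub>R v i) = 0" by simp
        with exp(1)[of x] have "x = 0" by (rule trans)
        then show False using x(3) by simp
      qed
      then obtain i where i: "x \<bullet> v i \<noteq> 0" by blast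
      then have "i \<notin> S" using coef[OF x(2), of i] by auto
      then have "m i < t\<^sup>2" using S by force
      then have "m i * (x \<bullet> v i)\<^sup>2 < t\<^sup>2 * (x \<bullet> v i)\<^sup>2" using i by (intro mult_strict_right_mono) auto
      then have "(\<Sum>i\<in>UNIV. m i * (x \<bullet> v i)\<^sup>2) < (\<Sum>i\<in>UNIV. t\<^sup>2 * (x \<bullet> v i)\<^sup>2)"
        using le by (intro sum_strict_mono_ex1) auto
      then have "(norm (A *v x))\<^sup>2 < (t * norm x)\<^sup>2"
        unfolding n by (simp add: power_mult_distrib power2_norm_eq_inner exp(2)[of x] sum_distrib_left)
      moreover have "(t * norm x)\<^sup>2 \<le> (norm (A *v x))\<^sup>2" using V(3)[OF x(1)] t by (intro power_mono) auto
      ultimately show False by simp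
    qed
  qed
  finally show ?thesis .
qed

definition decr_list :: "('n::finite \<Rightarrow> real) \<Rightarrow> real list" where
  "decr_list f = rev (sorted_list_of_multiset (image_mset f (mset_set UNIV)))"

lemma length_decr_list [simp]: "length (decr_list f) = CARD('n)" for f :: "'n::finite \<Rightarrow> real"
proof -
  have "length (sorted_list_of_multiset M) = size M" for M :: "real multiset"
    by (metis mset_sorted_list_of_multiset size_mset)
  then show ?thesis by (simp add: decr_list_def)
qed

lemma set_decr_list [simp]: "set (decr_list f) = range f"
  by (simp add: decr_list_def)

lemma decr_list_mono:
  assumes "i \<le> j" "j < length (decr_list f)"
  shows "decr_list f ! j \<le> decr_list f ! i"
proof -
  have "sorted_wrt (\<ge>) (decr_list f)" by (simp add: decr_list_def sorted_wrt_rev)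
  then show ?thesis using assms by (cases "i = j") (auto simp: sorted_wrt_iff_nth_less)
qed

lemma sum_decr_list:
  fixes f :: "'n::finite \<Rightarrow> real"
  shows "(\<Sum>k<CARD('n). g (decr_list f ! k)) = (\<Sum>i\<in>UNIV. g (f i) :: real)"
proof -
  have "(\<Sum>k<CARD('n). g (decr_list f ! k)) = sum_list (map g (decr_list f))"
    by (simp add: sum_list_sum_nth atLeast0LessThan)
  also have "\<dots> = sum_mset (image_mset g (mset (decr_list f)))"
    by (metis mset_map sum_mset_sum_list)
  also have "\<dots> = (\<Sum>i\<in>UNIV. g (f i))"
    by (simp add: decr_list_def image_mset.compositionality o_def sum_unfold_sum_mset)
  finally show ?thesis .
qed

lemma decr_list_eqI:
  fixes f :: "'n::finite \<Rightarrow> real" and b :: "nat \<Rightarrow> 'n"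
  assumes b: "bij_betw b {..<CARD('n)} UNIV" and k: "k < CARD('n)"
    and decr: "\<And>i. Suc i < CARD('n) \<Longrightarrow> f (b (Suc i)) \<le> f (b i)"
  shows "decr_list f ! k = f (b k)"
proof -
  define xs where "xs = map (\<lambda>i. f (b i)) [0..<CARD('n)]"
  have "mset xs = image_mset f (image_mset b (mset_set {..<CARD('n)}))"
    by (simp add: xs_def image_mset.compositionality o_def lessThan_atLeast0 flip: mset_upt)
  also have "image_mset b (mset_set {..<CARD('n)}) = mset_set UNIV"
    using b by (metis bij_betw_def image_mset_mset_set)
  finally have "mset xs = image_mset f (mset_set UNIV)" .
  moreover have "sorted (rev xs)"
    unfolding sorted_rev_iff_nth_Suc by (auto simp: xs_def decr)
  ultimately have "sorted_list_of_multiset (image_mset f (mset_set UNIV)) = rev xs"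
    by (metis mset_rev sorted_list_of_multiset_mset sorted_sort_id)
  then show ?thesis using k by (simp add: decr_list_def xs_def)
qed

lemma singular_values_eq:
  fixes A :: "real^'n^'n"
  shows "\<exists>s. (\<forall>i. s i \<ge> 0) \<and> singular_values A = decr_list s \<and> \<bar>det A\<bar> = prod s (UNIV :: 'n set)"
proof -
  obtain v :: "'n \<Rightarrow> real^'n" and m :: "'n \<Rightarrow> real" where
     m0: "\<And>i. m i \<ge> 0"
    and sv: "singular_values A = rev (sorted_list_of_multiset (image_mset (\<lambda>i. sqrt (m i)) (mset_set UNIV)))"
    and d: "(det A)\<^sup>2 = prod m UNIV"
    using singular_basis[of A] by blast
  have "(\<Prod>i\<in>UNIV. sqrt (m i))\<^sup>2 = (det A)\<^sup>2"
    unfolding d prod_power_distrib using m0 by simp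
  moreover have "(\<Prod>i\<in>UNIV. sqrt (m i)) \<ge> 0" using m0 by (intro prod_nonneg) auto
  ultimately have "\<bar>det A\<bar> = (\<Prod>i\<in>UNIV. sqrt (m i))"
    by (metis abs_of_nonneg power2_abs power2_eq_imp_eq abs_ge_zero)
  then show ?thesis using m0 sv by (intro exI[of _ "\<lambda>i. sqrt (m i)"]) (simp add: decr_list_def)
qed

lemma singular_values_pos:
  fixes A :: "real^'n^'n"
  assumes "det A \<noteq> 0" "k < CARD('n)"
  shows "singular_values A ! k > 0"
proof -
  obtain s where s: "\<And>i::'n. s i \<ge> 0" "singular_values A = decr_list s" "\<bar>det A\<bar> = prod s UNIV"
    using singular_values_eq[of A] by blast
  have "prod s UNIV \<noteq> 0" using s(3) assms(1) by (metis abs_eq_0_iff)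
  then have "s i > 0" for i using s(1)[of i] by (simp add: less_le)
  then have "\<forall>x\<in>set (decr_list s). x > 0" by auto
  then show ?thesis using s(2) assms(2) by (metis length_decr_list nth_mem)
qed

lemma singular_values_mono:
  fixes A :: "real^'n^'n"
  assumes "i \<le> j" "j < CARD('n)"
  shows "singular_values A ! j \<le> singular_values A ! i"
proof -
  obtain s :: "'n \<Rightarrow> real" where "singular_values A = decr_list s" using singular_values_eq[of A] by blast
  then show ?thesis using decr_list_mono[OF assms(1), of s] assms(2) by simp
qed

lemma sum_ln_singular_values:
  fixes A :: "real^'n^'n"
  assumes "det A \<noteq> 0"
  shows "(\<Sum>k<CARD('n). ln (singular_values A ! k)) = ln \<bar>det A\<bar>"
proof -
  obtain s where s: "\<And>i::'n. s i \<ge> 0" "singular_values A = decr_list s" "\<bar>det A\<bar> = prod s UNIV"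
    using singular_values_eq[of A] by blast
  have "prod s UNIV \<noteq> 0" using s(3) assms(1) by (metis abs_eq_0_iff)
  then have "s i > 0" for i using s(1)[of i] by (simp add: less_le)
  then have "ln (prod s UNIV) = (\<Sum>i\<in>UNIV. ln (s i))" by (intro ln_prod) (simp, metis less_irrefl)
  then show ?thesis by (simp add: s sum_decr_list)
qed

lemma singular_values_uminus [simp]: "singular_values (- A) = singular_values A"
  for A :: "real^'n^'n"
proof -
  have "transpose (- A) ** (- A) = transpose A ** A"
    by (simp add: vec_eq_iff matrix_matrix_mult_def transpose_def)
  then show ?thesis by (simp add: singular_values_def)
qed

section \<open>Matrices with bounded distortion\<close>

definition bilip :: "real \<Rightarrow> real^'n^'n \<Rightarrow> bool" where
  "bilip C P \<longleftrightarrow> (\<forall>x. norm x \<le> C * norm (P *v x) \<and> norm (P *v x) \<le> C * norm x)"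

lemma bilip_inverse:
  assumes "bilip C P" "P ** Q = mat 1"
  shows "bilip C Q"
  unfolding bilip_def
proof (intro allI)
  fix x
  have "P *v (Q *v x) = x" by (simp add: matrix_vector_mul_assoc assms(2))
  then show "norm x \<le> C * norm (Q *v x) \<and> norm (Q *v x) \<le> C * norm x"
    using assms(1) unfolding bilip_def by metis
qed

lemma bilip_invertible:
  assumes "bilip C P"
  shows "\<exists>Q. P ** Q = mat 1 \<and> Q ** P = mat 1"
proof -
  have "inj (\<lambda>x. P *v x)"
  proof (rule injI)
    fix x y assume "P *v x = P *v y"
    then have "P *v (x - y) = 0" by (simp add: matrix_vector_mult_diff_distrib)
    then show "x = y" using assms unfolding bilip_def by (metis mult_zero_right norm_eq_zero norm_le_zero_iff right_minus_eq)
  qed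
  then show ?thesis by (metis matrix_left_invertible_injective matrix_left_right_inverse)
qed

lemma bilip_mono: "bilip C P \<Longrightarrow> C \<le> C' \<Longrightarrow> bilip C' P"
  unfolding bilip_def by (meson mult_right_mono norm_ge_zero order_trans)

lemma invertible_bilip:
  fixes P :: "real^'n^'n"
  assumes "P ** Q = mat 1"
  shows "\<exists>C. C \<ge> 1 \<and> bilip C P"
proof -
  have QP: "Q ** P = mat 1" using assms by (simp add: matrix_left_right_inverse)
  obtain C1 where C1: "\<And>x. norm (P *v x) \<le> norm x * C1"
    using bounded_linear.bounded[OF matrix_vector_mul_bounded_linear[of P]] by blast
  obtain C2 where C2: "\<And>x. norm (Q *v x) \<le> norm x * C2"
    using bounded_linear.bounded[OF matrix_vector_mul_bounded_linear[of Q]] by blast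
  define C where "C = max 1 (max C1 C2)"
  have "norm (P *v x) \<le> C * norm x" for x
  proof -
    have "norm x * C1 \<le> norm x * C" by (intro mult_left_mono) (auto simp: C_def)
    then show ?thesis using C1[of x] by (simp add: mult.commute)
  qed
  moreover have "norm x \<le> C * norm (P *v x)" for x
  proof -
    have "norm (P *v x) * C2 \<le> norm (P *v x) * C" by (intro mult_left_mono) (auto simp: C_def)
    then show ?thesis using C2[of "P *v x"] by (simp add: mult.commute matrix_vector_mul_assoc QP)
  qed
  ultimately show ?thesis by (intro exI[of _ C]) (auto simp: bilip_def C_def)
qed

text \<open>The inverse of \<open>Q\<close> carries a subspace as in
  \<open>singular_values_ge_iff\<close> for \<open>A\<close> to one for \<open>P ** A ** Q\<close>.
  One factor \<open>C\<close> is lost to \<open>P\<close> and one to \<open>Q\<close>.\<close>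

lemma singular_values_le_transfer:
  fixes A P Q :: "real^'n^'n"
  assumes k: "k < CARD('n)" and det: "det A \<noteq> 0" and P: "bilip C P" and Q: "bilip C Q" and C: "C \<ge> 1"
  shows "singular_values A ! k \<le> C\<^sup>2 * singular_values (P ** A ** Q) ! k"
proof -
  define t where "t = singular_values A ! k"
  have t: "t > 0" unfolding t_def by (rule singular_values_pos[OF det k])
  then obtain V where V: "subspace V" "dim V = Suc k" "\<And>x. x \<in> V \<Longrightarrow> t * norm x \<le> norm (A *v x)"
    using singular_values_ge_iff[OF k t, of A] t_def by auto
  obtain R where R: "Q ** R = mat 1" "R ** Q = mat 1" using bilip_invertible[OF Q] by blast
  define V' where "V' = (\<lambda>x. R *v x) ` V"
  have "subspace V'" unfolding V'_def by (intro linear_subspace_image V) auto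
  moreover have "dim V' = Suc k"
  proof -
    have "inj (\<lambda>x. R *v x)" using R(1) by (metis injI matrix_vector_mul_assoc matrix_vector_mul_lid)
    then show ?thesis unfolding V'_def V(2)[symmetric]
      by (intro dim_image_eq) (auto intro: inj_on_subset)
  qed
  moreover have "(t / C\<^sup>2) * norm x \<le> norm ((P ** A ** Q) *v x)" if xV: "x \<in> V'" for x
  proof -
    obtain y where y: "y \<in> V" "x = R *v y" using xV by (auto simp: V'_def)
    have Qx: "Q *v x = y" by (simp add: y matrix_vector_mul_assoc R)
    have "t * norm x \<le> t * (C * norm y)" using Q t unfolding bilip_def Qx[symmetric]
      by (intro mult_left_mono) auto
    also have "\<dots> \<le> C * norm (A *v y)" using V(3)[OF y(1)] C by (simp add: mult.left_commute)
    also have "\<dots> \<le> C * (C * norm (P *v (A *v y)))" using P C unfolding bilip_def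
      by (intro mult_left_mono) auto
    also have "P *v (A *v y) = (P ** A ** Q) *v x" by (simp add: Qx flip: matrix_vector_mul_assoc)
    finally show ?thesis using C by (simp add: field_simps power2_eq_square)
  qed
  ultimately have "t / C\<^sup>2 \<le> singular_values (P ** A ** Q) ! k"
    using singular_values_ge_iff[OF k, of "t / C\<^sup>2" "P ** A ** Q"] t C by auto
  then show ?thesis using C unfolding t_def by (simp add: field_simps)
qed

lemma ln_singular_values_close:
  fixes A P Q :: "real^'n^'n"
  assumes k: "k < CARD('n)" and det: "det A \<noteq> 0" and P: "bilip C P" and Q: "bilip C Q" and C: "C \<ge> 1"
  shows "\<bar>ln (singular_values (P ** A ** Q) ! k) - ln (singular_values A ! k)\<bar> \<le> 2 * ln C"
proof -
  let ?B = "P ** A ** Q"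
  obtain P' where P': "P ** P' = mat 1" "P' ** P = mat 1" using bilip_invertible[OF P] by blast
  obtain Q' where Q': "Q ** Q' = mat 1" "Q' ** Q = mat 1" using bilip_invertible[OF Q] by blast
  have "det P \<noteq> 0" "det Q \<noteq> 0" using P' Q' by (metis det_I det_mul mult_zero_left zero_neq_one)+
  then have detB: "det ?B \<noteq> 0" using det by (simp add: det_mul)
  have "P' ** ?B ** Q' = (P' ** P) ** A ** (Q ** Q')" by (simp add: matrix_mul_assoc)
  then have A: "P' ** ?B ** Q' = A" by (simp add: P' Q')
  have 1: "singular_values A ! k \<le> C\<^sup>2 * singular_values ?B ! k"
    by (rule singular_values_le_transfer[OF k det P Q C])
  have 2: "singular_values ?B ! k \<le> C\<^sup>2 * singular_values A ! k"
    using singular_values_le_transfer[OF k detB bilip_inverse[OF P P'(1)] bilip_inverse[OF Q Q'(1)] C] A by simp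
  have pos: "singular_values A ! k > 0" "singular_values ?B ! k > 0"
    using singular_values_pos k det detB by blast+
  have ln2: "ln (C\<^sup>2 * x) = 2 * ln C + ln x" if "x > 0" for x
    using that C by (simp add: ln_mult ln_realpow)
  have "ln (singular_values A ! k) \<le> ln (C\<^sup>2 * singular_values ?B ! k)" using 1 pos C by (subst ln_le_cancel_iff) auto
  moreover have "ln (singular_values ?B ! k) \<le> ln (C\<^sup>2 * singular_values A ! k)" using 2 pos C by (subst ln_le_cancel_iff) auto
  ultimately show ?thesis using ln2 pos by auto
qed

lemma eigenvalue_moduli_similar:
  fixes A P Q :: "real^'n^'n"
  assumes "A ** P = P ** diagm l" "P ** Q = mat 1"
  shows "eigenvalue_moduli A = decr_list (\<lambda>i. \<bar>l i\<bar>)"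
proof -
  define c :: "real^'n^'n \<Rightarrow> complex^'n^'n" where "c = (\<lambda>X. \<chi> i j. complex_of_real (X $ i $ j))"
  have cm: "c (M ** N) = c M ** c N" for M N
    by (simp add: c_def matrix_matrix_mult_def vec_eq_iff)
  have "c (diagm l) = diagm (\<lambda>i. complex_of_real (l i))" "c (mat 1) = mat 1"
    by (auto simp: c_def diagm_def mat_def vec_eq_iff)
  then have "c A ** c P = c P ** diagm (\<lambda>i. complex_of_real (l i))" "c P ** c Q = mat 1"
    using assms cm by metis+
  from proots_charpoly_similar[OF this]
  have "proots (charpoly (\<chi> i j. complex_of_real (A $ i $ j))) = image_mset (\<lambda>i. complex_of_real (l i)) (mset_set UNIV)"
    unfolding c_def .
  then show ?thesis
    by (simp add: eigenvalue_moduli_def decr_list_def image_mset.compositionality o_def)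
qed

text \<open>With \<open>eigenvalue_moduli_similar\<close> this identifies the eigenvalue moduli of a
  diagonalizable matrix with the singular values of its diagonal form. The difference of Jordan and
  Cartan projection is then controlled by the distortion of an eigenbasis.\<close>

lemma singular_values_diagm: "singular_values (diagm l) = decr_list (\<lambda>i. \<bar>l i\<bar>)"
  for l :: "'n::finite \<Rightarrow> real"
proof -
  have "transpose (diagm l) ** diagm l = diagm (\<lambda>i. l i * l i)"
  proof -
    have "(\<Sum>k\<in>UNIV. (if k = i then l k else 0) * (if k = j then l k else 0)) = (if i = j then l i * l i else 0)" for i j
    proof -
      have "(\<Sum>k\<in>UNIV. (if k = i then l k else 0) * (if k = j then l k else 0))
          = (\<Sum>k\<in>UNIV. if k = i then (if k = j then l k * l k else 0) else 0)"
        by (intro sum.cong) auto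
      then show ?thesis by (simp add: sum.delta)
    qed
    then show ?thesis by (simp add: vec_eq_iff matrix_matrix_mult_def transpose_def diagm_def)
  qed
  moreover have "proots (charpoly (diagm (\<lambda>i. l i * l i))) = image_mset (\<lambda>i. l i * l i) (mset_set UNIV)"
    by (rule proots_charpoly_similar[of _ "mat 1" _ "mat 1"]) auto
  ultimately show ?thesis
    by (simp add: singular_values_def decr_list_def image_mset.compositionality o_def)
qed

subsection \<open>Lifts of elements of \<open>PSL(d,\<real>)\<close>\<close>

lemma SL_simps [simp]:
  "A \<in> carrier SL \<longleftrightarrow> det A = 1" "A \<otimes>\<^bsub>SL\<^esub> B = A ** B" "\<one>\<^bsub>SL\<^esub> = mat 1"
  by (simp_all add: SL_def)

lemma matrix_inv_SL:
  fixes A :: "real^'n^'n"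
  assumes "det A = 1"
  shows "A ** matrix_inv A = mat 1" "matrix_inv A ** A = mat 1" "det (matrix_inv A) = 1"
proof -
  have "invertible A" using assms by (simp add: invertible_det_nz)
  then have "A ** matrix_inv A = mat 1 \<and> matrix_inv A ** A = mat 1"
    unfolding invertible_def matrix_inv_def by (rule someI_ex)
  then show *: "A ** matrix_inv A = mat 1" "matrix_inv A ** A = mat 1" by auto
  then show "det (matrix_inv A) = 1" by (metis assms det_I det_mul mult.left_neutral)
qed

lemma group_SL: "group (SL :: (real^'n^'n) monoid)"
proof (rule groupI)
  fix A :: "real^'n^'n" assume "A \<in> carrier SL"
  then show "\<exists>B\<in>carrier SL. B \<otimes>\<^bsub>SL\<^esub> A = \<one>\<^bsub>SL\<^esub>"
    using matrix_inv_SL[of A] by (intro bexI[of _ "matrix_inv A"]) auto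
qed (auto simp: det_mul matrix_mul_assoc)

lemma matrix_mul_uminus [simp]:
  fixes A B :: "real^'n^'n"
  shows "(- A) ** B = - (A ** B)" "A ** (- B) = - (A ** B)"
  by (simp_all add: vec_eq_iff matrix_matrix_mult_def sum_negf)

lemma matrix_vector_uminus [simp]:
  fixes A :: "real^'n^'n"
  shows "(- A) *v x = - (A *v x)" "A *v (- x) = - (A *v x)"
  by (simp_all add: vec_eq_iff matrix_vector_mult_def sum_negf)

lemma normal_SL_center: "(SL_center :: (real^'n^'n) set) \<lhd> SL"
proof -
  have "subgroup (SL_center :: (real^'n^'n) set) SL"
  proof (rule group.subgroupI[OF group_SL])
    show "SL_center \<noteq> {}" by (auto simp: SL_center_def intro!: exI[of _ "mat 1"])
    fix A B :: "real^'n^'n" assume A: "A \<in> SL_center"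
    then have d: "det A = 1" by (simp add: SL_center_def)
    have "A ** A = mat 1" using A by (auto simp: SL_center_def)
    then have "inv\<^bsub>SL\<^esub> A = A"
      by (intro group.inv_equality[OF group_SL]) (auto simp: d)
    then show "inv\<^bsub>SL\<^esub> A \<in> SL_center" using A by simp
    assume "B \<in> SL_center"
    then show "A \<otimes>\<^bsub>SL\<^esub> B \<in> SL_center" using A by (auto simp: SL_center_def det_mul)
  qed (auto simp: SL_center_def)
  then show ?thesis
    by (rule group.normalI[OF group_SL])
      (auto simp: SL_center_def r_coset_def l_coset_def)
qed

definition cl :: "real^'n^'n \<Rightarrow> (real^'n^'n) set" where
  "cl A = SL_center #>\<^bsub>SL\<^esub> A"

text \<open>\<open>SL_center\<close> contains \<open>- mat 1\<close> only in even dimension. The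
  condition \<open>det B = 1\<close> keeps both parities in one formula: in odd dimension it
  excludes \<open>- A\<close>.\<close>

lemma cl_eq:
  fixes A :: "real^'n^'n"
  assumes "det A = 1"
  shows "cl A = {B. det B = 1 \<and> (B = A \<or> B = - A)}"
proof -
  have "det (- A) = det (- mat 1 ** A)" by simp
  then have "det (- A) = det (- mat 1 :: real^'n^'n)" using assms by (simp only: det_mul mult_1_right)
  then have *: "det (- A) = 1 \<longleftrightarrow> det (- mat 1 :: real^'n^'n) = 1" by simp
  show ?thesis
  proof (intro equalityI subsetI)
    fix B assume "B \<in> cl A"
    then show "B \<in> {B. det B = 1 \<and> (B = A \<or> B = - A)}"
      using assms * by (auto simp: cl_def r_coset_def SL_center_def)
  next
    fix B assume B: "B \<in> {B. det B = 1 \<and> (B = A \<or> B = - A)}"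
    then have "\<exists>h\<in>SL_center. B = h ** A"
    proof (cases "B = A")
      case True
      then show ?thesis by (intro bexI[of _ "mat 1"]) (auto simp: SL_center_def)
    next
      case False
      then show ?thesis using B * by (intro bexI[of _ "- mat 1"]) (auto simp: SL_center_def)
    qed
    then show "B \<in> cl A" by (auto simp: cl_def r_coset_def)
  qed
qed

lemma group_PSL: "group (PSL :: (real^'n^'n) set monoid)"
  unfolding PSL_def by (rule normal.factorgroup_is_group[OF normal_SL_center])

lemma PSL_carrier: "X \<in> carrier PSL \<longleftrightarrow> (\<exists>A. det A = 1 \<and> X = cl A)"
  by (auto simp: PSL_def FactGroup_def RCOSETS_def cl_def)

lemma PSL_mult:
  assumes "det A = 1" "det B = 1"
  shows "cl A \<otimes>\<^bsub>PSL\<^esub> cl B = cl (A ** B)"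
  using normal.rcos_sum[OF normal_SL_center, of A B] assms
  by (simp add: PSL_def FactGroup_def cl_def)

lemma PSL_one: "\<one>\<^bsub>PSL\<^esub> = cl (mat 1 :: real^'n^'n)"
proof -
  interpret N: normal "SL_center :: (real^'n^'n) set" SL by (rule normal_SL_center)
  have "SL_center \<subseteq> (carrier SL :: (real^'n^'n) set)" by (rule N.subset)
  then show ?thesis using group.coset_mult_one[OF group_SL, of "SL_center :: (real^'n^'n) set"]
    by (simp add: PSL_def FactGroup_def cl_def)
qed

lemma PSL_inv:
  assumes "det A = 1"
  shows "inv\<^bsub>PSL\<^esub> (cl A) = cl (matrix_inv A)"
proof (rule group.inv_equality[OF group_PSL])
  show "cl (matrix_inv A) \<otimes>\<^bsub>PSL\<^esub> cl A = \<one>\<^bsub>PSL\<^esub>"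
    using matrix_inv_SL[OF assms] assms by (simp add: PSL_mult PSL_one)
  show "cl A \<in> carrier PSL" "cl (matrix_inv A) \<in> carrier PSL"
    using matrix_inv_SL[OF assms] assms by (auto simp: PSL_carrier)
qed

lemma mem_cl: "det A = 1 \<Longrightarrow> A \<in> cl A"
  by (simp add: cl_eq)

lemma cl_of_mem:
  assumes "X \<in> carrier PSL" "A \<in> X"
  shows "det A = 1" "X = cl A"
proof -
  obtain B where B: "det B = 1" "X = cl B" using assms(1) by (auto simp: PSL_carrier)
  show d: "det A = 1" using assms(2) B by (simp add: cl_eq)
  show "X = cl A" using assms(2) B d by (auto simp: cl_eq)
qed

lemma psl_lift_mem: "X \<in> carrier PSL \<Longrightarrow> psl_lift X \<in> X"
  unfolding psl_lift_def by (rule someI_ex) (auto simp: PSL_carrier intro: mem_cl)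

lemma PSL_mem_mult:
  assumes "X \<in> carrier PSL" "A \<in> X" "Y \<in> carrier PSL" "B \<in> Y"
  shows "A ** B \<in> X \<otimes>\<^bsub>PSL\<^esub> Y"
  using cl_of_mem[OF assms(1,2)] cl_of_mem[OF assms(3,4)] by (simp add: PSL_mult mem_cl det_mul)

lemma PSL_mem_inv:
  assumes "X \<in> carrier PSL" "A \<in> X"
  shows "matrix_inv A \<in> inv\<^bsub>PSL\<^esub> X"
  using cl_of_mem[OF assms(1,2)] by (simp add: PSL_inv mem_cl matrix_inv_SL)

lemma PSL_mem_eq:
  assumes "X \<in> carrier PSL" "A \<in> X" "B \<in> X"
  shows "B = A \<or> B = - A"
  using cl_of_mem[OF assms(1,2)] assms(3) by (auto simp: cl_eq)

lemma PSL_disjoint: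
  assumes "X \<in> carrier PSL" "Y \<in> carrier PSL" "A \<in> X" "A \<in> Y"
  shows "X = Y"
  using cl_of_mem[OF assms(1,3)] cl_of_mem[OF assms(2,4)] by simp

subsection \<open>Hyperbolic elements of discrete groups\<close>

text \<open>The area form, invariant under matrices of determinant 1. For independent
  \<open>x\<close> and \<open>y\<close>, \<open>norm x * norm y / \<bar>det2 x y\<bar>\<close> is
  the hyperbolic cosine of the distance from the base point to the geodesic joining their boundary
  points, and the signs of \<open>det2\<close> encode the cyclic order.\<close>

definition det2 :: "real^2 \<Rightarrow> real^2 \<Rightarrow> real" where
  "det2 x y = x $ 1 * y $ 2 - x $ 2 * y $ 1"

lemma det2_mult: "det2 (A *v x) (A *v y) = det A * det2 x y" for A :: "real^2^2"
  by (simp add: det2_def det_2 matrix_vector_mult_def sum_2 algebra_simps)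

lemma det2_linear [simp]:
  "det2 (x + y) z = det2 x z + det2 y z" "det2 z (x + y) = det2 z x + det2 z y"
  "det2 (x - y) z = det2 x z - det2 y z" "det2 z (x - y) = det2 z x - det2 z y"
  "det2 (c *\<^sub>R x) z = c * det2 x z" "det2 z (c *\<^sub>R x) = c * det2 z x"
  "det2 (- x) z = - det2 x z" "det2 z (- x) = - det2 z x"
  "det2 x x = 0" "det2 0 z = 0" "det2 z 0 = 0"
  by (simp_all add: det2_def algebra_simps)

lemma det2_swap: "det2 x y = - det2 y x"
  by (simp add: det2_def)

lemma inner_real2: "x \<bullet> y = x $ 1 * y $ 1 + x $ 2 * y $ 2" for x y :: "real^2"
  by (simp add: inner_vec_def sum_2)

lemma norm2_sq: "(norm x)\<^sup>2 = (x $ 1)\<^sup>2 + (x $ 2)\<^sup>2" for x :: "real^2"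
  unfolding power2_norm_eq_inner by (simp add: inner_real2 power2_eq_square)

lemma lagrange: "(x \<bullet> y)\<^sup>2 + (det2 x y)\<^sup>2 = (norm x)\<^sup>2 * (norm y)\<^sup>2"
  unfolding norm2_sq by (simp add: inner_real2 det2_def power2_eq_square algebra_simps)

lemma abs_det2_le: "\<bar>det2 x y\<bar> \<le> norm x * norm y"
proof (rule power2_le_imp_le)
  show "\<bar>det2 x y\<bar>\<^sup>2 \<le> (norm x * norm y)\<^sup>2"
    using lagrange[of x y] by (simp add: power_mult_distrib) (metis le_add_same_cancel2 zero_le_power2)
qed simp

lemma det2_expansion: "det2 p q *\<^sub>R v = det2 v q *\<^sub>R p + det2 p v *\<^sub>R q"
  by (simp add: vec_eq_iff forall_2 det2_def algebra_simps)

lemma det2_basis: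
  assumes "det2 p q \<noteq> 0"
  obtains \<alpha> \<beta> where "v = \<alpha> *\<^sub>R p + \<beta> *\<^sub>R q" "\<alpha> = det2 v q / det2 p q" "\<beta> = det2 p v / det2 p q"
proof (rule that[OF _ refl refl])
  have "det2 p q *\<^sub>R v = det2 p q *\<^sub>R ((det2 v q / det2 p q) *\<^sub>R p + (det2 p v / det2 p q) *\<^sub>R q)"
    using assms by (subst det2_expansion) (simp add: scaleR_add_right)
  then show "v = (det2 v q / det2 p q) *\<^sub>R p + (det2 p v / det2 p q) *\<^sub>R q" using assms by simp
qed

lemma det2_0_parallel:
  assumes "det2 x y = 0" "x \<noteq> 0"
  shows "\<exists>c. y = c *\<^sub>R x"
proof (cases "x $ 1 = 0")
  case True
  then have "x $ 2 \<noteq> 0" using assms(2) by (auto simp: vec_eq_iff forall_2)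
  then show ?thesis using assms(1) True
    by (intro exI[of _ "y $ 2 / x $ 2"]) (auto simp: vec_eq_iff forall_2 det2_def field_simps)
next
  case False
  then show ?thesis using assms(1)
    by (intro exI[of _ "y $ 1 / x $ 1"]) (auto simp: vec_eq_iff forall_2 det2_def field_simps)
qed

lemma continuous_on_det2 [continuous_intros]:
  "continuous_on S f \<Longrightarrow> continuous_on S g \<Longrightarrow> continuous_on S (\<lambda>x. det2 (f x) (g x))"
  unfolding det2_def by (intro continuous_intros)

lemma tendsto_det2 [tendsto_intros]:
  "(f \<longlongrightarrow> a) F \<Longrightarrow> (g \<longlongrightarrow> b) F \<Longrightarrow> ((\<lambda>x. det2 (f x) (g x)) \<longlongrightarrow> det2 a b) F"
  unfolding det2_def by (intro tendsto_intros)

lemma norm_matrix_vector_le: "norm (A *v x) \<le> norm A * norm x" for A :: "real^'n^'m"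
proof (rule power2_le_imp_le)
  have "(norm (A *v x))\<^sup>2 = (\<Sum>i\<in>UNIV. ((A $ i) \<bullet> x)\<^sup>2)"
    unfolding power2_norm_eq_inner by (simp add: inner_vec_def[of "A *v x"] matrix_vector_mul_component power2_eq_square)
  also have "\<dots> \<le> (\<Sum>i\<in>UNIV. (norm (A $ i))\<^sup>2 * (norm x)\<^sup>2)"
    by (intro sum_mono) (metis Cauchy_Schwarz_ineq power2_norm_eq_inner)
  also have "\<dots> = (norm A * norm x)\<^sup>2"
    by (simp add: power_mult_distrib power2_norm_eq_inner[of A] inner_vec_def[of A] power2_norm_eq_inner sum_distrib_right)
  finally show "(norm (A *v x))\<^sup>2 \<le> (norm A * norm x)\<^sup>2" .
qed simp

lemma norm_matrix_mult_le: "norm (A ** B) \<le> norm A * norm B" for A B :: "real^2^2"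
proof (rule power2_le_imp_le)
  have *: "(norm M)\<^sup>2 = (norm (M *v axis 1 1))\<^sup>2 + (norm (M *v axis 2 1))\<^sup>2" for M :: "real^2^2"
    by (simp add: power2_norm_eq_inner inner_vec_def sum_2 matrix_vector_mult_def axis_def)
  have "(norm (A ** B))\<^sup>2 = (norm (A *v (B *v axis 1 1)))\<^sup>2 + (norm (A *v (B *v axis 2 1)))\<^sup>2"
    by (simp add: * matrix_vector_mul_assoc)
  also have "\<dots> \<le> (norm A * norm (B *v axis 1 1))\<^sup>2 + (norm A * norm (B *v axis 2 1))\<^sup>2"
    by (intro add_mono power_mono norm_matrix_vector_le) auto
  also have "\<dots> = (norm A * norm B)\<^sup>2" by (simp add: *[of B] power_mult_distrib algebra_simps)
  finally show "(norm (A ** B))\<^sup>2 \<le> (norm A * norm B)\<^sup>2" .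
qed simp

lemma norm_matrix2_le: "norm M \<le> norm (M *v axis 1 1) + norm (M *v axis 2 1)" for M :: "real^2^2"
proof (rule power2_le_imp_le)
  have "(norm M)\<^sup>2 = (norm (M *v axis 1 1))\<^sup>2 + (norm (M *v axis 2 1))\<^sup>2"
    by (simp add: power2_norm_eq_inner inner_vec_def sum_2 matrix_vector_mult_def axis_def)
  then show "(norm M)\<^sup>2 \<le> (norm (M *v axis 1 1) + norm (M *v axis 2 1))\<^sup>2"
    by (simp add: power2_sum)
qed simp

text \<open>Serves to apply discreteness: group elements whose values on two fixed independent
  vectors are bounded have bounded norm, so there are finitely many.\<close>

lemma norm_le_basis:
  fixes M :: "real^2^2"
  assumes D: "det2 p q \<noteq> 0"
  shows "norm M \<le> 2 * (norm (M *v p) * norm q + norm (M *v q) * norm p) / \<bar>det2 p q\<bar>"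
proof -
  have *: "norm (M *v v) \<le> (norm (M *v p) * norm q + norm (M *v q) * norm p) / \<bar>det2 p q\<bar>" if "norm v = 1" for v
  proof -
    have "det2 p q *\<^sub>R (M *v v) = M *v (det2 v q *\<^sub>R p + det2 p v *\<^sub>R q)"
      by (simp add: matrix_vector_mult_scaleR flip: det2_expansion)
    also have "\<dots> = det2 v q *\<^sub>R (M *v p) + det2 p v *\<^sub>R (M *v q)"
      by (simp add: matrix_vector_mult_scaleR matrix_vector_right_distrib)
    finally have "\<bar>det2 p q\<bar> * norm (M *v v) \<le> \<bar>det2 v q\<bar> * norm (M *v p) + \<bar>det2 p v\<bar> * norm (M *v q)"
      by (metis norm_scaleR norm_triangle_ineq)
    also have "\<dots> \<le> norm q * norm (M *v p) + norm p * norm (M *v q)"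
      using abs_det2_le[of v q] abs_det2_le[of p v] that by (intro add_mono mult_right_mono) auto
    finally show ?thesis using D by (simp add: field_simps)
  qed
  have "norm (axis 1 1 :: real^2) = 1" "norm (axis 2 1 :: real^2) = 1" by auto
  from *[OF this(1)] *[OF this(2)] norm_matrix2_le[of M]
  have "norm M \<le> 2 * ((norm (M *v p) * norm q + norm (M *v q) * norm p) / \<bar>det2 p q\<bar>)" by linarith
  then show ?thesis by simp
qed

text \<open>\<open>a\<close> spans the attracting and \<open>b\<close> the repelling fixed point.
  The eigenvalue may be negative since the lift of an element of \<open>PSL\<close> is determined up
  to sign.\<close>

definition eigpair :: "real^2^2 \<Rightarrow> real^2 \<Rightarrow> real^2 \<Rightarrow> real \<Rightarrow> bool" where
  "eigpair M a b l \<longleftrightarrow> M *v a = l *\<^sub>R a \<and> M *v b = (1 / l) *\<^sub>R b \<and> \<bar>l\<bar> > 1 \<and> det2 a b \<noteq> 0"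

lemma eigpair_nz: "eigpair M a b l \<Longrightarrow> a \<noteq> 0 \<and> b \<noteq> 0 \<and> l \<noteq> 0"
  by (auto simp: eigpair_def)

lemma trace2: "trace M = M $ 1 $ 1 + M $ 2 $ 2" for M :: "real^2^2"
  by (simp add: trace_def sum_2)

lemma eigpair_trace:
  assumes "eigpair M a b l"
  shows "trace M = l + 1 / l"
proof -
  have e: "M *v a = l *\<^sub>R a" "M *v b = (1 / l) *\<^sub>R b" "det2 a b \<noteq> 0" using assms by (auto simp: eigpair_def)
  have "trace M * det2 a b = det2 (M *v a) b + det2 a (M *v b)"
    by (simp add: trace2 det2_def matrix_vector_mult_def sum_2 algebra_simps)
  also have "\<dots> = (l + 1 / l) * det2 a b" using e by (simp add: algebra_simps)
  finally show ?thesis using e(3) by simp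
qed

lemma eigpair_hyperbolic: "eigpair M a b l \<Longrightarrow> \<bar>trace M\<bar> > 2"
proof -
  assume e: "eigpair M a b l"
  then have l: "\<bar>l\<bar> > 1" "l \<noteq> 0" by (auto simp: eigpair_def)
  have "(\<bar>l\<bar> - 1)\<^sup>2 > 0" using l by simp
  then have "\<bar>l\<bar> * \<bar>l\<bar> + 1 > 2 * \<bar>l\<bar>" by (simp add: power2_eq_square algebra_simps)
  then have "\<bar>l\<bar> + 1 / \<bar>l\<bar> > 2" using l by (simp add: field_simps)
  moreover have "\<bar>l + 1 / l\<bar> = \<bar>l\<bar> + 1 / \<bar>l\<bar>"
  proof (cases "l > 0")
    case True
    then have "l + 1 / l > 0" by (intro add_pos_pos) auto
    then show ?thesis using True by simp
  next
    case False
    then have "l < 0" "1 / l < 0" using l by auto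
    then have "l + 1 / l < 0" by linarith
    then show ?thesis using \<open>l < 0\<close> by simp
  qed
  ultimately show ?thesis by (simp add: eigpair_trace[OF e])
qed

lemma hyperbolic_eigpair:
  fixes M :: "real^2^2"
  assumes "det M = 1" "\<bar>trace M\<bar> > 2"
  shows "\<exists>a b l. eigpair M a b l"
proof -
  define t where "t = trace M"
  define r where "r = sqrt (t\<^sup>2 - 4)"
  \<comment> \<open>The sign of \<open>r\<close> follows that of \<open>t\<close>, so the two terms
    reinforce each other and \<open>l\<close> is the root of modulus greater than 1.\<close>
  define l where "l = (if t > 0 then (t + r) / 2 else (t - r) / 2)"
  have "2\<^sup>2 < \<bar>t\<bar>\<^sup>2" using assms(2) by (intro power_strict_mono) (auto simp: t_def)
  then have t4: "t\<^sup>2 - 4 > 0" by simp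
  then have sq: "r > 0" "r\<^sup>2 = t\<^sup>2 - 4" by (auto simp: r_def)
  have l1: "\<bar>l\<bar> > 1"
  proof (cases "t > 0")
    case True
    then have "2 < t" using assms(2) unfolding t_def[symmetric] by simp
    then have "2 < t + r" using sq(1) by (rule_tac less_trans[of 2 t]) auto
    then have "l > 1" unfolding l_def if_P[OF True] by simp
    then show ?thesis by simp
  next
    case False
    then have "2 < - t" using assms(2) unfolding t_def[symmetric] by simp
    then have "t - r < - 2" using sq(1) by simp
    then have "l < - 1" unfolding l_def if_not_P[OF False] by simp
    then show ?thesis by simp
  qed
  have "(2 * l - t)\<^sup>2 = t\<^sup>2 - 4" using sq(2) by (auto simp: l_def add_divide_distrib diff_divide_distrib)
  then have ll: "l * l - t * l + 1 = 0" by (simp add: power2_eq_square algebra_simps)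
  then have l2: "t = l + 1 / l" using l1 by (auto simp: field_simps)
  have ker: "\<exists>x. x \<noteq> 0 \<and> M *v x = m *\<^sub>R x" if m: "m * m - t * m + 1 = 0" for m
  proof -
    have "det (M - m *\<^sub>R mat 1) = m * m - t * m + det M"
      by (simp add: det_2 mat_def t_def trace2 algebra_simps)
    then have "det (M - m *\<^sub>R mat 1) = 0" using m assms(1) by simp
    then have "\<not> invertible (M - m *\<^sub>R mat 1)" by (simp add: invertible_det_nz)
    then obtain x where "x \<noteq> 0" "(M - m *\<^sub>R mat 1) *v x = 0"
      by (metis invertible_left_inverse matrix_left_invertible_ker)
    then show ?thesis
      by (auto simp: matrix_vector_mult_diff_rdistrib scaleR_matrix_vector_assoc[symmetric])
  qed
  obtain a where a: "a \<noteq> 0" "M *v a = l *\<^sub>R a" using ker[OF ll] by blast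
  have "(1 / l) * (1 / l) - t * (1 / l) + 1 = 0" using l1 unfolding l2 by (auto simp: field_simps)
  then obtain b where b: "b \<noteq> 0" "M *v b = (1 / l) *\<^sub>R b" using ker by blast
  have "det2 a b \<noteq> 0"
  proof
    assume "det2 a b = 0"
    then obtain c where c: "b = c *\<^sub>R a" using a(1) det2_0_parallel by blast
    then have "c \<noteq> 0" using b(1) by auto
    have "(c * l) *\<^sub>R a = (c * (1 / l)) *\<^sub>R a"
      using b(2) a(2) c by (simp add: matrix_vector_mult_scaleR mult.commute)
    then have "c * l = c * (1 / l)" using a(1) by simp
    then have "l = 1 / l" using \<open>c \<noteq> 0\<close> by (metis mult_cancel_left)
    then have "l * l = 1" using l1 by (auto simp: field_simps)
    then have "\<bar>l\<bar> * \<bar>l\<bar> = 1" by (metis abs_mult abs_one)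
    moreover have "\<bar>l\<bar> * \<bar>l\<bar> > 1 * 1" using l1 by (intro mult_strict_mono) auto
    ultimately show False by simp
  qed
  then show ?thesis using a b l1 unfolding eigpair_def by blast
qed

text \<open>If the eigenlines are close, then unit eigenvectors \<open>u\<close> and
  \<open>v\<close>, with signs such that \<open>u \<bullet> v \<ge> 0\<close>, have a small
  difference; yet \<open>M\<close> stretches this difference to length at least
  \<open>\<bar>l\<bar> - 1 / \<bar>l\<bar>\<close>. So a bound on \<open>norm M\<close> bounds the
  angle from below.\<close>

lemma eigpair_separation:
  assumes e: "eigpair M a b l"
  shows "(\<bar>l\<bar> - 1 / \<bar>l\<bar>) * (norm a * norm b) \<le> 2 * norm M * \<bar>det2 a b\<bar>"
proof -
  define u where "u = (1 / norm a) *\<^sub>R a"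
  define s where "s = (if a \<bullet> b \<ge> 0 then 1 else -1 :: real)"
  define v where "v = (s / norm b) *\<^sub>R b"
  have nz: "a \<noteq> 0" "b \<noteq> 0" "l \<noteq> 0" using eigpair_nz[OF e] by auto
  have uv: "norm u = 1" "norm v = 1" using nz by (auto simp: u_def v_def s_def)
  have "u \<bullet> v = \<bar>a \<bullet> b\<bar> / (norm a * norm b)" by (simp add: u_def v_def s_def)
  then have uv0: "u \<bullet> v \<ge> 0" by simp
  have uv1: "u \<bullet> v \<le> 1" using Cauchy_Schwarz_ineq2[of u v] uv by simp
  have d: "\<bar>det2 u v\<bar> = \<bar>det2 a b\<bar> / (norm a * norm b)" by (simp add: u_def v_def s_def abs_mult)
  have "(norm (u - v))\<^sup>2 = 2 - 2 * (u \<bullet> v)"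
    using uv by (simp add: power2_norm_eq_inner inner_diff_left inner_diff_right inner_commute)
      (simp flip: power2_norm_eq_inner)
  also have "\<dots> \<le> 2 * (1 - (u \<bullet> v)\<^sup>2)"
    using mult_left_mono[OF uv1 uv0] by (simp add: power2_eq_square)
  also have "\<dots> = 2 * (det2 u v)\<^sup>2" using lagrange[of u v] uv by simp
  also have "\<dots> \<le> (2 * \<bar>det2 u v\<bar>)\<^sup>2" by (simp add: power_mult_distrib)
  finally have n: "norm (u - v) \<le> 2 * \<bar>det2 u v\<bar>" by (rule power2_le_imp_le) simp
  have "M *v (u - v) = l *\<^sub>R u - (1 / l) *\<^sub>R v"
    using e by (simp add: eigpair_def u_def v_def matrix_vector_mult_diff_distrib matrix_vector_mult_scaleR mult.commute)
  then have "norm (M *v (u - v)) \<ge> norm (l *\<^sub>R u) - norm ((1 / l) *\<^sub>R v)" by (metis norm_triangle_ineq2)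
  then have "\<bar>l\<bar> - 1 / \<bar>l\<bar> \<le> norm (M *v (u - v))" using uv by simp
  also have "\<dots> \<le> norm M * norm (u - v)" by (rule norm_matrix_vector_le)
  also have "\<dots> \<le> norm M * (2 * \<bar>det2 u v\<bar>)" using n by (intro mult_left_mono) auto
  finally show ?thesis using nz unfolding d by (simp add: field_simps)
qed

text \<open>\<open>G\<close> is the preimage of a Fuchsian group in \<open>SL(2,\<real>)\<close>, and nonzero vectors represent boundary points.
  The axiom \<open>orbits\<close> is non-elementarity, and \<open>gen\<close> says that \<open>S\<close> generates \<open>G\<close> up to signs.\<close>

locale sl2_group =
  fixes G :: "(real^2^2) set" and S :: "(real^2^2) set"
  assumes det1: "A \<in> G \<Longrightarrow> det A = 1"
    and one: "mat 1 \<in> G"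
    and mult: "A \<in> G \<Longrightarrow> B \<in> G \<Longrightarrow> A ** B \<in> G"
    and minv: "A \<in> G \<Longrightarrow> matrix_inv A \<in> G"
    and neg: "A \<in> G \<Longrightarrow> - A \<in> G"
    and discrete: "finite {A \<in> G. norm A \<le> C}"
    and orbits: "v \<noteq> 0 \<Longrightarrow> finite L \<Longrightarrow> 0 \<notin> L \<Longrightarrow> \<exists>g\<in>G. \<forall>w\<in>L. det2 (g *v v) w \<noteq> 0"
    and finS: "finite S" and SG: "S \<subseteq> G"
    and gen: "A \<in> G \<Longrightarrow> P (mat 1) \<Longrightarrow> (\<And>A. A \<in> S \<Longrightarrow> P A) \<Longrightarrow>
       (\<And>A B. A \<in> G \<Longrightarrow> B \<in> G \<Longrightarrow> P A \<Longrightarrow> P B \<Longrightarrow> P (A ** B)) \<Longrightarrow>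
       (\<And>A. A \<in> G \<Longrightarrow> P A \<Longrightarrow> P (matrix_inv A)) \<Longrightarrow>
       (\<And>A. A \<in> G \<Longrightarrow> P A \<Longrightarrow> P (- A)) \<Longrightarrow> P A"
begin

lemma inv_mult [simp]:
  assumes "A \<in> G"
  shows "A ** matrix_inv A = mat 1" "matrix_inv A ** A = mat 1"
    "A *v (matrix_inv A *v x) = x" "matrix_inv A *v (A *v x) = x"
  using matrix_inv_SL[OF det1[OF assms]] by (simp_all add: matrix_vector_mul_assoc)

lemma det2_G [simp]: "A \<in> G \<Longrightarrow> det2 (A *v x) (A *v y) = det2 x y"
  by (simp add: det2_mult det1)

lemma det2_move: "A \<in> G \<Longrightarrow> det2 (A *v x) y = det2 x (matrix_inv A *v y)"
  by (metis det2_G inv_mult(3) minv)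

lemma G_nz: "A \<in> G \<Longrightarrow> x \<noteq> 0 \<Longrightarrow> A *v x \<noteq> 0"
  by (metis inv_mult(4) matrix_vector_mult_0_right)

lemma infinite_G: "infinite G"
proof
  assume f: "finite G"
  have e: "(axis 1 1 :: real^2) \<noteq> 0" by simp
  have "0 \<notin> (\<lambda>g. g *v axis 1 1) ` G" using G_nz[OF _ e] by force
  then obtain g where "g \<in> G" "\<forall>w\<in>(\<lambda>g. g *v axis 1 1) ` G. det2 (g *v axis 1 1) w \<noteq> 0"
    using orbits[OF e, of "(\<lambda>g. g *v axis 1 1) ` G"] f by auto
  then show False by force
qed

lemma eigpair_conj:
  assumes "g \<in> G" "eigpair M a b l"
  shows "eigpair (g ** M ** matrix_inv g) (g *v a) (g *v b) l"
  using assms by (simp add: eigpair_def matrix_vector_mult_scaleR flip: matrix_vector_mul_assoc)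

lemma norm_G_basis:
  assumes "h \<in> G" "det2 p q \<noteq> 0" "norm (h *v p) \<le> R" "norm (h *v q) \<le> R"
  shows "norm h \<le> 2 * (R * norm q + R * norm p) / \<bar>det2 p q\<bar>"
proof -
  have "2 * (norm (h *v p) * norm q + norm (h *v q) * norm p) / \<bar>det2 p q\<bar> \<le> 2 * (R * norm q + R * norm p) / \<bar>det2 p q\<bar>"
    using assms by (intro divide_right_mono mult_left_mono add_mono mult_right_mono) auto
  then show ?thesis using norm_le_basis[OF assms(2), of h] by linarith
qed

lemma finite_bounded_basis:
  assumes "det2 p q \<noteq> 0"
  shows "finite {h \<in> G. norm (h *v p) \<le> R \<and> norm (h *v q) \<le> R}"
  by (rule finite_subset[OF _ discrete[of "2 * (R * norm q + R * norm p) / \<bar>det2 p q\<bar>"]])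
    (use norm_G_basis[OF _ assms] in blast)

text \<open>Each unit vector is moved off its line by some element of \<open>G\<close>, by
  \<open>orbits\<close> for \<open>{u}\<close>. The same element works nearby, so compactness of the
  circle leaves finitely many.\<close>

lemma no_common_line:
  "\<exists>F. finite F \<and> F \<subseteq> G \<and> (\<forall>u. u \<noteq> 0 \<longrightarrow> (\<exists>f\<in>F. det2 (f *v u) u \<noteq> 0))"
proof -
  have "\<exists>g\<in>G. det2 (g *v u) u \<noteq> 0" if "u \<in> sphere 0 1" for u
  proof -
    have "u \<noteq> 0" using that by force
    then show ?thesis using orbits[of u "{u}"] by auto
  qed
  then obtain g where g: "\<And>u. u \<in> sphere 0 1 \<Longrightarrow> g u \<in> G \<and> det2 (g u *v u) u \<noteq> 0" by metis
  define U where "U u = {v. det2 (g u *v v) v \<noteq> 0}" for u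
  have opn: "open (U u)" for u
  proof -
    have "open ((\<lambda>v. det2 (g u *v v) v) -` (- {0}))"
      by (intro open_vimage continuous_intros matrix_vector_mult_linear_continuous_on)
    then show ?thesis by (simp add: U_def vimage_def)
  qed
  have "compact (sphere (0::real^2) 1)" by simp
  moreover have "sphere 0 1 \<subseteq> (\<Union>u\<in>sphere 0 1. U u)" using g by (auto simp: U_def)
  ultimately obtain T where T: "T \<subseteq> sphere 0 1" "finite T" "sphere 0 1 \<subseteq> (\<Union>u\<in>T. U u)"
    using opn by (metis compactE_image)
  have "\<exists>f\<in>g ` T. det2 (f *v u) u \<noteq> 0" if u: "u \<noteq> 0" for u
  proof -
    have "(1 / norm u) *\<^sub>R u \<in> sphere 0 1" using u by simp
    then obtain t where "t \<in> T" "(1 / norm u) *\<^sub>R u \<in> U t" using T(3) by blast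
    then show ?thesis by (intro bexI[of _ "g t"]) (auto simp: U_def matrix_vector_mult_scaleR)
  qed
  then show ?thesis using T g by (intro exI[of _ "g ` T"]) auto
qed

text \<open>By compactness of the unit sphere it suffices that no \<open>X \<noteq> 0\<close> has
  determinant 0 and all traces \<open>trace (X ** f)\<close> equal to 0. Such an \<open>X\<close>
  and all \<open>X ** f\<close> would be nilpotent, so each \<open>f\<close> would preserve the line
  that is both image and kernel of \<open>X\<close>, against \<open>no_common_line\<close>.\<close>

lemma trace_lower_bound:
  "\<exists>F c. finite F \<and> F \<subseteq> G \<and> c > 0 \<and>
    (\<forall>X. norm X = 1 \<longrightarrow> \<bar>det X\<bar> < c \<longrightarrow> (\<exists>f\<in>F. c \<le> \<bar>trace (X ** f)\<bar>))"
proof -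
  obtain F0 where F0: "finite F0" "F0 \<subseteq> G" "\<And>u. u \<noteq> 0 \<Longrightarrow> \<exists>f\<in>F0. det2 (f *v u) u \<noteq> 0"
    using no_common_line by blast
  define F where "F = insert (mat 1) F0"
  have F: "finite F" "F \<subseteq> G" using F0 one by (auto simp: F_def)
  define m where "m X = max \<bar>det X\<bar> (\<Sum>f\<in>F. \<bar>trace (X ** f)\<bar>)" for X :: "real^2^2"
  have pos: "m X > 0" if "X \<noteq> 0" for X
  proof (rule ccontr)
    assume n: "\<not> m X > 0"
    have s0: "(\<Sum>f\<in>F. \<bar>trace (X ** f)\<bar>) \<ge> 0" by (intro sum_nonneg) auto
    have "\<bar>det X\<bar> \<le> 0" and s1: "(\<Sum>f\<in>F. \<bar>trace (X ** f)\<bar>) \<le> 0" using n by (simp_all add: m_def not_less)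
    then have d: "det X = 0" by simp
    have "(\<Sum>f\<in>F. \<bar>trace (X ** f)\<bar>) = 0" using s0 s1 by (rule antisym[rotated])
    then have t: "trace (X ** f) = 0" if "f \<in> F" for f
      using that F(1) by (simp add: sum_nonneg_eq_0_iff)
    \<comment> \<open>Cayley-Hamilton: with trace and determinant 0 the square vanishes.\<close>
    have ch: "Y *v (Y *v v) = 0" if "trace Y = 0" "det Y = 0" for Y :: "real^2^2" and v
    proof -
      have "Y *v (Y *v v) = trace Y *\<^sub>R (Y *v v) - det Y *\<^sub>R v"
        by (simp add: vec_eq_iff forall_2 matrix_vector_mult_def sum_2 trace2 det_2 algebra_simps)
      then show ?thesis using that by simp
    qed
    have "\<exists>v. X *v v \<noteq> 0" using that by (metis matrix_eq matrix_vector_mult_0)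
    then obtain v where v: "X *v v \<noteq> 0" by blast
    define u where "u = X *v v"
    have Xu: "X *v u = 0" unfolding u_def using t[of "mat 1"] d by (intro ch) (auto simp: F_def)
    have ker: "det2 p u = 0" if p: "X *v p = 0" for p
    proof (rule ccontr)
      assume "det2 p u \<noteq> 0"
      then obtain \<alpha> \<beta> where "v = \<alpha> *\<^sub>R p + \<beta> *\<^sub>R u" using det2_basis by metis
      then have "X *v v = 0" using p Xu by (simp add: matrix_vector_right_distrib matrix_vector_mult_scaleR)
      then show False using v by simp
    qed
    obtain f where f: "f \<in> F0" "det2 (f *v u) u \<noteq> 0" using F0(3) v u_def by blast
    have dXf: "det (X ** f) = 0" by (simp add: det_mul d)
    have "X *v (f *v (X *v (f *v w))) = 0" for w
      using ch[OF t[of f] dXf, of w] f(1) by (simp add: F_def matrix_vector_mul_assoc matrix_mul_assoc)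
    moreover have "\<exists>w. f *v w = v" using f(1) F0(2) inv_mult(3) by blast
    ultimately have "X *v (f *v u) = 0" unfolding u_def by metis
    then show False using ker f(2) by blast
  qed
  have cont: "continuous_on (sphere 0 1) m"
    unfolding m_def det_2 trace2 matrix_matrix_mult_def sum_2
    by (simp, intro continuous_intros)
  have ne: "sphere (0::real^2^2) 1 \<noteq> {}" by simp
  obtain X0 where X0: "X0 \<in> sphere 0 1" "\<And>X. X \<in> sphere 0 1 \<Longrightarrow> m X0 \<le> m X"
    using continuous_attains_inf[OF _ ne cont] by auto
  have m0: "m X0 > 0" using X0(1) by (intro pos) auto
  have F1: "card F > 0" using F(1) by (auto simp: F_def card_gt_0_iff)
  \<comment> \<open>If the sum of the absolute traces is at least \<open>m X0\<close>, one of the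
    summands reaches the average, which is \<open>c\<close>.\<close>
  define c where "c = m X0 / card F"
  have c: "c > 0" using m0 F1 by (simp add: c_def)
  have cm: "c \<le> m X0" using m0 F1 by (simp add: c_def divide_le_eq mult_le_cancel_left1)
  have "\<exists>f\<in>F. c \<le> \<bar>trace (X ** f)\<bar>" if X: "norm X = 1" "\<bar>det X\<bar> < c" for X
  proof (rule ccontr)
    assume "\<not> (\<exists>f\<in>F. c \<le> \<bar>trace (X ** f)\<bar>)"
    then have "(\<Sum>f\<in>F. \<bar>trace (X ** f)\<bar>) < (\<Sum>f\<in>F. c)"
      using F(1) F1 by (intro sum_strict_mono) (auto simp: card_gt_0_iff not_le)
    also have "\<dots> = m X0" using F1 by (simp add: c_def)
    finally have "m X < m X0" using X(2) cm by (simp add: m_def)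
    then show False using X0(2)[of X] X(1) by simp
  qed
  then show ?thesis using F c by blast
qed

text \<open>The base point is at bounded distance, in terms of \<open>K\<close>, from the axis of \<open>M\<close>.\<close>

definition sep :: "real \<Rightarrow> real^2^2 \<Rightarrow> bool" where
  "sep K M \<longleftrightarrow> (\<exists>a b l. eigpair M a b l \<and> norm a * norm b \<le> K * \<bar>det2 a b\<bar>)"

lemma sep_mono: "sep K M \<Longrightarrow> K \<le> K' \<Longrightarrow> sep K' M"
  unfolding sep_def by (meson abs_ge_zero mult_right_mono order_trans)

text \<open>A trace of modulus at least 4 gives \<open>\<bar>l\<bar> - 1 / \<bar>l\<bar> \<ge>
  \<bar>trace M\<bar> - 2 \<ge> \<bar>trace M\<bar> / 2\<close>. Then
  \<open>eigpair_separation\<close> compares this with \<open>norm M\<close>, which is at most a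
  multiple of the trace.\<close>

lemma sep_of_trace:
  assumes "det M = 1" "\<bar>trace M\<bar> \<ge> 4" "norm M \<le> C * \<bar>trace M\<bar>"
  shows "sep (4 * C) M"
proof -
  obtain a b l where e: "eigpair M a b l" using hyperbolic_eigpair[of M] assms by auto
  have l: "\<bar>l\<bar> > 1" using e by (simp add: eigpair_def)
  have "\<bar>trace M\<bar> \<le> \<bar>l\<bar> + 1 / \<bar>l\<bar>" using eigpair_trace[OF e] by (metis abs_divide abs_one abs_triangle_ineq)
  moreover have "1 / \<bar>l\<bar> \<le> 1" using l by simp
  ultimately have "\<bar>trace M\<bar> / 2 \<le> \<bar>l\<bar> - 1 / \<bar>l\<bar>" using assms(2) by linarith
  then have "\<bar>trace M\<bar> / 2 * (norm a * norm b) \<le> (\<bar>l\<bar> - 1 / \<bar>l\<bar>) * (norm a * norm b)"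
    by (intro mult_right_mono) auto
  also have "\<dots> \<le> 2 * norm M * \<bar>det2 a b\<bar>" by (rule eigpair_separation[OF e])
  also have "\<dots> \<le> 2 * (C * \<bar>trace M\<bar>) * \<bar>det2 a b\<bar>" using assms(3) by (intro mult_right_mono mult_left_mono) auto
  finally have "\<bar>trace M\<bar> * (norm a * norm b) \<le> \<bar>trace M\<bar> * (4 * C * \<bar>det2 a b\<bar>)" by (simp add: algebra_simps)
  then have "norm a * norm b \<le> 4 * C * \<bar>det2 a b\<bar>"
    using assms(2) mult_le_cancel_left_pos[of "\<bar>trace M\<bar>"] by (metis less_le_trans zero_less_numeral)
  then show ?thesis using e unfolding sep_def by blast
qed

lemma det_scaleR2: "det (c *\<^sub>R X) = c\<^sup>2 * det X" for X :: "real^2^2"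
  by (simp add: det_2 power2_eq_square algebra_simps)

lemma trace_scaleR2: "trace (c *\<^sub>R X) = c * trace X" for X :: "real^2^2"
  by (simp add: trace2 algebra_simps)

text \<open>Rescaled to norm 1, large elements of \<open>G\<close> are nearly singular, and a nearly singular \<open>X\<close> has
  \<open>trace (X ** f)\<close> bounded below for one of finitely many \<open>f\<close>.\<close>

lemma finite_hyperbolizing:
  "\<exists>F K. finite F \<and> F \<subseteq> G \<and> (\<forall>g\<in>G. \<exists>f\<in>F. sep K (g ** f))"
proof -
  obtain F c where F: "finite F" "F \<subseteq> G" "c > 0"
    "\<And>X. norm X = 1 \<Longrightarrow> \<bar>det X\<bar> < c \<Longrightarrow> (\<exists>f\<in>F. c \<le> \<bar>trace (X ** f)\<bar>)"
    using trace_lower_bound by blast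
  define B where "B = (\<Sum>f\<in>F. norm f)"
  have B: "norm f \<le> B" if "f \<in> F" for f unfolding B_def using F(1) that by (intro member_le_sum) auto
  \<comment> \<open>\<open>1 / c + 1\<close> makes the determinant of the rescaled matrix smaller
    than \<open>c\<close>, and \<open>4 / c\<close> makes the trace at least 4.\<close>
  define R where "R = max 1 (max (4 / c) (1 / c + 1))"
  have big: "\<exists>f\<in>F. sep (4 * (B / c)) (g ** f)" if g: "g \<in> G" "norm g \<ge> R" for g
  proof -
    have n: "norm g \<ge> 1" "norm g \<ge> 4 / c" "norm g \<ge> 1 / c + 1" using g(2) by (auto simp: R_def)
    define X where "X = (1 / norm g) *\<^sub>R g"
    have "norm g > 0" using n(1) by linarith
    then have nX: "norm X = 1" unfolding X_def by simp
    have "norm g * 1 \<le> norm g * norm g" using n(1) by (intro mult_left_mono) auto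
    then have "1 / c < (norm g)\<^sup>2" using n(3) by (simp add: power2_eq_square)
    then have "1 < (norm g)\<^sup>2 * c" using F(3) by (simp add: field_simps)
    then have dX: "\<bar>det X\<bar> < c" using n(1) det1[OF g(1)] F(3)
      by (simp add: X_def det_scaleR2 power_divide divide_less_eq field_simps)
    from F(4)[OF nX dX] obtain f where f: "f \<in> F" "c \<le> \<bar>trace (X ** f)\<bar>" by blast
    have "X ** f = (1 / norm g) *\<^sub>R (g ** f)" by (simp add: X_def vec_eq_iff matrix_matrix_mult_def sum_distrib_left)
    then have "\<bar>trace (X ** f)\<bar> = \<bar>trace (g ** f)\<bar> / norm g" by (simp add: trace_scaleR2 abs_mult)
    then have t: "c * norm g \<le> \<bar>trace (g ** f)\<bar>" using f(2) n(1)
      by (simp add: le_divide_eq split: if_splits)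
    have "4 \<le> c * norm g" using n(2) F(3) by (simp add: field_simps)
    then have t4: "4 \<le> \<bar>trace (g ** f)\<bar>" using t by linarith
    have B0: "B \<ge> 0" using B[OF f(1)] norm_ge_zero order_trans by blast
    have "norm (g ** f) \<le> norm g * norm f" by (rule norm_matrix_mult_le)
    also have "\<dots> \<le> norm g * B" using B[OF f(1)] by (intro mult_left_mono) auto
    also have "\<dots> = (B / c) * (c * norm g)" using F(3) by simp
    also have "\<dots> \<le> (B / c) * \<bar>trace (g ** f)\<bar>" using t B0 F(3) by (intro mult_left_mono) auto
    finally have "sep (4 * (B / c)) (g ** f)"
      using t4 g(1) f(1) F(2) by (intro sep_of_trace) (auto simp: det_mul det1)
    then show ?thesis using f(1) by blast
  qed
  have "\<exists>g\<in>G. norm g \<ge> R"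
  proof (rule ccontr)
    assume "\<not> (\<exists>g\<in>G. norm g \<ge> R)"
    then have "G \<subseteq> {A \<in> G. norm A \<le> R}" by force
    then show False using infinite_G discrete finite_subset by blast
  qed
  then obtain g0 f0 where g0: "g0 \<in> G" "f0 \<in> F" "sep (4 * (B / c)) (g0 ** f0)" using big by blast
  \<comment> \<open>The finitely many elements of norm at most \<open>R\<close> are all multiplied
    onto the one separated element \<open>g0 ** f0\<close>.\<close>
  define F' where "F' = F \<union> (\<lambda>g. matrix_inv g ** (g0 ** f0)) ` {g \<in> G. norm g \<le> R}"
  have "\<exists>f\<in>F'. sep (4 * (B / c)) (g ** f)" if g: "g \<in> G" for g
  proof (cases "norm g \<ge> R")
    case True
    then show ?thesis using big[OF g] by (auto simp: F'_def)
  next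
    case False
    have "g ** (matrix_inv g ** (g0 ** f0)) = g0 ** f0" using g by (metis inv_mult(1) matrix_mul_assoc matrix_mul_lid)
    then show ?thesis using False g g0(3)
      by (intro bexI[of _ "matrix_inv g ** (g0 ** f0)"]) (auto simp: F'_def)
  qed
  moreover have "finite F'" "F' \<subseteq> G" using F(1,2) discrete g0 by (auto simp: F'_def mult minv)
  ultimately show ?thesis by blast
qed

end

text \<open>If the inner products have opposite signs, the geodesic from \<open>v\<close> to
  \<open>w\<close> separates the base point from its image under the inverse of \<open>t\<close>, so
  it passes near the base point. Analytically: for nonzero parallel vectors both inner products have
  the same sign, and the unit pairs violating this form a compact set, on which \<open>det2\<close>
  is bounded away from 0.\<close>

lemma sign_change_separation:
  fixes t :: "real^2^2"
  assumes t: "det t = 1"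
  shows "\<exists>K. \<forall>v w. (v \<bullet> w) * ((t *v v) \<bullet> (t *v w)) \<le> 0 \<longrightarrow> norm v * norm w \<le> K * \<bar>det2 v w\<bar>"
proof -
  define S where "S = {p :: (real^2) \<times> (real^2). norm (fst p) = 1 \<and> norm (snd p) = 1 \<and>
     (fst p \<bullet> snd p) * ((t *v fst p) \<bullet> (t *v snd p)) \<le> 0}"
  have "closed S" unfolding S_def
    by (intro closed_Collect_conj closed_Collect_eq closed_Collect_le continuous_intros
        continuous_on_compose2[OF matrix_vector_mult_linear_continuous_on[of UNIV t]]) auto
  moreover have "S \<subseteq> cball 0 1 \<times> cball 0 1" by (auto simp: S_def)
  then have "bounded S" by (rule bounded_subset[rotated]) (intro bounded_Times bounded_cball)
  ultimately have cS: "compact S" by (simp add: compact_eq_bounded_closed)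
  have cont: "continuous_on S (\<lambda>p. \<bar>det2 (fst p) (snd p)\<bar>)" by (intro continuous_intros)
  have pos: "\<bar>det2 (fst p) (snd p)\<bar> > 0" if p: "p \<in> S" for p
  proof (rule ccontr)
    assume "\<not> \<bar>det2 (fst p) (snd p)\<bar> > 0"
    then have d: "det2 (fst p) (snd p) = 0" by simp
    have n: "norm (fst p) = 1" "norm (snd p) = 1" using p by (auto simp: S_def)
    then have nz: "fst p \<noteq> 0" "snd p \<noteq> 0" by force+
    obtain c where c: "snd p = c *\<^sub>R fst p" using det2_0_parallel[OF d nz(1)] by blast
    then have "c \<noteq> 0" using nz by auto
    have "t *v fst p \<noteq> 0"
      using t nz(1) by (metis matrix_inv_SL(2) matrix_vector_mul_assoc matrix_vector_mul_lid matrix_vector_mult_0_right)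
    then have "(c * (fst p \<bullet> fst p)) * (c * ((t *v fst p) \<bullet> (t *v fst p))) > 0"
    proof -
      have "fst p \<bullet> fst p > 0" "(t *v fst p) \<bullet> (t *v fst p) > 0"
        using nz(1) \<open>t *v fst p \<noteq> 0\<close> by simp_all
      then have "c\<^sup>2 * ((fst p \<bullet> fst p) * ((t *v fst p) \<bullet> (t *v fst p))) > 0"
        using \<open>c \<noteq> 0\<close> by (intro mult_pos_pos) auto
      then show ?thesis by (simp add: power2_eq_square mult_ac)
    qed
    then show False using p c by (auto simp: S_def matrix_vector_mult_scaleR)
  qed
  obtain k where k: "k > 0" "\<And>p. p \<in> S \<Longrightarrow> k \<le> \<bar>det2 (fst p) (snd p)\<bar>"
  proof (cases "S = {}")
    case True
    then show ?thesis using that[of 1] by auto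
  next
    case False
    then obtain p0 where "p0 \<in> S" "\<And>p. p \<in> S \<Longrightarrow> \<bar>det2 (fst p0) (snd p0)\<bar> \<le> \<bar>det2 (fst p) (snd p)\<bar>"
      using continuous_attains_inf[OF cS False cont] by blast
    then show ?thesis using that pos by blast
  qed
  have "norm v * norm w \<le> (1 / k) * \<bar>det2 v w\<bar>" if h: "(v \<bullet> w) * ((t *v v) \<bullet> (t *v w)) \<le> 0" for v w
  proof (cases "v = 0 \<or> w = 0")
    case False
    define p where "p = ((1 / norm v) *\<^sub>R v, (1 / norm w) *\<^sub>R w)"
    have "(fst p \<bullet> snd p) * ((t *v fst p) \<bullet> (t *v snd p)) = (1 / (norm v * norm w))\<^sup>2 * ((v \<bullet> w) * ((t *v v) \<bullet> (t *v w)))"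
      by (simp add: p_def matrix_vector_mult_scaleR power2_eq_square)
    also have "\<dots> \<le> 0" by (rule mult_nonneg_nonpos[OF zero_le_power2 h])
    finally have "p \<in> S" using False by (simp add: S_def p_def)
    from k(2)[OF this] have "k \<le> \<bar>det2 v w\<bar> / (norm v * norm w)" by (simp add: p_def abs_mult mult.commute)
    then show ?thesis using False k(1) by (simp add: field_simps)
  qed auto
  then show ?thesis by blast
qed

text \<open>Gaussian elimination: the equation \<open>s\<close> is solved for a pivot unknown
  \<open>k0\<close> and substituted into the others, which lowers both numbers by one.\<close>

lemma more_unknowns_than_equations:
  fixes x :: "'t \<Rightarrow> 's \<Rightarrow> real"
  assumes "finite S" "finite T" "card S < card T"
  shows "\<exists>c. (\<exists>k\<in>T. c k \<noteq> 0) \<and> (\<forall>s\<in>S. (\<Sum>k\<in>T. c k * x k s) = 0)"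
  using assms
proof (induction S arbitrary: T x rule: finite_induct)
  case empty
  then have "T \<noteq> {}" by auto
  then show ?case by (intro exI[of _ "\<lambda>_. 1"]) auto
next
  case (insert s S)
  show ?case
  proof (cases "\<forall>k\<in>T. x k s = 0")
    case True
    have "card S < card T" using insert by simp
    from insert.IH[OF insert.prems(1) this] show ?thesis using True by force
  next
    case False
    then obtain k0 where k0: "k0 \<in> T" "x k0 s \<noteq> 0" by blast
    define T' where "T' = T - {k0}"
    define y where "y k s' = x k s' - x k s / x k0 s * x k0 s'" for k s'
    have T': "finite T'" "card S < card T'" using insert k0 by (auto simp: T'_def)
    from insert.IH[OF this, of y] obtain c where
      c: "\<exists>k\<in>T'. c k \<noteq> 0" "\<And>s. s \<in> S \<Longrightarrow> (\<Sum>k\<in>T'. c k * y k s) = 0" by blast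
    define e where "e = - (\<Sum>k\<in>T'. c k * x k s) / x k0 s"
    define c' where "c' = c(k0 := e)"
    have split: "(\<Sum>k\<in>T. c' k * x k s') = e * x k0 s' + (\<Sum>k\<in>T'. c k * x k s')" for s'
    proof -
      have "(\<Sum>k\<in>T. c' k * x k s') = c' k0 * x k0 s' + (\<Sum>k\<in>T'. c' k * x k s')"
        unfolding T'_def using insert.prems(1) k0(1) by (rule sum.remove)
      also have "(\<Sum>k\<in>T'. c' k * x k s') = (\<Sum>k\<in>T'. c k * x k s')"
        by (intro sum.cong) (auto simp: c'_def T'_def)
      finally show ?thesis by (simp add: c'_def)
    qed
    have "(\<Sum>k\<in>T. c' k * x k s) = 0" unfolding split using k0(2) by (simp add: e_def)
    moreover have "(\<Sum>k\<in>T. c' k * x k s') = 0" if "s' \<in> S" for s'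
    proof -
      have "(\<Sum>k\<in>T'. c k * y k s') = (\<Sum>k\<in>T'. c k * x k s') - (\<Sum>k\<in>T'. c k * x k s) * (x k0 s' / x k0 s)"
        by (simp add: y_def right_diff_distrib sum_subtractf sum_distrib_right sum_divide_distrib mult.assoc)
      then have "(\<Sum>k\<in>T'. c k * x k s') = (\<Sum>k\<in>T'. c k * x k s) * (x k0 s' / x k0 s)"
        using c(2)[OF that] by simp
      then show ?thesis unfolding split e_def using k0(2) by simp
    qed
    moreover have "\<exists>k\<in>T. c' k \<noteq> 0" using c(1) by (auto simp: c'_def T'_def)
    ultimately show ?thesis by (intro exI[of _ c']) auto
  qed
qed

section \<open>Axes with the orbit of the base point on one side\<close>

context sl2_group
begin

text \<open>The sign of \<open>v \<bullet> w\<close> tells on which side of the geodesic from \<open>v\<close> to \<open>w\<close> the base point lies.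
  So the orbit of the base point lies on one side of the axis of a one-sided pair.\<close>

definition one_sided :: "real^2 \<Rightarrow> real^2 \<Rightarrow> bool" where
  "one_sided a b \<longleftrightarrow> det2 a b = 1 \<and> (\<forall>g\<in>G. (g *v a) \<bullet> (g *v b) > 0) \<and> (\<exists>M\<in>G. \<exists>l. eigpair M a b l)"

lemma one_sided_act:
  assumes "one_sided a b" "g \<in> G"
  shows "one_sided (g *v a) (g *v b)"
proof -
  obtain M l where M: "M \<in> G" "eigpair M a b l" using assms(1) by (auto simp: one_sided_def)
  have "g ** M ** matrix_inv g \<in> G" by (intro mult minv assms M)
  then show ?thesis using eigpair_conj[OF assms(2) M(2)] assms mult[OF _ assms(2)]
    by (auto simp: one_sided_def matrix_vector_mul_assoc)
qed

lemma eig_power: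
  assumes "M \<in> G" "M *v x = \<mu> *\<^sub>R x" "M *v y = (1 / \<mu>) *\<^sub>R y"
  shows "\<exists>N\<in>G. N *v x = \<mu> ^ n *\<^sub>R x \<and> N *v y = (1 / \<mu>) ^ n *\<^sub>R y"
proof (induction n)
  case 0
  then show ?case using one by (intro bexI[of _ "mat 1"]) auto
next
  case (Suc n)
  then obtain N where "N \<in> G" "N *v x = \<mu> ^ n *\<^sub>R x" "N *v y = (1 / \<mu>) ^ n *\<^sub>R y" by blast
  then show ?case using assms mult
    by (intro bexI[of _ "M ** N"]) (auto simp: matrix_vector_mult_scaleR simp flip: matrix_vector_mul_assoc)
qed

text \<open>Powers of a hyperbolic element with a fixed point inside the gap would make the images of
  \<^term>\<open>a\<close> and \<^term>\<open>b\<close> almost opposite.\<close>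

lemma no_fixed_point_in_gap:
  assumes os: "one_sided a b" and M: "M \<in> G" "M *v x = \<mu> *\<^sub>R x" "M *v y = (1 / \<mu>) *\<^sub>R y"
    and \<mu>: "\<bar>\<mu>\<bar> < 1" "\<mu> \<noteq> 0" and xy: "det2 x y \<noteq> 0" and x: "x = p *\<^sub>R a + q *\<^sub>R b"
  shows "p * q \<le> 0"
proof (rule ccontr)
  assume pq: "\<not> p * q \<le> 0"
  obtain \<alpha>1 \<beta>1 where a: "a = \<alpha>1 *\<^sub>R x + \<beta>1 *\<^sub>R y" "\<beta>1 = det2 x a / det2 x y" using det2_basis[OF xy] by metis
  obtain \<alpha>2 \<beta>2 where b: "b = \<alpha>2 *\<^sub>R x + \<beta>2 *\<^sub>R y" "\<beta>2 = det2 x b / det2 x y" using det2_basis[OF xy] by metis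
  have ab: "det2 a b = 1" using os by (simp add: one_sided_def)
  have "det2 x a = - q" "det2 x b = p" using ab det2_swap[of b a] by (simp_all add: x)
  then have "\<beta>1 * \<beta>2 = - (p * q) / (det2 x y)\<^sup>2" by (simp add: a(2) b(2) power2_eq_square)
  then have neg: "\<beta>1 * \<beta>2 < 0" using pq xy by (simp add: divide_less_0_iff)
  have yn: "norm y > 0" using xy by auto
  \<comment> \<open>The inner product of the images of \<open>a\<close> and \<open>b\<close> under
    the \<open>n\<close>-th power, multiplied by \<open>(\<mu> ^ n)\<^sup>2\<close>. The factor
    keeps the sign and makes the sequence converge, to the negative number
    \<open>\<beta>1 * \<beta>2 * (y \<bullet> y)\<close>.\<close>
  define f where "f n = (\<mu>^n)^4 * (\<alpha>1 * \<alpha>2 * (x \<bullet> x)) + (\<mu>^n)^2 * ((\<alpha>1 * \<beta>2 + \<alpha>2 * \<beta>1) * (x \<bullet> y)) + \<beta>1 * \<beta>2 * (y \<bullet> y)" for n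
  have pos: "f n > 0" for n
  proof -
    obtain N where N: "N \<in> G" "N *v x = \<mu> ^ n *\<^sub>R x" "N *v y = (1 / \<mu>) ^ n *\<^sub>R y" using eig_power[OF M] by blast
    define m where "m = \<mu> ^ n"
    have m: "m \<noteq> 0" "(1 / \<mu>) ^ n = 1 / m" using \<mu> by (auto simp: m_def power_divide)
    have "(N *v a) \<bullet> (N *v b) = (m * m) * (\<alpha>1 * \<alpha>2 * (x \<bullet> x)) + (\<alpha>1 * \<beta>2 + \<alpha>2 * \<beta>1) * (x \<bullet> y) + \<beta>1 * \<beta>2 * (y \<bullet> y) / (m * m)"
      unfolding a(1) b(1) using m(1)
      by (simp add: N matrix_vector_right_distrib matrix_vector_mult_scaleR m(2) m_def[symmetric]
          inner_add_left inner_add_right inner_commute field_simps)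
    then have "m^2 * ((N *v a) \<bullet> (N *v b)) = f n" using m(1)
      by (simp add: f_def m_def[symmetric] field_simps power2_eq_square power4_eq_xxxx)
    moreover have "(N *v a) \<bullet> (N *v b) > 0" using os N(1) by (simp add: one_sided_def)
    ultimately show ?thesis using m(1) by (metis mult_pos_pos zero_less_power2)
  qed
  have m0: "(\<lambda>n. \<mu> ^ n) \<longlonglongrightarrow> 0" using \<mu>(1) by (intro LIMSEQ_power_zero) auto
  have "f \<longlonglongrightarrow> 0^4 * (\<alpha>1 * \<alpha>2 * (x \<bullet> x)) + 0^2 * ((\<alpha>1 * \<beta>2 + \<alpha>2 * \<beta>1) * (x \<bullet> y)) + \<beta>1 * \<beta>2 * (y \<bullet> y)"
    unfolding f_def by (intro tendsto_intros m0)
  then have "f \<longlonglongrightarrow> \<beta>1 * \<beta>2 * (y \<bullet> y)" by simp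
  then have "\<beta>1 * \<beta>2 * (y \<bullet> y) \<ge> 0" using pos by (intro LIMSEQ_le_const) (auto intro: less_imp_le)
  moreover have "y \<bullet> y > 0" using yn by simp
  ultimately show False using mult_neg_pos[OF neg] by (metis not_less)
qed

text \<open>Each of \<open>a'\<close> and \<open>b'\<close> is a contracted fixed vector, the former
  of the inverse of \<open>M\<close> and the latter of \<open>M\<close>. So
  \<open>no_fixed_point_in_gap\<close> keeps both out of the open gap, where
  \<open>p * q > 0\<close>.\<close>

lemma one_sided_ends:
  assumes os: "one_sided a b" and os': "one_sided a' b'"
  shows "a' = p *\<^sub>R a + q *\<^sub>R b \<Longrightarrow> p * q \<le> 0" "b' = p *\<^sub>R a + q *\<^sub>R b \<Longrightarrow> p * q \<le> 0"
proof -
  obtain M l where M: "M \<in> G" "eigpair M a' b' l" using os' by (auto simp: one_sided_def)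
  then have e: "M *v a' = l *\<^sub>R a'" "M *v b' = (1 / l) *\<^sub>R b'" "\<bar>l\<bar> > 1" "det2 a' b' \<noteq> 0" "l \<noteq> 0"
    by (auto simp: eigpair_def)
  have i: "matrix_inv M *v b' = l *\<^sub>R b'" "matrix_inv M *v a' = (1 / l) *\<^sub>R a'"
  proof -
    have "M *v (l *\<^sub>R b') = b'" "M *v ((1 / l) *\<^sub>R a') = a'"
      using e by (simp_all add: matrix_vector_mult_scaleR)
    then show "matrix_inv M *v b' = l *\<^sub>R b'" "matrix_inv M *v a' = (1 / l) *\<^sub>R a'"
      using inv_mult(4)[OF M(1)] by metis+
  qed
  have "\<bar>1 / l\<bar> < 1" using e(3) by simp
  then show "a' = p *\<^sub>R a + q *\<^sub>R b \<Longrightarrow> p * q \<le> 0" "b' = p *\<^sub>R a + q *\<^sub>R b \<Longrightarrow> p * q \<le> 0"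
    using no_fixed_point_in_gap[OF os minv[OF M(1)] i(2), of b' p q]
      no_fixed_point_in_gap[OF os M(1) e(2), of a' p q] e i det2_swap[of a' b'] by auto
qed

text \<open>The two multipliers are inverse to each other because one-sided pairs are normalized by
  \<open>det2 a b = 1\<close>.\<close>

definition same_axis :: "real^2 \<Rightarrow> real^2 \<Rightarrow> real^2 \<Rightarrow> real^2 \<Rightarrow> bool" where
  "same_axis a b a' b' \<longleftrightarrow> (\<exists>p. p \<noteq> 0 \<and> a' = p *\<^sub>R a \<and> b' = (1 / p) *\<^sub>R b)"

text \<open>By \<open>one_sided_ends\<close> neither gap contains an endpoint of the other, and two
  open arcs with this property are disjoint or equal. In coordinates, \<open>p * s > 0\<close> is
  the case of equality, and otherwise all terms of \<open>\<gamma> * \<delta>\<close> are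
  nonpositive.\<close>

lemma gaps_disjoint:
  assumes os: "one_sided a b" and os': "one_sided a' b'" and ns: "\<not> same_axis a b a' b'"
    and pos: "\<alpha> * \<beta> > 0" and x: "\<alpha> *\<^sub>R a' + \<beta> *\<^sub>R b' = \<gamma> *\<^sub>R a + \<delta> *\<^sub>R b"
  shows "\<gamma> * \<delta> \<le> 0"
proof -
  have ab: "det2 a b = 1" "det2 a' b' = 1" using os os' by (auto simp: one_sided_def)
  obtain p q where a': "a' = p *\<^sub>R a + q *\<^sub>R b" using det2_basis[of a b] ab by (metis zero_neq_one)
  obtain r s where b': "b' = r *\<^sub>R a + s *\<^sub>R b" using det2_basis[of a b] ab by (metis zero_neq_one)
  have ba: "det2 b a = - 1" using ab det2_swap[of b a] by simp
  have D: "p * s - q * r = 1" using ab ba by (simp add: a' b' algebra_simps)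
  have 1: "p * q \<le> 0" "r * s \<le> 0" using one_sided_ends[OF os os'] a' b' by blast+
  have "a = s *\<^sub>R a' + (- q) *\<^sub>R b'" "b = (- r) *\<^sub>R a' + p *\<^sub>R b'"
  proof -
    have "s *\<^sub>R a' + (- q) *\<^sub>R b' = (p * s - q * r) *\<^sub>R a" by (simp add: a' b' algebra_simps)
    then show "a = s *\<^sub>R a' + (- q) *\<^sub>R b'" by (simp add: D)
    have "(- r) *\<^sub>R a' + p *\<^sub>R b' = (p * s - q * r) *\<^sub>R b" by (simp add: a' b' algebra_simps)
    then show "b = (- r) *\<^sub>R a' + p *\<^sub>R b'" by (simp add: D)
  qed
  then have "s * (- q) \<le> 0" "(- r) * p \<le> 0" using one_sided_ends[OF os' os] by blast+
  then have 2: "s * q \<ge> 0" "r * p \<ge> 0" by (simp_all only: mult_minus_right mult_minus_left neg_le_0_iff_le)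
  have "p * s \<le> 0"
  proof (rule ccontr)
    assume ps: "\<not> p * s \<le> 0"
    have "(p * s) * (q * q) = (p * q) * (s * q)" by (simp add: mult_ac)
    also have "\<dots> \<le> 0" by (rule mult_nonpos_nonneg[OF 1(1) 2(1)])
    finally have "q = 0" using ps by (metis mult_pos_pos not_le not_square_less_zero zero_less_mult_iff linorder_neqE_linordered_idom)
    have "(p * s) * (r * r) = (r * p) * (r * s)" by (simp add: mult_ac)
    also have "\<dots> \<le> 0" by (rule mult_nonneg_nonpos[OF 2(2) 1(2)])
    finally have "r = 0" using ps by (metis mult_pos_pos not_le not_square_less_zero zero_less_mult_iff linorder_neqE_linordered_idom)
    have "p \<noteq> 0" using D \<open>q = 0\<close> by auto
    then have "s = 1 / p" using D \<open>q = 0\<close> by (simp add: eq_divide_eq mult.commute)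
    then have "same_axis a b a' b'" using \<open>p \<noteq> 0\<close> \<open>q = 0\<close> \<open>r = 0\<close> a' b' by (auto simp: same_axis_def)
    then show False using ns by simp
  qed
  have gd: "\<gamma> = \<alpha> * p + \<beta> * r" "\<delta> = \<alpha> * q + \<beta> * s"
  proof -
    have "det2 (\<alpha> *\<^sub>R a' + \<beta> *\<^sub>R b') b = \<gamma>" "det2 a (\<alpha> *\<^sub>R a' + \<beta> *\<^sub>R b') = \<delta>"
      unfolding x using ab by simp_all
    then show "\<gamma> = \<alpha> * p + \<beta> * r" "\<delta> = \<alpha> * q + \<beta> * s" using ab by (simp_all add: a' b')
  qed
  have "\<gamma> * \<delta> = \<alpha>\<^sup>2 * (p * q) + \<beta>\<^sup>2 * (r * s) + (\<alpha> * \<beta>) * (p * s + q * r)"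
    by (simp add: gd power2_eq_square algebra_simps)
  moreover have "\<alpha>\<^sup>2 * (p * q) \<le> 0" "\<beta>\<^sup>2 * (r * s) \<le> 0" using 1 by (auto intro: mult_nonneg_nonpos)
  moreover have "(\<alpha> * \<beta>) * (p * s + q * r) \<le> 0" using pos \<open>p * s \<le> 0\<close> D by (intro mult_nonneg_nonpos) auto
  ultimately show ?thesis by linarith
qed

text \<open>The images of \<open>a\<close> and \<open>b\<close> form an acute angle, so neither is
  longer than their sum.\<close>

lemma one_sided_grows:
  assumes "one_sided a b"
  shows "finite {h \<in> G. norm (h *v (a + b)) \<le> R}"
proof (rule finite_subset)
  have "norm (h *v a) \<le> R \<and> norm (h *v b) \<le> R" if h: "h \<in> G" "norm (h *v (a + b)) \<le> R" for h
  proof -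
    have "(h *v a) \<bullet> (h *v b) > 0" using assms h(1) by (simp add: one_sided_def)
    then have "(norm (h *v a))\<^sup>2 \<le> (norm (h *v (a + b)))\<^sup>2" "(norm (h *v b))\<^sup>2 \<le> (norm (h *v (a + b)))\<^sup>2"
      unfolding power2_norm_eq_inner by (simp_all add: matrix_vector_right_distrib inner_add_left inner_add_right inner_commute)
    then show ?thesis using h(2) by (meson norm_ge_zero order_trans power2_le_imp_le)
  qed
  then show "{h \<in> G. norm (h *v (a + b)) \<le> R} \<subseteq> {h \<in> G. norm (h *v a) \<le> R \<and> norm (h *v b) \<le> R}" by blast
  show "finite \<dots>" using assms by (intro finite_bounded_basis) (simp add: one_sided_def)
qed

text \<open>For a translate with a different axis, \<open>gaps_disjoint\<close> gives the
  coordinates of the gap point no common sign, so nothing cancels in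
  \<open>\<delta> - \<gamma>\<close>. For a translate with the same axis the coordinates are
  \<open>p\<close> and \<open>1 / p\<close>, which nearly cancel only if
  \<open>\<bar>p\<bar>\<close> is near 1, hence for finitely many \<open>h\<close>.\<close>

lemma one_sided_gap_away:
  assumes os: "one_sided a b" and os1: "one_sided a1 b1"
  shows "\<exists>c>0. finite {h \<in> G. \<bar>det2 (a + b) (h *v (a1 + b1))\<bar> < c * norm (h *v (a1 + b1))}"
proof -
  have ab: "det2 a b = 1" using os by (simp add: one_sided_def)
  then have ba: "det2 b a = - 1" using det2_swap[of b a] by simp
  define m where "m = norm a + norm b"
  have "a \<noteq> 0" using ab by auto
  then have m: "m > 0" by (simp add: m_def add_pos_nonneg)
  have nle: "norm (\<gamma> *\<^sub>R a + \<delta> *\<^sub>R b) \<le> m * (\<bar>\<gamma>\<bar> + \<bar>\<delta>\<bar>)" for \<gamma> \<delta>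
  proof -
    have "norm (\<gamma> *\<^sub>R a + \<delta> *\<^sub>R b) \<le> \<bar>\<gamma>\<bar> * norm a + \<bar>\<delta>\<bar> * norm b"
      by (metis norm_scaleR norm_triangle_ineq)
    also have "\<dots> \<le> \<bar>\<gamma>\<bar> * m + \<bar>\<delta>\<bar> * m" by (intro add_mono mult_left_mono) (auto simp: m_def)
    finally show ?thesis by (simp add: algebra_simps)
  qed
  \<comment> \<open>The 3 is the constant in \<open>key\<close>: if one coordinate exceeds 2 in
    modulus and the other is below 1, their difference is at least a third of the sum of the
    moduli.\<close>
  define c where "c = 1 / (3 * m)"
  have c: "c > 0" using m by (simp add: c_def)
  define B where "B = {h \<in> G. norm (h *v a1) \<le> 2 * m \<and> norm (h *v b1) \<le> 2 * m}"
  have "finite B" unfolding B_def using os1 by (intro finite_bounded_basis) (simp add: one_sided_def)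
  moreover have "{h \<in> G. \<bar>det2 (a + b) (h *v (a1 + b1))\<bar> < c * norm (h *v (a1 + b1))} \<subseteq> B"
  proof (rule subsetI, rule ccontr)
    fix h assume h: "h \<in> {h \<in> G. \<bar>det2 (a + b) (h *v (a1 + b1))\<bar> < c * norm (h *v (a1 + b1))}" and nB: "h \<notin> B"
    then have hG: "h \<in> G" by blast
    have hv: "h *v (a1 + b1) = h *v a1 + h *v b1" by (simp add: matrix_vector_right_distrib)
    have os2: "one_sided (h *v a1) (h *v b1)" using one_sided_act[OF os1 hG] .
    obtain \<gamma> \<delta> where gd: "h *v (a1 + b1) = \<gamma> *\<^sub>R a + \<delta> *\<^sub>R b" using det2_basis[of a b] ab by (metis zero_neq_one)
    have d: "det2 (a + b) (h *v (a1 + b1)) = \<delta> - \<gamma>" using ab ba by (simp add: gd)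
    have key: "\<bar>\<gamma>\<bar> + \<bar>\<delta>\<bar> \<le> 3 * \<bar>\<delta> - \<gamma>\<bar>"
    proof (cases "same_axis a b (h *v a1) (h *v b1)")
      case False
      have "\<gamma> * \<delta> \<le> 0" using gaps_disjoint[OF os os2 False, of 1 1 \<gamma> \<delta>] gd hv by simp
      then have "\<bar>\<delta> - \<gamma>\<bar> = \<bar>\<gamma>\<bar> + \<bar>\<delta>\<bar>" by (auto simp: mult_le_0_iff)
      then show ?thesis by simp
    next
      case True
      then obtain p where p: "p \<noteq> 0" "h *v a1 = p *\<^sub>R a" "h *v b1 = (1 / p) *\<^sub>R b" by (auto simp: same_axis_def)
      have "det2 (h *v (a1 + b1)) b = p" "det2 a (h *v (a1 + b1)) = 1 / p"
        unfolding hv using ab by (simp_all add: p)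
      then have gd': "\<gamma> = p" "\<delta> = 1 / p" unfolding gd using ab by simp_all
      have "\<bar>p\<bar> > 2 \<or> \<bar>1 / p\<bar> > 2"
      proof (rule ccontr)
        assume "\<not> (\<bar>p\<bar> > 2 \<or> \<bar>1 / p\<bar> > 2)"
        then have "\<bar>p\<bar> * norm a \<le> 2 * m" "\<bar>1 / p\<bar> * norm b \<le> 2 * m" by (intro mult_mono; simp add: m_def)+
        then have "h \<in> B" using hG p(2,3) by (simp add: B_def)
        then show False using nB by simp
      qed
      moreover have "\<bar>p\<bar> * \<bar>1 / p\<bar> = 1" using p(1) by simp
      ultimately have "\<bar>\<gamma>\<bar> > 2 \<and> \<bar>\<delta>\<bar> < 1 \<or> \<bar>\<delta>\<bar> > 2 \<and> \<bar>\<gamma>\<bar> < 1"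
        unfolding gd' using p(1) by (auto simp: field_simps)
      moreover have "\<bar>\<gamma>\<bar> - \<bar>\<delta>\<bar> \<le> \<bar>\<delta> - \<gamma>\<bar>" "\<bar>\<delta>\<bar> - \<bar>\<gamma>\<bar> \<le> \<bar>\<delta> - \<gamma>\<bar>" by auto
      ultimately show ?thesis by (elim disjE conjE) linarith+
    qed
    have "c * norm (h *v (a1 + b1)) \<le> c * (m * (\<bar>\<gamma>\<bar> + \<bar>\<delta>\<bar>))" unfolding gd using nle c by (intro mult_left_mono) auto
    also have "\<dots> = (\<bar>\<gamma>\<bar> + \<bar>\<delta>\<bar>) / 3" using m by (simp add: c_def)
    also have "\<dots> \<le> \<bar>\<delta> - \<gamma>\<bar>" using key by simp
    finally show False using h d by simp
  qed
  ultimately show ?thesis using c finite_subset by blast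
qed

section \<open>Sides of orbit points and crossing numbers\<close>

lemma inverse_inverse [simp]: "h \<in> G \<Longrightarrow> matrix_inv (matrix_inv h) = h"
proof -
  assume h: "h \<in> G"
  have "h ** (matrix_inv h ** matrix_inv (matrix_inv h)) = h" using minv[OF h] by simp
  then show ?thesis unfolding matrix_mul_assoc using h by simp
qed

lemma finite_inverse_image:
  assumes "finite {h \<in> G. P h}"
  shows "finite {h \<in> G. P (matrix_inv h)}"
proof (rule finite_subset)
  show "{h \<in> G. P (matrix_inv h)} \<subseteq> matrix_inv ` {h \<in> G. P h}"
  proof
    fix h assume "h \<in> {h \<in> G. P (matrix_inv h)}"
    then show "h \<in> matrix_inv ` {h \<in> G. P h}"
      by (intro image_eqI[of _ _ "matrix_inv h"]) (auto simp: minv)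
  qed
qed (use assms in simp)

text \<open>Tells which of the two arcs between the boundary points of \<open>v\<close> and
  \<open>w\<close> contains that of \<open>z\<close>, with value 0 at the endpoints. The product
  makes it independent of the sign of the representative \<open>z\<close>.\<close>

definition side :: "real^2 \<Rightarrow> real^2 \<Rightarrow> real^2 \<Rightarrow> real" where
  "side v w z = sgn (det2 z v * det2 z w)"

lemma side_inv:
  assumes "h \<in> G"
  shows "side v w (h *v z) = sgn (det2 z (matrix_inv h *v v) * det2 z (matrix_inv h *v w))"
  by (simp add: side_def det2_move[OF assms])

lemma side_uminus [simp]: "side v w (- z) = side v w z"
  by (simp add: side_def)

text \<open>Long vectors \<open>x\<close> and \<open>y\<close> with bounded \<open>det2 x y\<close>
  are nearly parallel, so a direction \<open>z\<close> bounded away from both has their lines on the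
  same side up to the sign of \<open>x \<bullet> y\<close>. What matters is that the right-hand side
  does not involve \<open>z\<close>.\<close>

lemma sgn_by_inner:
  assumes c: "c > 0" and zx: "\<bar>det2 z x\<bar> \<ge> c * norm x" and zy: "\<bar>det2 z y\<bar> \<ge> c * norm y"
    and x: "norm x \<ge> R" and y: "norm y \<ge> R" and R: "R > 0" "c\<^sup>2 * R\<^sup>2 > \<bar>det2 x y\<bar> * (norm z)\<^sup>2"
  shows "sgn (det2 z x * det2 z y) = sgn (x \<bullet> y)"
proof -
  have nx: "norm x > 0" "norm y > 0" using x y R by auto
  define E where "E = det2 x y * (z \<bullet> x) * det2 z x"
  have id: "(norm x)\<^sup>2 * (det2 z x * det2 z y) = (x \<bullet> y) * (det2 z x)\<^sup>2 + E"
    unfolding E_def norm2_sq inner_real2 det2_def by (simp add: power2_eq_square algebra_simps)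
  have lt: "\<bar>E\<bar> < (norm x)\<^sup>2 * \<bar>det2 z x * det2 z y\<bar>"
  proof -
    have "\<bar>E\<bar> = \<bar>det2 x y\<bar> * \<bar>z \<bullet> x\<bar> * \<bar>det2 z x\<bar>" by (simp add: E_def abs_mult)
    also have "\<dots> \<le> \<bar>det2 x y\<bar> * (norm z * norm x) * (norm z * norm x)"
      by (intro mult_mono Cauchy_Schwarz_ineq2 abs_det2_le) auto
    also have "\<dots> = (norm x)\<^sup>2 * (\<bar>det2 x y\<bar> * (norm z)\<^sup>2)" by (simp add: power2_eq_square algebra_simps)
    also have "\<dots> < (norm x)\<^sup>2 * (c\<^sup>2 * R\<^sup>2)" using R(2) nx by (intro mult_strict_left_mono) auto
    also have "\<dots> = (norm x)\<^sup>2 * ((c * R) * (c * R))" by (simp add: power2_eq_square algebra_simps)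
    also have "\<dots> \<le> (norm x)\<^sup>2 * ((c * norm x) * (c * norm y))" using x y c R by (intro mult_left_mono mult_mono) auto
    also have "\<dots> \<le> (norm x)\<^sup>2 * (\<bar>det2 z x\<bar> * \<bar>det2 z y\<bar>)"
      using zx zy c by (intro mult_left_mono mult_mono) auto
    finally show ?thesis by (simp add: abs_mult)
  qed
  have "det2 z x \<noteq> 0" using zx nx c by (metis abs_zero mult_pos_pos not_less)
  then have "sgn ((det2 z x)\<^sup>2) = 1" by (intro sgn_pos) simp
  then have "sgn (x \<bullet> y) = sgn ((x \<bullet> y) * (det2 z x)\<^sup>2)" by (simp add: sgn_mult)
  also have "\<dots> = sgn ((norm x)\<^sup>2 * (det2 z x * det2 z y))"
  proof -
    have "\<bar>(norm x)\<^sup>2 * (det2 z x * det2 z y)\<bar> = (norm x)\<^sup>2 * \<bar>det2 z x * det2 z y\<bar>" by (simp add: abs_mult)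
    then have "\<bar>E\<bar> < \<bar>(norm x)\<^sup>2 * (det2 z x * det2 z y)\<bar>" using lt by simp
    moreover have "sgn Q = sgn P" if "P = Q + E" "\<bar>E\<bar> < \<bar>P\<bar>" for P Q :: real
    proof (cases "P > 0")
      case True
      then have "Q > 0" using that by linarith
      then show ?thesis using True by simp
    next
      case False
      then have "P < 0" "Q < 0" using that by linarith+
      then show ?thesis by simp
    qed
    ultimately show ?thesis using id by blast
  qed
  also have "\<dots> = sgn (det2 z x * det2 z y)"
  proof -
    have "sgn ((norm x)\<^sup>2) = 1" using nx by (intro sgn_pos) simp
    then show ?thesis by (simp add: sgn_mult)
  qed
  finally show ?thesis by simp
qed

text \<open>For all but finitely many \<open>h\<close>, the preimages \<open>x\<close> and
  \<open>y\<close> of \<open>v\<close> and \<open>w\<close> under \<open>h\<close> are long and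
  bounded away from \<open>z\<close> and \<open>z'\<close>. By \<open>sgn_by_inner\<close> both
  values of \<open>side\<close> then equal \<open>sgn (x \<bullet> y)\<close>.\<close>

lemma side_finite:
  assumes os: "one_sided a b" "one_sided a' b'" "one_sided a1 b1" "one_sided a2 b2"
  defines "z \<equiv> a + b" and "z' \<equiv> a' + b'" and "v \<equiv> a1 + b1" and "w \<equiv> a2 + b2"
  shows "finite {h \<in> G. side v w (h *v z) \<noteq> side v w (h *v z')}"
proof -
  obtain c1 where c1: "c1 > 0" "finite {h \<in> G. \<bar>det2 z (h *v v)\<bar> < c1 * norm (h *v v)}"
    using one_sided_gap_away[OF os(1,3)] unfolding z_def v_def by blast
  obtain c2 where c2: "c2 > 0" "finite {h \<in> G. \<bar>det2 z (h *v w)\<bar> < c2 * norm (h *v w)}"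
    using one_sided_gap_away[OF os(1,4)] unfolding z_def w_def by blast
  obtain c3 where c3: "c3 > 0" "finite {h \<in> G. \<bar>det2 z' (h *v v)\<bar> < c3 * norm (h *v v)}"
    using one_sided_gap_away[OF os(2,3)] unfolding z'_def v_def by blast
  obtain c4 where c4: "c4 > 0" "finite {h \<in> G. \<bar>det2 z' (h *v w)\<bar> < c4 * norm (h *v w)}"
    using one_sided_gap_away[OF os(2,4)] unfolding z'_def w_def by blast
  define c where "c = min (min c1 c2) (min c3 c4)"
  have c: "c > 0" "c \<le> c1" "c \<le> c2" "c \<le> c3" "c \<le> c4" using c1 c2 c3 c4 by (auto simp: c_def)
  define D where "D = \<bar>det2 v w\<bar> * ((norm z)\<^sup>2 + (norm z')\<^sup>2)"
  \<comment> \<open>Makes \<open>c\<^sup>2 * R\<close> exceed \<open>D\<close>; as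
    \<open>R \<ge> 1\<close>, so does \<open>c\<^sup>2 * R\<^sup>2\<close>, which is the bound that
    \<open>sgn_by_inner\<close> asks for.\<close>
  define R where "R = 1 + D / c\<^sup>2"
  have D0: "D \<ge> 0" by (simp add: D_def)
  have R1: "R \<ge> 1" using D0 c(1) by (simp add: R_def)
  have "D < c\<^sup>2 * R" using c(1) by (simp add: R_def field_simps)
  also have "\<dots> \<le> c\<^sup>2 * R\<^sup>2" using R1 by (intro mult_left_mono) (auto simp: power2_eq_square)
  finally have DR: "D < c\<^sup>2 * R\<^sup>2" .
  have Dz: "\<bar>det2 v w\<bar> * (norm z)\<^sup>2 \<le> D" "\<bar>det2 v w\<bar> * (norm z')\<^sup>2 \<le> D"
    unfolding D_def by (intro mult_left_mono; simp)+
  define bad where "bad h \<longleftrightarrow> \<bar>det2 z (h *v v)\<bar> < c1 * norm (h *v v) \<or> \<bar>det2 z (h *v w)\<bar> < c2 * norm (h *v w) \<or>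
     \<bar>det2 z' (h *v v)\<bar> < c3 * norm (h *v v) \<or> \<bar>det2 z' (h *v w)\<bar> < c4 * norm (h *v w) \<or>
     norm (h *v v) \<le> R \<or> norm (h *v w) \<le> R" for h
  have "{h \<in> G. bad h} = {h \<in> G. \<bar>det2 z (h *v v)\<bar> < c1 * norm (h *v v)} \<union> {h \<in> G. \<bar>det2 z (h *v w)\<bar> < c2 * norm (h *v w)}
     \<union> {h \<in> G. \<bar>det2 z' (h *v v)\<bar> < c3 * norm (h *v v)} \<union> {h \<in> G. \<bar>det2 z' (h *v w)\<bar> < c4 * norm (h *v w)}
     \<union> {h \<in> G. norm (h *v v) \<le> R} \<union> {h \<in> G. norm (h *v w) \<le> R}"
    by (auto simp: bad_def)
  then have fb: "finite {h \<in> G. bad h}"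
    using c1 c2 c3 c4 one_sided_grows[OF os(3)] one_sided_grows[OF os(4)] by (simp add: v_def w_def)
  have "side v w (h *v z) = side v w (h *v z')" if h: "h \<in> G" "\<not> bad (matrix_inv h)" for h
  proof -
    define x where "x = matrix_inv h *v v"
    define y where "y = matrix_inv h *v w"
    have dxy: "det2 x y = det2 v w" using minv[OF h(1)] by (simp add: x_def y_def)
    have ge: "\<bar>det2 u p\<bar> \<ge> c * norm p" if "\<not> \<bar>det2 u p\<bar> < k * norm p" "c \<le> k" for u p k
    proof -
      have "c * norm p \<le> k * norm p" using that(2) by (intro mult_right_mono) auto
      then show ?thesis using that(1) by linarith
    qed
    have nb: "\<bar>det2 z x\<bar> \<ge> c * norm x" "\<bar>det2 z y\<bar> \<ge> c * norm y" "\<bar>det2 z' x\<bar> \<ge> c * norm x" "\<bar>det2 z' y\<bar> \<ge> c * norm y"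
      "norm x \<ge> R" "norm y \<ge> R"
      using h(2) c ge unfolding bad_def x_def[symmetric] y_def[symmetric] by auto
    have "sgn (det2 z x * det2 z y) = sgn (x \<bullet> y)"
      by (rule sgn_by_inner[OF c(1) nb(1,2,5,6)]) (use R1 DR Dz dxy in auto)
    moreover have "sgn (det2 z' x * det2 z' y) = sgn (x \<bullet> y)"
      by (rule sgn_by_inner[OF c(1) nb(3,4,5,6)]) (use R1 DR Dz dxy in auto)
    ultimately show ?thesis unfolding side_inv[OF h(1)] x_def y_def by simp
  qed
  then have "{h \<in> G. side v w (h *v z) \<noteq> side v w (h *v z')} \<subseteq> {h \<in> G. bad (matrix_inv h)}" by blast
  then show ?thesis using finite_inverse_image[OF fb] finite_subset by blast
qed

text \<open>The total change of \<open>side v w\<close> over all translates of \<open>z\<close> and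
  \<open>z'\<close>. The index set is cut down to the nonzero terms because a sum over an infinite
  set is 0 by convention; \<open>cross_superset\<close> gives back the freedom that additivity
  requires.\<close>

definition cross :: "real^2 \<Rightarrow> real^2 \<Rightarrow> real^2 \<Rightarrow> real^2 \<Rightarrow> real" where
  "cross v w z z' = (\<Sum>h | h \<in> G \<and> side v w (h *v z) \<noteq> side v w (h *v z'). side v w (h *v z') - side v w (h *v z))"

lemma cross_superset:
  assumes "finite A" "A \<subseteq> G" "{h \<in> G. side v w (h *v z) \<noteq> side v w (h *v z')} \<subseteq> A"
  shows "cross v w z z' = (\<Sum>h\<in>A. side v w (h *v z') - side v w (h *v z))"
  unfolding cross_def by (rule sum.mono_neutral_left) (use assms in auto)

lemma cross_act:
  assumes g: "g \<in> G"
  shows "cross v w (g *v z) (g *v z') = cross v w z z'"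
  unfolding cross_def
proof (rule sum.reindex_bij_witness[of _ "\<lambda>h. h ** matrix_inv g" "\<lambda>h. h ** g"])
  fix h assume "h \<in> {h. h \<in> G \<and> side v w (h *v (g *v z)) \<noteq> side v w (h *v (g *v z'))}"
  then have h: "h \<in> G" "side v w (h *v (g *v z)) \<noteq> side v w (h *v (g *v z'))" by auto
  show "(h ** g) ** matrix_inv g = h" using g by (simp flip: matrix_mul_assoc)
  show "h ** g \<in> {h. h \<in> G \<and> side v w (h *v z) \<noteq> side v w (h *v z')}"
    using h g by (simp add: mult flip: matrix_vector_mul_assoc)
  show "side v w ((h ** g) *v z') - side v w ((h ** g) *v z) = side v w (h *v (g *v z')) - side v w (h *v (g *v z))"
    by (simp flip: matrix_vector_mul_assoc)
next
  fix h assume "h \<in> {h. h \<in> G \<and> side v w (h *v z) \<noteq> side v w (h *v z')}"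
  then have h: "h \<in> G" "side v w (h *v z) \<noteq> side v w (h *v z')" by auto
  show "(h ** matrix_inv g) ** g = h" using g by (simp flip: matrix_mul_assoc)
  show "h ** matrix_inv g \<in> {h. h \<in> G \<and> side v w (h *v (g *v z)) \<noteq> side v w (h *v (g *v z'))}"
    using h g by (simp add: mult minv flip: matrix_vector_mul_assoc)
qed

lemma cross_swap: "cross v w z' z = - cross v w z z'"
proof -
  have "{h. h \<in> G \<and> side v w (h *v z') \<noteq> side v w (h *v z)} = {h. h \<in> G \<and> side v w (h *v z) \<noteq> side v w (h *v z')}" by auto
  then show ?thesis unfolding cross_def by (simp flip: sum_negf)
qed

lemma cross_uminus: "cross v w z (- z') = cross v w z z'"
  by (simp add: cross_def)

definition gap_point :: "real^2 \<Rightarrow> bool" where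
  "gap_point z \<longleftrightarrow> (\<exists>a b. one_sided a b \<and> z = a + b)"

lemma gap_point_act: "gap_point z \<Longrightarrow> g \<in> G \<Longrightarrow> gap_point (g *v z)"
  unfolding gap_point_def using one_sided_act by (metis (no_types, lifting) matrix_vector_right_distrib)

lemma cross_finite:
  assumes "gap_point v" "gap_point w" "gap_point z" "gap_point z'"
  shows "finite {h \<in> G. side v w (h *v z) \<noteq> side v w (h *v z')}"
proof -
  obtain a b a' b' a1 b1 a2 b2 where "one_sided a b" "z = a + b" "one_sided a' b'" "z' = a' + b'"
    "one_sided a1 b1" "v = a1 + b1" "one_sided a2 b2" "w = a2 + b2"
    using assms unfolding gap_point_def by metis
  then show ?thesis using side_finite by simp
qed

lemma cross_add:
  assumes "gap_point v" "gap_point w" "gap_point z" "gap_point z'" "gap_point z''"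
  shows "cross v w z z'' = cross v w z z' + cross v w z' z''"
proof -
  define A where "A = {h \<in> G. side v w (h *v z) \<noteq> side v w (h *v z')} \<union> {h \<in> G. side v w (h *v z') \<noteq> side v w (h *v z'')}"
  have A: "finite A" "A \<subseteq> G" using cross_finite assms by (auto simp: A_def)
  have "{h \<in> G. side v w (h *v z) \<noteq> side v w (h *v z'')} \<subseteq> A"
    "{h \<in> G. side v w (h *v z) \<noteq> side v w (h *v z')} \<subseteq> A"
    "{h \<in> G. side v w (h *v z') \<noteq> side v w (h *v z'')} \<subseteq> A" by (auto simp: A_def)
  then show ?thesis using cross_superset[OF A] by (simp add: sum.distrib[symmetric])
qed

end

section \<open>Crossing numbers along an axis\<close>

lemma sgn_gap1:
  fixes \<gamma> \<delta> s :: real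
  assumes "\<gamma> * \<delta> \<le> 0" "s \<noteq> 0"
  shows "sgn (s * \<delta> - \<gamma> / s) = sgn s * sgn (\<delta> - \<gamma>)"
proof -
  have eq: "s * \<delta> - \<gamma> / s = (1 / s) * (s\<^sup>2 * \<delta> - \<gamma>)" using assms(2) by (simp add: field_simps power2_eq_square)
  have s2: "s\<^sup>2 > 0" using assms(2) by simp
  have "sgn (s\<^sup>2 * \<delta> - \<gamma>) = sgn (\<delta> - \<gamma>)"
  proof (cases "\<gamma> = 0")
    case True
    have "sgn (s\<^sup>2) = 1" using s2 by (rule sgn_pos)
    then show ?thesis using True by (simp only: sgn_mult diff_0_right mult_1_left)
  next
    case False
    show ?thesis
    proof (cases "\<gamma> > 0")
      case True
      then have d: "\<delta> \<le> 0" using assms(1) by (simp add: mult_le_0_iff)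
      then have "s\<^sup>2 * \<delta> \<le> 0" using s2 by (intro mult_nonneg_nonpos) auto
      then show ?thesis using True d by simp
    next
      case f: False
      then have d: "\<delta> \<ge> 0" using assms(1) False by (simp add: mult_le_0_iff)
      then have "s\<^sup>2 * \<delta> \<ge> 0" using s2 by simp
      then have "s\<^sup>2 * \<delta> - \<gamma> > 0" "\<delta> - \<gamma> > 0" using f False d by linarith+
      then show ?thesis by simp
    qed
  qed
  moreover have "sgn (1 / s) = sgn s" by (simp add: sgn_if)
  ultimately show ?thesis unfolding eq sgn_mult by simp
qed

lemma sgn_gap2:
  fixes s :: real
  assumes "s \<noteq> 0"
  shows "sgn (s - 1 / s) = sgn s * sgn (s\<^sup>2 - 1)"
proof -
  have "s - 1 / s = (1 / s) * (s\<^sup>2 - 1)" using assms by (simp add: field_simps power2_eq_square)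
  moreover have "sgn (1 / s) = sgn s" by (simp add: sgn_if)
  ultimately show ?thesis by (metis sgn_mult)
qed

context sl2_group
begin

definition equiv_axis :: "(real^2) \<times> (real^2) \<Rightarrow> (real^2) \<times> (real^2) \<Rightarrow> bool" where
  "equiv_axis P Q \<longleftrightarrow> (\<exists>g\<in>G. same_axis (fst P) (snd P) (g *v fst Q) (g *v snd Q))"

lemma equiv_axis_sym: "equiv_axis P Q \<Longrightarrow> equiv_axis Q P"
proof -
  assume "equiv_axis P Q"
  then obtain g p where g: "g \<in> G" "p \<noteq> 0" "g *v fst Q = p *\<^sub>R fst P" "g *v snd Q = (1 / p) *\<^sub>R snd P"
    by (auto simp: equiv_axis_def same_axis_def)
  have "fst P = (1 / p) *\<^sub>R (g *v fst Q)" "snd P = p *\<^sub>R (g *v snd Q)" using g by auto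
  then have "matrix_inv g *v fst P = (1 / p) *\<^sub>R fst Q" "matrix_inv g *v snd P = p *\<^sub>R snd Q"
    using g(1) by (simp_all add: matrix_vector_mult_scaleR)
  then show ?thesis using minv[OF g(1)] g(2) unfolding equiv_axis_def same_axis_def
    by (intro bexI[of _ "matrix_inv g"] exI[of _ "1 / p"]) auto
qed

text \<open>\<open>M\<close> moves \<open>a + b\<close> inside the gap of its own axis, while the
  gap point of another axis lies outside this gap and is therefore not passed. The factor
  \<open>sgn l\<close> stems from the choice of the lift and cancels in \<open>side\<close>.\<close>

lemma gap_sgn:
  assumes os: "one_sided a b" and e: "eigpair M a b l" and os1: "one_sided a1 b1"
    and h: "h \<in> G" and ns: "\<not> same_axis a b (h *v a1) (h *v b1)"
  shows "sgn (det2 (M *v (a + b)) (h *v (a1 + b1))) = sgn l * sgn (det2 (a + b) (h *v (a1 + b1)))"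
proof -
  have ab: "det2 a b = 1" using os by (simp add: one_sided_def)
  then have ba: "det2 b a = - 1" using det2_swap[of b a] by simp
  have l: "l \<noteq> 0" "M *v a = l *\<^sub>R a" "M *v b = (1 / l) *\<^sub>R b" using e by (auto simp: eigpair_def)
  obtain \<gamma> \<delta> where gd: "h *v (a1 + b1) = \<gamma> *\<^sub>R a + \<delta> *\<^sub>R b" using det2_basis[of a b] ab by (metis zero_neq_one)
  have "\<gamma> * \<delta> \<le> 0"
    using gaps_disjoint[OF os one_sided_act[OF os1 h] ns, of 1 1 \<gamma> \<delta>] gd by (simp add: matrix_vector_right_distrib)
  moreover have "det2 (a + b) (h *v (a1 + b1)) = \<delta> - \<gamma>" using ab ba by (simp add: gd)
  moreover have "det2 (M *v (a + b)) (h *v (a1 + b1)) = l * \<delta> - \<gamma> / l"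
    unfolding gd using ab ba by (simp add: matrix_vector_right_distrib[of M] l)
  ultimately show ?thesis using sgn_gap1[OF _ l(1)] by simp
qed

lemma side_unchanged:
  assumes os: "one_sided a b" and e: "eigpair M a b l" and os1: "one_sided a1 b1" and os2: "one_sided a2 b2"
    and h: "h \<in> G" and ns: "\<not> same_axis a b (matrix_inv h *v a1) (matrix_inv h *v b1)"
      "\<not> same_axis a b (matrix_inv h *v a2) (matrix_inv h *v b2)"
  shows "side (a1 + b1) (a2 + b2) (h *v (M *v (a + b))) = side (a1 + b1) (a2 + b2) (h *v (a + b))"
proof -
  have "l \<noteq> 0" using e by (auto simp: eigpair_def)
  then have "sgn l * sgn l = 1" by (simp add: sgn_if)
  then show ?thesis unfolding side_inv[OF h] sgn_mult
    using gap_sgn[OF os e os1 minv[OF h] ns(1)] gap_sgn[OF os e os2 minv[OF h] ns(2)]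
    by (simp add: mult.left_commute mult.assoc)
qed

lemma cross_other_axis:
  assumes os: "one_sided a b" and e: "eigpair M a b l" and os1: "one_sided a1 b1" and os2: "one_sided a2 b2"
    and ns: "\<not> equiv_axis (a, b) (a1, b1)" "\<not> equiv_axis (a, b) (a2, b2)"
  shows "cross (a1 + b1) (a2 + b2) (a + b) (M *v (a + b)) = 0"
proof -
  have "{h. h \<in> G \<and> side (a1 + b1) (a2 + b2) (h *v (a + b)) \<noteq> side (a1 + b1) (a2 + b2) (h *v (M *v (a + b)))} = {}"
  proof -
    have "side (a1 + b1) (a2 + b2) (h *v (M *v (a + b))) = side (a1 + b1) (a2 + b2) (h *v (a + b))" if "h \<in> G" for h
      using side_unchanged[OF os e os1 os2 that] ns minv[OF that] unfolding equiv_axis_def by auto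
    then show ?thesis by auto
  qed
  then show ?thesis unfolding cross_def by simp
qed

text \<open>Only those \<open>h\<close> contribute that preserve the axis. In the coordinate
  \<open>s\<close> along the axis, the modulus grows from \<open>\<bar>s\<bar>\<close> to
  \<open>\<bar>l * s\<bar>\<close>, so the value 1 is passed in one direction only. All terms
  therefore have the sign \<open>\<sigma>\<close> or vanish, and that of the identity does not
  vanish.\<close>

lemma cross_own_axis:
  assumes os: "one_sided a b" and M: "M \<in> G" and e: "eigpair M a b l" and os1: "one_sided a1 b1"
    and ns: "\<not> equiv_axis (a, b) (a1, b1)"
  shows "cross (a1 + b1) (a + b) (a + b) (M *v (a + b)) \<noteq> 0"
proof -
  have ab: "det2 a b = 1" using os by (simp add: one_sided_def)
  then have ba: "det2 b a = - 1" using det2_swap[of b a] by simp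
  have l: "\<bar>l\<bar> > 1" "l \<noteq> 0" "M *v a = l *\<^sub>R a" "M *v b = (1 / l) *\<^sub>R b" using e by (auto simp: eigpair_def)
  define z where "z = a + b"
  define v where "v = a1 + b1"
  have l2: "l\<^sup>2 > 1" using l(1) by (metis abs_square_less_1 abs_square_eq_1 linorder_neqE_linordered_idom not_less_iff_gr_or_eq order.asym)
  obtain \<gamma> \<delta> where gd: "v = \<gamma> *\<^sub>R a + \<delta> *\<^sub>R b" using det2_basis[of a b] ab by (metis zero_neq_one)
  have "\<not> same_axis a b a1 b1" using ns one unfolding equiv_axis_def by force
  then have gd0: "\<gamma> * \<delta> \<le> 0" using gaps_disjoint[OF os os1, of 1 1 \<gamma> \<delta>] gd by (simp add: v_def)
  have "v \<noteq> 0"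
  proof
    assume "v = 0"
    then have "b1 = - a1" by (simp add: v_def eq_neg_iff_add_eq_0 add.commute)
    then show False using os1 by (simp add: one_sided_def)
  qed
  then have "\<gamma> \<noteq> 0 \<or> \<delta> \<noteq> 0" using gd by auto
  then have "\<delta> \<noteq> \<gamma>" using gd0 by (auto simp: mult_le_0_iff)
  define \<sigma> where "\<sigma> = sgn (\<delta> - \<gamma>)"
  have \<sigma>: "\<sigma> * \<sigma> = 1" using \<open>\<delta> \<noteq> \<gamma>\<close> by (simp add: \<sigma>_def sgn_if)
  define trm where "trm h = side v z (h *v (M *v z)) - side v z (h *v z)" for h
  have on_axis: "trm h = \<sigma> * (sgn ((l * s)\<^sup>2 - 1) - sgn (s\<^sup>2 - 1))"
    if h: "h \<in> G" and p: "p \<noteq> 0" "matrix_inv h *v a = p *\<^sub>R a" "matrix_inv h *v b = (1 / p) *\<^sub>R b" and s: "s = 1 / p" for h p s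
  proof -
    have s0: "s \<noteq> 0" "l * s \<noteq> 0" using p s l by auto
    have y: "matrix_inv h *v z = (1 / s) *\<^sub>R a + s *\<^sub>R b" by (simp add: z_def matrix_vector_right_distrib p s)
    have x: "matrix_inv h *v v = (\<gamma> / s) *\<^sub>R a + (s * \<delta>) *\<^sub>R b"
      by (simp add: gd matrix_vector_right_distrib matrix_vector_mult_scaleR p s)
    have Mz: "M *v z = l *\<^sub>R a + (1 / l) *\<^sub>R b" by (simp add: z_def matrix_vector_right_distrib l)
    have "side v z (h *v z) = sgn ((s * \<delta> - \<gamma> / s) * (s - 1 / s))"
      unfolding side_inv[OF h] x y using ab ba by (simp add: z_def)
    also have "\<dots> = (sgn s * sgn s) * (\<sigma> * sgn (s\<^sup>2 - 1))"
      unfolding sgn_mult sgn_gap1[OF gd0 s0(1)] sgn_gap2[OF s0(1)] \<sigma>_def by (simp add: mult_ac)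
    finally have 1: "side v z (h *v z) = \<sigma> * sgn (s\<^sup>2 - 1)" using s0 by (simp add: sgn_if)
    have "side v z (h *v (M *v z)) = sgn (((l * s) * \<delta> - \<gamma> / (l * s)) * ((l * s) - 1 / (l * s)))"
      unfolding side_inv[OF h] x y Mz using ab ba by (simp add: mult.commute mult.left_commute mult.assoc)
    also have "\<dots> = (sgn (l * s) * sgn (l * s)) * (\<sigma> * sgn ((l * s)\<^sup>2 - 1))"
      unfolding sgn_mult[of "(l * s) * \<delta> - \<gamma> / (l * s)"] sgn_gap1[OF gd0 s0(2)] sgn_gap2[OF s0(2)] \<sigma>_def
      by (simp add: mult_ac)
    finally have 2: "side v z (h *v (M *v z)) = \<sigma> * sgn ((l * s)\<^sup>2 - 1)" using s0 by (simp add: sgn_if)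
    show ?thesis unfolding trm_def 1 2 by (simp add: right_diff_distrib)
  qed
  have nonneg: "\<sigma> * trm h \<ge> 0" if h: "h \<in> G" for h
  proof (cases "same_axis a b (matrix_inv h *v a) (matrix_inv h *v b)")
    case False
    have "\<not> same_axis a b (matrix_inv h *v a1) (matrix_inv h *v b1)"
      using ns minv[OF h] unfolding equiv_axis_def by auto
    then have "trm h = 0" unfolding trm_def v_def z_def using side_unchanged[OF os e os1 os h _ False] by simp
    then show ?thesis by simp
  next
    case True
    then obtain p where p: "p \<noteq> 0" "matrix_inv h *v a = p *\<^sub>R a" "matrix_inv h *v b = (1 / p) *\<^sub>R b"
      by (auto simp: same_axis_def)
    define s where "s = 1 / p"
    have "s\<^sup>2 \<le> (l * s)\<^sup>2" using l2 mult_right_mono[of 1 "l\<^sup>2" "s\<^sup>2"] by (simp add: power_mult_distrib)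
    then have "sgn ((l * s)\<^sup>2 - 1) - sgn (s\<^sup>2 - 1) \<ge> 0" by (auto simp: sgn_if)
    then show ?thesis unfolding on_axis[OF h p s_def] using \<sigma> by (simp flip: mult.assoc)
  qed
  have "matrix_inv (mat 1) = (mat 1 :: real^2^2)" using inv_mult(1)[OF one] by simp
  \<comment> \<open>Here \<open>s = 1\<close>: the path starts at the point \<open>z\<close> itself,
    where the sign is 0, and contributes half a crossing.\<close>
  then have "trm (mat 1) = \<sigma> * (sgn ((l * 1)\<^sup>2 - 1) - sgn (1\<^sup>2 - 1))" by (intro on_axis[OF one, of 1]) auto
  then have t1: "\<sigma> * trm (mat 1) = 1" using l2 \<sigma> by simp
  define A where "A = {h. h \<in> G \<and> side v z (h *v z) \<noteq> side v z (h *v (M *v z))}"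
  have "gap_point z" "gap_point v" using os os1 by (auto simp: gap_point_def z_def v_def)
  then have fA: "finite A" using cross_finite[of v z z "M *v z"] gap_point_act[OF _ M] by (simp add: A_def)
  have 1: "mat 1 \<in> A" using t1 one by (auto simp: A_def trm_def)
  have "\<sigma> * cross v z z (M *v z) = (\<Sum>h\<in>A. \<sigma> * trm h)" by (simp add: cross_def A_def trm_def sum_distrib_left)
  also have "\<dots> > 0" by (rule sum_pos2[OF fA 1]) (use t1 nonneg in \<open>auto simp: A_def\<close>)
  finally show ?thesis unfolding v_def z_def by auto
qed

text \<open>For pairs \<open>(a\<^sub>i, b\<^sub>i)\<close> in \<open>T\<close> and \<open>v\<^sub>i = a\<^sub>i + b\<^sub>i\<close>, the maps sending \<open>g\<close> to \<open>cross v\<^sub>1 v\<^sub>i v\<^sub>1 (g v\<^sub>1)\<close>, for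
  \<open>i \<noteq> 1\<close>, are homomorphisms from \<open>G\<close> to \<open>\<real>\<close>, so they are determined by their values on \<open>S\<close>.
  They are linearly independent: on the hyperbolic elements with axes \<open>(a\<^sub>k, b\<^sub>k)\<close>, \<open>k \<noteq> 1\<close>, they
  form an invertible diagonal matrix.\<close>

lemma inequivalent_axes_card:
  assumes T: "finite T" "\<And>P. P \<in> T \<Longrightarrow> one_sided (fst P) (snd P)"
    "\<And>P Q. P \<in> T \<Longrightarrow> Q \<in> T \<Longrightarrow> P \<noteq> Q \<Longrightarrow> \<not> equiv_axis P Q"
  shows "card T \<le> card S + 1"
proof (rule ccontr)
  assume c: "\<not> card T \<le> card S + 1"
  then have "T \<noteq> {}" by auto
  then obtain P1 where P1: "P1 \<in> T" by blast
  define v where "v P = fst P + snd P" for P :: "(real^2) \<times> (real^2)"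
  define \<theta> where "\<theta> P g = cross (v P1) (v P) (v P1) (g *v v P1)" for P g
  have gp: "gap_point (v P)" if "P \<in> T" for P using T(2)[OF that] by (auto simp: gap_point_def v_def)
  have "card S < card (T - {P1})" using c T(1) P1 by simp
  then obtain c where c: "\<exists>P\<in>T - {P1}. c P \<noteq> 0" "\<And>s. s \<in> S \<Longrightarrow> (\<Sum>P\<in>T - {P1}. c P * \<theta> P s) = 0"
    using more_unknowns_than_equations[OF finS, of "T - {P1}" \<theta>] T(1) by auto
  define \<psi> where "\<psi> g = (\<Sum>P\<in>T - {P1}. c P * \<theta> P g)" for g
  have \<theta>_mult: "\<theta> P (g ** g') = \<theta> P g + \<theta> P g'" if "P \<in> T" "g \<in> G" "g' \<in> G" for P g g'
  proof -
    have "\<theta> P (g ** g') = cross (v P1) (v P) (v P1) (g *v v P1) + cross (v P1) (v P) (g *v v P1) (g *v (g' *v v P1))"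
      unfolding \<theta>_def matrix_vector_mul_assoc[symmetric]
      by (intro cross_add gp P1 that gap_point_act)
    then show ?thesis using that by (simp add: cross_act \<theta>_def)
  qed
  have \<theta>_one: "\<theta> P (mat 1) = 0" for P by (simp add: \<theta>_def cross_def)
  have \<psi>_mult: "\<psi> (g ** g') = \<psi> g + \<psi> g'" if "g \<in> G" "g' \<in> G" for g g'
    unfolding \<psi>_def using \<theta>_mult that by (simp add: sum.distrib distrib_left)
  have \<psi>0: "\<psi> g = 0" if "g \<in> G" for g
  proof (rule gen[OF that, where P = "\<lambda>g. \<psi> g = 0"])
    show "\<psi> (mat 1) = 0" by (simp add: \<psi>_def \<theta>_one)
    show "\<psi> A = 0" if "A \<in> S" for A using c(2)[OF that] by (simp add: \<psi>_def)
    show "\<psi> (A ** B) = 0" if "A \<in> G" "B \<in> G" "\<psi> A = 0" "\<psi> B = 0" for A B using \<psi>_mult that by simp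
    show "\<psi> (matrix_inv A) = 0" if "A \<in> G" "\<psi> A = 0" for A
      using \<psi>_mult[OF that(1) minv[OF that(1)]] that \<open>\<psi> (mat 1) = 0\<close> by simp
    show "\<psi> (- A) = 0" if "A \<in> G" "\<psi> A = 0" for A using that(2) by (simp add: \<psi>_def \<theta>_def cross_uminus)
  qed
  obtain Q where Q: "Q \<in> T - {P1}" "c Q \<noteq> 0" using c(1) by blast
  have osQ: "one_sided (fst Q) (snd Q)" using T(2) Q by blast
  then obtain M l where M: "M \<in> G" "eigpair M (fst Q) (snd Q) l" by (auto simp: one_sided_def)
  have QT: "Q \<in> T" "Q \<noteq> P1" using Q by auto
  have \<theta>M: "\<theta> P M = cross (v P1) (v P) (v Q) (M *v v Q)" if "P \<in> T" for P
  proof -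
    have "\<theta> P M = cross (v P1) (v P) (v P1) (v Q) + cross (v P1) (v P) (v Q) (M *v v P1)"
      unfolding \<theta>_def by (intro cross_add gp P1 that QT gap_point_act M)
    moreover have "cross (v P1) (v P) (v Q) (M *v v P1) = cross (v P1) (v P) (v Q) (M *v v Q) + cross (v P1) (v P) (M *v v Q) (M *v v P1)"
      by (intro cross_add gp P1 that QT gap_point_act M)
    ultimately show ?thesis using cross_act[OF M(1), of "v P1" "v P" "v Q" "v P1"] cross_swap[of "v P1" "v P" "v P1" "v Q"] by simp
  qed
  have ne1: "\<not> equiv_axis (fst Q, snd Q) (fst P1, snd P1)" using T(3)[OF QT(1) P1 QT(2)] by simp
  have "\<theta> P M = 0" if "P \<in> T - {P1}" "P \<noteq> Q" for P
  proof -
    have P: "P \<in> T" using that by blast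
    have "\<not> equiv_axis (fst Q, snd Q) (fst P, snd P)" using T(3)[OF QT(1) P] that(2) by auto
    then show ?thesis unfolding \<theta>M[OF P] v_def
      using cross_other_axis[OF osQ M(2) T(2)[OF P1] T(2)[OF P] ne1] by simp
  qed
  then have "\<psi> M = (\<Sum>P\<in>T - {P1}. if P = Q then c Q * \<theta> Q M else 0)"
    unfolding \<psi>_def by (intro sum.cong) auto
  then have "\<psi> M = c Q * \<theta> Q M" using Q(1) T(1) by simp
  moreover have "\<theta> Q M \<noteq> 0" unfolding \<theta>M[OF QT(1)] v_def
    by (rule cross_own_axis[OF osQ M T(2)[OF P1] ne1])
  ultimately show False using \<psi>0[OF M(1)] Q(2) by simp
qed

text \<open>The bound of \<open>inequivalent_axes_card\<close> lets an inequivalent family of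
  largest size be chosen; a one-sided pair equivalent to none of its members could be added to
  it.\<close>

lemma finite_one_sided_axes:
  "\<exists>T. finite T \<and> (\<forall>P\<in>T. one_sided (fst P) (snd P)) \<and> (\<forall>a b. one_sided a b \<longrightarrow> (\<exists>Q\<in>T. equiv_axis Q (a, b)))"
proof -
  define good where "good T \<longleftrightarrow> finite T \<and> (\<forall>P\<in>T. one_sided (fst P) (snd P)) \<and>
    (\<forall>P\<in>T. \<forall>Q\<in>T. P \<noteq> Q \<longrightarrow> \<not> equiv_axis P Q)" for T
  have bound: "\<forall>T. good T \<longrightarrow> card T \<le> card S + 1"
  proof (intro allI impI)
    fix T assume "good T"
    then show "card T \<le> card S + 1" unfolding good_def by (intro inequivalent_axes_card) blast+
  qed
  have "good {}" by (simp add: good_def)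
  then obtain T where T: "good T" "\<forall>T'. good T' \<longrightarrow> card T' \<le> card T"
    using ex_has_greatest_nat[of good "{}" card "card S + 2"] bound by fastforce
  have "\<exists>Q\<in>T. equiv_axis Q (a, b)" if os: "one_sided a b" for a b
  proof (rule ccontr)
    assume n: "\<not> (\<exists>Q\<in>T. equiv_axis Q (a, b))"
    have refl: "equiv_axis (a, b) (a, b)"
      using one unfolding equiv_axis_def same_axis_def by (intro bexI[of _ "mat 1"] exI[of _ 1]) auto
    then have "(a, b) \<notin> T" using n by blast
    then have "card (insert (a, b) T) = card T + 1" using T(1) by (simp add: good_def)
    moreover have "good (insert (a, b) T)" using T(1) os n equiv_axis_sym unfolding good_def by auto
    ultimately show False using T(2) by fastforce
  qed
  then show ?thesis using T(1) unfolding good_def by blast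
qed

text \<open>If the orbit of the base point meets both sides of an axis, then one of the steps given by the
  generators crosses a translate of this axis. Otherwise the axis is one of the finitely many one-sided ones.\<close>

theorem hyperbolic_conj_separated:
  "\<exists>K. \<forall>M\<in>G. (\<exists>a b l. eigpair M a b l) \<longrightarrow> (\<exists>g\<in>G. sep K (g ** M ** matrix_inv g))"
proof -
  have "\<forall>t\<in>S. \<exists>K. \<forall>v w. (v \<bullet> w) * ((t *v v) \<bullet> (t *v w)) \<le> 0 \<longrightarrow> norm v * norm w \<le> K * \<bar>det2 v w\<bar>"
    using sign_change_separation det1 SG by blast
  then obtain K where K: "\<And>t v w. t \<in> S \<Longrightarrow> (v \<bullet> w) * ((t *v v) \<bullet> (t *v w)) \<le> 0 \<Longrightarrow> norm v * norm w \<le> K t * \<bar>det2 v w\<bar>"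
    by metis
  obtain T where T: "finite T" "\<And>P. P \<in> T \<Longrightarrow> one_sided (fst P) (snd P)"
    "\<And>a b. one_sided a b \<Longrightarrow> \<exists>Q\<in>T. equiv_axis Q (a, b)" using finite_one_sided_axes by blast
  \<comment> \<open>The three summands serve the three cases: an axis through an orbit point, a
    generator step that crosses the axis, and a one-sided axis.\<close>
  define K1 where "K1 = 1 + (\<Sum>t\<in>S. \<bar>K t\<bar>) + (\<Sum>P\<in>T. norm (fst P) * norm (snd P))"
  have s0: "(\<Sum>t\<in>S. \<bar>K t\<bar>) \<ge> 0" "(\<Sum>P\<in>T. norm (fst P) * norm (snd P)) \<ge> 0" by (auto intro: sum_nonneg)
  have KS: "K t \<le> K1" if "t \<in> S" for t
    proof -
    have "\<bar>K t\<bar> \<le> (\<Sum>t\<in>S. \<bar>K t\<bar>)" using that finS by (intro member_le_sum) auto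
    then show ?thesis using s0 unfolding K1_def by linarith
  qed
  have KT: "norm (fst P) * norm (snd P) \<le> K1" if "P \<in> T" for P
    proof -
    have "norm (fst P) * norm (snd P) \<le> (\<Sum>P\<in>T. norm (fst P) * norm (snd P))"
      using that T(1) by (intro member_le_sum) auto
    then show ?thesis using s0 unfolding K1_def by linarith
  qed
  have "\<exists>g\<in>G. sep K1 (g ** M ** matrix_inv g)" if M: "M \<in> G" and e0: "eigpair M a0 b0 l" for M a0 b0 l
  proof -
    define a where "a = a0"
    define b where "b = (1 / det2 a0 b0) *\<^sub>R b0"
    have e: "eigpair M a b l" and ab: "det2 a b = 1"
      using e0 by (simp_all add: eigpair_def a_def b_def matrix_vector_mult_scaleR)
    define s where "s g = (g *v a) \<bullet> (g *v b)" for g :: "real^2^2"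
    have sepI: ?thesis if "g \<in> G" "norm (g *v a) * norm (g *v b) \<le> K1" for g
      using eigpair_conj[OF that(1) e] that ab unfolding sep_def by force
    show ?thesis
    proof (cases "\<exists>g\<in>G. s g = 0")
      case True
      then obtain g where g: "g \<in> G" "s g = 0" by blast
      have "(norm (g *v a) * norm (g *v b))\<^sup>2 = 1\<^sup>2"
        using lagrange[of "g *v a" "g *v b"] g ab by (simp add: s_def power_mult_distrib)
      then have "norm (g *v a) * norm (g *v b) = 1" by (metis norm_ge_zero mult_nonneg_nonneg power2_eq_imp_eq zero_le_one)
      moreover have "1 \<le> K1" using s0 by (simp add: K1_def)
      ultimately show ?thesis using sepI[OF g(1)] by simp
    next
      case nz: False
      show ?thesis
      proof (cases "\<exists>g\<in>G. \<exists>t\<in>S. s g * s (t ** g) \<le> 0")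
        case True
        then obtain g t where g: "g \<in> G" "t \<in> S" "s g * s (t ** g) \<le> 0" by blast
        then have "norm (g *v a) * norm (g *v b) \<le> K t * \<bar>det2 (g *v a) (g *v b)\<bar>"
          by (intro K) (auto simp: s_def matrix_vector_mul_assoc)
        also have "\<dots> \<le> K1" using g KS ab by simp
        finally show ?thesis using sepI[OF g(1)] by blast
      next
        case False
        have same: "\<forall>g\<in>G. s g * s (A ** g) > 0" if "A \<in> G" for A
        proof (rule gen[OF that, where P = "\<lambda>A. \<forall>g\<in>G. s g * s (A ** g) > 0"])
          show "\<forall>g\<in>G. s g * s (mat 1 ** g) > 0" using nz by (auto simp: zero_less_mult_iff linorder_neq_iff)
          show "\<forall>g\<in>G. s g * s (A ** g) > 0" if "A \<in> S" for A using False that by force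
          show "\<forall>g\<in>G. s g * s (A ** B ** g) > 0"
            if AB: "A \<in> G" "B \<in> G" "\<forall>g\<in>G. s g * s (A ** g) > 0" "\<forall>g\<in>G. s g * s (B ** g) > 0" for A B
          proof
            fix g assume g: "g \<in> G"
            have "s g * s (B ** g) > 0" "s (B ** g) * s (A ** (B ** g)) > 0" using AB g mult by blast+
            then have "s g * s (A ** (B ** g)) > 0" by (auto simp: zero_less_mult_iff)
            then show "s g * s (A ** B ** g) > 0" by (simp add: matrix_mul_assoc)
          qed
          show "\<forall>g\<in>G. s g * s (matrix_inv A ** g) > 0" if A: "A \<in> G" "\<forall>g\<in>G. s g * s (A ** g) > 0" for A
          proof
            fix g assume g: "g \<in> G"
            have "s (matrix_inv A ** g) * s (A ** (matrix_inv A ** g)) > 0" using A g mult minv by blast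
            moreover have "A ** (matrix_inv A ** g) = g" using A(1) by (simp add: matrix_mul_assoc)
            ultimately show "s g * s (matrix_inv A ** g) > 0" by (simp add: mult.commute)
          qed
          show "\<forall>g\<in>G. s g * s (- A ** g) > 0" if "A \<in> G" "\<forall>g\<in>G. s g * s (A ** g) > 0" for A
            using that by (simp add: s_def)
        qed
        have same': "s (mat 1) * s g > 0" if "g \<in> G" for g using same[OF that] one by force
        have "\<exists>a' b'. one_sided a' b' \<and> (\<forall>g::real^2^2. norm (g *v a') * norm (g *v b') = norm (g *v a) * norm (g *v b))"
        proof (cases "s (mat 1) > 0")
          case True
          then have "one_sided a b" using same' e M ab unfolding one_sided_def s_def by (auto simp: zero_less_mult_iff)
          then show ?thesis by blast
        next
          case neg: False
          \<comment> \<open>If the orbit lies on the other side, the axis is read backwards: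
            \<open>(b, - a)\<close> again has \<open>det2\<close> equal to 1 and belongs to the
            inverse.\<close>
          have "eigpair (matrix_inv M) b (- a) l"
          proof -
            have l: "l \<noteq> 0" "\<bar>l\<bar> > 1" "M *v a = l *\<^sub>R a" "M *v b = (1 / l) *\<^sub>R b" using e by (auto simp: eigpair_def)
            then have "M *v (l *\<^sub>R b) = b" "M *v ((1 / l) *\<^sub>R a) = a" by (simp_all add: matrix_vector_mult_scaleR)
            then have "matrix_inv M *v b = l *\<^sub>R b" "matrix_inv M *v a = (1 / l) *\<^sub>R a"
              using inv_mult(4)[OF M] by metis+
            then show ?thesis using l ab det2_swap[of b a] by (simp add: eigpair_def)
          qed
          moreover have "(g *v b) \<bullet> (g *v (- a)) > 0" if "g \<in> G" for g
            using same'[OF that] neg by (simp add: s_def inner_commute zero_less_mult_iff)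
          ultimately have "one_sided b (- a)" using minv[OF M] ab det2_swap[of b a] unfolding one_sided_def by auto
          then have "one_sided b (- a) \<and> (\<forall>g::real^2^2. norm (g *v b) * norm (g *v (- a)) = norm (g *v a) * norm (g *v b))"
            by (simp add: mult.commute)
          then show ?thesis by blast
        qed
        then obtain a' b' where os: "one_sided a' b'" and n: "\<And>g::real^2^2. norm (g *v a') * norm (g *v b') = norm (g *v a) * norm (g *v b)"
          by blast
        obtain Q where Q: "Q \<in> T" "equiv_axis Q (a', b')" using T(3)[OF os] by blast
        then obtain g p where g: "g \<in> G" "p \<noteq> 0" "g *v a' = p *\<^sub>R fst Q" "g *v b' = (1 / p) *\<^sub>R snd Q"
          by (auto simp: equiv_axis_def same_axis_def)
        have "norm (g *v a) * norm (g *v b) = norm (fst Q) * norm (snd Q)" using g n[of g] by simp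
        then show ?thesis using sepI[OF g(1)] KT[OF Q(1)] by simp
      qed
    qed
  qed
  then show ?thesis by blast
qed

end

subsection \<open>Compatible bases and positive tuples\<close>

lemma ordered_basis_iff:
  fixes b :: "nat \<Rightarrow> real^'n"
  shows "ordered_basis b \<longleftrightarrow> (\<forall>c. (\<Sum>i<CARD('n). c i *\<^sub>R b i) = 0 \<longrightarrow> (\<forall>i<CARD('n). c i = 0))"
proof (intro iffI allI impI)
  fix c i assume b: "ordered_basis b" and s: "(\<Sum>i<CARD('n). c i *\<^sub>R b i) = 0" and i: "i < CARD('n)"
  have inj: "inj_on b {..<CARD('n)}" and ind: "independent (b ` {..<CARD('n)})"
    using b by (auto simp: ordered_basis_def)
  define u where "u v = c (the_inv_into {..<CARD('n)} b v)" for v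
  have "(\<Sum>v\<in>b ` {..<CARD('n)}. u v *\<^sub>R v) = (\<Sum>i<CARD('n). c i *\<^sub>R b i)"
    by (subst sum.reindex[OF inj]) (auto simp: u_def the_inv_into_f_f[OF inj] intro!: sum.cong)
  then have "(\<Sum>v\<in>b ` {..<CARD('n)}. u v *\<^sub>R v) = 0" using s by simp
  then have "u (b i) = 0" using independentD[OF ind, of "b ` {..<CARD('n)}" u "b i"] i by blast
  then show "c i = 0" using i by (simp add: u_def the_inv_into_f_f[OF inj])
next
  assume h: "\<forall>c. (\<Sum>i<CARD('n). c i *\<^sub>R b i) = 0 \<longrightarrow> (\<forall>i<CARD('n). c i = 0)"
  have inj: "inj_on b {..<CARD('n)}"
  proof (rule inj_onI, rule ccontr)
    fix i j assume ij: "i \<in> {..<CARD('n)}" "j \<in> {..<CARD('n)}" "b i = b j" "i \<noteq> j"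
    define c :: "nat \<Rightarrow> real" where "c k = (if k = i then 1 else 0) - (if k = j then 1 else 0)" for k
    have "(\<Sum>k<CARD('n). c k *\<^sub>R b k) = (\<Sum>k<CARD('n). (if k = i then b k else 0)) - (\<Sum>k<CARD('n). (if k = j then b k else 0))"
      unfolding sum_subtractf[symmetric] by (intro sum.cong) (auto simp: c_def)
    also have "\<dots> = 0" using ij by (simp add: sum.delta)
    finally have "c i = 0" using h ij by blast
    then show False using ij by (simp add: c_def)
  qed
  moreover have "independent (b ` {..<CARD('n)})"
  proof
    assume "dependent (b ` {..<CARD('n)})"
    then obtain u v where u: "v \<in> b ` {..<CARD('n)}" "u v \<noteq> 0" "(\<Sum>v\<in>b ` {..<CARD('n)}. u v *\<^sub>R v) = 0"
      by (auto simp: dependent_finite)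
    have "(\<Sum>i<CARD('n). u (b i) *\<^sub>R b i) = 0" using u(3) by (simp add: sum.reindex[OF inj])
    then show False using h u(1,2) by force
  qed
  ultimately show "ordered_basis b" by (simp add: ordered_basis_def)
qed

lemma ordered_basis_zero:
  fixes b :: "nat \<Rightarrow> real^'n"
  assumes "ordered_basis b" "(\<Sum>i<CARD('n). c i *\<^sub>R b i) = 0" "i < CARD('n)"
  shows "c i = 0"
  using assms(1)[unfolded ordered_basis_iff, THEN spec, of c] assms(2,3) by simp

lemma basis_expansion_exists:
  fixes b :: "nat \<Rightarrow> real^'n"
  assumes "ordered_basis b"
  shows "\<exists>c. v = (\<Sum>i<CARD('n). c i *\<^sub>R b i)"
proof -
  have inj: "inj_on b {..<CARD('n)}" and ind: "independent (b ` {..<CARD('n)})"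
    using assms by (auto simp: ordered_basis_def)
  have "card (b ` {..<CARD('n)}) = CARD('n)" using inj by (simp add: card_image)
  then have "v \<in> span (b ` {..<CARD('n)})" using card_ge_dim_independent[OF subset_UNIV ind] by auto
  then obtain u where "v = (\<Sum>w\<in>b ` {..<CARD('n)}. u w *\<^sub>R w)" by (auto simp: span_finite)
  then have "v = (\<Sum>i<CARD('n). u (b i) *\<^sub>R b i)" by (simp add: sum.reindex[OF inj])
  then show ?thesis by (rule exI[of _ "\<lambda>i. u (b i)"])
qed

lemma basis_expansion_unique:
  fixes b :: "nat \<Rightarrow> real^'n"
  assumes "ordered_basis b" "(\<Sum>i<CARD('n). c i *\<^sub>R b i) = (\<Sum>i<CARD('n). e i *\<^sub>R b i)" "i < CARD('n)"
  shows "c i = e i"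
proof -
  have "(\<Sum>i<CARD('n). (c i - e i) *\<^sub>R b i) = 0" using assms(2) by (simp add: scaleR_diff_left sum_subtractf)
  then have "c i - e i = 0" using ordered_basis_zero[OF assms(1), of "\<lambda>i. c i - e i"] assms(3) by simp
  then show ?thesis by simp
qed

lemma representation_basis:
  fixes b :: "nat \<Rightarrow> real^'n"
  assumes b: "ordered_basis b"
  shows "v = (\<Sum>i<CARD('n). representation (b ` {..<CARD('n)}) v (b i) *\<^sub>R b i)"
proof -
  have inj: "inj_on b {..<CARD('n)}" and ind: "independent (b ` {..<CARD('n)})"
    using b by (auto simp: ordered_basis_def)
  have "card (b ` {..<CARD('n)}) = CARD('n)" using inj by (simp add: card_image)
  then have "v \<in> span (b ` {..<CARD('n)})" using card_ge_dim_independent[OF subset_UNIV ind] by auto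
  from sum_representation_eq[OF ind this, of "b ` {..<CARD('n)}"]
  have "(\<Sum>w\<in>b ` {..<CARD('n)}. representation (b ` {..<CARD('n)}) v w *\<^sub>R w) = v" by simp
  then show ?thesis by (simp add: sum.reindex[OF inj])
qed

lemma span_family_subset:
  fixes b :: "nat \<Rightarrow> real^'n"
  assumes "finite I"
  shows "v \<in> span (b ` I) \<Longrightarrow> \<exists>c. v = (\<Sum>i\<in>I. c i *\<^sub>R b i)"
proof (induction rule: span_induct_alt)
  case base
  then show ?case by (intro exI[of _ "\<lambda>_. 0"]) simp
next
  case (step t x y)
  then obtain c i where c: "y = (\<Sum>i\<in>I. c i *\<^sub>R b i)" and i: "i \<in> I" "x = b i" by blast
  have "(\<Sum>k\<in>I. (c k + (if k = i then t else 0)) *\<^sub>R b k) = y + (\<Sum>k\<in>I. (if k = i then t *\<^sub>R b k else 0))"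
    unfolding c sum.distrib[symmetric] by (intro sum.cong) (auto simp: algebra_simps)
  also have "\<dots> = t *\<^sub>R x + y" using i assms by (simp add: sum.delta add.commute)
  finally show ?case by metis
qed

lemma flags_dim: "F \<in> flags \<Longrightarrow> subspace (F k) \<and> dim (F k) = min k CARD('n)" for F :: "'n::finite flag"
  by (simp add: flags_def)

lemma flags_mono: "F \<in> flags \<Longrightarrow> i \<le> j \<Longrightarrow> F i \<subseteq> F j" for F :: "'n::finite flag"
  unfolding flags_def mono_def by blast

lemma compatible_spans:
  fixes b :: "nat \<Rightarrow> real^'n"
  assumes c: "compatible b E F" and EF: "E \<in> flags" "F \<in> flags" and k: "k \<le> CARD('n)"
  shows "E k = span (b ` {..<k})" "F k = span (b ` {CARD('n) - k..<CARD('n)})"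
proof -
  have b: "inj_on b {..<CARD('n)}" "independent (b ` {..<CARD('n)})"
    and m: "\<And>i. i < CARD('n) \<Longrightarrow> b i \<in> E (Suc i) \<and> b i \<in> F (CARD('n) - i)"
    using c by (auto simp: compatible_def ordered_basis_def)
  have *: "V = span (b ` I)" if V: "subspace V" "dim V = k" and I: "I \<subseteq> {..<CARD('n)}" "card I = k" "b ` I \<subseteq> V" for V I
  proof -
    have ind: "independent (b ` I)" using b(2) I(1) by (meson image_mono independent_mono)
    have "card (b ` I) = k" using I b(1) by (simp add: card_image inj_on_subset)
    then have "V \<subseteq> span (b ` I)" using card_ge_dim_independent[OF I(3) ind] V by simp
    moreover have "span (b ` I) \<subseteq> V" using I(3) V(1) by (rule span_minimal)
    ultimately show ?thesis by blast
  qed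
  have d: "subspace (E k)" "dim (E k) = k" "subspace (F k)" "dim (F k) = k"
    using flags_dim[OF EF(1), of k] flags_dim[OF EF(2), of k] k by auto
  have "b i \<in> E k" if "i < k" for i
    using m[of i] flags_mono[OF EF(1), of "Suc i" k] that k by force
  then show "E k = span (b ` {..<k})" using k by (intro *[OF d(1,2)]) auto
  have "b i \<in> F k" if "i \<in> {CARD('n) - k..<CARD('n)}" for i
    using m[of i] flags_mono[OF EF(2), of "CARD('n) - i" k] that k by force
  then show "F k = span (b ` {CARD('n) - k..<CARD('n)})" using k by (intro *[OF d(3,4)]) auto
qed

text \<open>\<open>x\<close> lies both in the span of the first \<open>j + 1\<close> and in that of
  the last \<open>CARD('n) - j\<close> basis vectors, which share only the line of
  \<open>b j\<close>. Consequently a compatible basis is unique up to rescaling each vector.\<close>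

lemma compatible_line:
  fixes b :: "nat \<Rightarrow> real^'n"
  assumes c: "compatible b E F" and EF: "E \<in> flags" "F \<in> flags" and j: "j < CARD('n)"
    and x: "x \<in> E (Suc j)" "x \<in> F (CARD('n) - j)"
  shows "\<exists>t. x = t *\<^sub>R b j"
proof -
  have ob: "ordered_basis b" using c by (simp add: compatible_def)
  have "x \<in> span (b ` {..<Suc j})" "x \<in> span (b ` {j..<CARD('n)})"
    using x compatible_spans[OF c EF, of "Suc j"] compatible_spans[OF c EF, of "CARD('n) - j"] j by auto
  from span_family_subset[OF finite_lessThan this(1)] span_family_subset[OF finite_atLeastLessThan this(2)]
  obtain p q where p: "x = (\<Sum>i<Suc j. p i *\<^sub>R b i)" and q: "x = (\<Sum>i\<in>{j..<CARD('n)}. q i *\<^sub>R b i)"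
    by blast
  define p' where "p' i = (if i < Suc j then p i else 0)" for i
  define q' where "q' i = (if j \<le> i then q i else 0)" for i
  have "(\<Sum>i<CARD('n). p' i *\<^sub>R b i) = x" unfolding p
    by (rule sum.mono_neutral_cong_right) (use j in \<open>auto simp: p'_def\<close>)
  moreover have "(\<Sum>i<CARD('n). q' i *\<^sub>R b i) = x" unfolding q
    by (rule sum.mono_neutral_cong_right) (use j in \<open>auto simp: q'_def\<close>)
  ultimately have eq: "p' i = q' i" if "i < CARD('n)" for i
    using basis_expansion_unique[OF ob, of p' q'] that by simp
  have "p i = 0" if "i < j" for i using eq[of i] that j by (simp add: p'_def q'_def)
  then have "x = p j *\<^sub>R b j" unfolding p by (simp add: lessThan_Suc)
  then show ?thesis by blast
qed

lemma compatible_rescale: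
  fixes b b' :: "nat \<Rightarrow> real^'n"
  assumes c: "compatible b E F" and EF: "E \<in> flags" "F \<in> flags"
    and b': "\<And>j. j < CARD('n) \<Longrightarrow> b' j \<noteq> 0 \<and> b' j \<in> E (Suc j) \<and> b' j \<in> F (CARD('n) - j)"
  shows "compatible b' E F" "\<exists>t. \<forall>j<CARD('n). t j \<noteq> 0 \<and> b' j = t j *\<^sub>R b j"
proof -
  have "\<forall>j. \<exists>t. j < CARD('n) \<longrightarrow> b' j = t *\<^sub>R b j" using compatible_line[OF c EF] b' by blast
  then obtain t where t: "\<And>j. j < CARD('n) \<Longrightarrow> b' j = t j *\<^sub>R b j" by metis
  have tnz: "t j \<noteq> 0" if "j < CARD('n)" for j using t[OF that] b'[OF that] by auto
  show "\<exists>t. \<forall>j<CARD('n). t j \<noteq> 0 \<and> b' j = t j *\<^sub>R b j" using t tnz by blast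
  have ob: "ordered_basis b" using c by (simp add: compatible_def)
  have "ordered_basis b'"
    unfolding ordered_basis_iff
  proof (intro allI impI)
    fix e i assume "(\<Sum>i<CARD('n). e i *\<^sub>R b' i) = 0" and i: "i < CARD('n)"
    then have "(\<Sum>i<CARD('n). (e i * t i) *\<^sub>R b i) = 0" using t by simp
    then have "e i * t i = 0" using ordered_basis_zero[OF ob, of "\<lambda>i. e i * t i"] i by simp
    then show "e i = 0" using tnz[OF i] by simp
  qed
  then show "compatible b' E F" using c b' by (simp add: compatible_def)
qed

lemma compatible_nonzero:
  fixes b :: "nat \<Rightarrow> real^'n"
  assumes "compatible b E F" "j < CARD('n)"
  shows "b j \<noteq> 0" "b j \<in> E (Suc j)" "b j \<in> F (CARD('n) - j)"
proof -
  have "independent (b ` {..<CARD('n)})" using assms by (simp add: compatible_def ordered_basis_def)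
  then show "b j \<noteq> 0" using assms(2) dependent_zero by (metis imageI lessThan_iff)
qed (use assms in \<open>auto simp: compatible_def\<close>)

lemma compatible_scale:
  fixes b b' :: "nat \<Rightarrow> real^'n"
  assumes "compatible b E F" "compatible b' E F" "E \<in> flags" "F \<in> flags"
  shows "\<exists>t. \<forall>j<CARD('n). t j \<noteq> 0 \<and> b' j = t j *\<^sub>R b j"
  using compatible_rescale(2)[OF assms(1,3,4)] compatible_nonzero[OF assms(2)] by blast

text \<open>The two subspaces have dimensions adding up to \<open>CARD('n) - 1\<close>. Normals can
  be scaled to norm 1 and passed to limits, and their values on a compatible basis determine the
  unipotent entry of interest.\<close>

definition hyperplane_normal :: "'n::finite flag \<Rightarrow> 'n flag \<Rightarrow> nat \<Rightarrow> real^'n \<Rightarrow> bool" where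
  "hyperplane_normal E X j n \<longleftrightarrow> n \<noteq> 0 \<and> (\<forall>v\<in>E j. n \<bullet> v = 0) \<and> (\<forall>v\<in>X (CARD('n) - 1 - j). n \<bullet> v = 0)"

lemma hyperplane_normal_exists:
  fixes E X :: "'n::finite flag"
  assumes "E \<in> flags" "X \<in> flags" "j < CARD('n)"
  shows "\<exists>n. hyperplane_normal E X j n"
proof -
  define V where "V = {x + y |x y. x \<in> E j \<and> y \<in> X (CARD('n) - 1 - j)}"
  have E: "subspace (E j)" "dim (E j) = j" and X: "subspace (X (CARD('n) - 1 - j))" "dim (X (CARD('n) - 1 - j)) = CARD('n) - 1 - j"
    using flags_dim[OF assms(1), of j] flags_dim[OF assms(2), of "CARD('n) - 1 - j"] assms(3) by auto
  have "dim V + dim (E j \<inter> X (CARD('n) - 1 - j)) = dim (E j) + dim (X (CARD('n) - 1 - j))"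
    unfolding V_def by (rule dim_sums_Int[OF E(1) X(1)])
  then have "dim V < DIM(real^'n)" using E X assms(3) by simp
  then obtain n where n: "n \<noteq> 0" "\<And>y. y \<in> span V \<Longrightarrow> orthogonal n y"
    using orthogonal_to_subspace_exists by blast
  have "E j \<subseteq> V" "X (CARD('n) - 1 - j) \<subseteq> V"
    unfolding V_def using subspace_0[OF E(1)] subspace_0[OF X(1)] by force+
  then have "hyperplane_normal E X j n"
    using n span_superset[of V] by (auto simp: hyperplane_normal_def orthogonal_def)
  then show ?thesis by blast
qed

text \<open>\<open>n\<close> kills \<open>E j\<close> and every \<open>u *v b k\<close> with
  \<open>k > j\<close>, so expanding \<open>u *v b (Suc j)\<close> modulo \<open>E j\<close> gives
  the second equation. If \<open>n \<bullet> b j\<close> were 0, then \<open>n\<close> would kill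
  all \<open>b k\<close> successively, since \<open>u *v b k\<close> differs from \<open>b k\<close>
  by earlier basis vectors.\<close>

lemma hyperplane_normal_coefficient:
  fixes b :: "nat \<Rightarrow> real^'n"
  assumes c: "compatible b E F" and EF: "E \<in> flags" "F \<in> flags" and j: "Suc j < CARD('n)"
    and u: "\<And>k. k < CARD('n) \<Longrightarrow> u *v b k - b k \<in> span (b ` {..<k})"
    and w: "u *v b (Suc j) - b (Suc j) - w *\<^sub>R b j \<in> span (b ` {..<j})"
    and n: "hyperplane_normal E (flag_act u F) j n"
  shows "n \<bullet> b j \<noteq> 0" "n \<bullet> b (Suc j) = - w * (n \<bullet> b j)"
proof -
  have nz: "n \<noteq> 0" and nE: "\<And>v. v \<in> E j \<Longrightarrow> n \<bullet> v = 0"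
    and nX: "\<And>v. v \<in> F (CARD('n) - 1 - j) \<Longrightarrow> n \<bullet> (u *v v) = 0"
    using n by (auto simp: hyperplane_normal_def flag_act_def)
  have nu: "n \<bullet> (u *v b k) = 0" if "j < k" "k < CARD('n)" for k
  proof -
    have "b k \<in> F (CARD('n) - k)" using compatible_nonzero[OF c that(2)] by blast
    moreover have "CARD('n) - k \<le> CARD('n) - 1 - j" using that by linarith
    ultimately have "b k \<in> F (CARD('n) - 1 - j)" using flags_mono[OF EF(2)] by blast
    then show ?thesis by (rule nX)
  qed
  have E: "E j = span (b ` {..<j})" using compatible_spans(1)[OF c EF] j by simp
  have "n \<bullet> (u *v b (Suc j) - b (Suc j) - w *\<^sub>R b j) = 0" using nE w E by blast
  then show eq: "n \<bullet> b (Suc j) = - w * (n \<bullet> b j)" using nu[of "Suc j"] j by (simp add: inner_diff_right)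
  show "n \<bullet> b j \<noteq> 0"
  proof
    assume 0: "n \<bullet> b j = 0"
    have nb: "n \<bullet> b k = 0" if "k < CARD('n)" for k
      using that
    proof (induction k rule: less_induct)
      case (less k)
      consider "k < j" | "k = j" | "j < k" by linarith
      then show ?case
      proof cases
        case 1
        then have "b k \<in> E j" unfolding E by (intro span_base) auto
        then show ?thesis by (rule nE)
      next
        case 2
        then show ?thesis using 0 by simp
      next
        case 3
        have "n \<bullet> v = 0" if "v \<in> span (b ` {..<k})" for v
          using that
        proof (induction rule: span_induct_alt)
          case (step t x y)
          then show ?case using less by (auto simp: inner_add_right)
        qed simp
        from this[OF u[OF less.prems]] show ?thesis using nu[OF 3 less.prems] by (simp add: inner_diff_right)
      qed
    qed
    obtain e where "n = (\<Sum>i<CARD('n). e i *\<^sub>R b i)"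
      using basis_expansion_exists[of b n] c by (auto simp: compatible_def)
    moreover have "n \<bullet> (\<Sum>i<CARD('n). e i *\<^sub>R b i) = 0" using nb by (simp add: inner_sum_right)
    ultimately have "n \<bullet> n = 0" by (metis (full_types))
    then show False using nz by simp
  qed
qed

lemma minor_entry:
  fixes M :: "real mat"
  assumes "M \<in> carrier_mat d d" "i < d" "j < d"
  shows "minor M {i} {j} = M $$ (i, j)"
proof -
  have s: "{a. a < dim_row M \<and> a \<in> {i}} = {i}" "{a. a < dim_col M \<and> a \<in> {j}} = {j}" using assms by auto
  have "submatrix M {i} {j} \<in> carrier_mat 1 1" by (intro carrier_matI) (simp_all only: dim_submatrix s, simp_all)
  then have "Determinant.det (submatrix M {i} {j}) = submatrix M {i} {j} $$ (0, 0)" by (rule Determinant.det_single)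
  also have "\<dots> = M $$ (pick {i} 0, pick {j} 0)" by (rule submatrix_index) (simp_all only: s, simp_all)
  also have "\<dots> = M $$ (i, j)"
  proof -
    have "pick {i} 0 = i" "pick {j} 0 = j" by (auto intro: Least_equality)
    then show ?thesis by (simp only:)
  qed
  finally show ?thesis by (simp add: minor_def)
qed

text \<open>Extracts the entries on and just above the diagonal: unipotency makes the former 1, and
  the minors of size one make the latter positive.\<close>

lemma U_pos_facts:
  fixes b :: "nat \<Rightarrow> real^'n"
  assumes b: "ordered_basis b" and u: "u \<in> U_pos b"
  shows "k < CARD('n) \<Longrightarrow> u *v b k - b k \<in> span (b ` {..<k})"
    and "Suc j < CARD('n) \<Longrightarrow> \<exists>w>0. u *v b (Suc j) - b (Suc j) - w *\<^sub>R b j \<in> span (b ` {..<j})"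
proof -
  define M where "M = matrix_in_basis b u"
  have M: "M \<in> carrier_mat CARD('n) CARD('n)" by (simp add: M_def matrix_in_basis_def)
  have ub: "u *v b k = (\<Sum>i<CARD('n). M $$ (i, k) *\<^sub>R b i)" if "k < CARD('n)" for k
    using that by (subst representation_basis[OF b]) (simp add: M_def matrix_in_basis_def)
  have upper: "M $$ (i, k) = 0" if "k < i" "i < CARD('n)" for i k
  proof -
    have "upper_triangular M" using u by (simp add: U_pos_def M_def)
    then show ?thesis using that M unfolding upper_triangular_def by auto
  qed
  have in_span: "(\<Sum>i<k. c i *\<^sub>R b i) \<in> span (b ` {..<k})" for c k
    by (intro span_sum span_scale span_base) auto
  have ub2: "u *v b k = (\<Sum>i<k. M $$ (i, k) *\<^sub>R b i) + M $$ (k, k) *\<^sub>R b k" if k: "k < CARD('n)" for k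
  proof -
    have "u *v b k = (\<Sum>i<Suc k. M $$ (i, k) *\<^sub>R b i)" unfolding ub[OF k]
      by (rule sum.mono_neutral_right) (use k upper in auto)
    then show ?thesis by (simp add: lessThan_Suc add.commute)
  qed
  \<comment> \<open>Modulo the earlier basis vectors, \<open>u - mat 1\<close> multiplies
    \<open>b k\<close> by \<open>M $$ (k, k) - 1\<close>, and nilpotency forces this factor to
    vanish.\<close>
  have diag: "M $$ (k, k) = 1" if k: "k < CARD('n)" for k
  proof -
    obtain m where m: "((\<lambda>v. (u - mat 1) *v v) ^^ m) = (\<lambda>v. 0)" using u by (auto simp: U_pos_def unipotent_def)
    have pres: "(u - mat 1) *v v \<in> span (b ` {..<k})" if "v \<in> span (b ` {..<k})" for v
      using that
    proof (induction rule: span_induct_alt)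
      case (step t x y)
      then obtain i where i: "i < k" "x = b i" by auto
      have "u *v b i \<in> span (b ` {..<k})" unfolding ub2[OF less_trans[OF i(1) k]]
        using i by (intro span_add span_sum span_scale span_base) auto
      moreover have "b i \<in> span (b ` {..<k})" using i by (intro span_base) auto
      ultimately have "(u - mat 1) *v x \<in> span (b ` {..<k})" by (simp add: matrix_vector_mult_diff_rdistrib span_diff i)
      then show ?case using step by (simp add: matrix_vector_right_distrib matrix_vector_mult_scaleR span_add span_scale)
    qed (simp add: span_zero)
    have "\<exists>w\<in>span (b ` {..<k}). ((\<lambda>v. (u - mat 1) *v v) ^^ p) (b k) = (M $$ (k, k) - 1) ^ p *\<^sub>R b k + w" for p
    proof (induction p)
      case 0
      then show ?case by (intro bexI[of _ 0]) (auto simp: span_zero)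
    next
      case (Suc p)
      then obtain w where w: "w \<in> span (b ` {..<k})"
        "((\<lambda>v. (u - mat 1) *v v) ^^ p) (b k) = (M $$ (k, k) - 1) ^ p *\<^sub>R b k + w" by blast
      define w' where "w' = (M $$ (k, k) - 1) ^ p *\<^sub>R (\<Sum>i<k. M $$ (i, k) *\<^sub>R b i) + (u - mat 1) *v w"
      have "w' \<in> span (b ` {..<k})" unfolding w'_def by (intro span_add span_scale in_span pres w)
      moreover have "((\<lambda>v. (u - mat 1) *v v) ^^ Suc p) (b k) = (M $$ (k, k) - 1) ^ Suc p *\<^sub>R b k + w'"
      proof -
        have "(u - mat 1) *v b k = (\<Sum>i<k. M $$ (i, k) *\<^sub>R b i) + (M $$ (k, k) - 1) *\<^sub>R b k"
          by (simp add: matrix_vector_mult_diff_rdistrib ub2[OF k] algebra_simps)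
        then show ?thesis unfolding funpow.simps o_apply w(2) w'_def
          by (simp add: matrix_vector_right_distrib matrix_vector_mult_scaleR algebra_simps)
      qed
      ultimately show ?case by blast
    qed
    from this[of m] obtain w where w: "w \<in> span (b ` {..<k})" "(M $$ (k, k) - 1) ^ m *\<^sub>R b k + w = 0"
      unfolding m by auto
    obtain c where c: "w = (\<Sum>i<k. c i *\<^sub>R b i)" using span_family_subset[OF _ w(1)] by auto
    define e where "e i = (if i < k then c i else if i = k then (M $$ (k, k) - 1) ^ m else 0)" for i
    have "(\<Sum>i<CARD('n). e i *\<^sub>R b i) = (\<Sum>i<Suc k. e i *\<^sub>R b i)"
      by (rule sum.mono_neutral_right) (use k in \<open>auto simp: e_def\<close>)
    also have "\<dots> = w + e k *\<^sub>R b k" unfolding c by (simp add: lessThan_Suc e_def add.commute)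
    also have "\<dots> = 0" using w(2) by (simp add: e_def add.commute)
    finally have "e k = 0" using ordered_basis_zero[OF b, of e] k by simp
    then show ?thesis by (simp add: e_def)
  qed
  show "u *v b k - b k \<in> span (b ` {..<k})" if k: "k < CARD('n)"
    unfolding ub2[OF k] diag[OF k] using in_span by simp
  show "\<exists>w>0. u *v b (Suc j) - b (Suc j) - w *\<^sub>R b j \<in> span (b ` {..<j})" if j: "Suc j < CARD('n)"
  proof (intro exI conjI)
    \<comment> \<open>A witness that the entry in row \<open>j\<close> and column
      \<open>j + 1\<close> is not forced to be 0.\<close>
    define N :: "real mat" where "N = Matrix.mat CARD('n) CARD('n) (\<lambda>(i, k). if i \<le> k then 1 else 0)"
    have N: "N \<in> carrier_mat CARD('n) CARD('n)" "upper_triangular N" by (auto simp: N_def upper_triangular_def)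
    have "minor N {j} {Suc j} = 1" using j minor_entry[OF N(1)] by (simp add: N_def)
    then have "\<not> forced_zero CARD('n) {j} {Suc j}" using N unfolding forced_zero_def by force
    then have "minor M {j} {Suc j} > 0" using u j unfolding U_pos_def M_def by auto
    then show "M $$ (j, Suc j) > 0" using minor_entry[OF M] j by simp
    show "u *v b (Suc j) - b (Suc j) - M $$ (j, Suc j) *\<^sub>R b j \<in> span (b ` {..<j})"
      unfolding ub2[OF j] diag[OF j] using in_span[where k = j] by (simp add: lessThan_Suc)
  qed
qed

text \<open>An upper unitriangular matrix in the basis \<open>b\<close> whose entry in row
  \<open>j\<close> and column \<open>j + 1\<close> is \<open>w\<close>. The formulation by spans
  makes products easy: the entries \<open>w\<close> add up.\<close>

definition unitri :: "(nat \<Rightarrow> real^'n) \<Rightarrow> real^'n^'n \<Rightarrow> nat \<Rightarrow> real \<Rightarrow> bool" where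
  "unitri b u j w \<longleftrightarrow> (\<forall>k<CARD('n). u *v b k - b k \<in> span (b ` {..<k})) \<and>
     u *v b (Suc j) - b (Suc j) - w *\<^sub>R b j \<in> span (b ` {..<j})"

lemma unitri_preserves:
  fixes b :: "nat \<Rightarrow> real^'n"
  assumes u: "unitri b u j w" and k: "k \<le> CARD('n)" and v: "v \<in> span (b ` {..<k})"
  shows "u *v v \<in> span (b ` {..<k})"
  using v
proof (induction rule: span_induct_alt)
  case (step t x y)
  then obtain i where i: "i < k" "x = b i" by auto
  have "u *v b i - b i \<in> span (b ` {..<i})" using u i k by (simp add: unitri_def)
  also have "span (b ` {..<i}) \<subseteq> span (b ` {..<k})" using i by (intro span_mono) auto
  finally have 1: "u *v b i - b i \<in> span (b ` {..<k})" .
  have "b i \<in> span (b ` {..<k})" using i by (intro span_base) auto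
  from span_add[OF 1 this] have "u *v b i \<in> span (b ` {..<k})" by simp
  then show ?case using step i by (simp add: matrix_vector_right_distrib matrix_vector_mult_scaleR span_add span_scale)
qed (simp add: span_zero)

lemma unitri_mult:
  fixes b :: "nat \<Rightarrow> real^'n"
  assumes u: "unitri b u j w" and u': "unitri b u' j w'" and j: "Suc j < CARD('n)"
  shows "unitri b (u ** u') j (w + w')"
  unfolding unitri_def
proof (intro conjI allI impI)
  fix k assume k: "k < CARD('n)"
  have "(u ** u') *v b k - b k = u *v (u' *v b k - b k) + (u *v b k - b k)"
    by (simp add: matrix_vector_mult_diff_distrib flip: matrix_vector_mul_assoc)
  moreover have "u *v (u' *v b k - b k) \<in> span (b ` {..<k})"
    by (rule unitri_preserves[OF u]) (use u' k in \<open>auto simp: unitri_def\<close>)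
  moreover have "u *v b k - b k \<in> span (b ` {..<k})" using u k by (simp add: unitri_def)
  ultimately show "(u ** u') *v b k - b k \<in> span (b ` {..<k})" by (simp only: span_add)
next
  define s where "s = u' *v b (Suc j) - b (Suc j) - w' *\<^sub>R b j"
  have us: "u *v s \<in> span (b ` {..<j})"
    by (rule unitri_preserves[OF u]) (use u' j in \<open>auto simp: unitri_def s_def\<close>)
  have "u' *v b (Suc j) = b (Suc j) + w' *\<^sub>R b j + s" by (simp add: s_def)
  then have "(u ** u') *v b (Suc j) - b (Suc j) - (w + w') *\<^sub>R b j =
      (u *v b (Suc j) - b (Suc j) - w *\<^sub>R b j) + w' *\<^sub>R (u *v b j - b j) + u *v s"
    by (simp add: matrix_vector_right_distrib matrix_vector_mult_scaleR algebra_simps flip: matrix_vector_mul_assoc)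
  moreover have "u *v b (Suc j) - b (Suc j) - w *\<^sub>R b j \<in> span (b ` {..<j})" using u by (simp add: unitri_def)
  moreover have "u *v b j - b j \<in> span (b ` {..<j})" using u j by (simp add: unitri_def)
  ultimately show "(u ** u') *v b (Suc j) - b (Suc j) - (w + w') *\<^sub>R b j \<in> span (b ` {..<j})"
    using us by (simp only: span_add span_scale)
qed

lemma U_pos_unitri:
  fixes b :: "nat \<Rightarrow> real^'n"
  assumes "ordered_basis b" "u \<in> U_pos b" "Suc j < CARD('n)"
  shows "\<exists>w>0. unitri b u j w"
proof -
  obtain w where "w > 0" "u *v b (Suc j) - b (Suc j) - w *\<^sub>R b j \<in> span (b ` {..<j})"
    using U_pos_facts(2)[OF assms(1,2,3)] by blast
  then show ?thesis using U_pos_facts(1)[OF assms(1,2)] unfolding unitri_def by (intro exI[of _ w]) simp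
qed

text \<open>If \<open>X = u F\<close> for a unipotent \<open>u\<close> which is upper triangular in the basis \<open>b\<close> compatible with
  \<open>(E, F)\<close>, then the ratio is the absolute value of the entry of \<open>u\<close> in row \<open>j\<close> and column \<open>j + 1\<close>.
  These entries are additive in \<open>u\<close>.\<close>

definition ratio_is :: "(nat \<Rightarrow> real^'n) \<Rightarrow> 'n::finite flag \<Rightarrow> 'n flag \<Rightarrow> nat \<Rightarrow> real \<Rightarrow> bool" where
  "ratio_is b E X j w \<longleftrightarrow> (\<forall>n. hyperplane_normal E X j n \<longrightarrow> n \<bullet> b j \<noteq> 0 \<and> \<bar>n \<bullet> b (Suc j)\<bar> = w * \<bar>n \<bullet> b j\<bar>)"

text \<open>A positive tuple brings a compatible basis \<open>b0\<close> of its own. Passing to the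
  prescribed basis \<open>b\<close> multiplies the entry by a quotient of scaling factors, and the
  absolute values in \<open>ratio_is\<close> absorb their signs.\<close>

lemma ratio_is_unitri:
  fixes b0 :: "nat \<Rightarrow> real^'n"
  assumes c: "compatible b0 E F" and EF: "E \<in> flags" "F \<in> flags" and j: "Suc j < CARD('n)"
    and u: "unitri b0 u j w" and w: "w > 0" and X: "X = flag_act u F"
    and b: "\<forall>i<CARD('n). t i \<noteq> 0 \<and> b i = t i *\<^sub>R b0 i"
  shows "ratio_is b E X j (\<bar>t (Suc j)\<bar> / \<bar>t j\<bar> * w)"
  unfolding ratio_is_def
proof (intro allI impI)
  fix n assume n: "hyperplane_normal E X j n"
  have tj: "t j \<noteq> 0" "b j = t j *\<^sub>R b0 j" "b (Suc j) = t (Suc j) *\<^sub>R b0 (Suc j)" using b j by auto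
  have "n \<bullet> b0 j \<noteq> 0" "n \<bullet> b0 (Suc j) = - w * (n \<bullet> b0 j)"
    using hyperplane_normal_coefficient[OF c EF j, of u w n] u n unfolding X unitri_def by blast+
  then show "n \<bullet> b j \<noteq> 0 \<and> \<bar>n \<bullet> b (Suc j)\<bar> = \<bar>t (Suc j)\<bar> / \<bar>t j\<bar> * w * \<bar>n \<bullet> b j\<bar>"
    using tj w by (simp add: abs_mult)
qed

lemma positive_pair:
  assumes "positive_tuple [E, F]"
  shows "E \<in> flags" "F \<in> flags" "\<exists>b. compatible b E F"
  using assms by (auto simp: positive_tuple_def)

lemma positive_triple:
  fixes E X F :: "'n::finite flag"
  assumes p: "positive_tuple [E, X, F]" and c: "compatible b E F" and j: "Suc j < CARD('n)"
  shows "\<exists>w>0. ratio_is b E X j w"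
proof -
  obtain b0 u where EXF: "E \<in> flags" "X \<in> flags" "F \<in> flags" and c0: "compatible b0 E F"
    and u: "u (1::nat) \<in> U_pos b0" and X: "X = flag_act (u 1) F"
    using p by (auto simp: positive_tuple_def Let_def numeral_3_eq_3 numeral_2_eq_2 upt_rec atLeastLessThanSuc)
  have ob: "ordered_basis b0" using c0 by (simp add: compatible_def)
  obtain w where w: "w > 0" "unitri b0 (u 1) j w" using U_pos_unitri[OF ob u j] by blast
  obtain t where t: "\<forall>i<CARD('n). t i \<noteq> 0 \<and> b i = t i *\<^sub>R b0 i"
    using compatible_scale[OF c0 c EXF(1,3)] by blast
  have "ratio_is b E X j (\<bar>t (Suc j)\<bar> / \<bar>t j\<bar> * w)"
    by (rule ratio_is_unitri[OF c0 EXF(1,3) j w(2,1) X t])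
  moreover have "\<bar>t (Suc j)\<bar> / \<bar>t j\<bar> * w > 0" using t j w by simp
  ultimately show ?thesis by blast
qed

lemma flag_act_mult: "flag_act A (flag_act B F) = flag_act (A ** B) F"
  by (simp add: flag_act_def image_image matrix_vector_mul_assoc)

text \<open>\<open>X'\<close> arises from \<open>F\<close> by one more unipotent factor than
  \<open>X\<close>, and this factor adds a positive number to the entry. So the flag nearer to
  \<open>E\<close> has the larger ratio.\<close>

lemma positive_quad:
  fixes E X F :: "'n::finite flag"
  assumes p: "positive_tuple [E, X', X, F]" and c: "compatible b E F" and j: "Suc j < CARD('n)"
  shows "\<exists>w w'. 0 < w \<and> w < w' \<and> ratio_is b E X j w \<and> ratio_is b E X' j w'"
proof -
  have un: "{Suc 0..<Suc (Suc (Suc 0))} = {Suc 0, Suc (Suc 0)}" by auto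
  obtain b0 u where EXF: "E \<in> flags" "X \<in> flags" "F \<in> flags" and c0: "compatible b0 E F"
    and u: "u (Suc 0) \<in> U_pos b0" "u (Suc (Suc 0)) \<in> U_pos b0"
    and X': "X' = flag_act (u (Suc (Suc 0))) (flag_act (u (Suc 0)) F)" and X: "X = flag_act (u (Suc (Suc 0))) F"
    using p by (auto simp: positive_tuple_def Let_def un)
  have ob: "ordered_basis b0" using c0 by (simp add: compatible_def)
  obtain w where w: "w > 0" "unitri b0 (u (Suc 0)) j w" using U_pos_unitri[OF ob u(1) j] by blast
  obtain w2 where w2: "w2 > 0" "unitri b0 (u (Suc (Suc 0))) j w2" using U_pos_unitri[OF ob u(2) j] by blast
  obtain t where t: "\<forall>i<CARD('n). t i \<noteq> 0 \<and> b i = t i *\<^sub>R b0 i"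
    using compatible_scale[OF c0 c EXF(1,3)] by blast
  have "ratio_is b E X j (\<bar>t (Suc j)\<bar> / \<bar>t j\<bar> * w2)"
    by (rule ratio_is_unitri[OF c0 EXF(1,3) j w2(2,1) X t])
  moreover have "ratio_is b E X' j (\<bar>t (Suc j)\<bar> / \<bar>t j\<bar> * (w2 + w))"
    by (rule ratio_is_unitri[OF c0 EXF(1,3) j unitri_mult[OF w2(2) w(2) j] _ _ t])
      (use w w2 X' in \<open>auto simp: flag_act_mult\<close>)
  moreover have "\<bar>t (Suc j)\<bar> / \<bar>t j\<bar> > 0" using t j by simp
  then have "0 < \<bar>t (Suc j)\<bar> / \<bar>t j\<bar> * w2" "\<bar>t (Suc j)\<bar> / \<bar>t j\<bar> * w2 < \<bar>t (Suc j)\<bar> / \<bar>t j\<bar> * (w2 + w)"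
    using w w2 by (intro mult_pos_pos mult_strict_left_mono; simp)+
  ultimately show ?thesis by blast
qed

lemma compatible_act:
  fixes A :: "real^'n^'n"
  assumes A: "A' ** A = mat 1" and c: "compatible b E F"
  shows "compatible (\<lambda>i. A *v b i) (flag_act A E) (flag_act A F)"
proof -
  have inj: "A *v x = A *v y \<Longrightarrow> x = y" for x y
    by (metis A matrix_vector_mul_assoc matrix_vector_mul_lid)
  have "transverse (flag_act A E) (flag_act A F)"
  proof -
    have "flag_act A E i \<inter> flag_act A F (CARD('n) - i) = {0}" if "i \<le> CARD('n)" for i
    proof -
      have "E i \<inter> F (CARD('n) - i) = {0}" using c that by (simp add: compatible_def transverse_def)
      moreover have "flag_act A E i \<inter> flag_act A F (CARD('n) - i) = (\<lambda>v. A *v v) ` (E i \<inter> F (CARD('n) - i))"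
        unfolding flag_act_def using inj by blast
      ultimately show ?thesis by simp
    qed
    then show ?thesis by (simp add: transverse_def)
  qed
  moreover have "ordered_basis (\<lambda>i. A *v b i)"
    unfolding ordered_basis_iff
  proof (intro allI impI)
    fix e i assume s: "(\<Sum>i<CARD('n). e i *\<^sub>R (A *v b i)) = 0" and i: "i < CARD('n)"
    have "A *v (\<Sum>i<CARD('n). e i *\<^sub>R b i) = A *v 0"
      using s by (simp add: linear_sum[OF matrix_vector_mul_linear] matrix_vector_mult_scaleR)
    then have "(\<Sum>i<CARD('n). e i *\<^sub>R b i) = 0" by (rule inj)
    then show "e i = 0" using ordered_basis_zero[of b e] c i by (simp add: compatible_def)
  qed
  ultimately show ?thesis using c by (auto simp: compatible_def flag_act_def)
qed

lemma hyperplane_normal_act: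
  fixes A :: "real^'n^'n"
  assumes A: "A' ** A = mat 1" and n: "hyperplane_normal E X j n"
  shows "hyperplane_normal (flag_act A E) (flag_act A X) j (n v* A')" "(n v* A') \<bullet> (A *v x) = n \<bullet> x"
proof -
  show eq: "(n v* A') \<bullet> (A *v x) = n \<bullet> x" for x
    by (simp add: dot_lmul_matrix matrix_vector_mul_assoc A)
  have "n v* A' \<noteq> 0"
  proof
    assume "n v* A' = 0"
    then have "n \<bullet> n = 0" using eq[of n] by simp
    then show False using n by (simp add: hyperplane_normal_def)
  qed
  then show "hyperplane_normal (flag_act A E) (flag_act A X) j (n v* A')"
    using n eq by (auto simp: hyperplane_normal_def flag_act_def)
qed

section \<open>Ordered bases as matrices and the flag topology\<close>

definition nidx :: "'n::finite \<Rightarrow> nat" where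
  "nidx = (SOME h. bij_betw h UNIV {..<CARD('n)})"

lemma bij_nidx: "bij_betw (nidx :: 'n::finite \<Rightarrow> nat) UNIV {..<CARD('n)}"
  unfolding nidx_def
proof (rule someI_ex[where P = "\<lambda>h. bij_betw h (UNIV :: 'n set) {..<CARD('n)}"])
  show "\<exists>h. bij_betw h (UNIV :: 'n set) {..<CARD('n)}"
    using ex_bij_betw_finite_nat[of "UNIV :: 'n set"] by (simp add: atLeast0LessThan)
qed

lemma nidx_less [simp]: "nidx (i :: 'n::finite) < CARD('n)"
  using bij_betwE[OF bij_nidx] by auto

definition colmat :: "(nat \<Rightarrow> real^'n) \<Rightarrow> real^'n^'n" where
  "colmat b = (\<chi> i j. b (nidx j) $ i)"

lemma colmat_mult: "colmat b *v x = (\<Sum>j\<in>UNIV. x $ j *\<^sub>R b (nidx j))"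
  by (simp add: colmat_def matrix_vector_mult_def vec_eq_iff mult.commute)

lemma colmat_sum:
  fixes b :: "nat \<Rightarrow> real^'n"
  shows "colmat b *v (\<chi> j. c (nidx j)) = (\<Sum>i<CARD('n). c i *\<^sub>R b i)"
  unfolding colmat_mult using sum.reindex_bij_betw[OF bij_nidx, of "\<lambda>i. c i *\<^sub>R b i"] by simp

lemma colmat_invertible:
  fixes b :: "nat \<Rightarrow> real^'n"
  shows "ordered_basis b \<longleftrightarrow> det (colmat b) \<noteq> 0"
proof -
  define i' :: "nat \<Rightarrow> 'n" where "i' = the_inv_into UNIV nidx"
  have i': "nidx (i' k) = k" if "k < CARD('n)" for k
    unfolding i'_def using that bij_nidx by (intro f_the_inv_into_f_bij_betw) auto
  have i'': "i' (nidx j) = j" for j unfolding i'_def using bij_nidx the_inv_into_f_f by (metis UNIV_I bij_betw_def)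
  have "det (colmat b) \<noteq> 0 \<longleftrightarrow> (\<forall>x. colmat b *v x = 0 \<longrightarrow> x = 0)"
    by (metis invertible_det_nz invertible_left_inverse matrix_left_invertible_ker)
  also have "\<dots> \<longleftrightarrow> ordered_basis b"
    unfolding ordered_basis_iff
  proof (intro iffI allI impI)
    fix c k assume h: "\<forall>x. colmat b *v x = 0 \<longrightarrow> x = 0" and s: "(\<Sum>i<CARD('n). c i *\<^sub>R b i) = 0" and k: "k < CARD('n)"
    have "(\<chi> j. c (nidx j)) = (0 :: real^'n)" using h colmat_sum[of b c] s by simp
    then have "c (nidx (i' k)) = 0" by (simp add: vec_eq_iff)
    then show "c k = 0" using i'[OF k] by simp
  next
    fix x assume h: "\<forall>c. (\<Sum>i<CARD('n). c i *\<^sub>R b i) = 0 \<longrightarrow> (\<forall>i<CARD('n). c i = 0)" and s: "colmat b *v x = 0"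
    have "(\<chi> j. x $ i' (nidx j)) = x" by (simp add: i'' vec_eq_iff)
    then have "(\<Sum>i<CARD('n). x $ i' i *\<^sub>R b i) = 0" using colmat_sum[of b "\<lambda>i. x $ i' i"] s by simp
    then have "x $ i' (nidx j) = 0" for j :: 'n using h[rule_format, of "\<lambda>i. x $ i' i" "nidx j"] by simp
    then show "x = 0" by (simp add: i'' vec_eq_iff)
  qed
  finally show ?thesis by simp
qed

text \<open>Cramer's rule: the coordinates of \<open>v\<close> beyond the first \<open>k\<close>
  vanish. The determinants are polynomial in \<open>b\<close> and \<open>v\<close>, so membership is
  a closed condition on both together.\<close>

lemma flag_of_basis_iff:
  fixes b :: "nat \<Rightarrow> real^'n"
  assumes b: "ordered_basis b"
  shows "v \<in> flag_of_basis b k \<longleftrightarrow> (\<forall>i. k \<le> nidx i \<longrightarrow> det ((\<chi> a j. if j = i then v $ a else colmat b $ a $ j) :: real^'n^'n) = 0)"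
proof -
  define D where "D i = det ((\<chi> a j. if j = i then v $ a else colmat b $ a $ j) :: real^'n^'n)" for i
  have d: "det (colmat b) \<noteq> 0" using b by (simp add: colmat_invertible)
  have cr: "colmat b *v x = v \<longleftrightarrow> x = (\<chi> i. D i / det (colmat b))" for x
    using cramer[OF d, of x v] by (simp add: D_def)
  let ?x = "(\<chi> i. D i / det (colmat b)) :: real^'n"
  have vx: "colmat b *v ?x = v" using cr by blast
  show ?thesis unfolding D_def[symmetric]
  proof
    assume "v \<in> flag_of_basis b k"
    then obtain c where c: "v = (\<Sum>i<min k CARD('n). c i *\<^sub>R b i)"
      using span_family_subset[of "{..<min k CARD('n)}" v b] by (auto simp: flag_of_basis_def)
    define c' where "c' i = (if i < k then c i else 0)" for i
    have "(\<Sum>i<CARD('n). c' i *\<^sub>R b i) = v" unfolding c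
      by (rule sum.mono_neutral_cong_right) (auto simp: c'_def)
    then have "colmat b *v (\<chi> j. c' (nidx j)) = v" by (simp add: colmat_sum)
    then have eq: "(\<chi> j. c' (nidx j)) = ?x" using cr by blast
    show "\<forall>i. k \<le> nidx i \<longrightarrow> D i = 0"
    proof (intro allI impI)
      fix i :: 'n assume "k \<le> nidx i"
      then have "?x $ i = 0" using eq[symmetric] by (simp add: c'_def)
      then show "D i = 0" using d by simp
    qed
  next
    assume h: "\<forall>i. k \<le> nidx i \<longrightarrow> D i = 0"
    have "v = (\<Sum>j\<in>UNIV. ?x $ j *\<^sub>R b (nidx j))" using vx unfolding colmat_mult by simp
    also have "\<dots> \<in> span (b ` {..<min k CARD('n)})"
    proof (rule span_sum)
      fix j :: 'n
      show "?x $ j *\<^sub>R b (nidx j) \<in> span (b ` {..<min k CARD('n)})"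
      proof (cases "k \<le> nidx j")
        case True
        then show ?thesis using h by (simp add: span_zero)
      next
        case False
        then show ?thesis by (intro span_scale span_base) auto
      qed
    qed
    finally show "v \<in> flag_of_basis b k" by (simp add: flag_of_basis_def)
  qed
qed

lemma continuous_on_det:
  fixes f :: "'a::topological_space \<Rightarrow> real^'n^'n"
  assumes "\<And>i j. continuous_on S (\<lambda>x. f x $ i $ j)"
  shows "continuous_on S (\<lambda>x. det (f x))"
  unfolding det_def
  by (intro continuous_on_sum continuous_on_mult continuous_on_const continuous_on_prod assms)

text \<open>If \<open>v\<close> were not in the limit space, the flags whose \<open>k\<close>-th
  member avoids a small closed ball around \<open>v\<close> would form a neighbourhood of
  \<open>\<xi> y\<close> containing no \<open>\<xi> (x m)\<close> for large \<open>m\<close>. It is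
  open in the quotient topology since avoiding a compact ball is an open condition on the basis
  (\<open>O1_iff\<close>, a tube lemma) and depends on the flag alone
  (\<open>W_iff\<close>).\<close>

lemma flag_map_closed_graph:
  fixes \<xi> :: "complex \<Rightarrow> 'n::finite flag"
  assumes cont: "continuous_map (top_of_set \<Lambda>) flag_topology \<xi>"
    and x: "\<And>m. x m \<in> \<Lambda>" "y \<in> \<Lambda>" "x \<longlonglongrightarrow> y"
    and w: "\<And>m. w m \<in> \<xi> (x m) k" "w \<longlonglongrightarrow> v"
  shows "v \<in> \<xi> y k"
proof (rule ccontr)
  assume nv: "v \<notin> \<xi> y k"
  define bases where "bases = {b :: nat \<Rightarrow> real^'n. ordered_basis b}"
  have tsp: "\<xi> z \<in> flag_of_basis ` bases" if "z \<in> \<Lambda>" for z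
  proof -
    have "\<xi> z \<in> topspace flag_topology" using cont that by (auto simp: continuous_map_def)
    then obtain U where "openin flag_topology U" "\<xi> z \<in> U" by (meson openin_topspace)
    then show ?thesis by (auto simp: flag_topology_def openin_quotient_topology bases_def)
  qed
  obtain b where b: "b \<in> bases" "\<xi> y = flag_of_basis b" using tsp[OF x(2)] by blast
  define C where "C = {p :: (real^'n^'n) \<times> (real^'n). \<forall>i. k \<le> nidx i \<longrightarrow>
      det ((\<chi> a j. if j = i then snd p $ a else fst p $ a $ j) :: real^'n^'n) = 0}"
  have mem: "u \<in> flag_of_basis b' k \<longleftrightarrow> (colmat b', u) \<in> C" if "b' \<in> bases" for b' u
    using flag_of_basis_iff[of b' u k] that by (simp add: C_def bases_def cong: if_cong)
  have "C = (\<Inter>i\<in>{i. k \<le> nidx i}. {p. det ((\<chi> a j. if j = i then snd p $ a else fst p $ a $ j) :: real^'n^'n) = 0})"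
    by (auto simp: C_def)
  moreover have "closed {p :: (real^'n^'n) \<times> (real^'n). det ((\<chi> a j. if j = i then snd p $ a else fst p $ a $ j) :: real^'n^'n) = 0}" for i
  proof (intro closed_Collect_eq continuous_on_det continuous_on_const)
    fix a j
    show "continuous_on UNIV (\<lambda>p :: (real^'n^'n) \<times> (real^'n). (\<chi> a j. if j = i then snd p $ a else fst p $ a $ j) $ a $ j)"
      by (cases "j = i") (simp_all add: continuous_intros)
  qed
  ultimately have clC: "closed C" by auto
  have "(colmat b, v) \<notin> C" using mem[OF b(1)] nv b(2) by simp
  then obtain e where e: "e > 0" "ball (colmat b, v) e \<subseteq> - C" using clC by (meson ComplI open_Compl openE)
  define r where "r = e / 2"
  have r: "r > 0" using e by (simp add: r_def)
  have avoid: "(P, u) \<notin> C" if "dist (colmat b) P < r" "dist v u < r" for P u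
  proof -
    have "dist (colmat b, v) (P, u) \<le> dist (colmat b) P + dist v u"
      unfolding dist_prod_def by (simp add: sqrt_sum_squares_le_sum)
    also have "\<dots> < e" using that by (simp add: r_def)
    finally show ?thesis using e(2) by auto
  qed
  \<comment> \<open>Openness is built in by the radius \<open>d\<close>; compactness of the ball
    then removes the radius in \<open>O1_iff\<close>.\<close>
  define O1 where "O1 = {P :: real^'n^'n. \<exists>d>0. \<forall>P'. dist P P' < d \<longrightarrow> (\<forall>u\<in>cball v (r / 2). (P', u) \<notin> C)}"
  have O1: "open O1"
    unfolding open_dist
  proof
    fix P assume "P \<in> O1"
    then obtain d where d: "d > 0" "\<And>P'. dist P P' < d \<Longrightarrow> (\<forall>u\<in>cball v (r / 2). (P', u) \<notin> C)" by (auto simp: O1_def)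
    have "Q \<in> O1" if "dist Q P < d / 2" for Q
      unfolding O1_def
    proof (intro CollectI exI[of _ "d / 2"] conjI allI impI)
      fix P' assume "dist Q P' < d / 2"
      then have "dist P P' < d" using that dist_triangle[of P P' Q] by (simp add: dist_commute)
      then show "\<forall>u\<in>cball v (r / 2). (P', u) \<notin> C" by (rule d(2))
    qed (use d in auto)
    then show "\<exists>e>0. \<forall>Q. dist Q P < e \<longrightarrow> Q \<in> O1" using d(1) by (intro exI[of _ "d / 2"]) auto
  qed
  have bO1: "colmat b \<in> O1" unfolding O1_def
    using r avoid by (intro CollectI exI[of _ r]) (auto simp: dist_commute)
  define W where "W = flag_of_basis ` {b' \<in> bases. \<forall>u\<in>cball v (r / 2). (colmat b', u) \<notin> C}"
  have W_iff: "flag_of_basis b' \<in> W \<longleftrightarrow> (\<forall>u\<in>cball v (r / 2). (colmat b', u) \<notin> C)" if b': "b' \<in> bases" for b'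
  proof
    assume "flag_of_basis b' \<in> W"
    then obtain b'' where "b'' \<in> bases" "flag_of_basis b' = flag_of_basis b''" "\<forall>u\<in>cball v (r / 2). (colmat b'', u) \<notin> C"
      by (auto simp: W_def)
    then show "\<forall>u\<in>cball v (r / 2). (colmat b', u) \<notin> C" using mem[OF b'] mem by metis
  next
    assume "\<forall>u\<in>cball v (r / 2). (colmat b', u) \<notin> C"
    then show "flag_of_basis b' \<in> W" using b' by (auto simp: W_def)
  qed
  have "compact (cball v (r / 2))" by simp
  have O1_iff: "P \<in> O1 \<longleftrightarrow> (\<forall>u\<in>cball v (r / 2). (P, u) \<notin> C)" for P
  proof
    assume "P \<in> O1"
    then show "\<forall>u\<in>cball v (r / 2). (P, u) \<notin> C" by (auto simp: O1_def)
  next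
    assume h: "\<forall>u\<in>cball v (r / 2). (P, u) \<notin> C"
    show "P \<in> O1"
    proof (rule ccontr)
      assume "P \<notin> O1"
      then have h2: "\<And>d. d > 0 \<Longrightarrow> \<exists>P'. dist P P' < d \<and> (\<exists>u\<in>cball v (r / 2). (P', u) \<in> C)"
        unfolding O1_def by blast
      have "\<exists>P' u. dist P P' < inverse (real (Suc m)) \<and> u \<in> cball v (r / 2) \<and> (P', u) \<in> C" for m
      proof -
        have "inverse (real (Suc m)) > 0" by simp
        from h2[OF this] show ?thesis by blast
      qed
      then obtain Q u where Q: "\<And>m. dist P (Q m) < inverse (real (Suc m))" "\<And>m. u m \<in> cball v (r / 2)" "\<And>m. (Q m, u m) \<in> C"
        by metis
      have "seq_compact (cball v (r / 2))" by (simp add: compact_imp_seq_compact)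
      from this[unfolded seq_compact_def, rule_format, of u] Q(2)
      obtain u0 s where u0: "u0 \<in> cball v (r / 2)" "strict_mono s" "(u \<circ> s) \<longlonglongrightarrow> u0"
        by blast
      have "(\<lambda>m. dist (Q m) P) \<longlonglongrightarrow> 0"
        by (rule tendsto_sandwich[OF _ _ tendsto_const LIMSEQ_inverse_real_of_nat])
          (use Q(1) in \<open>auto simp: dist_commute less_imp_le intro!: always_eventually\<close>)
      then have "Q \<longlonglongrightarrow> P" by (subst tendsto_dist_iff)
      then have "(Q \<circ> s) \<longlonglongrightarrow> P" by (rule LIMSEQ_subseq_LIMSEQ[OF _ u0(2)])
      then have "(\<lambda>m. ((Q \<circ> s) m, (u \<circ> s) m)) \<longlonglongrightarrow> (P, u0)" using u0(3) by (rule tendsto_Pair)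
      then have "(P, u0) \<in> C" using Q(3) closed_sequentially[OF clC, of "\<lambda>m. ((Q \<circ> s) m, (u \<circ> s) m)" "(P, u0)"] by simp
      then show False using h u0(1) by blast
    qed
  qed
  have "continuous_on UNIV (\<lambda>b' :: nat \<Rightarrow> real^'n. b' (nidx j) $ i)" for i and j :: 'n
    by (rule continuous_on_component[OF continuous_on_product_coordinates])
  then have "continuous_on UNIV (\<lambda>b'. colmat b' :: real^'n^'n)"
    unfolding colmat_def by (intro continuous_on_vec_lambda) blast
  then have "open ((\<lambda>b'. colmat b') -` O1)" using O1 by (rule open_vimage[rotated])
  moreover have "{b' \<in> bases. flag_of_basis b' \<in> W} = bases \<inter> ((\<lambda>b'. colmat b') -` O1)"
    using W_iff O1_iff by auto
  ultimately have "openin (top_of_set bases) {b' \<in> bases. flag_of_basis b' \<in> W}" by (simp add: openin_open_Int)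
  then have "openin flag_topology W"
    unfolding flag_topology_def openin_quotient_topology by (auto simp: W_def bases_def)
  then have "openin (top_of_set \<Lambda>) {z \<in> \<Lambda>. \<xi> z \<in> W}" using cont by (simp add: continuous_map_def)
  then obtain T where T: "open T" "{z \<in> \<Lambda>. \<xi> z \<in> W} = \<Lambda> \<inter> T" by (auto simp: openin_open)
  have "\<xi> y \<in> W" using W_iff[OF b(1)] O1_iff bO1 b(2) by simp
  then have "y \<in> T" using T(2) x(2) by blast
  then have "\<forall>\<^sub>F m in sequentially. x m \<in> T" using x(3) T(1) by (simp add: topological_tendstoD)
  moreover have "\<forall>\<^sub>F m in sequentially. dist (w m) v < r / 2" using w(2) r by (intro tendstoD) auto
  ultimately have "\<forall>\<^sub>F m in sequentially. x m \<in> T \<and> dist (w m) v < r / 2" by (rule eventually_conj)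
  then obtain m where m: "x m \<in> T" "dist (w m) v < r / 2" by (auto simp: eventually_sequentially)
  then have "\<xi> (x m) \<in> W" using T(2) x(1) by blast
  obtain b' where b': "b' \<in> bases" "\<xi> (x m) = flag_of_basis b'" using tsp[OF x(1)] by blast
  then have "(colmat b', w m) \<notin> C" using \<open>\<xi> (x m) \<in> W\<close> W_iff[OF b'(1)] m(2) by (auto simp: dist_commute)
  then show False using mem[OF b'(1), of "w m"] w(1)[of m] b'(2) by simp
qed

subsection \<open>Positive curves of flags\<close>

text \<open>The limit curve in homogeneous coordinates, with \<open>L\<close> as the cone over the
  limit set. The sign condition on all pairs confines the representatives to a half plane, where the
  cyclic order is a linear order given by \<open>det2\<close>. \<open>closed_graph\<close> is
  continuity in the form that limits of bases and normals call for.\<close>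

locale flag_curve =
  fixes L :: "(real^2) set" and \<zeta> :: "real^2 \<Rightarrow> 'n::finite flag"
  assumes L_nz: "0 \<notin> L"
    and L_scale: "v \<in> L \<Longrightarrow> c \<noteq> 0 \<Longrightarrow> c *\<^sub>R v \<in> L \<and> \<zeta> (c *\<^sub>R v) = \<zeta> v"
    and L_closed: "(\<And>m. x m \<in> L) \<Longrightarrow> x \<longlonglongrightarrow> y \<Longrightarrow> y \<noteq> 0 \<Longrightarrow> y \<in> L"
    and closed_graph: "(\<And>m. x m \<in> L) \<Longrightarrow> y \<in> L \<Longrightarrow> x \<longlonglongrightarrow> y \<Longrightarrow> (\<And>m. z m \<in> \<zeta> (x m) k) \<Longrightarrow> z \<longlonglongrightarrow> u \<Longrightarrow> u \<in> \<zeta> y k"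
    and positive: "length vs \<ge> 2 \<Longrightarrow> set vs \<subseteq> L \<Longrightarrow> sorted_wrt (\<lambda>v w. det2 v w < 0) vs \<Longrightarrow> positive_tuple (map \<zeta> vs)"
begin

lemma pair:
  assumes "a \<in> L" "b \<in> L" "det2 a b \<noteq> 0"
  shows "\<zeta> a \<in> flags" "\<zeta> b \<in> flags" "\<exists>\<beta>. compatible \<beta> (\<zeta> a) (\<zeta> b)"
proof -
  define s :: real where "s = (if det2 a b < 0 then 1 else - 1)"
  have "sorted_wrt (\<lambda>v w. det2 v w < 0) [a, s *\<^sub>R b]" using assms(3) by (simp add: s_def)
  moreover have "s \<noteq> 0" by (simp add: s_def)
  then have sb: "s *\<^sub>R b \<in> L" "\<zeta> (s *\<^sub>R b) = \<zeta> b" using L_scale[OF assms(2)] by auto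
  ultimately have "positive_tuple (map \<zeta> [a, s *\<^sub>R b])" using assms(1) by (intro positive) auto
  then have "positive_tuple [\<zeta> a, \<zeta> b]" using sb by simp
  then show "\<zeta> a \<in> flags" "\<zeta> b \<in> flags" "\<exists>\<beta>. compatible \<beta> (\<zeta> a) (\<zeta> b)" using positive_pair by auto
qed

lemma triple:
  assumes "a \<in> L" "x \<in> L" "b \<in> L" "det2 a x < 0" "det2 a b < 0" "det2 x b < 0"
  shows "positive_tuple [\<zeta> a, \<zeta> x, \<zeta> b]"
  using positive[of "[a, x, b]"] assms by simp

lemma quad:
  assumes "a \<in> L" "x' \<in> L" "x \<in> L" "b \<in> L" "det2 a x' < 0" "det2 a x < 0" "det2 a b < 0" "det2 x' x < 0" "det2 x' b < 0" "det2 x b < 0"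
  shows "positive_tuple [\<zeta> a, \<zeta> x', \<zeta> x, \<zeta> b]"
  using positive[of "[a, x', x, b]"] assms by simp

lemma unit_basis:
  assumes "a \<in> L" "b \<in> L" "det2 a b \<noteq> 0" "compatible \<beta> (\<zeta> a) (\<zeta> b)"
  shows "compatible (\<lambda>i. (1 / norm (\<beta> i)) *\<^sub>R \<beta> i) (\<zeta> a) (\<zeta> b)"
    and "i < CARD('n) \<Longrightarrow> norm ((1 / norm (\<beta> i)) *\<^sub>R \<beta> i) = 1"
proof -
  show "compatible (\<lambda>i. (1 / norm (\<beta> i)) *\<^sub>R \<beta> i) (\<zeta> a) (\<zeta> b)"
  proof (rule compatible_rescale(1)[OF assms(4) pair(1,2)[OF assms(1,2,3)]])
    fix j assume j: "j < CARD('n)"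
    have "subspace (\<zeta> a (Suc j))" "subspace (\<zeta> b (CARD('n) - j))"
      using flags_dim pair(1,2)[OF assms(1,2,3)] by blast+
    then show "(1 / norm (\<beta> j)) *\<^sub>R \<beta> j \<noteq> 0 \<and> (1 / norm (\<beta> j)) *\<^sub>R \<beta> j \<in> \<zeta> a (Suc j) \<and> (1 / norm (\<beta> j)) *\<^sub>R \<beta> j \<in> \<zeta> b (CARD('n) - j)"
      using compatible_nonzero[OF assms(4) j] by (simp add: subspace_scale)
  qed
  show "i < CARD('n) \<Longrightarrow> norm ((1 / norm (\<beta> i)) *\<^sub>R \<beta> i) = 1" using compatible_nonzero(1)[OF assms(4)] by simp
qed

text \<open>\<open>closed_graph\<close> puts each limit vector into the intersection of a member of
  each limit flag. These intersections are lines because the limit pair has a compatible basis, and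
  unit length keeps the limit vectors nonzero.\<close>

lemma basis_limit:
  assumes ab: "a \<in> L" "b \<in> L" "det2 a b \<noteq> 0"
    and conv: "\<And>m. A m \<in> L" "A \<longlonglongrightarrow> a" "\<And>m. B m \<in> L" "B \<longlonglongrightarrow> b"
    and \<beta>: "\<And>m. compatible (\<beta> m) (\<zeta> (A m)) (\<zeta> (B m))" "\<And>m i. i < CARD('n) \<Longrightarrow> norm (\<beta> m i) = 1"
    and \<beta>': "\<And>i. i < CARD('n) \<Longrightarrow> (\<lambda>m. \<beta> m i) \<longlonglongrightarrow> \<beta>' i"
  shows "compatible \<beta>' (\<zeta> a) (\<zeta> b)"
proof -
  obtain \<beta>0 where \<beta>0: "compatible \<beta>0 (\<zeta> a) (\<zeta> b)" using pair(3)[OF ab] by blast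
  show ?thesis
  proof (rule compatible_rescale(1)[OF \<beta>0 pair(1,2)[OF ab]])
    fix j assume j: "j < CARD('n)"
    have "(\<lambda>m. norm (\<beta> m j)) \<longlonglongrightarrow> norm (\<beta>' j)" by (intro tendsto_norm \<beta>' j)
    then have "norm (\<beta>' j) = 1" using \<beta>(2)[OF j] LIMSEQ_unique[OF _ tendsto_const] by simp
    then have "\<beta>' j \<noteq> 0" by auto
    moreover have "\<beta>' j \<in> \<zeta> a (Suc j)"
      by (rule closed_graph[OF conv(1) ab(1) conv(2) _ \<beta>'[OF j]]) (use compatible_nonzero[OF \<beta>(1) j] in blast)
    moreover have "\<beta>' j \<in> \<zeta> b (CARD('n) - j)"
      by (rule closed_graph[OF conv(3) ab(2) conv(4) _ \<beta>'[OF j]]) (use compatible_nonzero[OF \<beta>(1) j] in blast)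
    ultimately show "\<beta>' j \<noteq> 0 \<and> \<beta>' j \<in> \<zeta> a (Suc j) \<and> \<beta>' j \<in> \<zeta> b (CARD('n) - j)" by blast
  qed
qed

lemma colmat_nidx: "colmat \<beta> $ i $ j = \<beta> (nidx j) $ i"
  by (simp add: colmat_def)

lemma nidx_surj: "i < CARD('n) \<Longrightarrow> \<exists>j :: 'n. nidx j = i"
  using bij_nidx[where 'n = 'n] unfolding bij_betw_def by (metis imageE lessThan_iff)

lemma norm_colmat_le:
  assumes "\<And>i. i < CARD('n) \<Longrightarrow> norm (\<beta> i :: real^'n) = 1"
  shows "norm (colmat \<beta>) \<le> real CARD('n) * real CARD('n)"
proof -
  have "norm (colmat \<beta>) \<le> (\<Sum>i\<in>UNIV. norm (colmat \<beta> $ i))" 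
    unfolding norm_vec_def[of "colmat \<beta>"] by (rule L2_set_le_sum) simp
  also have "\<dots> \<le> (\<Sum>i\<in>(UNIV :: 'n set). real CARD('n))"
  proof (rule sum_mono)
    fix i :: 'n
    have "norm (colmat \<beta> $ i) \<le> (\<Sum>j\<in>UNIV. \<bar>colmat \<beta> $ i $ j\<bar>)" by (rule norm_le_l1_cart)
    also have "\<dots> \<le> (\<Sum>j\<in>(UNIV :: 'n set). 1)"
    proof (rule sum_mono)
      fix j :: 'n
      show "\<bar>colmat \<beta> $ i $ j\<bar> \<le> 1" unfolding colmat_nidx using component_le_norm_cart[of "\<beta> (nidx j)" i] assms[of "nidx j"] by simp
    qed
    finally show "norm (colmat \<beta> $ i) \<le> real CARD('n)" by simp
  qed
  finally show ?thesis by simp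
qed

lemma column_limit:
  assumes "(\<lambda>m. colmat (\<beta> m)) \<longlonglongrightarrow> P" "i < CARD('n)"
  shows "(\<lambda>m. \<beta> m i :: real^'n) \<longlonglongrightarrow> (\<chi> k. P $ k $ (inv_into UNIV nidx i))"
proof -
  have n: "nidx (inv_into UNIV nidx i :: 'n) = i" using nidx_surj[OF assms(2)] by (intro f_inv_into_f) auto
  have "(\<lambda>m. colmat (\<beta> m) $ k $ (inv_into UNIV nidx i)) \<longlonglongrightarrow> P $ k $ (inv_into UNIV nidx i)" for k
    by (intro tendsto_vec_nth assms(1))
  then have "(\<lambda>m. \<beta> m i $ k) \<longlonglongrightarrow> P $ k $ (inv_into UNIV nidx i)" for k
    by (simp add: colmat_nidx n)
  then show ?thesis by (intro vec_tendstoI) simp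
qed

lemma normalize_pair:
  assumes "a \<in> L" "b \<in> L" "norm a * norm b \<le> K * \<bar>det2 a b\<bar>"
  defines "a' \<equiv> (1 / norm a) *\<^sub>R a" and "b' \<equiv> (1 / norm b) *\<^sub>R b"
  shows "a' \<in> L" "b' \<in> L" "\<zeta> a' = \<zeta> a" "\<zeta> b' = \<zeta> b" "norm a' = 1" "norm b' = 1" "1 \<le> K * \<bar>det2 a' b'\<bar>"
proof -
  have nz: "norm a > 0" "norm b > 0" using assms(1,2) L_nz by auto
  then show "a' \<in> L" "b' \<in> L" "\<zeta> a' = \<zeta> a" "\<zeta> b' = \<zeta> b" "norm a' = 1" "norm b' = 1"
    using L_scale[OF assms(1), of "1 / norm a"] L_scale[OF assms(2), of "1 / norm b"]
    by (auto simp: a'_def b'_def)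
  have "K * \<bar>det2 a' b'\<bar> = K * \<bar>det2 a b\<bar> / (norm a * norm b)" using nz by (simp add: a'_def b'_def abs_mult)
  then show "1 \<le> K * \<bar>det2 a' b'\<bar>" using nz assms(3) by simp
qed

text \<open>After scaling, the admissible pairs form a compact set, as
  \<open>\<bar>det2 a b\<bar>\<close> stays away from 0. If the constants had to grow along a
  sequence, unit compatible bases would converge to a compatible basis of the limit pair; its matrix
  is invertible, and near an invertible matrix the distortion is bounded.\<close>

theorem bounded_basis:
  "\<exists>C\<ge>1. \<forall>a\<in>L. \<forall>b\<in>L. norm a * norm b \<le> K * \<bar>det2 a b\<bar> \<longrightarrow>
     (\<exists>\<beta>. compatible \<beta> (\<zeta> a) (\<zeta> b) \<and> bilip C (colmat \<beta>))"
proof (rule ccontr)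
  assume "\<not> ?thesis"
  then have "\<exists>a b. a \<in> L \<and> b \<in> L \<and> norm a * norm b \<le> K * \<bar>det2 a b\<bar> \<and>
     (\<forall>\<beta>. compatible \<beta> (\<zeta> a) (\<zeta> b) \<longrightarrow> \<not> bilip (real (Suc m)) (colmat \<beta>))" for m
    by (metis le_add1 of_nat_1 of_nat_le_iff plus_1_eq_Suc)
  then obtain A0 B0 where AB0: "\<And>m. A0 m \<in> L" "\<And>m. B0 m \<in> L" "\<And>m. norm (A0 m) * norm (B0 m) \<le> K * \<bar>det2 (A0 m) (B0 m)\<bar>"
    "\<And>m \<beta>. compatible \<beta> (\<zeta> (A0 m)) (\<zeta> (B0 m)) \<Longrightarrow> \<not> bilip (real (Suc m)) (colmat \<beta>)" by metis
  define A where "A m = (1 / norm (A0 m)) *\<^sub>R A0 m" for m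
  define B where "B m = (1 / norm (B0 m)) *\<^sub>R B0 m" for m
  note N = normalize_pair[OF AB0(1,2,3), folded A_def B_def]
  have "\<exists>\<beta>. compatible \<beta> (\<zeta> (A m)) (\<zeta> (B m)) \<and> (\<forall>i<CARD('n). norm (\<beta> i) = 1)" for m
  proof -
    have d: "det2 (A m) (B m) \<noteq> 0" using N(7)[of m] by auto
    obtain \<beta> where "compatible \<beta> (\<zeta> (A m)) (\<zeta> (B m))" using pair(3)[OF N(1,2) d] by blast
    then show ?thesis using unit_basis[OF N(1,2) d] by blast
  qed
  then obtain \<beta> where \<beta>: "\<And>m. compatible (\<beta> m) (\<zeta> (A m)) (\<zeta> (B m))" "\<And>m i. i < CARD('n) \<Longrightarrow> norm (\<beta> m i) = 1"
    by metis
  define T where "T = cball (0::real^2) 1 \<times> cball (0::real^2) 1 \<times> cball (0 :: real^'n^'n) (real CARD('n) * real CARD('n))"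
  have "compact T" unfolding T_def by (intro compact_Times compact_cball)
  then have sT: "seq_compact T" by (rule compact_imp_seq_compact)
  have "\<forall>m. (A m, B m, colmat (\<beta> m)) \<in> T"
    using N(5,6) norm_colmat_le[OF \<beta>(2)] by (auto simp: T_def)
  from sT[unfolded seq_compact_def, rule_format, of "\<lambda>m. (A m, B m, colmat (\<beta> m))"] this
  obtain l s where s: "strict_mono s" and lim: "((\<lambda>m. (A m, B m, colmat (\<beta> m))) \<circ> s) \<longlonglongrightarrow> l" by blast
  obtain a b P where l: "l = (a, b, P)" by (metis prod_cases3)
  have lims: "(\<lambda>m. A (s m)) \<longlonglongrightarrow> a" "(\<lambda>m. B (s m)) \<longlonglongrightarrow> b" "(\<lambda>m. colmat (\<beta> (s m))) \<longlonglongrightarrow> P"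
    using tendsto_fst[OF lim] tendsto_fst[OF tendsto_snd[OF lim]] tendsto_snd[OF tendsto_snd[OF lim]] by (simp_all add: l o_def)
  have n: "norm a = 1" "norm b = 1"
    using LIMSEQ_unique[OF tendsto_norm[OF lims(1)], of 1] LIMSEQ_unique[OF tendsto_norm[OF lims(2)], of 1] N(5,6) by simp_all
  have "(\<lambda>m. K * \<bar>det2 (A (s m)) (B (s m))\<bar>) \<longlonglongrightarrow> K * \<bar>det2 a b\<bar>" by (intro tendsto_intros lims)
  then have "1 \<le> K * \<bar>det2 a b\<bar>" by (rule LIMSEQ_le_const) (use N(7) in blast)
  then have d: "det2 a b \<noteq> 0" by auto
  have ab: "a \<in> L" "b \<in> L"
    using L_closed[OF _ lims(1)] L_closed[OF _ lims(2)] N(1,2) n by force+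
  define \<beta>' where "\<beta>' i = (\<chi> k. P $ k $ (inv_into UNIV nidx i)) " for i
  have "compatible \<beta>' (\<zeta> a) (\<zeta> b)"
    by (rule basis_limit[OF ab d N(1) lims(1) N(2) lims(2) \<beta>]) (use column_limit[OF lims(3)] in \<open>auto simp: \<beta>'_def\<close>)
  moreover have "colmat \<beta>' = P"
  proof -
    have "inj (nidx :: 'n \<Rightarrow> nat)" using bij_nidx[where 'n = 'n] by (simp add: bij_betw_def)
    then show ?thesis by (simp add: vec_eq_iff colmat_nidx \<beta>'_def)
  qed
  ultimately have "det P \<noteq> 0" using colmat_invertible[of \<beta>'] by (simp add: compatible_def)
  then obtain Q where "P ** Q = mat 1" by (metis invertible_det_nz invertible_right_inverse)
  then obtain C where C: "C \<ge> 1" "bilip C P" using invertible_bilip by blast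
  \<comment> \<open>A perturbation of norm at most \<open>1 / (2 * C)\<close> leaves half of the
    lower bound \<open>norm x / C\<close>, whence the constant \<open>2 * C\<close>.\<close>
  have "\<forall>\<^sub>F m in sequentially. dist (colmat (\<beta> (s m))) P < 1 / (2 * C)" using lims(3) C by (intro tendstoD) auto
  moreover have "\<forall>\<^sub>F m in sequentially. 2 * C \<le> real m" 
    using filterlim_real_sequentially unfolding filterlim_at_top by blast
  ultimately have "\<forall>\<^sub>F m in sequentially. dist (colmat (\<beta> (s m))) P < 1 / (2 * C) \<and> 2 * C \<le> real m" by (rule eventually_conj)
  then obtain m where m: "norm (colmat (\<beta> (s m)) - P) \<le> 1 / (2 * C)" "2 * C \<le> real m"
    by (auto simp: eventually_sequentially dist_norm intro: less_imp_le)
  have "bilip (2 * C) (colmat (\<beta> (s m)))"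
    unfolding bilip_def
  proof (intro allI)
    fix x
    let ?M = "colmat (\<beta> (s m))"
    have Mx: "?M *v x = P *v x + (?M - P) *v x" by (simp add: matrix_vector_mult_diff_rdistrib)
    have e: "norm ((?M - P) *v x) \<le> norm x / (2 * C)"
      using norm_matrix_vector_le[of "?M - P" x] mult_right_mono[OF m(1), of "norm x"] by simp
    have P: "norm x \<le> C * norm (P *v x)" "norm (P *v x) \<le> C * norm x" using C(2) by (auto simp: bilip_def)
    have c1: "norm x / C \<le> norm (P *v x)" using P(1) C(1) by (simp add: divide_le_eq mult.commute)
    have "norm (P *v x) \<le> norm (?M *v x) + norm ((?M - P) *v x)"
      unfolding Mx using norm_triangle_ineq4[of "P *v x + (?M - P) *v x" "(?M - P) *v x"] by simp
    then have "norm x / C - norm x / (2 * C) \<le> norm (?M *v x)" using e c1 by linarith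
    moreover have "norm x / C - norm x / (2 * C) = norm x / (2 * C)" using C(1) by (simp add: field_simps)
    ultimately have 1: "norm x \<le> 2 * C * norm (?M *v x)" using C(1) by (simp add: divide_le_eq mult.commute)
    have "norm (?M *v x) \<le> norm (P *v x) + norm ((?M - P) *v x)" unfolding Mx by (rule norm_triangle_ineq)
    moreover have "norm x / (2 * C) \<le> C * norm x"
    proof -
      have "norm x * 1 \<le> norm x * (C * (2 * C))" using C(1) by (intro mult_left_mono) (auto intro: mult_ge1_I)
      then show ?thesis using C(1) by (simp add: divide_le_eq mult_ac)
    qed
    ultimately have "norm (?M *v x) \<le> 2 * C * norm x" using e P(2) by linarith
    then show "norm x \<le> 2 * C * norm (?M *v x) \<and> norm (?M *v x) \<le> 2 * C * norm x" using 1 by blast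
  qed
  moreover have "2 * C \<le> real (Suc (s m))" using m(2) seq_suble[OF s, of m] by linarith
  ultimately have "bilip (real (Suc (s m))) (colmat (\<beta> (s m)))" by (rule bilip_mono)
  then show False using AB0(4)[of "\<beta> (s m)" "s m"] \<beta>(1)[of "s m"] N(3,4) by simp
qed

end

section \<open>Uniform growth of the ratio between two flags\<close>

lemma hyperplane_normal_scale:
  "hyperplane_normal E X j n \<Longrightarrow> c \<noteq> 0 \<Longrightarrow> hyperplane_normal E X j (c *\<^sub>R n)"
  by (simp add: hyperplane_normal_def)

context flag_curve
begin

lemma hyperplane_normal_limit:
  assumes ab: "a \<in> L" "b \<in> L" "det2 a b \<noteq> 0" and A: "\<And>m. A m \<in> L" and B: "\<And>m. B m \<in> L" "\<And>m. det2 (A m) (B m) \<noteq> 0"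
    and \<beta>: "\<And>m. compatible (\<beta> m) (\<zeta> (A m)) (\<zeta> (B m))" "compatible \<beta>' (\<zeta> a) (\<zeta> b)"
    and \<beta>': "\<And>i. i < CARD('n) \<Longrightarrow> (\<lambda>m. \<beta> m i) \<longlonglongrightarrow> \<beta>' i"
    and n: "\<And>m. hyperplane_normal (\<zeta> (A m)) X j (n m)" "\<And>m. norm (n m) = 1" "n \<longlonglongrightarrow> n'" and j: "j < CARD('n)"
  shows "hyperplane_normal (\<zeta> a) X j n'"
  unfolding hyperplane_normal_def
proof (intro conjI ballI)
  have "norm n' = 1" using LIMSEQ_unique[OF tendsto_norm[OF n(3)], of 1] n(2) by simp
  then show "n' \<noteq> 0" by auto
next
  fix v assume v: "v \<in> \<zeta> a j"
  have "\<zeta> a j = span (\<beta>' ` {..<j})" using compatible_spans(1)[OF \<beta>(2) pair(1,2)[OF ab]] j by simp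
  then obtain c where c: "v = (\<Sum>i<j. c i *\<^sub>R \<beta>' i)" using v span_family_subset[of "{..<j}" v \<beta>'] by auto
  have "(\<lambda>m. n m \<bullet> (\<Sum>i<j. c i *\<^sub>R \<beta> m i)) \<longlonglongrightarrow> n' \<bullet> (\<Sum>i<j. c i *\<^sub>R \<beta>' i)"
    by (intro tendsto_intros n \<beta>') (use j in auto)
  moreover have "n m \<bullet> (\<Sum>i<j. c i *\<^sub>R \<beta> m i) = 0" for m
  proof -
    have "\<zeta> (A m) j = span (\<beta> m ` {..<j})" using compatible_spans(1)[OF \<beta>(1) pair(1,2)[OF A B]] j by simp
    moreover have "(\<Sum>i<j. c i *\<^sub>R \<beta> m i) \<in> span (\<beta> m ` {..<j})" by (intro span_sum span_scale span_base) auto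
    ultimately show ?thesis using n(1)[of m] by (simp add: hyperplane_normal_def)
  qed
  ultimately show "n' \<bullet> v = 0" unfolding c using LIMSEQ_unique[OF _ tendsto_const] by simp
next
  fix v assume v: "v \<in> X (CARD('n) - 1 - j)"
  have "(\<lambda>m. n m \<bullet> v) \<longlonglongrightarrow> n' \<bullet> v" by (intro tendsto_intros n)
  moreover have "n m \<bullet> v = 0" for m using n(1)[of m] v by (simp add: hyperplane_normal_def)
  ultimately show "n' \<bullet> v = 0" using LIMSEQ_unique[OF _ tendsto_const] by simp
qed

text \<open>The arguments are in the order of the tuple in \<open>positive_quad\<close>:
  \<open>x'\<close> is the point nearer to \<open>a\<close>.\<close>

definition ordered4 :: "real^2 \<Rightarrow> real^2 \<Rightarrow> real^2 \<Rightarrow> real^2 \<Rightarrow> bool" where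
  "ordered4 a x' x b \<longleftrightarrow> det2 a x' < 0 \<and> det2 a x < 0 \<and> det2 a b < 0 \<and> det2 x' x < 0 \<and> det2 x' b < 0 \<and> det2 x b < 0"

text \<open>Angles bounded below, in a form homogeneous in \<open>a\<close> and \<open>b\<close>.
  The norms of \<open>x\<close> and \<open>x'\<close> do not appear because these two vectors stay
  fixed while \<open>a\<close> and \<open>b\<close> vary.\<close>

definition spread :: "real \<Rightarrow> real \<Rightarrow> real^2 \<Rightarrow> real^2 \<Rightarrow> real^2 \<Rightarrow> real^2 \<Rightarrow> bool" where
  "spread K \<epsilon> a x' x b \<longleftrightarrow> norm a * norm b \<le> K * \<bar>det2 a b\<bar> \<and> \<epsilon> * norm a \<le> \<bar>det2 a x\<bar> \<and> \<epsilon> * norm b \<le> \<bar>det2 x b\<bar> \<and>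
     \<epsilon> * norm a \<le> \<bar>det2 a x'\<bar> \<and> \<epsilon> * norm b \<le> \<bar>det2 x' b\<bar>"

text \<open>The strict inequality \<open>w < w'\<close> of \<open>positive_quad\<close> becomes
  uniform because the configurations allowed by \<open>spread\<close> are compact up to scaling.
  Cross-multiplied pairings replace ratios, so that the inequality is homogeneous in all the data
  and passes to limits.\<close>

lemma spread_gap:
  assumes x: "x \<in> L" "x' \<in> L" and \<epsilon>: "\<epsilon> > 0" and j: "Suc j < CARD('n)"
  shows "\<exists>c>0. \<forall>a\<in>L. \<forall>b\<in>L. ordered4 a x' x b \<longrightarrow> spread K \<epsilon> a x' x b \<longrightarrow>
     (\<forall>\<beta> n n'. compatible \<beta> (\<zeta> a) (\<zeta> b) \<longrightarrow> hyperplane_normal (\<zeta> a) (\<zeta> x) j n \<longrightarrow> hyperplane_normal (\<zeta> a) (\<zeta> x') j n' \<longrightarrow>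
        (1 + c) * (\<bar>n \<bullet> \<beta> (Suc j)\<bar> * \<bar>n' \<bullet> \<beta> j\<bar>) \<le> \<bar>n' \<bullet> \<beta> (Suc j)\<bar> * \<bar>n \<bullet> \<beta> j\<bar>)"
proof (rule ccontr)
  assume neg: "\<not> ?thesis"
  define bad where "bad c a b \<beta> n n' \<longleftrightarrow> a \<in> L \<and> b \<in> L \<and> ordered4 a x' x b \<and> spread K \<epsilon> a x' x b \<and>
    compatible \<beta> (\<zeta> a) (\<zeta> b) \<and> hyperplane_normal (\<zeta> a) (\<zeta> x) j n \<and> hyperplane_normal (\<zeta> a) (\<zeta> x') j n' \<and>
    \<bar>n' \<bullet> \<beta> (Suc j)\<bar> * \<bar>n \<bullet> \<beta> j\<bar> \<le> (1 + c) * (\<bar>n \<bullet> \<beta> (Suc j)\<bar> * \<bar>n' \<bullet> \<beta> j\<bar>)" for c a b \<beta> n n'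
  have ex1: "\<exists>a b \<beta> n n'. bad (inverse (real (Suc m))) a b \<beta> n n'" for m
  proof -
    have "inverse (real (Suc m)) > 0" by simp
    then show ?thesis using neg unfolding bad_def by (meson linear)
  qed
  have ex2: "\<exists>a b \<beta> n n'. bad (inverse (real (Suc m))) a b \<beta> n n' \<and> norm a = 1 \<and> norm b = 1 \<and>
     (\<forall>i<CARD('n). norm (\<beta> i) = 1) \<and> norm n = 1 \<and> norm n' = 1" for m
  proof -
    define c where "c = inverse (real (Suc m))"
    obtain a b \<beta> n n' where h: "bad c a b \<beta> n n'" using ex1 c_def by blast
    define a' where "a' = (1 / norm a) *\<^sub>R a"
    define b' where "b' = (1 / norm b) *\<^sub>R b"
    define \<beta>' where "\<beta>' i = (1 / norm (\<beta> i)) *\<^sub>R \<beta> i" for i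
    define n1 where "n1 = (1 / norm n) *\<^sub>R n"
    define n2 where "n2 = (1 / norm n') *\<^sub>R n'"
    have ab: "a \<in> L" "b \<in> L" "det2 a b \<noteq> 0" and cb: "compatible \<beta> (\<zeta> a) (\<zeta> b)" using h by (auto simp: bad_def ordered4_def)
    have nn: "n \<noteq> 0" "n' \<noteq> 0" using h by (auto simp: bad_def hyperplane_normal_def)
    have na: "norm a > 0" "norm b > 0" using ab L_nz by auto
    have a': "a' \<in> L" "b' \<in> L" "\<zeta> a' = \<zeta> a" "\<zeta> b' = \<zeta> b"
      using L_scale[OF ab(1), of "1 / norm a"] L_scale[OF ab(2), of "1 / norm b"] na by (auto simp: a'_def b'_def)
    have bj: "norm (\<beta> j) > 0" "norm (\<beta> (Suc j)) > 0" using compatible_nonzero(1)[OF cb] j by auto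
    have "ordered4 a' x' x b'" using h na
      by (auto simp: bad_def ordered4_def a'_def b'_def divide_less_0_iff mult_less_0_iff zero_less_divide_iff)
    moreover have "spread K \<epsilon> a' x' x b'"
      using h na by (simp add: bad_def spread_def a'_def b'_def abs_mult field_simps)
    moreover have "hyperplane_normal (\<zeta> a') (\<zeta> x) j n1" "hyperplane_normal (\<zeta> a') (\<zeta> x') j n2"
      using h nn unfolding bad_def a' n1_def n2_def by (auto intro!: hyperplane_normal_scale)
    moreover have "\<bar>n2 \<bullet> \<beta>' (Suc j)\<bar> * \<bar>n1 \<bullet> \<beta>' j\<bar> \<le> (1 + c) * (\<bar>n1 \<bullet> \<beta>' (Suc j)\<bar> * \<bar>n2 \<bullet> \<beta>' j\<bar>)"
    proof -
      define t where "t = 1 / (norm n * norm n' * norm (\<beta> j) * norm (\<beta> (Suc j)))"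
      have "t \<ge> 0" by (simp add: t_def)
      then have "t * (\<bar>n' \<bullet> \<beta> (Suc j)\<bar> * \<bar>n \<bullet> \<beta> j\<bar>) \<le> t * ((1 + c) * (\<bar>n \<bullet> \<beta> (Suc j)\<bar> * \<bar>n' \<bullet> \<beta> j\<bar>))"
        using h by (intro mult_left_mono) (auto simp: bad_def)
      then show ?thesis by (simp add: t_def n1_def n2_def \<beta>'_def abs_mult mult_ac)
    qed
    moreover have "compatible \<beta>' (\<zeta> a') (\<zeta> b')" 
    proof -
      have "\<beta>' = (\<lambda>i. (1 / norm (\<beta> i)) *\<^sub>R \<beta> i)" by (rule ext) (simp add: \<beta>'_def)
      then show ?thesis using unit_basis(1)[OF ab cb] by (simp only: a')
    qed
    ultimately have "bad c a' b' \<beta>' n1 n2" using a' by (simp add: bad_def)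
    moreover have "\<forall>i<CARD('n). norm (\<beta>' i) = 1" using unit_basis(2)[OF ab cb] by (simp add: \<beta>'_def)
    moreover have "norm a' = 1" "norm b' = 1" "norm n1 = 1" "norm n2 = 1" using na nn by (auto simp: a'_def b'_def n1_def n2_def)
    ultimately show ?thesis unfolding c_def by blast
  qed
  then obtain A B \<beta> n n' where bad: "\<And>m. bad (inverse (real (Suc m))) (A m) (B m) (\<beta> m) (n m) (n' m)"
    and N: "\<And>m. norm (A m) = 1" "\<And>m. norm (B m) = 1" "\<And>m i. i < CARD('n) \<Longrightarrow> norm (\<beta> m i) = 1" "\<And>m. norm (n m) = 1" "\<And>m. norm (n' m) = 1"
    by metis
  define T where "T = cball (0::real^2) 1 \<times> cball (0::real^2) 1 \<times> cball (0 :: real^'n^'n) (real CARD('n) * real CARD('n)) \<times>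
     cball (0::real^'n) 1 \<times> cball (0::real^'n) 1"
  define z where "z m = (A m, B m, colmat (\<beta> m), n m, n' m)" for m
  have "compact T" unfolding T_def by (intro compact_Times compact_cball)
  then have sT: "seq_compact T" by (rule compact_imp_seq_compact)
  have "\<forall>m. z m \<in> T"
    using N norm_colmat_le[OF N(3)] by (auto simp: T_def z_def)
  from sT[unfolded seq_compact_def, rule_format, of z] this
  obtain l s where s: "strict_mono s" and lim: "(z \<circ> s) \<longlonglongrightarrow> l" by blast
  obtain a b P p p' where l: "l = (a, b, P, p, p')" by (metis prod_cases5)
  have lims: "(\<lambda>m. A (s m)) \<longlonglongrightarrow> a" "(\<lambda>m. B (s m)) \<longlonglongrightarrow> b" "(\<lambda>m. colmat (\<beta> (s m))) \<longlonglongrightarrow> P"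
    "(\<lambda>m. n (s m)) \<longlonglongrightarrow> p" "(\<lambda>m. n' (s m)) \<longlonglongrightarrow> p'"
    using tendsto_fst[OF lim] tendsto_fst[OF tendsto_snd[OF lim]] tendsto_fst[OF tendsto_snd[OF tendsto_snd[OF lim]]]
      tendsto_fst[OF tendsto_snd[OF tendsto_snd[OF tendsto_snd[OF lim]]]] tendsto_snd[OF tendsto_snd[OF tendsto_snd[OF tendsto_snd[OF lim]]]]
    by (simp_all add: l o_def z_def)
  have na: "norm a = 1" "norm b = 1"
    using LIMSEQ_unique[OF tendsto_norm[OF lims(1)], of 1] LIMSEQ_unique[OF tendsto_norm[OF lims(2)], of 1] N(1,2) by simp_all
  have AB: "A m \<in> L" "B m \<in> L" "det2 (A m) (B m) \<noteq> 0" for m using bad[of m] by (auto simp: bad_def ordered4_def)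
  have ab: "a \<in> L" "b \<in> L"
    using L_closed[OF _ lims(1)] L_closed[OF _ lims(2)] AB na by force+
  have le0: "lim1 \<le> 0" if "(\<lambda>m. f (s m)) \<longlonglongrightarrow> lim1" "\<And>m. f m < (0::real)" for f lim1
    using LIMSEQ_le_const2[OF that(1)] that(2) less_imp_le by blast
  have ge: "k \<le> lim1" if "(\<lambda>m. f (s m)) \<longlonglongrightarrow> lim1" "\<And>m. k \<le> f m" for f lim1 and k :: real
    using LIMSEQ_le_const[OF that(1)] that(2) by blast
  have o: "det2 (A m) x' < 0" "det2 (A m) x < 0" "det2 (A m) (B m) < 0" "det2 x' x < 0" "det2 x' (B m) < 0" "det2 x (B m) < 0" for m
    using bad[of m] by (auto simp: bad_def ordered4_def)
  have sp: "1 \<le> K * \<bar>det2 (A m) (B m)\<bar>" "\<epsilon> \<le> \<bar>det2 (A m) x\<bar>" "\<epsilon> \<le> \<bar>det2 x (B m)\<bar>" "\<epsilon> \<le> \<bar>det2 (A m) x'\<bar>" "\<epsilon> \<le> \<bar>det2 x' (B m)\<bar>" for m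
    using bad[of m] N(1,2) by (auto simp: bad_def spread_def)
  have c1: "(\<lambda>m. det2 (A (s m)) (B (s m))) \<longlonglongrightarrow> det2 a b" "(\<lambda>m. det2 (A (s m)) x) \<longlonglongrightarrow> det2 a x"
    "(\<lambda>m. det2 x (B (s m))) \<longlonglongrightarrow> det2 x b" "(\<lambda>m. det2 (A (s m)) x') \<longlonglongrightarrow> det2 a x'" "(\<lambda>m. det2 x' (B (s m))) \<longlonglongrightarrow> det2 x' b"
    by (intro tendsto_intros lims)+
  have "1 \<le> K * \<bar>det2 a b\<bar>" by (rule ge[OF tendsto_mult[OF tendsto_const tendsto_rabs[OF c1(1)]]]) (rule sp)
  then have d: "det2 a b < 0" using le0[OF c1(1) o(3)] by (cases "det2 a b = 0") auto
  have d2: "det2 a x < 0" "det2 x b < 0" "det2 a x' < 0" "det2 x' b < 0"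
    using ge[OF tendsto_rabs[OF c1(2)] sp(2)] ge[OF tendsto_rabs[OF c1(3)] sp(3)] ge[OF tendsto_rabs[OF c1(4)] sp(4)]
      ge[OF tendsto_rabs[OF c1(5)] sp(5)] le0[OF c1(2) o(2)] le0[OF c1(3) o(6)] le0[OF c1(4) o(1)] le0[OF c1(5) o(5)] \<epsilon> by auto
  have dn: "det2 a b \<noteq> 0" using d by simp
  define \<beta>' where "\<beta>' i = (\<chi> k. P $ k $ (inv_into UNIV nidx i)) " for i
  have \<beta>lim: "(\<lambda>m. \<beta> (s m) i) \<longlonglongrightarrow> \<beta>' i" if "i < CARD('n)" for i
    using column_limit[OF lims(3) that] by (simp add: \<beta>'_def)
  have cm: "compatible (\<beta> m) (\<zeta> (A m)) (\<zeta> (B m))" for m using bad[of m] by (simp add: bad_def)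
  have c: "compatible \<beta>' (\<zeta> a) (\<zeta> b)"
    by (rule basis_limit[OF ab dn AB(1) lims(1) AB(2) lims(2) cm N(3) \<beta>lim])
  have hn: "hyperplane_normal (\<zeta> (A m)) (\<zeta> x) j (n m)" "hyperplane_normal (\<zeta> (A m)) (\<zeta> x') j (n' m)" for m
    using bad[of m] by (auto simp: bad_def)
  have j': "j < CARD('n)" using j by simp
  have hp: "hyperplane_normal (\<zeta> a) (\<zeta> x) j p"
    by (rule hyperplane_normal_limit[OF ab dn AB(1) AB(2) AB(3) cm c \<beta>lim hn(1) N(4) lims(4) j'])
  have hp': "hyperplane_normal (\<zeta> a) (\<zeta> x') j p'"
    by (rule hyperplane_normal_limit[OF ab dn AB(1) AB(2) AB(3) cm c \<beta>lim hn(2) N(5) lims(5) j'])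
  obtain w w' where w: "0 < w" "w < w'" "ratio_is \<beta>' (\<zeta> a) (\<zeta> x) j w" "ratio_is \<beta>' (\<zeta> a) (\<zeta> x') j w'"
    using positive_quad[OF quad[OF ab(1) x(2,1) ab(2) d2(3,1) d o(4) d2(4,2)] c j] by blast
  have r: "p \<bullet> \<beta>' j \<noteq> 0" "\<bar>p \<bullet> \<beta>' (Suc j)\<bar> = w * \<bar>p \<bullet> \<beta>' j\<bar>" "p' \<bullet> \<beta>' j \<noteq> 0" "\<bar>p' \<bullet> \<beta>' (Suc j)\<bar> = w' * \<bar>p' \<bullet> \<beta>' j\<bar>"
    using w hp hp' unfolding ratio_is_def by blast+
  have "(\<lambda>m. (1 + inverse (real (Suc m))) * (\<bar>n (s m) \<bullet> \<beta> (s m) (Suc j)\<bar> * \<bar>n' (s m) \<bullet> \<beta> (s m) j\<bar>) - \<bar>n' (s m) \<bullet> \<beta> (s m) (Suc j)\<bar> * \<bar>n (s m) \<bullet> \<beta> (s m) j\<bar>)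
    \<longlonglongrightarrow> (1 + 0) * (\<bar>p \<bullet> \<beta>' (Suc j)\<bar> * \<bar>p' \<bullet> \<beta>' j\<bar>) - \<bar>p' \<bullet> \<beta>' (Suc j)\<bar> * \<bar>p \<bullet> \<beta>' j\<bar>"
    by (intro tendsto_intros lims \<beta>lim j j' LIMSEQ_inverse_real_of_nat)
  moreover have "0 \<le> (1 + inverse (real (Suc m))) * (\<bar>n (s m) \<bullet> \<beta> (s m) (Suc j)\<bar> * \<bar>n' (s m) \<bullet> \<beta> (s m) j\<bar>) - \<bar>n' (s m) \<bullet> \<beta> (s m) (Suc j)\<bar> * \<bar>n (s m) \<bullet> \<beta> (s m) j\<bar>" for m
  proof -
    have "inverse (real (Suc (s m))) \<le> inverse (real (Suc m))"
      using seq_suble[OF s, of m] by (intro le_imp_inverse_le) auto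
    then have "(1 + inverse (real (Suc (s m)))) * (\<bar>n (s m) \<bullet> \<beta> (s m) (Suc j)\<bar> * \<bar>n' (s m) \<bullet> \<beta> (s m) j\<bar>) \<le>
       (1 + inverse (real (Suc m))) * (\<bar>n (s m) \<bullet> \<beta> (s m) (Suc j)\<bar> * \<bar>n' (s m) \<bullet> \<beta> (s m) j\<bar>)"
      by (intro mult_right_mono) auto
    then show ?thesis using bad[of "s m"] by (simp add: bad_def)
  qed
  ultimately have "0 \<le> (1 + 0) * (\<bar>p \<bullet> \<beta>' (Suc j)\<bar> * \<bar>p' \<bullet> \<beta>' j\<bar>) - \<bar>p' \<bullet> \<beta>' (Suc j)\<bar> * \<bar>p \<bullet> \<beta>' j\<bar>"
    using LIMSEQ_le_const by blast
  then have "w' * (\<bar>p \<bullet> \<beta>' j\<bar> * \<bar>p' \<bullet> \<beta>' j\<bar>) \<le> w * (\<bar>p \<bullet> \<beta>' j\<bar> * \<bar>p' \<bullet> \<beta>' j\<bar>)" by (simp add: r mult_ac)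
  moreover have "\<bar>p \<bullet> \<beta>' j\<bar> * \<bar>p' \<bullet> \<beta>' j\<bar> > 0" using r by simp
  ultimately show False using mult_strict_right_mono[OF w(2)] by (meson not_less)
qed

end

subsection \<open>Separated elements in a conjugacy class\<close>

text \<open>The floor of \<open>ln w / ln q\<close> is the exponent. Powers have natural exponents,
  so its sign decides between the two forms.\<close>

lemma real_between_powers:
  fixes q w :: real
  assumes "q > 1" "w > 0"
  shows "\<exists>m::nat. 1 \<le> q ^ m * w \<and> q ^ m * w < q \<or> 1 \<le> w / q ^ m \<and> w / q ^ m < q"
proof -
  define m where "m = \<lfloor>ln w / ln q\<rfloor>"
  have lq: "ln q > 0" using assms by simp
  have "real_of_int m \<le> ln w / ln q" "ln w / ln q < real_of_int m + 1" unfolding m_def by linarith+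
  then have 1: "real_of_int m * ln q \<le> ln w" "ln w < (real_of_int m + 1) * ln q" using lq by (simp_all add: field_simps)
  have pw: "q ^ n = exp (real n * ln q)" for n using assms by (simp add: exp_of_nat_mult)
  have 2: "exp (ln w - real_of_int m * ln q) \<ge> 1" using 1 by simp
  have "exp (ln w - real_of_int m * ln q) < exp (ln q)" using 1 by (simp add: algebra_simps)
  then have 3: "exp (ln w - real_of_int m * ln q) < q" using assms by simp
  show ?thesis
  proof (cases "m \<ge> 0")
    case True
    then have "w / q ^ nat m = exp (ln w - real_of_int m * ln q)" unfolding pw using assms by (simp add: exp_diff)
    then show ?thesis using 2 3 by metis
  next
    case False
    then have "real (nat (- m)) = - real_of_int m" by simp
    then have "q ^ nat (- m) * w = exp (ln w - real_of_int m * ln q)" unfolding pw using assms by (simp add: exp_diff exp_minus field_simps)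
    then show ?thesis using 2 3 by metis
  qed
qed

text \<open>\<open>R\<close> selects lifts, hence is multiplicative only up to sign in the
  application. The sign does not affect flags, and \<open>equivariant\<close> records the action on
  these.\<close>

locale hitchin_rep = sl2_group G S + flag_curve L \<zeta>
  for G S :: "(real^2^2) set" and L :: "(real^2) set" and \<zeta> :: "real^2 \<Rightarrow> 'n::finite flag" +
  fixes R :: "real^2^2 \<Rightarrow> real^'n^'n"
  assumes R_det: "A \<in> G \<Longrightarrow> det (R A) = 1"
    and equivariant: "A \<in> G \<Longrightarrow> v \<in> L \<Longrightarrow> \<zeta> (A *v v) = flag_act (R A) (\<zeta> v)"
    and fixed_in_L: "A \<in> G \<Longrightarrow> eigpair A a b l \<Longrightarrow> a \<in> L"
begin

text \<open>Repelling fixed points are included by \<open>eigpair_inverse\<close>. Each member has a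
  partner at the other end of an axis, so its value under \<open>\<zeta>\<close> is a genuine flag
  (\<open>fixed_flag\<close>).\<close>

definition fixed_vectors :: "(real^2) set" where
  "fixed_vectors = {v. \<exists>M\<in>G. \<exists>b l. eigpair M v b l}"

lemma eigpair_inverse:
  assumes "M \<in> G" "eigpair M a b l"
  shows "eigpair (matrix_inv M) b (- a) l"
proof -
  have l: "l \<noteq> 0" "\<bar>l\<bar> > 1" "M *v a = l *\<^sub>R a" "M *v b = (1 / l) *\<^sub>R b" "det2 a b \<noteq> 0" using assms(2) by (auto simp: eigpair_def)
  then have "M *v (l *\<^sub>R b) = b" "M *v ((1 / l) *\<^sub>R a) = a" by (simp_all add: matrix_vector_mult_scaleR)
  then have "matrix_inv M *v b = l *\<^sub>R b" "matrix_inv M *v a = (1 / l) *\<^sub>R a"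
    using inv_mult(4)[OF assms(1)] by metis+
  then show ?thesis using l det2_swap[of b a] by (simp add: eigpair_def)
qed

lemma fixed_subset: "fixed_vectors \<subseteq> L"
  unfolding fixed_vectors_def using fixed_in_L by blast

lemma fixed_act: "v \<in> fixed_vectors \<Longrightarrow> g \<in> G \<Longrightarrow> g *v v \<in> fixed_vectors"
proof -
  assume v: "v \<in> fixed_vectors" and g: "g \<in> G"
  then obtain M b l where "M \<in> G" "eigpair M v b l" by (auto simp: fixed_vectors_def)
  then show "g *v v \<in> fixed_vectors"
    using eigpair_conj[OF g, of M v b l] mult minv g unfolding fixed_vectors_def by blast
qed

lemma fixed_scale: "v \<in> fixed_vectors \<Longrightarrow> c \<noteq> 0 \<Longrightarrow> c *\<^sub>R v \<in> fixed_vectors"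
proof -
  assume v: "v \<in> fixed_vectors" and c: "c \<noteq> 0"
  then obtain M b l where "M \<in> G" "eigpair M v b l" by (auto simp: fixed_vectors_def)
  then have "eigpair M (c *\<^sub>R v) b l" using c by (simp add: eigpair_def matrix_vector_mult_scaleR mult.commute)
  then show "c *\<^sub>R v \<in> fixed_vectors" using \<open>M \<in> G\<close> unfolding fixed_vectors_def by blast
qed

lemma fixed_pair: "M \<in> G \<Longrightarrow> eigpair M a b l \<Longrightarrow> a \<in> fixed_vectors \<and> b \<in> fixed_vectors"
  using eigpair_inverse minv unfolding fixed_vectors_def by blast

lemma R_inverse: "A \<in> G \<Longrightarrow> matrix_inv (R A) ** R A = mat 1 \<and> R A ** matrix_inv (R A) = mat 1"
  using matrix_inv_SL R_det by blast

lemma ordered4_act: "g \<in> G \<Longrightarrow> ordered4 (g *v a) x' x (g *v b) \<longleftrightarrow> ordered4 a (matrix_inv g *v x') (matrix_inv g *v x) b"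
  using det2_move[of g a x'] det2_move[of g a x] det2_move[of "matrix_inv g" x b] det2_move[of "matrix_inv g" x' b]
    minv[of g] by (simp add: ordered4_def)

lemma fixed_flag:
  assumes "z \<in> fixed_vectors"
  shows "\<zeta> z \<in> flags"
proof -
  obtain M e l where M: "M \<in> G" "eigpair M z e l" using assms by (auto simp: fixed_vectors_def)
  then have "det2 z e \<noteq> 0" by (simp add: eigpair_def)
  moreover have "e \<in> L" "z \<in> L" using fixed_pair[OF M] fixed_subset by auto
  ultimately show ?thesis using pair(1) by blast
qed

text \<open>The gap constant belongs to the fixed vectors \<open>x\<close> and \<open>x'\<close>,
  with the axis moved by \<open>h\<close>. Moving everything back by the inverse of \<open>h\<close>
  leaves the pairings of normals with basis vectors unchanged
  (\<open>hyperplane_normal_act\<close>).\<close>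

lemma gap_transport:
  assumes h: "h \<in> G" and ab: "a \<in> fixed_vectors" "b \<in> fixed_vectors" and xs: "x \<in> fixed_vectors" "x' \<in> fixed_vectors"
    and o: "ordered4 (h *v a) x' x (h *v b)" and sp: "spread K \<epsilon> (h *v a) x' x (h *v b)"
    and c: "c > 0" and gap: "\<forall>a\<in>L. \<forall>b\<in>L. ordered4 a x' x b \<longrightarrow> spread K \<epsilon> a x' x b \<longrightarrow>
     (\<forall>\<beta> n n'. compatible \<beta> (\<zeta> a) (\<zeta> b) \<longrightarrow> hyperplane_normal (\<zeta> a) (\<zeta> x) j n \<longrightarrow> hyperplane_normal (\<zeta> a) (\<zeta> x') j n' \<longrightarrow>
        (1 + c) * (\<bar>n \<bullet> \<beta> (Suc j)\<bar> * \<bar>n' \<bullet> \<beta> j\<bar>) \<le> \<bar>n' \<bullet> \<beta> (Suc j)\<bar> * \<bar>n \<bullet> \<beta> j\<bar>)"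
    and \<beta>: "compatible \<beta> (\<zeta> a) (\<zeta> b)" and j: "Suc j < CARD('n)"
    and w: "ratio_is \<beta> (\<zeta> a) (\<zeta> (matrix_inv h *v x)) j w" "ratio_is \<beta> (\<zeta> a) (\<zeta> (matrix_inv h *v x')) j w'"
  shows "(1 + c) * w \<le> w'"
proof -
  define y where "y = matrix_inv h *v x"
  define y' where "y' = matrix_inv h *v x'"
  have y: "y \<in> fixed_vectors" "y' \<in> fixed_vectors" using fixed_act[OF _ minv[OF h]] xs by (auto simp: y_def y'_def)
  then have yL: "y \<in> L" "y' \<in> L" "a \<in> L" "b \<in> L" "x \<in> L" "x' \<in> L" using fixed_subset ab xs by auto
  have hab: "h *v a \<in> L" "h *v b \<in> L" using fixed_act[OF _ h] ab fixed_subset by auto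
  have hy: "h *v y = x" "h *v y' = x'" using h by (simp_all add: y_def y'_def)
  have jc: "j < CARD('n)" using j by simp
  obtain n where n: "hyperplane_normal (\<zeta> a) (\<zeta> y) j n" using hyperplane_normal_exists[OF fixed_flag[OF ab(1)] fixed_flag[OF y(1)] jc] by blast
  obtain n' where n': "hyperplane_normal (\<zeta> a) (\<zeta> y') j n'" using hyperplane_normal_exists[OF fixed_flag[OF ab(1)] fixed_flag[OF y(2)] jc] by blast
  define Q where "Q = matrix_inv (R h)"
  have Q: "Q ** R h = mat 1" using R_inverse[OF h] by (simp add: Q_def)
  have e: "\<zeta> (h *v a) = flag_act (R h) (\<zeta> a)" "\<zeta> (h *v b) = flag_act (R h) (\<zeta> b)" "\<zeta> x = flag_act (R h) (\<zeta> y)" "\<zeta> x' = flag_act (R h) (\<zeta> y')"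
    using equivariant[OF h yL(3)] equivariant[OF h yL(4)] equivariant[OF h yL(1)] equivariant[OF h yL(2)] by (simp_all add: hy)
  have "(1 + c) * (\<bar>(n v* Q) \<bullet> (R h *v \<beta> (Suc j))\<bar> * \<bar>(n' v* Q) \<bullet> (R h *v \<beta> j)\<bar>) \<le> \<bar>(n' v* Q) \<bullet> (R h *v \<beta> (Suc j))\<bar> * \<bar>(n v* Q) \<bullet> (R h *v \<beta> j)\<bar>"
    by (rule gap[rule_format, OF hab o sp, of "\<lambda>i. R h *v \<beta> i"])
      (use compatible_act[OF Q \<beta>] hyperplane_normal_act(1)[OF Q n] hyperplane_normal_act(1)[OF Q n'] in \<open>simp_all add: e\<close>)
  then have 1: "(1 + c) * (\<bar>n \<bullet> \<beta> (Suc j)\<bar> * \<bar>n' \<bullet> \<beta> j\<bar>) \<le> \<bar>n' \<bullet> \<beta> (Suc j)\<bar> * \<bar>n \<bullet> \<beta> j\<bar>"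
    by (simp add: hyperplane_normal_act(2)[OF Q n] hyperplane_normal_act(2)[OF Q n'])
  have 2: "n \<bullet> \<beta> j \<noteq> 0" "\<bar>n \<bullet> \<beta> (Suc j)\<bar> = w * \<bar>n \<bullet> \<beta> j\<bar>" "n' \<bullet> \<beta> j \<noteq> 0" "\<bar>n' \<bullet> \<beta> (Suc j)\<bar> = w' * \<bar>n' \<bullet> \<beta> j\<bar>"
    using w(1)[unfolded ratio_is_def, rule_format, OF n[unfolded y_def]]
      w(2)[unfolded ratio_is_def, rule_format, OF n'[unfolded y'_def]] by simp_all
  have "((1 + c) * w) * (\<bar>n \<bullet> \<beta> j\<bar> * \<bar>n' \<bullet> \<beta> j\<bar>) \<le> w' * (\<bar>n \<bullet> \<beta> j\<bar> * \<bar>n' \<bullet> \<beta> j\<bar>)"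
    using 1 unfolding 2 by (simp add: mult_ac)
  moreover have "\<bar>n \<bullet> \<beta> j\<bar> * \<bar>n' \<bullet> \<beta> j\<bar> > 0" using 2 by simp
  ultimately show ?thesis by (rule mult_right_le_imp_le)
qed

lemma ratio_unique:
  assumes "a \<in> fixed_vectors" "y \<in> fixed_vectors" "j < CARD('n)" "ratio_is \<beta> (\<zeta> a) (\<zeta> y) j w" "ratio_is \<beta> (\<zeta> a) (\<zeta> y) j w'"
  shows "w = w'"
proof -
  obtain n where "hyperplane_normal (\<zeta> a) (\<zeta> y) j n"
    using hyperplane_normal_exists[OF fixed_flag[OF assms(1)] fixed_flag[OF assms(2)] assms(3)] by blast
  then have "n \<bullet> \<beta> j \<noteq> 0" "w * \<bar>n \<bullet> \<beta> j\<bar> = w' * \<bar>n \<bullet> \<beta> j\<bar>"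
    using assms(4,5) unfolding ratio_is_def by metis+
  then show ?thesis by simp
qed

text \<open>The quotient of \<open>norm (h *v a)\<close> by \<open>norm (h *v b)\<close> tells which
  part of the axis \<open>h\<close> brings near the base point. By \<open>le\<close> the intervals
  of \<open>h\<close> and \<open>h0\<close> on the arc overlap, so these quotients agree up to a
  bounded factor. As the products of the two norms are comparable by \<open>spread\<close>, so are
  the norms themselves, and \<open>norm_le_basis\<close> applies.\<close>

lemma same_key_close:
  assumes h: "h \<in> G" and h0: "h0 \<in> G" and ab: "det2 a b < 0" and \<epsilon>: "\<epsilon> > 0"
    and X: "norm x \<le> X" "norm x' \<le> X" "norm x0 \<le> X" "norm x0' \<le> X"
    and o: "ordered4 (h *v a) x' x (h *v b)" "ordered4 (h0 *v a) x0' x0 (h0 *v b)"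
    and sp: "spread K \<epsilon> (h *v a) x' x (h *v b)" "spread K \<epsilon> (h0 *v a) x0' x0 (h0 *v b)"
    and le: "\<not> det2 (matrix_inv h *v x) (matrix_inv h0 *v x0') < 0" "\<not> det2 (matrix_inv h0 *v x0) (matrix_inv h *v x') < 0"
  shows "norm (h ** matrix_inv h0) \<le> 4 * (X * (1 + K) / \<epsilon>) * K"
proof -
  have X0: "X \<ge> 0" using X(1) norm_ge_zero order_trans by blast
  have key: "\<epsilon>\<^sup>2 * (norm (k0 *v a) * norm (k *v b)) \<le> X\<^sup>2 * (norm (k *v a) * norm (k0 *v b))"
    if k: "k \<in> G" "k0 \<in> G" and n: "norm u \<le> X" "norm u' \<le> X"
      and d: "det2 (k *v a) u < 0" "det2 u (k *v b) < 0" "det2 (k0 *v a) u' < 0" "det2 u' (k0 *v b) < 0"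
      and s: "\<epsilon> * norm (k *v b) \<le> \<bar>det2 u (k *v b)\<bar>" "\<epsilon> * norm (k0 *v a) \<le> \<bar>det2 (k0 *v a) u'\<bar>"
      and nn: "\<not> det2 (matrix_inv k *v u) (matrix_inv k0 *v u') < 0" for k k0 u u'
  proof -
    define y where "y = matrix_inv k *v u"
    define y' where "y' = matrix_inv k0 *v u'"
    have e: "det2 a y = det2 (k *v a) u" "det2 y b = det2 u (k *v b)" "det2 a y' = det2 (k0 *v a) u'" "det2 y' b = det2 u' (k0 *v b)"
      using det2_move[OF k(1), of a u] det2_move[OF k(2), of a u'] det2_move[OF minv[OF k(1)], of u b] det2_move[OF minv[OF k(2)], of u' b] k
      by (simp_all add: y_def y'_def)
    \<comment> \<open>The Pluecker relation for \<open>a, b, y, y'\<close>: the order of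
      \<open>y\<close> and \<open>y'\<close> becomes an inequality between products of determinants
      with \<open>a\<close> and \<open>b\<close>.\<close>
    have pl: "det2 a b * det2 y y' = det2 a y' * det2 y b - det2 a y * det2 y' b"
      by (simp add: det2_def algebra_simps)
    have "det2 a b * det2 y y' \<le> 0" using ab nn unfolding y_def[symmetric] y'_def[symmetric] by (intro mult_nonpos_nonneg) auto
    then have "det2 a y' * det2 y b \<le> det2 a y * det2 y' b" unfolding pl by simp
    then have 1: "\<bar>det2 (k0 *v a) u'\<bar> * \<bar>det2 u (k *v b)\<bar> \<le> \<bar>det2 (k *v a) u\<bar> * \<bar>det2 u' (k0 *v b)\<bar>"
      using d unfolding e by simp
    have "\<epsilon>\<^sup>2 * (norm (k0 *v a) * norm (k *v b)) = (\<epsilon> * norm (k0 *v a)) * (\<epsilon> * norm (k *v b))" by (simp add: power2_eq_square)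
    also have "\<dots> \<le> \<bar>det2 (k0 *v a) u'\<bar> * \<bar>det2 u (k *v b)\<bar>" using s \<epsilon> by (intro mult_mono) auto
    also have "\<dots> \<le> \<bar>det2 (k *v a) u\<bar> * \<bar>det2 u' (k0 *v b)\<bar>" by (rule 1)
    also have "\<dots> \<le> (norm (k *v a) * norm u) * (norm u' * norm (k0 *v b))" by (intro mult_mono abs_det2_le) auto
    also have "\<dots> \<le> (norm (k *v a) * X) * (X * norm (k0 *v b))" using n X0 by (intro mult_mono mult_left_mono mult_right_mono) auto
    finally show ?thesis by (simp add: power2_eq_square mult_ac)
  qed
  have 1: "\<epsilon>\<^sup>2 * (norm (h0 *v a) * norm (h *v b)) \<le> X\<^sup>2 * (norm (h *v a) * norm (h0 *v b))"
    by (rule key[OF h h0 X(1,4) _ _ _ _ _ _ le(1)]) (use o sp in \<open>auto simp: ordered4_def spread_def\<close>)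
  have 2: "\<epsilon>\<^sup>2 * (norm (h *v a) * norm (h0 *v b)) \<le> X\<^sup>2 * (norm (h0 *v a) * norm (h *v b))"
    by (rule key[OF h0 h X(3,2) _ _ _ _ _ _ le(2)]) (use o sp in \<open>auto simp: ordered4_def spread_def\<close>)
  define D where "D = \<bar>det2 a b\<bar>"
  have D: "D > 0" using ab by (simp add: D_def)
  have K: "norm (h *v a) * norm (h *v b) \<le> K * D" "norm (h0 *v a) * norm (h0 *v b) \<le> K * D"
    using sp h h0 by (auto simp: spread_def D_def)
  have Dle: "D \<le> norm (h *v a) * norm (h *v b)" "D \<le> norm (h0 *v a) * norm (h0 *v b)"
    using abs_det2_le[of "h *v a" "h *v b"] abs_det2_le[of "h0 *v a" "h0 *v b"] h h0 by (auto simp: D_def)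
  have "1 * D \<le> K * D" using K(1) Dle(1) by linarith
  then have K1: "K \<ge> 1" using D by simp
  \<comment> \<open>Satisfies \<open>X\<^sup>2 * K \<le> \<epsilon>\<^sup>2 * C1\<^sup>2\<close>;
    the factor \<open>1 + K\<close> stands in for a square root of \<open>K\<close>.\<close>
  define C1 where "C1 = X * (1 + K) / \<epsilon>"
  have C10: "C1 \<ge> 0" using X0 K1 \<epsilon> by (simp add: C1_def)
  have "K \<le> (1 + K)\<^sup>2" using K1 by (simp add: power2_eq_square algebra_simps)
  then have C1: "X\<^sup>2 * K \<le> \<epsilon>\<^sup>2 * C1\<^sup>2" using \<epsilon> by (simp add: C1_def power_divide power_mult_distrib mult_left_mono)
  have cmp: "p \<le> C1 * p0" if i: "\<epsilon>\<^sup>2 * (p * q0) \<le> X\<^sup>2 * (p0 * q)" "p * q \<le> K * D" "D \<le> p0 * q0" "p \<ge> 0" "p0 \<ge> 0" "q0 \<ge> 0" for p p0 q q0 :: real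
  proof (rule power2_le_imp_le)
    have "p0 * q0 > 0" using D i by linarith
    then have q0: "q0 > 0" using i by (auto simp: zero_less_mult_iff)
    have "\<epsilon>\<^sup>2 * p\<^sup>2 * q0 = p * (\<epsilon>\<^sup>2 * (p * q0))" by (simp add: power2_eq_square mult_ac)
    also have "\<dots> \<le> p * (X\<^sup>2 * (p0 * q))" using i by (intro mult_left_mono) auto
    also have "\<dots> = X\<^sup>2 * p0 * (p * q)" by (simp add: mult_ac)
    also have "\<dots> \<le> X\<^sup>2 * p0 * (K * (p0 * q0))" 
    proof (rule mult_left_mono)
      have "K * D \<le> K * (p0 * q0)" using i(3) K1 by (intro mult_left_mono) auto
      then show "p * q \<le> K * (p0 * q0)" using i(2) by (rule order_trans[rotated])
    qed (use i in simp)
    also have "\<dots> = (X\<^sup>2 * K) * (p0\<^sup>2 * q0)" by (simp add: power2_eq_square mult_ac)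
    also have "\<dots> \<le> (\<epsilon>\<^sup>2 * C1\<^sup>2) * (p0\<^sup>2 * q0)" using C1 q0 by (intro mult_right_mono) auto
    finally have "(\<epsilon>\<^sup>2 * q0) * p\<^sup>2 \<le> (\<epsilon>\<^sup>2 * q0) * (C1 * p0)\<^sup>2" by (simp add: power_mult_distrib mult_ac)
    moreover have "\<epsilon>\<^sup>2 * q0 > 0" using \<epsilon> q0 by simp
    ultimately show "p\<^sup>2 \<le> (C1 * p0)\<^sup>2" by (simp only: mult_le_cancel_left_pos)
    show "0 \<le> C1 * p0" using C10 i by simp
  qed
  have a: "norm (h *v a) \<le> C1 * norm (h0 *v a)"
    by (rule cmp[OF 2]) (use K Dle in \<open>auto simp: mult.commute\<close>)
  have b: "norm (h *v b) \<le> C1 * norm (h0 *v b)"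
    by (rule cmp[of "norm (h *v b)" "norm (h0 *v a)" "norm (h0 *v b)" "norm (h *v a)"]) (use 1 K Dle in \<open>auto simp: mult.commute\<close>)
  let ?g = "h ** matrix_inv h0"
  have g: "?g *v (h0 *v a) = h *v a" "?g *v (h0 *v b) = h *v b" using h0 by (simp_all flip: matrix_vector_mul_assoc)
  have dn: "det2 (h0 *v a) (h0 *v b) \<noteq> 0" using h0 ab by simp
  have "norm ?g \<le> 2 * (norm (h *v a) * norm (h0 *v b) + norm (h *v b) * norm (h0 *v a)) / D"
    using norm_le_basis[OF dn, of ?g] h0 unfolding g by (simp add: D_def)
  also have "\<dots> \<le> 2 * (C1 * norm (h0 *v a) * norm (h0 *v b) + C1 * norm (h0 *v b) * norm (h0 *v a)) / D"
    using a b D by (intro divide_right_mono mult_left_mono add_mono mult_right_mono) auto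
  also have "\<dots> = 4 * C1 * (norm (h0 *v a) * norm (h0 *v b)) / D" by (simp add: mult_ac)
  also have "\<dots> \<le> 4 * C1 * (K * D) / D" using K(2) C10 D by (intro divide_right_mono mult_left_mono) auto
  also have "\<dots> = 4 * C1 * K" using D by simp
  finally show ?thesis by (simp add: C1_def)
qed

end

section \<open>Counting conjugates in good position\<close>

lemma ratio_is_act:
  fixes A :: "real^'n^'n"
  assumes A: "A' ** A = mat 1" "A ** A' = mat 1" and E: "flag_act A E = E"
    and ev: "\<And>i. i < CARD('n) \<Longrightarrow> A *v \<beta> i = ev i *\<^sub>R \<beta> i" and nz: "ev j \<noteq> 0" "ev (Suc j) \<noteq> 0" and j: "Suc j < CARD('n)"
    and w: "ratio_is \<beta> E X j w"
  shows "ratio_is \<beta> E (flag_act A X) j (\<bar>ev j\<bar> / \<bar>ev (Suc j)\<bar> * w)"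
  unfolding ratio_is_def
proof (intro allI impI)
  fix n assume n: "hyperplane_normal E (flag_act A X) j n"
  have bk: "flag_act A' (flag_act A X) = X" "flag_act A' E = E"
  proof -
    show "flag_act A' (flag_act A X) = X" by (simp add: flag_act_mult A) (simp add: flag_act_def)
    have "flag_act A' E = flag_act A' (flag_act A E)" using E by simp
    then show "flag_act A' E = E" by (simp add: flag_act_mult A) (simp add: flag_act_def)
  qed
  have n': "hyperplane_normal E X j (n v* A)" using hyperplane_normal_act(1)[OF A(2) n] by (simp add: bk)
  have v: "(n v* A) \<bullet> \<beta> j = ev j * (n \<bullet> \<beta> j)" "(n v* A) \<bullet> \<beta> (Suc j) = ev (Suc j) * (n \<bullet> \<beta> (Suc j))"
    using ev j by (simp_all add: dot_lmul_matrix)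
  have "(n v* A) \<bullet> \<beta> j \<noteq> 0" "\<bar>(n v* A) \<bullet> \<beta> (Suc j)\<bar> = w * \<bar>(n v* A) \<bullet> \<beta> j\<bar>"
    using w[unfolded ratio_is_def, rule_format, OF n'] by blast+
  then show "n \<bullet> \<beta> j \<noteq> 0 \<and> \<bar>n \<bullet> \<beta> (Suc j)\<bar> = \<bar>ev j\<bar> / \<bar>ev (Suc j)\<bar> * w * \<bar>n \<bullet> \<beta> j\<bar>"
    unfolding v using nz by (auto simp: abs_mult field_simps)
qed

context hitchin_rep
begin

definition good_position :: "(real^2) set \<Rightarrow> real \<Rightarrow> real \<Rightarrow> real^2 \<Rightarrow> real^2 \<Rightarrow> bool" where
  "good_position P K \<epsilon> a b \<longleftrightarrow> (\<exists>x\<in>P. \<exists>x'\<in>P. ordered4 a x' x b \<and> spread K \<epsilon> a x' x b)"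

definition good_conjugates :: "(real^2) set \<Rightarrow> real \<Rightarrow> real \<Rightarrow> real^2^2 \<Rightarrow> real^2 \<Rightarrow> real^2 \<Rightarrow> (real^2^2) set" where
  "good_conjugates P K \<epsilon> \<eta> a b = {h ** \<eta> ** matrix_inv h |h. h \<in> G \<and> good_position P K \<epsilon> (h *v a) (h *v b)}"

text \<open>The ratio grows by the factor \<open>q\<close> along one period of \<open>\<eta>\<close>, and by at least the factor
  \<open>1 + c\<close> on each of the intervals belonging to a conjugate in good position. Such an interval
  therefore contains a power of \<open>1 + c\<close>, whose exponent determines the conjugate up to finitely
  many possibilities.\<close>

lemma good_conjugates_bound:
  assumes P: "finite P" "P \<subseteq> fixed_vectors" and \<epsilon>: "\<epsilon> > 0" and j: "Suc j < CARD('n)"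
  shows "\<exists>N\<ge>0. \<forall>\<eta>\<in>G. \<forall>a b l A A' \<beta> ev. eigpair \<eta> a b l \<longrightarrow> det2 a b < 0 \<longrightarrow>
     A' ** A = mat 1 \<longrightarrow> A ** A' = mat 1 \<longrightarrow> (\<forall>y\<in>fixed_vectors. \<zeta> (\<eta> *v y) = flag_act A (\<zeta> y)) \<longrightarrow>
     compatible \<beta> (\<zeta> a) (\<zeta> b) \<longrightarrow> (\<forall>i<CARD('n). A *v \<beta> i = ev i *\<^sub>R \<beta> i \<and> ev i \<noteq> 0) \<longrightarrow>
     good_conjugates P K \<epsilon> \<eta> a b \<noteq> {} \<longrightarrow>
     \<bar>ev (Suc j)\<bar> < \<bar>ev j\<bar> \<and> finite (good_conjugates P K \<epsilon> \<eta> a b) \<and>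
     real (card (good_conjugates P K \<epsilon> \<eta> a b)) \<le> N * (1 + ln (\<bar>ev j\<bar> / \<bar>ev (Suc j)\<bar>))"
proof -
  have "\<exists>c>0. \<forall>a\<in>L. \<forall>b\<in>L. ordered4 a x' x b \<longrightarrow> spread K \<epsilon> a x' x b \<longrightarrow>
     (\<forall>\<beta> n n'. compatible \<beta> (\<zeta> a) (\<zeta> b) \<longrightarrow> hyperplane_normal (\<zeta> a) (\<zeta> x) j n \<longrightarrow> hyperplane_normal (\<zeta> a) (\<zeta> x') j n' \<longrightarrow>
        (1 + c) * (\<bar>n \<bullet> \<beta> (Suc j)\<bar> * \<bar>n' \<bullet> \<beta> j\<bar>) \<le> \<bar>n' \<bullet> \<beta> (Suc j)\<bar> * \<bar>n \<bullet> \<beta> j\<bar>)"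
    if "x \<in> P" "x' \<in> P" for x x'
    using spread_gap[OF _ _ \<epsilon> j, of x x' K] that P(2) fixed_subset by blast
  then obtain cc where cc: "\<And>x x'. x \<in> P \<Longrightarrow> x' \<in> P \<Longrightarrow> cc x x' > 0 \<and> (\<forall>a\<in>L. \<forall>b\<in>L. ordered4 a x' x b \<longrightarrow> spread K \<epsilon> a x' x b \<longrightarrow>
     (\<forall>\<beta> n n'. compatible \<beta> (\<zeta> a) (\<zeta> b) \<longrightarrow> hyperplane_normal (\<zeta> a) (\<zeta> x) j n \<longrightarrow> hyperplane_normal (\<zeta> a) (\<zeta> x') j n' \<longrightarrow>
        (1 + cc x x') * (\<bar>n \<bullet> \<beta> (Suc j)\<bar> * \<bar>n' \<bullet> \<beta> j\<bar>) \<le> \<bar>n' \<bullet> \<beta> (Suc j)\<bar> * \<bar>n \<bullet> \<beta> j\<bar>))"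
    by metis
  \<comment> \<open>One gap constant for all pairs from \<open>P\<close>; the inserted 1 keeps the
    minimum meaningful when \<open>P\<close> is empty.\<close>
  define c where "c = Min (insert 1 ((\<lambda>(x, x'). cc x x') ` (P \<times> P)))"
  have fin: "finite (insert 1 ((\<lambda>(x, x'). cc x x') ` (P \<times> P)))" using P(1) by simp
  have c0: "c > 0" unfolding c_def using fin cc by (subst Min_gr_iff) auto
  have c_le: "c \<le> cc x x'" if "x \<in> P" "x' \<in> P" for x x' unfolding c_def using fin that by (intro Min_le) auto
  define X where "X = (\<Sum>x\<in>P. norm x)"
  have X: "norm x \<le> X" if "x \<in> P" for x unfolding X_def using P(1) that by (intro member_le_sum) auto
  define B where "B = {g \<in> G. norm g \<le> 4 * (X * (1 + K) / \<epsilon>) * K}"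
  have finB: "finite B" unfolding B_def by (rule discrete)
  define lc where "lc = ln (1 + c)"
  have lc: "lc > 0" using c0 by (simp add: lc_def)
  define N where "N = real (card P * card P * card B) * (3 + 1 / lc)"
  have N0: "N \<ge> 0" using lc by (simp add: N_def)
  \<comment> \<open>\<open>A\<close> is kept abstract because the bound will also be applied to the
    inverse of \<open>\<eta>\<close>, with the inverse of the matrix \<open>R \<eta>\<close> in
    place of a value of \<open>R\<close>.\<close>
  have "\<bar>ev (Suc j)\<bar> < \<bar>ev j\<bar> \<and> finite (good_conjugates P K \<epsilon> \<eta> a b) \<and>
     real (card (good_conjugates P K \<epsilon> \<eta> a b)) \<le> N * (1 + ln (\<bar>ev j\<bar> / \<bar>ev (Suc j)\<bar>))"
    if \<eta>: "\<eta> \<in> G" and e: "eigpair \<eta> a b l" and ab: "det2 a b < 0" and A: "A' ** A = mat 1" "A ** A' = mat 1"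
      and eq: "\<forall>y\<in>fixed_vectors. \<zeta> (\<eta> *v y) = flag_act A (\<zeta> y)" and \<beta>: "compatible \<beta> (\<zeta> a) (\<zeta> b)"
      and ev: "\<forall>i<CARD('n). A *v \<beta> i = ev i *\<^sub>R \<beta> i \<and> ev i \<noteq> 0" and ne: "good_conjugates P K \<epsilon> \<eta> a b \<noteq> {}"
    for \<eta> a b l A A' \<beta> ev
  proof -
    define arc where "arc y \<longleftrightarrow> y \<in> fixed_vectors \<and> det2 a y < 0 \<and> det2 y b < 0" for y
    have abF: "a \<in> fixed_vectors" "b \<in> fixed_vectors" using fixed_pair[OF \<eta> e] by auto
    then have abL: "a \<in> L" "b \<in> L" using fixed_subset by auto
    have jc: "j < CARD('n)" using j by simp
    have arcL: "y \<in> L" if "arc y" for y using that fixed_subset by (auto simp: arc_def)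
    \<comment> \<open>With respect to the fixed basis \<open>\<beta>\<close> the ratio is a
      coordinate on the arc from \<open>a\<close> to \<open>b\<close>, increasing towards
      \<open>a\<close>.\<close>
    define wv where "wv y = (SOME w. w > 0 \<and> ratio_is \<beta> (\<zeta> a) (\<zeta> y) j w)" for y
    have wv: "wv y > 0" "ratio_is \<beta> (\<zeta> a) (\<zeta> y) j (wv y)" if "arc y" for y
    proof -
      have "\<exists>w. w > 0 \<and> ratio_is \<beta> (\<zeta> a) (\<zeta> y) j w"
        using positive_triple[OF triple[OF abL(1) arcL[OF that] abL(2)] \<beta> j] that ab by (auto simp: arc_def)
      from someI_ex[OF this] show "wv y > 0" "ratio_is \<beta> (\<zeta> a) (\<zeta> y) j (wv y)" by (auto simp: wv_def)
    qed
    have uniq: "wv y = w" if "arc y" "ratio_is \<beta> (\<zeta> a) (\<zeta> y) j w" for y w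
      using ratio_unique[OF abF(1) _ jc wv(2)[OF that(1)] that(2)] that(1) by (simp add: arc_def)
    have mono: "wv y < wv y'" if yy: "arc y" "arc y'" "det2 y' y < 0" for y y'
    proof -
      obtain w w' where w: "0 < w" "w < w'" "ratio_is \<beta> (\<zeta> a) (\<zeta> y) j w" "ratio_is \<beta> (\<zeta> a) (\<zeta> y') j w'"
        using positive_quad[OF quad[OF abL(1) arcL[OF yy(2)] arcL[OF yy(1)] abL(2)] \<beta> j] yy ab by (auto simp: arc_def)
      then show ?thesis using uniq yy by metis
    qed
    define q where "q = \<bar>ev j\<bar> / \<bar>ev (Suc j)\<bar>"
    have l: "l \<noteq> 0" "\<bar>l\<bar> > 1" "\<eta> *v a = l *\<^sub>R a" "\<eta> *v b = (1 / l) *\<^sub>R b" using e by (auto simp: eigpair_def)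
    \<comment> \<open>The lift with positive multiplier maps the arc to itself instead of to its
      negative.\<close>
    define \<eta>' where "\<eta>' = (if l > 0 then \<eta> else - \<eta>)"
    define m where "m = \<bar>l\<bar>"
    have m: "m > 1" using l by (simp add: m_def)
    have \<eta>'G: "\<eta>' \<in> G" using \<eta> neg by (simp add: \<eta>'_def)
    have \<eta>'v: "\<eta>' *v a = m *\<^sub>R a" "\<eta>' *v b = (1 / m) *\<^sub>R b" using l by (auto simp: \<eta>'_def m_def)
    have \<eta>'\<zeta>: "\<zeta> (\<eta>' *v y) = flag_act A (\<zeta> y)" if "y \<in> fixed_vectors" for y
    proof -
      have "\<eta> *v y \<in> L" using fixed_act[OF that \<eta>] fixed_subset by blast
      then have "\<zeta> (- (\<eta> *v y)) = \<zeta> (\<eta> *v y)" using L_scale[of "\<eta> *v y" "- 1"] by simp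
      then show ?thesis using eq that by (simp add: \<eta>'_def)
    qed
    have Ea: "flag_act A (\<zeta> a) = \<zeta> a"
      using eq abF(1) l L_scale[OF abL(1) l(1)] by metis
    have comm: "\<eta>' ** \<eta> = \<eta> ** \<eta>'" by (simp add: \<eta>'_def)
    have step: "arc (\<eta>' *v y) \<and> wv (\<eta>' *v y) = q * wv y" if y: "arc y" for y
    proof -
      have yF: "y \<in> fixed_vectors" using y by (simp add: arc_def)
      have "m * det2 a (\<eta>' *v y) = det2 (\<eta>' *v a) (\<eta>' *v y)" by (simp add: \<eta>'v)
      then have 1: "m * det2 a (\<eta>' *v y) = det2 a y" using \<eta>'G by simp
      have "(1 / m) * det2 (\<eta>' *v y) b = det2 (\<eta>' *v y) (\<eta>' *v b)" by (simp add: \<eta>'v)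
      then have 2: "(1 / m) * det2 (\<eta>' *v y) b = det2 y b" using \<eta>'G by simp
      have "m * det2 a (\<eta>' *v y) < 0" "(1 / m) * det2 (\<eta>' *v y) b < 0" using 1 2 y by (simp_all only: arc_def)
      then have "det2 a (\<eta>' *v y) < 0" "det2 (\<eta>' *v y) b < 0" using m by (simp_all add: mult_less_0_iff divide_less_0_iff)
      then have ar: "arc (\<eta>' *v y)" using fixed_act[OF yF \<eta>'G] by (simp add: arc_def)
      have "ratio_is \<beta> (\<zeta> a) (flag_act A (\<zeta> y)) j (q * wv y)"
        unfolding q_def by (rule ratio_is_act[OF A Ea _ _ _ j wv(2)[OF y]]) (use ev j in auto)
      then have "wv (\<eta>' *v y) = q * wv y" using uniq[OF ar] \<eta>'\<zeta>[OF yF] by simp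
      then show ?thesis using ar by blast
    qed
    have arc_h: "arc (matrix_inv h *v x)" "arc (matrix_inv h *v x')" if h: "h \<in> G" "x \<in> P" "x' \<in> P" "ordered4 (h *v a) x' x (h *v b)" for h x x'
      using that fixed_act[OF _ minv[OF h(1)]] P(2) ordered4_act[OF h(1), of a x' x b] by (auto simp: arc_def ordered4_def)
    obtain h1 x1 x1' where h1: "h1 \<in> G" "x1 \<in> P" "x1' \<in> P" "ordered4 (h1 *v a) x1' x1 (h1 *v b)"
      using ne by (auto simp: good_conjugates_def good_position_def)
    define y1 where "y1 = matrix_inv h1 *v x1"
    have y1: "arc y1" using arc_h[OF h1] by (simp add: y1_def)
    \<comment> \<open>\<open>\<eta>'\<close> moves points of the arc towards \<open>a\<close>, where
      the ratio is larger.\<close>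
    have q1: "q > 1"
    proof -
      have "det2 (\<eta>' *v y1) y1 < 0"
      proof -
        obtain \<alpha> \<gamma> where y: "y1 = \<alpha> *\<^sub>R a + \<gamma> *\<^sub>R b" "\<alpha> = det2 y1 b / det2 a b" "\<gamma> = det2 a y1 / det2 a b"
          using det2_basis[of a b] ab by (metis less_irrefl)
        have pos: "\<alpha> > 0" "\<gamma> > 0" using y(2,3) y1 ab by (auto simp: arc_def divide_neg_neg)
        have "det2 (\<eta>' *v y1) y1 = (\<alpha> * \<gamma>) * (m - 1 / m) * det2 a b"
          by (simp add: y(1) matrix_vector_right_distrib matrix_vector_mult_scaleR \<eta>'v det2_swap[of b a] algebra_simps)
        moreover have "m - 1 / m > 0"
        proof -
          have "1 / m < 1" using m by simp
          then show ?thesis using m by linarith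
        qed
        ultimately show ?thesis using pos ab by (simp add: mult_pos_neg)
      qed
      then have "wv y1 < q * wv y1" using mono[OF y1, of "\<eta>' *v y1"] step[OF y1] by simp
      then show ?thesis using wv(1)[OF y1] by simp
    qed
    \<comment> \<open>Powers of \<open>\<eta>'\<close> commute with \<open>\<eta>\<close>, so
      changing \<open>h\<close> by one of them does not change the conjugate; it only multiplies the
      coordinate by a power of \<open>q\<close>.\<close>
    have pw: "\<exists>E\<in>G. E ** \<eta> = \<eta> ** E \<and> (\<exists>t>0. E *v a = t *\<^sub>R a \<and> E *v b = (1 / t) *\<^sub>R b) \<and>
       (\<forall>y. arc y \<longrightarrow> arc (E *v y) \<and> wv (E *v y) = q ^ k * wv y)" for k
    proof (induction k)
      case 0
      have "\<exists>t>0. mat 1 *v a = t *\<^sub>R a \<and> mat 1 *v b = (1 / t) *\<^sub>R b" by (rule exI[of _ 1]) simp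
      then show ?case using one by (intro bexI[of _ "mat 1"]) simp_all
    next
      case (Suc k)
      then obtain E t where E: "E \<in> G" "E ** \<eta> = \<eta> ** E" "t > 0" "E *v a = t *\<^sub>R a" "E *v b = (1 / t) *\<^sub>R b"
        "\<And>y. arc y \<Longrightarrow> arc (E *v y) \<and> wv (E *v y) = q ^ k * wv y" by blast
      have c: "(\<eta>' ** E) ** \<eta> = \<eta> ** (\<eta>' ** E)"
      proof -
        have "(\<eta>' ** E) ** \<eta> = \<eta>' ** (\<eta> ** E)" unfolding E(2)[symmetric] by (simp add: matrix_mul_assoc)
        also have "\<dots> = (\<eta> ** \<eta>') ** E" unfolding comm[symmetric] by (simp add: matrix_mul_assoc)
        finally show ?thesis by (simp add: matrix_mul_assoc)
      qed
      have v: "(\<eta>' ** E) *v a = (m * t) *\<^sub>R a" "(\<eta>' ** E) *v b = (1 / (m * t)) *\<^sub>R b"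
        using E by (simp_all add: \<eta>'v matrix_vector_mult_scaleR mult.commute flip: matrix_vector_mul_assoc)
      have "arc ((\<eta>' ** E) *v y) \<and> wv ((\<eta>' ** E) *v y) = q ^ Suc k * wv y" if "arc y" for y
        using E(6)[OF that] step[of "E *v y"] by (simp add: matrix_vector_mul_assoc[symmetric])
      moreover have "m * t > 0" using m E(3) by simp
      ultimately show ?case using mult[OF \<eta>'G E(1)] c v by blast
    qed
    have pw': "\<exists>E\<in>G. E ** \<eta> = \<eta> ** E \<and> (\<exists>t>0. E *v a = t *\<^sub>R a \<and> E *v b = (1 / t) *\<^sub>R b) \<and> 
       (\<forall>y. arc (E *v y) \<longrightarrow> arc y \<longrightarrow> wv (E *v y) = wv y / q ^ k)" for k
    proof -
      obtain E t where E: "E \<in> G" "E ** \<eta> = \<eta> ** E" "t > 0" "E *v a = t *\<^sub>R a" "E *v b = (1 / t) *\<^sub>R b"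
        "\<And>y. arc y \<Longrightarrow> arc (E *v y) \<and> wv (E *v y) = q ^ k * wv y" using pw[of k] by blast
      have "matrix_inv E ** (E ** \<eta>) ** matrix_inv E = matrix_inv E ** (\<eta> ** E) ** matrix_inv E" using E(2) by simp
      moreover have "matrix_inv E ** (E ** \<eta>) ** matrix_inv E = (matrix_inv E ** E) ** \<eta> ** matrix_inv E"
        "matrix_inv E ** (\<eta> ** E) ** matrix_inv E = matrix_inv E ** \<eta> ** (E ** matrix_inv E)" by (simp_all add: matrix_mul_assoc)
      ultimately have c: "matrix_inv E ** \<eta> = \<eta> ** matrix_inv E" using E(1) by simp
      have "E *v ((1 / t) *\<^sub>R a) = a" "E *v (t *\<^sub>R b) = b" using E by (simp_all add: matrix_vector_mult_scaleR)
      then have v: "matrix_inv E *v a = (1 / t) *\<^sub>R a" "matrix_inv E *v b = (1 / (1 / t)) *\<^sub>R b"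
        using inv_mult(4)[OF E(1), of "(1 / t) *\<^sub>R a"] inv_mult(4)[OF E(1), of "t *\<^sub>R b"] by simp_all
      have "wv (matrix_inv E *v y) = wv y / q ^ k" if "arc (matrix_inv E *v y)" for y
        using E(6)[OF that] E(1) q1 by (simp add: field_simps)
      moreover have "1 / t > 0" using E(3) by simp
      ultimately show ?thesis using minv[OF E(1)] c v by blast
    qed
    define M where "M = nat \<lceil>ln q / lc\<rceil> + 1"
    \<comment> \<open>Intervals that contain the same \<open>(1 + c) ^ k\<close> overlap, which is
      the situation of \<open>same_key_close\<close>.\<close>
    define key where "key r x x' k h \<longleftrightarrow> h \<in> G \<and> r = h ** \<eta> ** matrix_inv h \<and> ordered4 (h *v a) x' x (h *v b) \<and> spread K \<epsilon> (h *v a) x' x (h *v b) \<and>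
      wv (matrix_inv h *v x) \<le> (1 + c) ^ k \<and> (1 + c) ^ k \<le> wv (matrix_inv h *v x')" for r x x' and k :: nat and h
    have has_key: "\<exists>x\<in>P. \<exists>x'\<in>P. \<exists>k\<le>M. \<exists>h. key r x x' k h" if r: "r \<in> good_conjugates P K \<epsilon> \<eta> a b" for r
    proof -
      obtain h0 x x' where h0: "h0 \<in> G" "r = h0 ** \<eta> ** matrix_inv h0" and x: "x \<in> P" "x' \<in> P"
        and o0: "ordered4 (h0 *v a) x' x (h0 *v b)" "spread K \<epsilon> (h0 *v a) x' x (h0 *v b)"
        using r by (auto simp: good_conjugates_def good_position_def)
      have ar: "arc (matrix_inv h0 *v x)" using arc_h[OF h0(1) x o0(1)] by blast
      have "\<exists>E\<in>G. E ** \<eta> = \<eta> ** E \<and> (\<exists>t>0. E *v a = t *\<^sub>R a \<and> E *v b = (1 / t) *\<^sub>R b) \<and>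
         (arc (E *v (matrix_inv h0 *v x)) \<longrightarrow> 1 \<le> wv (E *v (matrix_inv h0 *v x)) \<and> wv (E *v (matrix_inv h0 *v x)) < q)"
        using real_between_powers[OF q1 wv(1)[OF ar]] pw pw' ar by metis
      then obtain E t where E: "E \<in> G" "E ** \<eta> = \<eta> ** E" "t > 0" "E *v a = t *\<^sub>R a" "E *v b = (1 / t) *\<^sub>R b"
        "arc (E *v (matrix_inv h0 *v x)) \<Longrightarrow> 1 \<le> wv (E *v (matrix_inv h0 *v x)) \<and> wv (E *v (matrix_inv h0 *v x)) < q" by blast
      \<comment> \<open>The representative of the conjugate whose interval begins with a coordinate
        in \<open>[1, q)\<close>.\<close>
      define h where "h = h0 ** matrix_inv E"
      have hG: "h \<in> G" using h0 E minv mult by (simp add: h_def)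
      have hi: "matrix_inv h = E ** matrix_inv h0"
      proof -
        have "h ** (E ** matrix_inv h0) = h0 ** (matrix_inv E ** E) ** matrix_inv h0" by (simp add: h_def matrix_mul_assoc)
        then have "h ** (E ** matrix_inv h0) = mat 1" using E(1) h0(1) by simp
        then have "matrix_inv h ** (h ** (E ** matrix_inv h0)) = matrix_inv h" by simp
        then show ?thesis using hG by (simp add: matrix_mul_assoc)
      qed
      have rh: "r = h ** \<eta> ** matrix_inv h"
      proof -
        have "h ** \<eta> ** matrix_inv h = h0 ** matrix_inv E ** (\<eta> ** E) ** matrix_inv h0" unfolding hi unfolding h_def by (simp add: matrix_mul_assoc)
        also have "\<dots> = h0 ** (matrix_inv E ** E) ** \<eta> ** matrix_inv h0" unfolding E(2)[symmetric] by (simp add: matrix_mul_assoc)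
        finally show ?thesis using E(1) h0(2) by simp
      qed
      have "E *v ((1 / t) *\<^sub>R a) = a" "E *v (t *\<^sub>R b) = b" using E by (simp_all add: matrix_vector_mult_scaleR)
      then have "matrix_inv E *v a = (1 / t) *\<^sub>R a" "matrix_inv E *v b = t *\<^sub>R b" using inv_mult(4)[OF E(1)] by metis+
      then have hv: "h *v a = (1 / t) *\<^sub>R (h0 *v a)" "h *v b = t *\<^sub>R (h0 *v b)"
        by (simp_all add: h_def matrix_vector_mult_scaleR flip: matrix_vector_mul_assoc)
      have o: "ordered4 (h *v a) x' x (h *v b)" using o0(1) E(3) by (simp add: hv ordered4_def divide_less_0_iff mult_less_0_iff)
      have sp: "spread K \<epsilon> (h *v a) x' x (h *v b)" using o0(2) E(3) by (simp add: hv spread_def abs_mult field_simps)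
      have ar2: "arc (matrix_inv h *v x)" "arc (matrix_inv h *v x')" using arc_h[OF hG x o] by auto
      define w where "w = wv (matrix_inv h *v x)"
      have w: "1 \<le> w" "w < q" using E(6) ar2(1) by (simp_all add: w_def hi matrix_vector_mul_assoc)
      have "(1 + cc x x') * w \<le> wv (matrix_inv h *v x')"
        unfolding w_def using cc[OF x] x P(2)
        by (intro gap_transport[OF hG abF _ _ o sp _ _ \<beta> j wv(2)[OF ar2(1)] wv(2)[OF ar2(2)]]) auto
      moreover have "(1 + c) * w \<le> (1 + cc x x') * w" using c_le[OF x] w by (intro mult_right_mono) auto
      ultimately have gap: "(1 + c) * w \<le> wv (matrix_inv h *v x')" by linarith
      \<comment> \<open>The least exponent with \<open>w \<le> (1 + c) ^ k\<close>; the power is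
        then at most \<open>(1 + c) * w\<close>, which still belongs to the interval.\<close>
      define k where "k = nat \<lceil>ln w / lc\<rceil>"
      have lw: "ln w \<ge> 0" using w by simp
      then have kr: "real k = of_int \<lceil>ln w / lc\<rceil>" using lc by (simp add: k_def)
      have "ln w / lc \<le> real k" "real k \<le> ln w / lc + 1" unfolding kr by linarith+
      then have kb: "ln w \<le> real k * lc" "real k * lc \<le> ln w + lc" using lc by (simp_all add: field_simps)
      have pk: "(1 + c) ^ k = exp (real k * lc)" using c0 by (simp add: exp_of_nat_mult lc_def)
      have "exp (ln w) \<le> (1 + c) ^ k" unfolding pk using kb by simp
      then have k1: "w \<le> (1 + c) ^ k" using w by simp
      have "(1 + c) ^ k \<le> exp (ln w + lc)" unfolding pk using kb by simp
      then have k2: "(1 + c) ^ k \<le> (1 + c) * w" using w c0 by (simp add: exp_add lc_def mult.commute)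
      have "ln w / lc \<le> ln q / lc" using w q1 lc by (intro divide_right_mono) auto
      then have "nat \<lceil>ln w / lc\<rceil> \<le> nat \<lceil>ln q / lc\<rceil>" by (intro nat_mono ceiling_mono)
      then have "k \<le> M" unfolding k_def M_def by simp
      moreover have "key r x x' k h" unfolding key_def using hG rh o sp k1 k2 gap by (auto simp: w_def)
      ultimately show ?thesis using x by blast
    qed
    have fibre: "\<exists>r0. {r. \<exists>h. key r x x' k h} \<subseteq> (\<lambda>g. g ** r0 ** matrix_inv g) ` B" if x: "x \<in> P" "x' \<in> P" for x x' k
    proof (cases "{r. \<exists>h. key r x x' k h} = {}")
      case False
      then obtain r0 h0 where k0: "key r0 x x' k h0" by blast
      have "r \<in> (\<lambda>g. g ** r0 ** matrix_inv g) ` B" if kr: "key r x x' k h" for r h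
      proof -
        have hG: "h \<in> G" "h0 \<in> G" using kr k0 by (auto simp: key_def)
        have ar: "arc (matrix_inv h *v x)" "arc (matrix_inv h *v x')" "arc (matrix_inv h0 *v x)" "arc (matrix_inv h0 *v x')"
          using arc_h[OF hG(1) x] arc_h[OF hG(2) x] kr k0 by (auto simp: key_def)
        have le: "\<not> det2 (matrix_inv h *v x) (matrix_inv h0 *v x') < 0" "\<not> det2 (matrix_inv h0 *v x) (matrix_inv h *v x') < 0"
          using mono[OF ar(4,1)] mono[OF ar(2,3)] kr k0 by (auto simp: key_def)
        have "norm (h ** matrix_inv h0) \<le> 4 * (X * (1 + K) / \<epsilon>) * K"
          by (rule same_key_close[OF hG ab \<epsilon> X[OF x(1)] X[OF x(2)] X[OF x(1)] X[OF x(2)] _ _ _ _ le]) (use kr k0 in \<open>auto simp: key_def\<close>)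
        then have gB: "h ** matrix_inv h0 \<in> B" using hG mult minv by (simp add: B_def)
        define g where "g = h ** matrix_inv h0"
        have gG: "g \<in> G" using gB by (simp add: g_def B_def)
        have gi: "matrix_inv g = h0 ** matrix_inv h"
        proof -
          have "g ** (h0 ** matrix_inv h) = h ** (matrix_inv h0 ** h0) ** matrix_inv h" by (simp add: g_def matrix_mul_assoc)
          then have "g ** (h0 ** matrix_inv h) = mat 1" using hG by simp
          then have "matrix_inv g ** (g ** (h0 ** matrix_inv h)) = matrix_inv g" by simp
          then show ?thesis using gG by (simp add: matrix_mul_assoc)
        qed
        have "g ** r0 ** matrix_inv g = h ** (matrix_inv h0 ** h0) ** \<eta> ** (matrix_inv h0 ** h0) ** matrix_inv h"
        proof -
          have r0: "r0 = h0 ** \<eta> ** matrix_inv h0" using k0 by (simp add: key_def)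
          show ?thesis unfolding gi r0 unfolding g_def by (simp only: matrix_mul_assoc)
        qed
        then have "g ** r0 ** matrix_inv g = r" using hG kr by (simp add: key_def)
        then show ?thesis using gB unfolding g_def by blast
      qed
      then show ?thesis by blast
    qed auto
    have fin_card: "finite {r. \<exists>h. key r x x' k h} \<and> card {r. \<exists>h. key r x x' k h} \<le> card B" if xx: "x \<in> P" "x' \<in> P" for x x' k
    proof -
      obtain r0 where r0: "{r. \<exists>h. key r x x' k h} \<subseteq> (\<lambda>g. g ** r0 ** matrix_inv g) ` B" using fibre[OF xx] by blast
      have "card {r. \<exists>h. key r x x' k h} \<le> card ((\<lambda>g. g ** r0 ** matrix_inv g) ` B)" using r0 finB by (intro card_mono) auto
      also have "\<dots> \<le> card B" using finB by (rule card_image_le)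
      finally show ?thesis using r0 finB finite_subset by blast
    qed
    define I where "I = P \<times> P \<times> {..M}"
    define Fb where "Fb = (\<lambda>(x, x', k). {r. \<exists>h. key r x x' k h})"
    have finI: "finite I" using P(1) by (simp add: I_def)
    have sub: "good_conjugates P K \<epsilon> \<eta> a b \<subseteq> (\<Union>i\<in>I. Fb i)"
    proof
      fix r assume "r \<in> good_conjugates P K \<epsilon> \<eta> a b"
      then obtain x x' k h where "x \<in> P" "x' \<in> P" "k \<le> M" "key r x x' k h" using has_key by blast
      then show "r \<in> (\<Union>i\<in>I. Fb i)" by (intro UN_I[of "(x, x', k)"]) (auto simp: I_def Fb_def)
    qed
    have finU: "finite (\<Union>i\<in>I. Fb i)" using finI fin_card by (auto simp: I_def Fb_def)
    have "card (good_conjugates P K \<epsilon> \<eta> a b) \<le> card (\<Union>i\<in>I. Fb i)" using sub finU by (rule card_mono[rotated])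
    also have "\<dots> \<le> (\<Sum>i\<in>I. card (Fb i))" using finI by (rule card_UN_le)
    also have "\<dots> \<le> (\<Sum>i\<in>I. card B)" using fin_card by (intro sum_mono) (auto simp: I_def Fb_def)
    also have "\<dots> = card P * card P * card B * (M + 1)" by (simp add: I_def card_cartesian_product algebra_simps)
    finally have "real (card (good_conjugates P K \<epsilon> \<eta> a b)) \<le> real (card P * card P * card B * (M + 1))" by (rule of_nat_mono)
    also have "\<dots> = real (card P * card P * card B) * (real M + 1)" by (simp add: algebra_simps)
    also have "\<dots> \<le> real (card P * card P * card B) * ((3 + 1 / lc) * (1 + ln q))"
    proof (rule mult_left_mono)
      have "ln q \<ge> 0" using q1 by simp
      then have "real (nat \<lceil>ln q / lc\<rceil>) \<le> ln q / lc + 1" using lc by simp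
      then have "real M + 1 \<le> 3 + ln q / lc" by (simp add: M_def)
      also have "\<dots> \<le> (3 + 1 / lc) * (1 + ln q)" using \<open>ln q \<ge> 0\<close> lc by (simp add: algebra_simps)
      finally show "real M + 1 \<le> (3 + 1 / lc) * (1 + ln q)" .
    qed simp
    finally have "real (card (good_conjugates P K \<epsilon> \<eta> a b)) \<le> N * (1 + ln q)" by (simp add: N_def mult.assoc)
    moreover have "\<bar>ev (Suc j)\<bar> < \<bar>ev j\<bar>"
    proof -
      have "\<bar>ev (Suc j)\<bar> > 0" using ev j by simp
      then show ?thesis using q1 by (simp add: q_def less_divide_eq)
    qed
    moreover have "finite (good_conjugates P K \<epsilon> \<eta> a b)" using sub finU by (rule finite_subset)
    ultimately show ?thesis by (simp add: q_def)
  qed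
  then show ?thesis using N0 by blast
qed

section \<open>Fixed points in general position\<close>

lemma fixed_nonempty: "fixed_vectors \<noteq> {}"
proof -
  obtain F K where F: "F \<subseteq> G" "\<forall>g\<in>G. \<exists>f\<in>F. sep K (g ** f)" using finite_hyperbolizing by blast
  then obtain f where f: "f \<in> F" "sep K (mat 1 ** f)" using one by blast
  then have "f \<in> G" using F by blast
  moreover obtain a b l where "eigpair f a b l" using f(2) by (auto simp: sep_def)
  ultimately show ?thesis unfolding fixed_vectors_def by blast
qed

lemma many_fixed_vectors: "\<exists>P. finite P \<and> P \<subseteq> fixed_vectors \<and> card P = n \<and> (\<forall>x\<in>P. \<forall>y\<in>P. x \<noteq> y \<longrightarrow> det2 x y \<noteq> 0)"
proof (induction n)
  case 0
  then show ?case by (intro exI[of _ "{}"]) auto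
next
  case (Suc n)
  then obtain P where P: "finite P" "P \<subseteq> fixed_vectors" "card P = n" "\<forall>x\<in>P. \<forall>y\<in>P. x \<noteq> y \<longrightarrow> det2 x y \<noteq> 0" by blast
  obtain v where v: "v \<in> fixed_vectors" using fixed_nonempty by blast
  have nz: "v \<noteq> 0" "0 \<notin> P" using v P(2) fixed_subset L_nz by auto
  obtain g where g: "g \<in> G" "\<forall>w\<in>P. det2 (g *v v) w \<noteq> 0" using orbits[OF nz(1) P(1) nz(2)] by blast
  have "g *v v \<notin> P" using g(2) by force
  moreover have "det2 w (g *v v) \<noteq> 0" if "w \<in> P" for w using g(2) that det2_swap[of w "g *v v"] by auto
  ultimately show ?case using P g fixed_act[OF v g(1)] by (intro exI[of _ "insert (g *v v) P"]) auto
qed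

text \<open>Of five fixed points at least three are far from \<open>a\<close> and \<open>b\<close>, and two of these lie on the same
  side of the axis.\<close>

lemma good_position_exists:
  "\<exists>P \<epsilon>. finite P \<and> P \<subseteq> fixed_vectors \<and> \<epsilon> > 0 \<and>
     (\<forall>a b. det2 a b < 0 \<longrightarrow> norm a * norm b \<le> K * \<bar>det2 a b\<bar> \<longrightarrow> good_position P K \<epsilon> a b \<or> good_position P K \<epsilon> b (- a))"
proof -
  obtain P where P: "finite P" "P \<subseteq> fixed_vectors" "card P = 5" "\<And>x y. x \<in> P \<Longrightarrow> y \<in> P \<Longrightarrow> x \<noteq> y \<Longrightarrow> det2 x y \<noteq> 0"
    using many_fixed_vectors[of 5] by blast
  define Ds where "Ds = insert 1 ((\<lambda>(x, y). \<bar>det2 x y\<bar>) ` {(x, y) \<in> P \<times> P. x \<noteq> y})"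
  define D where "D = Min Ds"
  have "finite {(x, y) \<in> P \<times> P. x \<noteq> y}" by (rule finite_subset[of _ "P \<times> P"]) (use P(1) in auto)
  then have finD: "finite Ds" by (simp add: Ds_def)
  have "D > 0" unfolding D_def using finD P(4) by (subst Min_gr_iff) (auto simp: Ds_def)
  have Dle: "D \<le> \<bar>det2 x y\<bar>" if "x \<in> P" "y \<in> P" "x \<noteq> y" for x y
    unfolding D_def using finD that by (intro Min_le) (auto simp: Ds_def)
  define X where "X = 1 + (\<Sum>x\<in>P. norm x)"
  have s0: "(\<Sum>x\<in>P. norm x) \<ge> 0" by (intro sum_nonneg) auto
  then have X0: "X > 0" by (simp add: X_def)
  have X: "norm x < X" if "x \<in> P" for x
    using member_le_sum[of x P norm] that P(1) by (simp add: X_def)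
  \<comment> \<open>Two distinct points of \<open>P\<close> cannot both be this close to one
    direction: by \<open>det2_expansion\<close> their \<open>det2\<close> would be smaller than
    \<open>D\<close> in modulus.\<close>
  define \<epsilon> where "\<epsilon> = D / (2 * X)"
  have \<epsilon>: "\<epsilon> > 0" using \<open>D > 0\<close> X0 by (simp add: \<epsilon>_def)
  have bad: "x = y" if xy: "x \<in> P" "y \<in> P" "\<bar>det2 a x\<bar> < \<epsilon> * norm a" "\<bar>det2 a y\<bar> < \<epsilon> * norm a" for a x y
  proof (rule ccontr)
    assume ne: "x \<noteq> y"
    have "\<bar>det2 x y\<bar> * norm a = norm (det2 a y *\<^sub>R x + det2 x a *\<^sub>R y)"
      unfolding det2_expansion[symmetric] by simp
    also have "\<dots> \<le> \<bar>det2 a y\<bar> * norm x + \<bar>det2 a x\<bar> * norm y"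
      using norm_triangle_ineq[of "det2 a y *\<^sub>R x" "det2 x a *\<^sub>R y"] det2_swap[of x a] by simp
    also have "\<dots> < (\<epsilon> * norm a) * X + (\<epsilon> * norm a) * X"
      using xy X[OF xy(1)] X[OF xy(2)] by (intro add_strict_mono mult_strict_mono') auto
    also have "\<dots> = D * norm a" using X0 by (simp add: \<epsilon>_def)
    finally have "\<bar>det2 x y\<bar> * norm a < D * norm a" .
    moreover have "D * norm a \<le> \<bar>det2 x y\<bar> * norm a" using Dle[OF xy(1,2) ne] by (intro mult_right_mono) auto
    ultimately show False by simp
  qed
  \<comment> \<open>Both signs are included, so that a representative with
    \<open>det2 a x < 0\<close> is always at hand.\<close>
  define P' where "P' = P \<union> uminus ` P"
  have "finite P'" using P(1) by (simp add: P'_def)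
  moreover have "P' \<subseteq> fixed_vectors"
  proof
    fix x assume "x \<in> P'"
    then show "x \<in> fixed_vectors" using P(2) fixed_scale[of _ "-1"] by (auto simp: P'_def)
  qed
  moreover have "good_position P' K \<epsilon> a b \<or> good_position P' K \<epsilon> b (- a)" if ab: "det2 a b < 0" "norm a * norm b \<le> K * \<bar>det2 a b\<bar>" for a b
  proof -
    define bad_set where "bad_set u = {x \<in> P. \<bar>det2 u x\<bar> < \<epsilon> * norm u}" for u
    have cb: "card (bad_set u) \<le> 1" for u
    proof (cases "bad_set u = {}")
      case False
      then obtain x where "x \<in> bad_set u" by blast
      then have "bad_set u \<subseteq> {x}" using bad by (auto simp: bad_set_def)
      then show ?thesis using card_mono[of "{x}" "bad_set u"] by simp
    qed simp
    have "card (bad_set a \<union> bad_set b) \<le> 2" using card_Un_le[of "bad_set a" "bad_set b"] cb[of a] cb[of b] by linarith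
    moreover have fb: "finite (bad_set a \<union> bad_set b)" "bad_set a \<union> bad_set b \<subseteq> P" using P(1) by (auto simp: bad_set_def)
    ultimately have "card (P - (bad_set a \<union> bad_set b)) \<ge> 3" using P(3) by (simp add: card_Diff_subset)
    then obtain T where T: "T \<subseteq> P - (bad_set a \<union> bad_set b)" "card T = 3" by (meson obtain_subset_with_card_n)
    then obtain x1 x2 x3 where x: "T = {x1, x2, x3}" "x1 \<noteq> x2" "x1 \<noteq> x3" "x2 \<noteq> x3" by (auto simp: card_3_iff)
    define s where "s x = (if det2 a x < 0 then x else - x)" for x
    have ok: "\<epsilon> * norm a \<le> \<bar>det2 a x\<bar>" "\<epsilon> * norm b \<le> \<bar>det2 b x\<bar>" "x \<in> P" if "x \<in> T" for x
      using that T(1) by (auto simp: bad_set_def)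
    have na: "norm a > 0" "norm b > 0" using ab(1) by auto
    have s: "s x \<in> P'" "det2 a (s x) < 0" "\<epsilon> * norm a \<le> \<bar>det2 a (s x)\<bar>" "\<epsilon> * norm b \<le> \<bar>det2 (s x) b\<bar>" "det2 (s x) b \<noteq> 0" if "x \<in> T" for x
    proof -
      have "\<epsilon> * norm a > 0" "\<epsilon> * norm b > 0" using \<epsilon> na by auto
      then have nz: "det2 a x \<noteq> 0" "det2 b x \<noteq> 0" using ok[OF that] by auto
      show "s x \<in> P'" using ok(3)[OF that] by (simp add: s_def P'_def)
      show "det2 a (s x) < 0" using nz(1) by (simp add: s_def)
      have "\<bar>det2 a (s x)\<bar> = \<bar>det2 a x\<bar>" by (simp add: s_def)
      then show "\<epsilon> * norm a \<le> \<bar>det2 a (s x)\<bar>" using ok(1)[OF that] by (simp only:)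
      have "\<bar>det2 x b\<bar> = \<bar>det2 b x\<bar>" unfolding det2_swap[of x b] by simp
      moreover have "\<bar>det2 (s x) b\<bar> = \<bar>det2 x b\<bar>" by (simp add: s_def)
      ultimately have sb: "\<bar>det2 (s x) b\<bar> = \<bar>det2 b x\<bar>" by simp
      then show "\<epsilon> * norm b \<le> \<bar>det2 (s x) b\<bar>" using ok(2)[OF that] by (simp only:)
      show "det2 (s x) b \<noteq> 0" using nz(2) sb by auto
    qed
    have ne: "det2 (s x) (s y) \<noteq> 0" if "x \<in> T" "y \<in> T" "x \<noteq> y" for x y
      using P(4)[OF ok(3)[OF that(1)] ok(3)[OF that(2)] that(3)] by (simp add: s_def)
    have "\<exists>x\<in>T. \<exists>y\<in>T. x \<noteq> y \<and> (det2 (s x) b < 0 \<longleftrightarrow> det2 (s y) b < 0)" using x by auto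
    then obtain x y where xy: "x \<in> T" "y \<in> T" "x \<noteq> y" "det2 (s x) b < 0 \<longleftrightarrow> det2 (s y) b < 0" by blast
    have fin: ?thesis if uv: "u \<in> T" "v \<in> T" "det2 (s u) (s v) < 0" "det2 (s u) b < 0 \<longleftrightarrow> det2 (s v) b < 0" for u v
    proof (cases "det2 (s u) b < 0")
      case True
      have "ordered4 a (s u) (s v) b" using True uv s[OF uv(1)] s[OF uv(2)] ab by (simp add: ordered4_def)
      moreover have "spread K \<epsilon> a (s u) (s v) b" using s[OF uv(1)] s[OF uv(2)] ab by (simp add: spread_def)
      ultimately show ?thesis using s(1)[OF uv(1)] s(1)[OF uv(2)] unfolding good_position_def by blast
    next
      case False
      have pos: "det2 (s u) b > 0" "det2 (s v) b > 0" using False uv(4) s(5)[OF uv(1)] s(5)[OF uv(2)] by auto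
      have sw: "det2 b (s u) = - det2 (s u) b" "det2 b (s v) = - det2 (s v) b" "det2 b a = - det2 a b" "det2 (s u) a = - det2 a (s u)" "det2 (s v) a = - det2 a (s v)"
        by (rule det2_swap)+
      have "ordered4 b (s u) (s v) (- a)" using pos uv s[OF uv(1)] s[OF uv(2)] ab by (simp add: ordered4_def sw)
      moreover have "spread K \<epsilon> b (s u) (s v) (- a)" using s[OF uv(1)] s[OF uv(2)] ab by (simp add: spread_def sw mult.commute)
      ultimately show ?thesis using s(1)[OF uv(1)] s(1)[OF uv(2)] unfolding good_position_def by blast
    qed
    show ?thesis
    proof (cases "det2 (s x) (s y) < 0")
      case True
      then show ?thesis using fin[OF xy(1,2)] xy(4) by blast
    next
      case False
      then have "det2 (s y) (s x) < 0" using ne[OF xy(1-3)] det2_swap[of "s y" "s x"] by simp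
      then show ?thesis using fin[OF xy(2,1)] xy(4) by blast
    qed
  qed
  ultimately show ?thesis using \<epsilon> by blast
qed

section \<open>Diagonalizing the images of separated elements\<close>

lemma eigpair_unique:
  assumes "eigpair M a b l" "eigpair M a1 b1 l1"
  shows "\<exists>c. c \<noteq> 0 \<and> a1 = c *\<^sub>R a" "\<exists>c. c \<noteq> 0 \<and> b1 = c *\<^sub>R b"
proof -
  have e: "det2 a b \<noteq> 0" "M *v a = l *\<^sub>R a" "M *v b = (1 / l) *\<^sub>R b" "\<bar>l\<bar> > 1" "l \<noteq> 0" using assms(1) by (auto simp: eigpair_def)
  have e1: "det2 a1 b1 \<noteq> 0" "M *v a1 = l1 *\<^sub>R a1" "M *v b1 = (1 / l1) *\<^sub>R b1" "\<bar>l1\<bar> > 1" "l1 \<noteq> 0" using assms(2) by (auto simp: eigpair_def)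
  have le: "\<bar>1 / l\<bar> < 1" "\<bar>1 / l1\<bar> < 1" using e e1 by auto
  have eig: "m * det2 v b = l * det2 v b" "m * det2 a v = (1 / l) * det2 a v" if "M *v v = m *\<^sub>R v" for v m
  proof -
    obtain \<alpha> \<gamma> where v: "v = \<alpha> *\<^sub>R a + \<gamma> *\<^sub>R b" using det2_basis[OF e(1)] by metis
    have "M *v v = (\<alpha> * l) *\<^sub>R a + (\<gamma> * (1 / l)) *\<^sub>R b"
      unfolding v by (simp add: matrix_vector_right_distrib matrix_vector_mult_scaleR e)
    then have "m *\<^sub>R v = (\<alpha> * l) *\<^sub>R a + (\<gamma> * (1 / l)) *\<^sub>R b" using that by simp
    then have "det2 (m *\<^sub>R v) b = \<alpha> * l * det2 a b" "det2 a (m *\<^sub>R v) = \<gamma> * (1 / l) * det2 a b" by simp_all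
    moreover have "det2 v b = \<alpha> * det2 a b" "det2 a v = \<gamma> * det2 a b" unfolding v by simp_all
    ultimately show "m * det2 v b = l * det2 v b" "m * det2 a v = (1 / l) * det2 a v" by simp_all
  qed
  have "l1 \<noteq> 1 / l" using le e1 by auto
  moreover have "(l1 - 1 / l) * det2 a a1 = 0" using eig(2)[OF e1(2)] by (simp add: left_diff_distrib)
  ultimately have "det2 a a1 = 0" by simp
  moreover have "a \<noteq> 0" "a1 \<noteq> 0" "b \<noteq> 0" "b1 \<noteq> 0" using e(1) e1(1) by auto
  ultimately show "\<exists>c. c \<noteq> 0 \<and> a1 = c *\<^sub>R a" using det2_0_parallel[of a a1] by force
  have "1 / l1 \<noteq> l" using le e by auto
  moreover have "(1 / l1 - l) * det2 b1 b = 0" using eig(1)[OF e1(3)] by (simp add: left_diff_distrib)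
  ultimately have "det2 b1 b = 0" by simp
  then have "det2 b b1 = 0" using det2_swap[of b b1] by simp
  then show "\<exists>c. c \<noteq> 0 \<and> b1 = c *\<^sub>R b" using det2_0_parallel[of b b1] \<open>b \<noteq> 0\<close> \<open>b1 \<noteq> 0\<close> by force
qed

lemma sep_eigpair: "sep K M \<Longrightarrow> eigpair M a b l \<Longrightarrow> norm a * norm b \<le> K * \<bar>det2 a b\<bar>"
proof -
  assume s: "sep K M" and e: "eigpair M a b l"
  obtain a1 b1 l1 where e1: "eigpair M a1 b1 l1" "norm a1 * norm b1 \<le> K * \<bar>det2 a1 b1\<bar>" using s by (auto simp: sep_def)
  obtain c c' where c: "c \<noteq> 0" "a1 = c *\<^sub>R a" "c' \<noteq> 0" "b1 = c' *\<^sub>R b" using eigpair_unique[OF e e1(1)] by blast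
  have "\<bar>c * c'\<bar> * (norm a * norm b) \<le> \<bar>c * c'\<bar> * (K * \<bar>det2 a b\<bar>)" using e1(2) c by (simp add: abs_mult mult_ac)
  then show ?thesis using c(1,3) by simp
qed

text \<open>\<open>\<eta>\<close> fixes both boundary points, so \<open>R \<eta>\<close> preserves
  both flags and hence the lines \<open>\<zeta> a (Suc i) \<inter> \<zeta> b (CARD('n) - i)\<close>,
  which are spanned by the basis vectors.\<close>

lemma R_eigenbasis:
  assumes \<eta>: "\<eta> \<in> G" and e: "eigpair \<eta> a b l" and \<beta>: "compatible \<beta> (\<zeta> a) (\<zeta> b)"
  shows "\<exists>ev. \<forall>i<CARD('n). R \<eta> *v \<beta> i = ev i *\<^sub>R \<beta> i \<and> ev i \<noteq> 0"
proof -
  have ab: "a \<in> fixed_vectors" "b \<in> fixed_vectors" using fixed_pair[OF \<eta> e] by auto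
  then have abL: "a \<in> L" "b \<in> L" using fixed_subset by auto
  have l: "l \<noteq> 0" "1 / l \<noteq> 0" "\<eta> *v a = l *\<^sub>R a" "\<eta> *v b = (1 / l) *\<^sub>R b" using e by (auto simp: eigpair_def)
  have "flag_act (R \<eta>) (\<zeta> a) = \<zeta> a" "flag_act (R \<eta>) (\<zeta> b) = \<zeta> b"
    using equivariant[OF \<eta>] abL l L_scale[OF abL(1) l(1)] L_scale[OF abL(2) l(2)] by metis+
  then have inva: "v \<in> \<zeta> a k \<Longrightarrow> R \<eta> *v v \<in> \<zeta> a k" and invb: "v \<in> \<zeta> b k \<Longrightarrow> R \<eta> *v v \<in> \<zeta> b k" for v k
    unfolding flag_act_def by (metis imageI)+
  have "\<exists>t. R \<eta> *v \<beta> i = t *\<^sub>R \<beta> i" if i: "i < CARD('n)" for i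
    by (rule compatible_line[OF \<beta> fixed_flag[OF ab(1)] fixed_flag[OF ab(2)] i])
      (use compatible_nonzero[OF \<beta> i] inva invb in blast)+
  then obtain ev where ev: "\<And>i. i < CARD('n) \<Longrightarrow> R \<eta> *v \<beta> i = ev i *\<^sub>R \<beta> i" by metis
  have "ev i \<noteq> 0" if i: "i < CARD('n)" for i
  proof
    assume "ev i = 0"
    then have "R \<eta> *v \<beta> i = 0" using ev[OF i] by simp
    then have "matrix_inv (R \<eta>) *v (R \<eta> *v \<beta> i) = 0" by simp
    then have "\<beta> i = 0" using R_inverse[OF \<eta>] by (simp add: matrix_vector_mul_assoc)
    then show False using compatible_nonzero(1)[OF \<beta> i] by simp
  qed
  then show ?thesis using ev by blast
qed

lemma colmat_diag:
  assumes \<beta>: "ordered_basis (\<beta> :: nat \<Rightarrow> real^'n)" and ev: "\<And>i. i < CARD('n) \<Longrightarrow> A *v \<beta> i = ev i *\<^sub>R \<beta> i"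
  shows "A ** colmat \<beta> = colmat \<beta> ** diagm (\<lambda>i. ev (nidx i))" "\<exists>Q. colmat \<beta> ** Q = mat 1"
proof -
  have "(A ** colmat \<beta>) $ i $ k = (colmat \<beta> ** diagm (\<lambda>i. ev (nidx i))) $ i $ k" for i k
  proof -
    have "(A ** colmat \<beta>) $ i $ k = (A *v \<beta> (nidx k)) $ i"
      by (simp add: matrix_matrix_mult_def matrix_vector_mult_def colmat_nidx)
    also have "\<dots> = ev (nidx k) * \<beta> (nidx k) $ i" using ev[of "nidx k"] by simp
    also have "\<dots> = (colmat \<beta> ** diagm (\<lambda>i. ev (nidx i))) $ i $ k"
      by (simp add: matrix_matrix_mult_def diagm_def colmat_nidx if_distrib cong: if_cong)
    finally show ?thesis .
  qed
  then show "A ** colmat \<beta> = colmat \<beta> ** diagm (\<lambda>i. ev (nidx i))" by (simp add: vec_eq_iff)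
  show "\<exists>Q. colmat \<beta> ** Q = mat 1" using \<beta> colmat_invertible[of \<beta>] by (metis invertible_det_nz invertible_right_inverse)
qed

lemma eigenvalue_moduli_nth:
  assumes \<beta>: "ordered_basis (\<beta> :: nat \<Rightarrow> real^'n)" and ev: "\<And>i. i < CARD('n) \<Longrightarrow> A *v \<beta> i = ev i *\<^sub>R \<beta> i"
    and decr: "\<And>i. Suc i < CARD('n) \<Longrightarrow> \<bar>ev (Suc i)\<bar> < \<bar>ev i\<bar>" and k: "k < CARD('n)"
  shows "eigenvalue_moduli A ! k = \<bar>ev k\<bar>"
proof -
  obtain Q where Q: "colmat \<beta> ** Q = mat 1" using colmat_diag(2)[where A = A, OF \<beta> ev] by metis
  have e: "eigenvalue_moduli A = decr_list (\<lambda>i::'n. \<bar>ev (nidx i)\<bar>)"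
    by (rule eigenvalue_moduli_similar[OF colmat_diag(1)[OF \<beta> ev] Q])
  define c :: "nat \<Rightarrow> 'n" where "c = inv_into UNIV nidx"
  have c: "nidx (c i) = i" if "i < CARD('n)" for i
    using nidx_surj[OF that] unfolding c_def by (intro f_inv_into_f) auto
  have "bij_betw c {..<CARD('n)} UNIV" unfolding c_def using bij_nidx by (rule bij_betw_inv_into)
  then have "decr_list (\<lambda>i::'n. \<bar>ev (nidx i)\<bar>) ! k = \<bar>ev (nidx (c k))\<bar>"
    by (rule decr_list_eqI[OF _ k]) (use decr c in \<open>auto intro: less_imp_le\<close>)
  then show ?thesis using e c[OF k] by simp
qed

end

lemma matrix_inv_eqI:
  fixes A B :: "'a::semiring_1^'n^'n"
  assumes "A ** B = mat 1" "B ** A = mat 1"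
  shows "matrix_inv A = B"
proof -
  have "A ** matrix_inv A = mat 1 \<and> matrix_inv A ** A = mat 1"
    unfolding matrix_inv_def by (rule someI_ex) (use assms in blast)
  then have "matrix_inv A ** A ** B = B" by simp
  then show ?thesis by (simp only: matrix_mul_assoc[symmetric] assms(1) matrix_mul_rid)
qed

context hitchin_rep
begin

lemma separated_eigenbasis:
  assumes \<eta>: "\<eta> \<in> G" and s: "sep K \<eta>"
  obtains a b l \<beta> ev where "eigpair \<eta> a b l" "det2 a b < 0" "norm a * norm b \<le> K * \<bar>det2 a b\<bar>"
    "compatible \<beta> (\<zeta> a) (\<zeta> b)" "\<forall>i<CARD('n). R \<eta> *v \<beta> i = ev i *\<^sub>R \<beta> i \<and> ev i \<noteq> 0"
proof -
  obtain a b0 l where e0: "eigpair \<eta> a b0 l" "norm a * norm b0 \<le> K * \<bar>det2 a b0\<bar>" using s by (auto simp: sep_def)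
  define b where "b = (if det2 a b0 < 0 then b0 else - b0)"
  have "- b0 = (-1) *\<^sub>R b0" by simp
  then have "\<eta> *v (- b0) = - (\<eta> *v b0)" by (simp only: matrix_vector_mult_scaleR) simp
  then have e: "eigpair \<eta> a b l" "norm a * norm b \<le> K * \<bar>det2 a b\<bar>" "det2 a b < 0" using e0 by (auto simp: eigpair_def b_def)
  have "a \<in> L" "b \<in> L" using fixed_pair[OF \<eta> e(1)] fixed_subset by auto
  then obtain \<beta> where \<beta>: "compatible \<beta> (\<zeta> a) (\<zeta> b)" using pair(3) e(3) by force
  obtain ev where "\<forall>i<CARD('n). R \<eta> *v \<beta> i = ev i *\<^sub>R \<beta> i \<and> ev i \<noteq> 0" using R_eigenbasis[OF \<eta> e(1) \<beta>] by blast
  then show thesis using that e \<beta> by blast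
qed

text \<open>A compatible basis from \<open>bounded_basis\<close> diagonalizes
  \<open>R \<eta>\<close>, and for the diagonal matrix the two lists agree. They differ for
  \<open>R \<eta>\<close> only by the distortion of the basis, which depends on \<open>K\<close> and
  not on \<open>\<eta>\<close>.\<close>

lemma singular_values_near_eigenvalue_moduli:
  "\<exists>C\<ge>1. \<forall>\<eta>\<in>G. sep K \<eta> \<longrightarrow> (\<forall>k<CARD('n).
     \<bar>ln (singular_values (R \<eta>) ! k) - ln (eigenvalue_moduli (R \<eta>) ! k)\<bar> \<le> 2 * ln C)"
proof -
  obtain C where C: "C \<ge> 1" "\<forall>a\<in>L. \<forall>b\<in>L. norm a * norm b \<le> K * \<bar>det2 a b\<bar> \<longrightarrow>
      (\<exists>\<beta>. compatible \<beta> (\<zeta> a) (\<zeta> b) \<and> bilip C (colmat \<beta>))"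
    using bounded_basis by blast
  have "\<bar>ln (singular_values (R \<eta>) ! k) - ln (eigenvalue_moduli (R \<eta>) ! k)\<bar> \<le> 2 * ln C"
    if \<eta>: "\<eta> \<in> G" and s: "sep K \<eta>" and k: "k < CARD('n)" for \<eta> k
  proof -
    obtain a b l where e: "eigpair \<eta> a b l" "norm a * norm b \<le> K * \<bar>det2 a b\<bar>" using s by (auto simp: sep_def)
    have "a \<in> L" "b \<in> L" using fixed_pair[OF \<eta> e(1)] fixed_subset by auto
    then obtain \<beta> where \<beta>: "compatible \<beta> (\<zeta> a) (\<zeta> b)" "bilip C (colmat \<beta>)" using C(2) e(2) by blast
    obtain ev where ev: "\<forall>i<CARD('n). R \<eta> *v \<beta> i = ev i *\<^sub>R \<beta> i \<and> ev i \<noteq> 0" using R_eigenbasis[OF \<eta> e(1) \<beta>(1)] by blast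
    have ob: "ordered_basis \<beta>" using \<beta>(1) by (simp add: compatible_def)
    define D :: "real^'n^'n" where "D = diagm (\<lambda>i. ev (nidx i))"
    have AP: "R \<eta> ** colmat \<beta> = colmat \<beta> ** D" unfolding D_def by (rule colmat_diag(1)[OF ob]) (use ev in blast)
    have "\<exists>Q. colmat \<beta> ** Q = mat 1" by (rule colmat_diag(2)[where A = "R \<eta>", OF ob]) (use ev in blast)
    then obtain Q where Q: "colmat \<beta> ** Q = mat 1" by metis
    have RQ: "R \<eta> = colmat \<beta> ** D ** Q" unfolding AP[symmetric] by (simp add: Q flip: matrix_mul_assoc)
    have "det (colmat \<beta>) * det D = det (R \<eta>) * det (colmat \<beta>)" unfolding det_mul[symmetric] AP ..
    moreover have "det (colmat \<beta>) * det Q = 1" unfolding det_mul[symmetric] Q by simp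
    ultimately have dD: "det D \<noteq> 0" using R_det[OF \<eta>] by force
    have "eigenvalue_moduli (R \<eta>) = decr_list (\<lambda>i::'n. \<bar>ev (nidx i)\<bar>)"
      by (rule eigenvalue_moduli_similar[OF AP[unfolded D_def] Q])
    moreover have "singular_values D = decr_list (\<lambda>i::'n. \<bar>ev (nidx i)\<bar>)" unfolding D_def by (rule singular_values_diagm)
    ultimately have "eigenvalue_moduli (R \<eta>) = singular_values D" by simp
    moreover have "\<bar>ln (singular_values (colmat \<beta> ** D ** Q) ! k) - ln (singular_values D ! k)\<bar> \<le> 2 * ln C"
      by (rule ln_singular_values_close[OF k dD \<beta>(2) bilip_inverse[OF \<beta>(2) Q] C(1)])
    ultimately show ?thesis using RQ by simp
  qed
  then show ?thesis using C(1) by blast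
qed

lemma compatible_reverse:
  fixes \<beta> :: "nat \<Rightarrow> real^'n"
  assumes "compatible \<beta> E F"
  shows "compatible (\<lambda>i. \<beta> (CARD('n) - 1 - i)) F E"
proof -
  have inj: "inj_on (\<lambda>i. CARD('n) - 1 - i) {..<CARD('n)}" by (auto simp: inj_on_def)
  have "(\<lambda>i. CARD('n) - 1 - i) ` {..<CARD('n)} \<subseteq> {..<CARD('n)}" by auto
  then have im: "(\<lambda>i. CARD('n) - 1 - i) ` {..<CARD('n)} = {..<CARD('n)}" using endo_inj_surj[OF finite_lessThan _ inj] by blast
  have b: "inj_on \<beta> {..<CARD('n)}" "independent (\<beta> ` {..<CARD('n)})" using assms by (auto simp: compatible_def ordered_basis_def)
  have "inj_on (\<beta> \<circ> (\<lambda>i. CARD('n) - 1 - i)) {..<CARD('n)}" by (rule comp_inj_on[OF inj]) (simp only: im b(1))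
  moreover have "(\<lambda>i. \<beta> (CARD('n) - 1 - i)) ` {..<CARD('n)} = \<beta> ` {..<CARD('n)}"
    by (subst im[symmetric]) (simp only: image_image)
  ultimately have "ordered_basis (\<lambda>i. \<beta> (CARD('n) - 1 - i))" using b(2) by (simp add: ordered_basis_def comp_def)
  moreover have "F i \<inter> E (CARD('n) - i) = {0}" if "i \<le> CARD('n)" for i
  proof -
    have "E (CARD('n) - i) \<inter> F (CARD('n) - (CARD('n) - i)) = {0}"
      using assms unfolding compatible_def transverse_def by (meson diff_le_self)
    then show ?thesis using that by (simp add: Int_commute)
  qed
  moreover have "\<beta> (CARD('n) - 1 - i) \<in> F (Suc i) \<inter> E (CARD('n) - i)" if "i < CARD('n)" for i
  proof -
    have "CARD('n) - 1 - i < CARD('n)" using that by simp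
    then have "\<beta> (CARD('n) - 1 - i) \<in> E (Suc (CARD('n) - 1 - i)) \<inter> F (CARD('n) - (CARD('n) - 1 - i))"
      using assms unfolding compatible_def by blast
    moreover have "Suc (CARD('n) - 1 - i) = CARD('n) - i" "CARD('n) - (CARD('n) - 1 - i) = Suc i" using that by auto
    ultimately show ?thesis by simp
  qed
  ultimately show ?thesis by (simp add: compatible_def transverse_def)
qed

text \<open>A separated conjugate is in good position for one of the two orientations of its axis,
  and reversing the axis means passing to the inverse of \<open>\<eta>\<close>. In the reversed
  basis the eigenvalues are the inverses, and the quotient at index \<open>CARD('n) - 2 - j\<close>
  is again that of \<open>ev j\<close> and \<open>ev (Suc j)\<close> in modulus.\<close>

lemma separated_conjugates_bound:
  assumes j: "Suc j < CARD('n)"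
  shows "\<exists>N\<ge>0. \<forall>\<eta>\<in>G. sep K \<eta> \<longrightarrow>
     finite {r. \<exists>h\<in>G. r = h ** \<eta> ** matrix_inv h \<and> sep K r} \<and>
     real (card {r. \<exists>h\<in>G. r = h ** \<eta> ** matrix_inv h \<and> sep K r}) \<le>
       N * (1 + (ln (eigenvalue_moduli (R \<eta>) ! j) - ln (eigenvalue_moduli (R \<eta>) ! Suc j)))"
proof -
  obtain P \<epsilon> where P: "finite P" "P \<subseteq> fixed_vectors" "\<epsilon> > 0"
    and gp: "\<And>a b. det2 a b < 0 \<Longrightarrow> norm a * norm b \<le> K * \<bar>det2 a b\<bar> \<Longrightarrow> good_position P K \<epsilon> a b \<or> good_position P K \<epsilon> b (- a)"
    using good_position_exists[of K] by blast
  let ?d = "CARD('n)"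
  define bnd where "bnd i N \<longleftrightarrow> N \<ge> 0 \<and> (\<forall>\<eta>\<in>G. \<forall>a b l A A' \<beta> ev. eigpair \<eta> a b l \<longrightarrow> det2 a b < 0 \<longrightarrow>
     A' ** A = mat 1 \<longrightarrow> A ** A' = mat 1 \<longrightarrow> (\<forall>y\<in>fixed_vectors. \<zeta> (\<eta> *v y) = flag_act A (\<zeta> y)) \<longrightarrow>
     compatible \<beta> (\<zeta> a) (\<zeta> b) \<longrightarrow> (\<forall>i<CARD('n). A *v \<beta> i = ev i *\<^sub>R \<beta> i \<and> ev i \<noteq> 0) \<longrightarrow>
     good_conjugates P K \<epsilon> \<eta> a b \<noteq> {} \<longrightarrow>
     \<bar>ev (Suc i)\<bar> < \<bar>ev i\<bar> \<and> finite (good_conjugates P K \<epsilon> \<eta> a b) \<and>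
     real (card (good_conjugates P K \<epsilon> \<eta> a b)) \<le> N * (1 + ln (\<bar>ev i\<bar> / \<bar>ev (Suc i)\<bar>)))" for i and N :: real
  have bex: "\<exists>N. bnd i N" if "Suc i < ?d" for i
    unfolding bnd_def by (rule good_conjugates_bound[OF P that])
  then obtain N1 where N1: "bnd j N1" using j by blast
  have j': "Suc (?d - 2 - j) < ?d" using j by simp
  then obtain N2 where N2: "bnd (?d - 2 - j) N2" using bex by blast
  have N0: "N1 \<ge> 0" "N2 \<ge> 0" using N1 N2 by (auto simp: bnd_def)
  have "finite {r. \<exists>h\<in>G. r = h ** \<eta> ** matrix_inv h \<and> sep K r} \<and>
     real (card {r. \<exists>h\<in>G. r = h ** \<eta> ** matrix_inv h \<and> sep K r}) \<le>
       (N1 + N2) * (1 + (ln (eigenvalue_moduli (R \<eta>) ! j) - ln (eigenvalue_moduli (R \<eta>) ! Suc j)))"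
    if \<eta>: "\<eta> \<in> G" and s: "sep K \<eta>" for \<eta>
  proof -
    obtain a b l \<beta> ev where e: "eigpair \<eta> a b l" "det2 a b < 0" "norm a * norm b \<le> K * \<bar>det2 a b\<bar>"
      and \<beta>: "compatible \<beta> (\<zeta> a) (\<zeta> b)" and ev: "\<forall>i<?d. R \<eta> *v \<beta> i = ev i *\<^sub>R \<beta> i \<and> ev i \<noteq> 0"
      by (rule separated_eigenbasis[OF \<eta> s])
    let ?Y = "matrix_inv \<eta>"
    define X where "X = good_conjugates P K \<epsilon> \<eta> a b"
    define X' where "X' = good_conjugates P K \<epsilon> ?Y b (- a)"
    have e': "eigpair ?Y b (- a) l" "det2 b (- a) < 0" using eigpair_inverse[OF \<eta> e(1)] e(2) det2_swap[of b a] by auto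
    have ab: "a \<in> L" "b \<in> L" using fixed_pair[OF \<eta> e(1)] fixed_subset by auto
    have za: "\<zeta> (- a) = \<zeta> a" using L_scale[OF ab(1), of "-1"] by simp
    have Rq: "matrix_inv (R \<eta>) ** R \<eta> = mat 1" "R \<eta> ** matrix_inv (R \<eta>) = mat 1" using R_inverse[OF \<eta>] by auto
    have eq1: "\<forall>y\<in>fixed_vectors. \<zeta> (\<eta> *v y) = flag_act (R \<eta>) (\<zeta> y)" using equivariant[OF \<eta>] fixed_subset by blast
    have eq2: "\<forall>y\<in>fixed_vectors. \<zeta> (?Y *v y) = flag_act (matrix_inv (R \<eta>)) (\<zeta> y)"
    proof
      fix y assume "y \<in> fixed_vectors"
      then have y: "?Y *v y \<in> L" using fixed_act minv[OF \<eta>] fixed_subset by blast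
      have "\<zeta> y = flag_act (R \<eta>) (\<zeta> (?Y *v y))" using equivariant[OF \<eta> y] \<eta> by simp
      then have "flag_act (matrix_inv (R \<eta>)) (\<zeta> y) = flag_act (matrix_inv (R \<eta>)) (flag_act (R \<eta>) (\<zeta> (?Y *v y)))" by simp
      also have "\<dots> = \<zeta> (?Y *v y)" by (simp add: flag_act_mult Rq) (simp add: flag_act_def)
      finally show "\<zeta> (?Y *v y) = flag_act (matrix_inv (R \<eta>)) (\<zeta> y)" by simp
    qed
    define \<beta>' where "\<beta>' i = \<beta> (?d - 1 - i)" for i
    define ev' where "ev' i = 1 / ev (?d - 1 - i)" for i
    have \<beta>': "compatible \<beta>' (\<zeta> b) (\<zeta> (- a))" unfolding \<beta>'_def za by (rule compatible_reverse[OF \<beta>])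
    have ev': "\<forall>i<?d. matrix_inv (R \<eta>) *v \<beta>' i = ev' i *\<^sub>R \<beta>' i \<and> ev' i \<noteq> 0"
    proof (intro allI impI)
      fix i assume "i < ?d"
      define m where "m = ?d - 1 - i"
      have "m < ?d" by (simp add: m_def)
      then have m: "R \<eta> *v \<beta> m = ev m *\<^sub>R \<beta> m" "ev m \<noteq> 0" using ev by auto
      have "matrix_inv (R \<eta>) *v (R \<eta> *v \<beta> m) = \<beta> m" by (simp add: matrix_vector_mul_assoc Rq)
      then have "ev m *\<^sub>R (matrix_inv (R \<eta>) *v \<beta> m) = \<beta> m" unfolding m(1) by (simp only: matrix_vector_mult_scaleR)
      then have "(1 / ev m) *\<^sub>R (ev m *\<^sub>R (matrix_inv (R \<eta>) *v \<beta> m)) = (1 / ev m) *\<^sub>R \<beta> m" by simp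
      then have "matrix_inv (R \<eta>) *v \<beta> m = (1 / ev m) *\<^sub>R \<beta> m" using m(2) by simp
      then show "matrix_inv (R \<eta>) *v \<beta>' i = ev' i *\<^sub>R \<beta>' i \<and> ev' i \<noteq> 0"
        using m(2) unfolding \<beta>'_def ev'_def m_def[symmetric] by simp
    qed
    have A1: "\<bar>ev (Suc i)\<bar> < \<bar>ev i\<bar> \<and> finite X \<and> real (card X) \<le> N * (1 + ln (\<bar>ev i\<bar> / \<bar>ev (Suc i)\<bar>))"
      if "X \<noteq> {}" "bnd i N" for i N
      using that(2)[unfolded bnd_def] \<eta> e(1,2) Rq eq1 \<beta> ev that(1) unfolding X_def by blast
    have A2: "\<bar>ev' (Suc i)\<bar> < \<bar>ev' i\<bar> \<and> finite X' \<and> real (card X') \<le> N * (1 + ln (\<bar>ev' i\<bar> / \<bar>ev' (Suc i)\<bar>))"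
      if "X' \<noteq> {}" "bnd i N" for i N
      using that(2)[unfolded bnd_def] minv[OF \<eta>] e' Rq eq2 \<beta>' ev' that(1) unfolding X'_def by blast
    have rat: "\<bar>ev' (?d - 2 - i)\<bar> = 1 / \<bar>ev (Suc i)\<bar>" "\<bar>ev' (Suc (?d - 2 - i))\<bar> = 1 / \<bar>ev i\<bar>" "Suc (?d - 2 - i) < ?d" if "Suc i < ?d" for i
    proof -
      have "?d - 1 - (?d - 2 - i) = Suc i" "?d - 1 - Suc (?d - 2 - i) = i" using that by auto
      then show "\<bar>ev' (?d - 2 - i)\<bar> = 1 / \<bar>ev (Suc i)\<bar>" "\<bar>ev' (Suc (?d - 2 - i))\<bar> = 1 / \<bar>ev i\<bar>" by (simp_all add: ev'_def)
      show "Suc (?d - 2 - i) < ?d" using that by simp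
    qed
    let ?C = "{r. \<exists>h\<in>G. r = h ** \<eta> ** matrix_inv h \<and> sep K r}"
    have sub: "?C \<subseteq> X \<union> matrix_inv ` X'"
    proof
      fix r assume "r \<in> ?C"
      then obtain h where h: "h \<in> G" "r = h ** \<eta> ** matrix_inv h" "sep K r" by blast
      have er: "eigpair r (h *v a) (h *v b) l" unfolding h(2) by (rule eigpair_conj[OF h(1) e(1)])
      have "norm (h *v a) * norm (h *v b) \<le> K * \<bar>det2 (h *v a) (h *v b)\<bar>" by (rule sep_eigpair[OF h(3) er])
      moreover have "det2 (h *v a) (h *v b) < 0" using e(2) h(1) by simp
      ultimately consider "good_position P K \<epsilon> (h *v a) (h *v b)" | "good_position P K \<epsilon> (h *v b) (- (h *v a))" using gp by blast
      then show "r \<in> X \<union> matrix_inv ` X'"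
      proof cases
        case 1
        then show ?thesis using h unfolding X_def good_conjugates_def by blast
      next
        case 2
        have "h *v (- a) = - (h *v a)" using matrix_vector_mult_scaleR[of h "-1" a] by simp
        then have "h ** ?Y ** matrix_inv h \<in> X'" using 2 h(1) unfolding X'_def good_conjugates_def by auto
        moreover have "matrix_inv (h ** ?Y ** matrix_inv h) = r"
        proof (rule matrix_inv_eqI)
          have hh: "h ** matrix_inv h = mat 1" "matrix_inv h ** h = mat 1" "\<eta> ** ?Y = mat 1" "?Y ** \<eta> = mat 1" using h(1) \<eta> by auto
          have c1: "matrix_inv h ** (h ** x) = x" "\<eta> ** (?Y ** x) = x" "?Y ** (\<eta> ** x) = x" for x :: "real^2^2"
            unfolding matrix_mul_assoc hh by simp_all
          show "(h ** ?Y ** matrix_inv h) ** r = mat 1" unfolding h(2) matrix_mul_assoc[symmetric] c1 hh ..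
          show "r ** (h ** ?Y ** matrix_inv h) = mat 1" unfolding h(2) matrix_mul_assoc[symmetric] c1 hh ..
        qed
        ultimately show ?thesis by blast
      qed
    qed
    have "mat 1 ** \<eta> ** matrix_inv (mat 1) = \<eta>" using one inv_mult(1)[OF one] by simp
    then have "\<eta> \<in> ?C" using s one by force
    then have ne: "X \<noteq> {} \<or> X' \<noteq> {}" using sub by blast
    \<comment> \<open>\<open>\<eta>\<close> is a separated conjugate of itself, so \<open>X\<close>
      or \<open>X'\<close> is nonempty, and then the bound at any index orders the eigenvalues
      there. This identifies an index of the basis with a position in the decreasing list of
      moduli.\<close>
    have decr: "\<bar>ev (Suc i)\<bar> < \<bar>ev i\<bar>" if i: "Suc i < ?d" for i
    proof (cases "X = {}")
      case False
      obtain N where "bnd i N" using bex[OF i] by blast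
      then show ?thesis using A1[OF False] by blast
    next
      case True
      then have "X' \<noteq> {}" using ne by simp
      moreover obtain N where "bnd (?d - 2 - i) N" using bex[OF rat(3)[OF i]] by blast
      ultimately have "\<bar>ev' (Suc (?d - 2 - i))\<bar> < \<bar>ev' (?d - 2 - i)\<bar>" using A2 by blast
      then have "1 / \<bar>ev i\<bar> < 1 / \<bar>ev (Suc i)\<bar>" unfolding rat(1,2)[OF i] .
      moreover have "\<bar>ev i\<bar> > 0" "\<bar>ev (Suc i)\<bar> > 0" using ev i by auto
      ultimately show ?thesis by (simp add: field_simps)
    qed
    have ob: "ordered_basis \<beta>" using \<beta> by (simp add: compatible_def)
    have em: "eigenvalue_moduli (R \<eta>) ! k = \<bar>ev k\<bar>" if "k < ?d" for k
      by (rule eigenvalue_moduli_nth[OF ob, where ev = ev]) (use ev decr that in auto)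
    have evp: "\<bar>ev j\<bar> > 0" "\<bar>ev (Suc j)\<bar> > 0" using ev j by auto
    define q where "q = ln (eigenvalue_moduli (R \<eta>) ! j) - ln (eigenvalue_moduli (R \<eta>) ! Suc j)"
    have q: "ln (\<bar>ev j\<bar> / \<bar>ev (Suc j)\<bar>) = q" unfolding q_def using em[of j] em[of "Suc j"] j evp by (simp add: ln_div)
    have q': "ln (\<bar>ev' (?d - 2 - j)\<bar> / \<bar>ev' (Suc (?d - 2 - j))\<bar>) = q" unfolding rat(1,2)[OF j] q[symmetric] by simp
    have q0: "q \<ge> 0" unfolding q[symmetric] using decr[OF j] evp by (intro ln_ge_zero) simp
    have X: "finite X \<and> real (card X) \<le> N1 * (1 + q)"
    proof (cases "X = {}")
      case True
      then show ?thesis using q0 N0 by simp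
    next
      case False
      then show ?thesis using A1[OF False N1] unfolding q by blast
    qed
    have X': "finite X' \<and> real (card X') \<le> N2 * (1 + q)"
    proof (cases "X' = {}")
      case True
      then show ?thesis using q0 N0 by simp
    next
      case False
      then show ?thesis using A2[OF False N2] unfolding q' by blast
    qed
    have fin: "finite (X \<union> matrix_inv ` X')" using X X' by blast
    have "card ?C \<le> card (X \<union> matrix_inv ` X')" by (rule card_mono[OF fin sub])
    also have "\<dots> \<le> card X + card (matrix_inv ` X')" by (rule card_Un_le)
    also have "\<dots> \<le> card X + card X'" using card_image_le X' by (meson add_left_mono)
    finally have "real (card ?C) \<le> real (card X) + real (card X')" by linarith
    also have "\<dots> \<le> (N1 + N2) * (1 + q)" using X X' by (simp add: distrib_right)
    finally show ?thesis using finite_subset[OF sub fin] unfolding q_def by blast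
  qed
  then show ?thesis using N0 by (intro exI[of _ "N1 + N2"]) auto
qed

end

subsection \<open>The action on the boundary circle\<close>

text \<open>The complex numbers are the rows of \<open>cayley\<close> applied to the columns of
  \<open>M\<close>; a common factor \<open>- \<i> / 2\<close> of numerator and denominator
  cancels.\<close>

lemma disc_act_formula:
  fixes X :: "(real^2^2) set" and z :: complex
  defines "M \<equiv> psl_lift X"
  shows "disc_act X z =
    (\<i> * Complex (M $ 1 $ 1) (- M $ 2 $ 1) * (1 + z) + Complex (M $ 1 $ 2) (- M $ 2 $ 2) * (1 - z)) /
    (\<i> * Complex (M $ 1 $ 1) (M $ 2 $ 1) * (1 + z) + Complex (M $ 1 $ 2) (M $ 2 $ 2) * (1 - z))"
proof -
  define N :: "complex^2^2" where "N = vector [vector [1 / 2, 1 / 2], vector [\<i> / 2, - \<i> / 2]]"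
  have "matrix_inv cayley = N"
    by (rule matrix_inv_eqI)
      (simp_all add: N_def cayley_def vec_eq_iff forall_2 matrix_matrix_mult_def sum_2 mat_def vector_2)
  moreover define D where "D = \<i> * Complex (M $ 1 $ 1) (M $ 2 $ 1) * (1 + z) + Complex (M $ 1 $ 2) (M $ 2 $ 2) * (1 - z)"
  define E where "E = \<i> * Complex (M $ 1 $ 1) (- M $ 2 $ 1) * (1 + z) + Complex (M $ 1 $ 2) (- M $ 2 $ 2) * (1 - z)"
  let ?A = "cayley ** (\<chi> i j. complex_of_real (M $ i $ j)) ** N"
  have "?A $ 1 $ 1 * z + ?A $ 1 $ 2 = E * (- \<i> / 2)" "?A $ 2 $ 1 * z + ?A $ 2 $ 2 = D * (- \<i> / 2)"
    by (simp_all add: D_def E_def N_def cayley_def matrix_matrix_mult_def sum_2 vector_2 complex_eq_iff algebra_simps)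
      (simp_all add: field_simps)
  ultimately show ?thesis unfolding disc_act_def moebius_def M_def[symmetric] D_def[symmetric] E_def[symmetric] by simp
qed

text \<open>The Cayley transform of \<open>v $ 1 / v $ 2\<close> in homogeneous form, which includes
  the point at infinity \<open>v $ 2 = 0\<close>.\<close>

definition pt :: "real^2 \<Rightarrow> complex" where
  "pt v = Complex (v $ 1) (- v $ 2) / Complex (v $ 1) (v $ 2)"

lemma Complex_nz: "v \<noteq> 0 \<Longrightarrow> Complex (v $ 1) (v $ 2) \<noteq> 0" for v :: "real^2"
  by (simp add: complex_eq_iff vec_eq_iff forall_2)

lemma norm_pt: "v \<noteq> 0 \<Longrightarrow> cmod (pt v) = 1"
proof -
  assume "v \<noteq> 0"
  then have "cmod (Complex (v $ 1) (v $ 2)) \<noteq> 0" using Complex_nz by simp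
  moreover have "cmod (Complex (v $ 1) (- v $ 2)) = cmod (Complex (v $ 1) (v $ 2))" by (simp add: cmod_def)
  ultimately show "cmod (pt v) = 1" by (simp add: pt_def norm_divide)
qed

lemma pt_scale: "c \<noteq> 0 \<Longrightarrow> pt (c *\<^sub>R v) = pt v"
proof -
  assume c: "c \<noteq> 0"
  have "Complex (c * x) (c * y) = complex_of_real c * Complex x y" for x y by (simp add: complex_eq_iff)
  from this[of "v $ 1" "v $ 2"] this[of "v $ 1" "- v $ 2"] show ?thesis using c by (simp add: pt_def)
qed

lemma pt_eq_iff:
  assumes "v \<noteq> 0" "w \<noteq> 0"
  shows "pt v = pt w \<longleftrightarrow> det2 v w = 0"
proof -
  have "pt v = pt w \<longleftrightarrow> Complex (v $ 1) (- v $ 2) * Complex (w $ 1) (w $ 2) = Complex (w $ 1) (- w $ 2) * Complex (v $ 1) (v $ 2)"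
    unfolding pt_def using assms by (simp add: frac_eq_eq Complex_nz)
  also have "\<dots> \<longleftrightarrow> det2 v w = 0" by (simp add: complex_eq_iff det2_def algebra_simps)
  finally show ?thesis .
qed

lemma disc_act_pt:
  assumes "v \<noteq> 0"
  shows "disc_act X (pt v) = pt (psl_lift X *v v)"
proof -
  define m where "m = Complex (v $ 1) (v $ 2)"
  have m: "m \<noteq> 0" using assms Complex_nz by (simp add: m_def)
  define z where "z = pt v"
  have z: "z * m = Complex (v $ 1) (- v $ 2)" using m by (simp add: z_def pt_def m_def)
  define M where "M = psl_lift X"
  define w where "w = M *v v"
  have w: "w $ 1 = M $ 1 $ 1 * v $ 1 + M $ 1 $ 2 * v $ 2" "w $ 2 = M $ 2 $ 1 * v $ 1 + M $ 2 $ 2 * v $ 2"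
    by (simp_all add: w_def matrix_vector_mult_def sum_2)
  have zm: "(1 + z) * m = 2 * complex_of_real (v $ 1)" "(1 - z) * m = 2 * \<i> * complex_of_real (v $ 2)"
    unfolding distrib_right left_diff_distrib z by (simp_all add: m_def complex_eq_iff)
  have *: "(p * (1 + z) + q * (1 - z)) * m = p * (2 * complex_of_real (v $ 1)) + q * (2 * \<i> * complex_of_real (v $ 2))" for p q
    unfolding zm[symmetric] by (simp add: algebra_simps)
  have "disc_act X z = (((\<i> * Complex (M $ 1 $ 1) (- M $ 2 $ 1)) * (1 + z) + Complex (M $ 1 $ 2) (- M $ 2 $ 2) * (1 - z)) * m) /
    (((\<i> * Complex (M $ 1 $ 1) (M $ 2 $ 1)) * (1 + z) + Complex (M $ 1 $ 2) (M $ 2 $ 2) * (1 - z)) * m)"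
    using m unfolding disc_act_formula M_def by simp
  also have "\<dots> = (2 * \<i> * Complex (w $ 1) (- w $ 2)) / (2 * \<i> * Complex (w $ 1) (w $ 2))"
    unfolding * by (rule arg_cong2[where f = "(/)"]) (simp_all add: w complex_eq_iff algebra_simps)
  finally show ?thesis by (simp add: pt_def z_def w_def M_def)
qed

lemma disc_act_0:
  fixes X :: "(real^2^2) set"
  shows "disc_act X 0 = (\<i> * Complex (psl_lift X $ 1 $ 1) (- psl_lift X $ 2 $ 1) + Complex (psl_lift X $ 1 $ 2) (- psl_lift X $ 2 $ 2)) /
    (\<i> * Complex (psl_lift X $ 1 $ 1) (psl_lift X $ 2 $ 1) + Complex (psl_lift X $ 1 $ 2) (psl_lift X $ 2 $ 2))"
  by (simp add: disc_act_formula)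

lemma norm_disc_act_0:
  assumes "det (psl_lift X) = 1"
  shows "cmod (disc_act X 0) < 1"
proof -
  define M where "M = psl_lift X"
  define n where "n = \<i> * Complex (M $ 1 $ 1) (- M $ 2 $ 1) + Complex (M $ 1 $ 2) (- M $ 2 $ 2)"
  define m where "m = \<i> * Complex (M $ 1 $ 1) (M $ 2 $ 1) + Complex (M $ 1 $ 2) (M $ 2 $ 2)"
  have "M $ 1 $ 1 * M $ 2 $ 2 - M $ 1 $ 2 * M $ 2 $ 1 = 1" using assms by (simp add: M_def det_2)
  then have "(cmod m)\<^sup>2 - (cmod n)\<^sup>2 = 4"
    unfolding cmod_power2 m_def n_def by (simp add: power2_eq_square algebra_simps)
  then have "(cmod n)\<^sup>2 < (cmod m)\<^sup>2" by simp
  then have "cmod n < cmod m" by (rule power2_less_imp_less) simp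
  moreover from this have "cmod m > 0" using norm_ge_zero[of n] by linarith
  ultimately show ?thesis unfolding disc_act_0 M_def[symmetric] n_def[symmetric] m_def[symmetric] by (simp add: norm_divide)
qed

lemma tendsto_pt:
  assumes "x \<longlonglongrightarrow> y" "y \<noteq> 0"
  shows "(\<lambda>m. pt (x m)) \<longlonglongrightarrow> pt y"
  unfolding pt_def by (intro tendsto_intros assms(1) Complex_nz[OF assms(2)])

text \<open>With \<open>V\<close> the complex number of coordinates \<open>v\<close>, \<open>pt v = cnj V / V\<close>; dividing all the
  vectors by the first one makes their arguments lie in \<open>(-\<pi>, 0]\<close>.\<close>

lemma cyclically_ordered_pt:
  assumes vs: "\<forall>v\<in>set vs. v \<noteq> 0" and s: "sorted_wrt (\<lambda>v w. det2 v w < 0) vs"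
  shows "cyclically_ordered (map pt vs)"
proof (cases vs)
  case Nil
  then show ?thesis by (simp add: cyclically_ordered_def)
next
  case (Cons v0 vs')
  define V where "V v = Complex (v $ 1) (v $ 2)" for v :: "real^2"
  define z where "z v = V v / V v0" for v
  \<comment> \<open>\<open>pt v\<close> has argument \<open>- 2 * Arg (V v)\<close> up to full
    turns; the term \<open>Arg (pt v0)\<close> restores what the division by \<open>V v0\<close>
    removes.\<close>
  define t where "t v = Arg (pt v0) - 2 * Arg (z v)" for v
  have v0: "V v0 \<noteq> 0" using vs Cons Complex_nz by (simp add: V_def)
  have nz: "z v \<noteq> 0" if "v \<in> set vs" for v using that vs Complex_nz v0 by (simp add: z_def V_def)
  have zc: "z v = cmod (z v) * cis (Arg (z v))" for v by (cases "z v = 0") (auto simp: cis_Arg sgn_eq)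
  have re: "Re (z v) = cmod (z v) * cos (Arg (z v))" and im: "Im (z v) = cmod (z v) * sin (Arg (z v))" for v
    using cos_Arg[of "z v"] sin_Arg[of "z v"] by (cases "z v = 0"; simp)+
  have pt: "pt v = cis (t v)" if v: "v \<in> set vs" for v
  proof -
    have V: "V v = z v * V v0" using v0 by (simp add: z_def)
    have "pt v = cnj (V v) / V v" by (simp add: pt_def V_def complex_cnj)
    also have "\<dots> = (cnj (z v) / z v) * (cnj (V v0) / V v0)" unfolding V by simp
    also have "cnj (z v) / z v = cis (- 2 * Arg (z v))"
    proof -
      have "cnj (z v) = cnj (cmod (z v) * cis (Arg (z v)))" by (rule arg_cong[OF zc])
      also have "\<dots> = cmod (z v) * cis (- Arg (z v))" by (simp add: cis_cnj)
      finally have "cnj (z v) / z v = (cmod (z v) * cis (- Arg (z v))) / (cmod (z v) * cis (Arg (z v)))"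
        by (rule arg_cong2[OF _ zc])
      also have "\<dots> = cis (- Arg (z v)) / cis (Arg (z v))" using nz[OF v] by (intro mult_divide_mult_cancel_left) simp
      finally show ?thesis by (simp add: cis_divide)
    qed
    also have "cnj (V v0) / V v0 = cis (Arg (pt v0))"
    proof -
      have "pt v0 \<noteq> 0" "cmod (pt v0) = 1" using norm_pt[of v0] vs Cons by auto
      then have "cis (Arg (pt v0)) = pt v0" by (simp add: cis_Arg sgn_eq)
      then show ?thesis by (simp add: pt_def V_def complex_cnj)
    qed
    finally show ?thesis by (simp add: t_def cis_mult)
  qed
  have Imz: "Re (z v) * Im (z w) - Im (z v) * Re (z w) = det2 v w / (cmod (V v0))\<^sup>2" for v w
  proof -
    have "cnj (z v) * z w = cnj (V v) * V w / (cnj (V v0) * V v0)" by (simp add: z_def)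
    also have "cnj (V v0) * V v0 = complex_of_real ((cmod (V v0))\<^sup>2)" by (metis complex_norm_square mult.commute)
    finally have "Im (cnj (z v) * z w) = Im (cnj (V v) * V w) / (cmod (V v0))\<^sup>2" by (simp only: Im_divide_of_real)
    then show ?thesis by (simp add: V_def det2_def)
  qed
  have rng: "- pi < Arg (z v) \<and> Arg (z v) \<le> 0" if v: "v \<in> set vs" for v
  proof (cases "v = v0")
    case True
    then show ?thesis using v0 by (simp add: z_def)
  next
    case False
    then have "det2 v0 v < 0" using v s Cons by auto
    moreover have "z v0 = 1" using v0 by (simp add: z_def)
    ultimately have "Im (z v) < 0" using Imz[of v0 v] v0 by (simp add: divide_neg_pos)
    then have "Arg (z v) < 0" by (simp add: Arg_neg_iff)
    then show ?thesis using mpi_less_Arg[of "z v"] by simp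
  qed
  have lt: "t v < t w" if v: "v \<in> set vs" "w \<in> set vs" and d: "det2 v w < 0" for v w
  proof (rule ccontr)
    assume "\<not> t v < t w"
    then have a: "Arg (z w) - Arg (z v) \<ge> 0" "Arg (z w) - Arg (z v) \<le> pi" using rng[OF v(1)] rng[OF v(2)] by (auto simp: t_def)
    have "Re (z v) * Im (z w) - Im (z v) * Re (z w) = cmod (z v) * cmod (z w) * sin (Arg (z w) - Arg (z v))"
      unfolding re im by (simp add: sin_diff algebra_simps)
    moreover have "sin (Arg (z w) - Arg (z v)) \<ge> 0" using a by (intro sin_ge_zero)
    ultimately have "det2 v w / (cmod (V v0))\<^sup>2 \<ge> 0" unfolding Imz by simp
    then show False using d v0 by (simp add: zero_le_divide_iff)
  qed
  have "sorted_wrt (\<lambda>v w. t v < t w) vs" by (rule sorted_wrt_mono_rel[OF _ s]) (use lt in blast)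
  then have "sorted_wrt (<) (map t vs)" by (simp add: sorted_wrt_map)
  moreover have "map pt vs = map cis (map t vs)" using pt by simp
  moreover have "\<forall>s\<in>set (map t vs). \<forall>u\<in>set (map t vs). u < s + 2 * pi"
  proof (intro ballI)
    fix s u assume "s \<in> set (map t vs)" "u \<in> set (map t vs)"
    then obtain v w where "v \<in> set vs" "s = t v" "w \<in> set vs" "u = t w" by auto
    then show "u < s + 2 * pi" using rng[of v] rng[of w] by (auto simp: t_def)
  qed
  ultimately show ?thesis unfolding cyclically_ordered_def by blast
qed

section \<open>The group of lifts of a Fuchsian group\<close>

lemma uminus_mem_PSL:
  fixes X :: "(real^2^2) set"
  assumes "X \<in> carrier PSL" "A \<in> X"
  shows "- A \<in> X"
proof -
  have A: "det A = 1" "X = cl A" using cl_of_mem[OF assms] by auto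
  moreover have "det (- A) = det A" by (simp add: det_2)
  ultimately show ?thesis unfolding A(2) cl_eq[OF A(1)] by simp
qed

lemma finite_PSL_elem: "X \<in> carrier PSL \<Longrightarrow> finite X" for X :: "(real^2^2) set"
proof -
  assume X: "X \<in> carrier PSL"
  then have "X \<subseteq> {psl_lift X, - psl_lift X}" using PSL_mem_eq[OF X psl_lift_mem[OF X]] by blast
  then show "finite X" by (rule finite_subset) simp
qed

text \<open>Cayley-Hamilton. The formula shows that the inverse depends continuously on the entries,
  as the limit in \<open>discrete_finite\<close> requires.\<close>

lemma matrix_inv_2:
  fixes B :: "real^2^2"
  assumes "det B = 1"
  shows "matrix_inv B = trace B *\<^sub>R mat 1 - B"
proof -
  have "B ** (trace B *\<^sub>R mat 1 - B) = det B *\<^sub>R mat 1" "(trace B *\<^sub>R mat 1 - B) ** B = det B *\<^sub>R mat 1"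
    by (simp_all add: vec_eq_iff forall_2 matrix_matrix_mult_def sum_2 mat_def det_2 trace2 algebra_simps)
  then show ?thesis using assms by (intro matrix_inv_eqI) simp_all
qed

text \<open>Infinitely many bounded lifts would yield a convergent sequence of distinct ones, and
  the quotients of consecutive terms tend to the identity. The identity is isolated in
  \<open>\<Gamma>\<close>, so these quotients are eventually \<open>mat 1\<close> or
  \<open>- mat 1\<close>.\<close>

lemma discrete_finite:
  fixes \<Gamma> :: "(real^2^2) set set"
  assumes \<Gamma>: "subgroup \<Gamma> PSL" and disc: "subtopology PSL_topology \<Gamma> = discrete_topology \<Gamma>"
  shows "finite {A \<in> \<Union>\<Gamma>. norm A \<le> C}"
proof (rule ccontr)
  assume "infinite {A \<in> \<Union>\<Gamma>. norm A \<le> C}"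
  then obtain f :: "nat \<Rightarrow> real^2^2" where f: "inj f" "range f \<subseteq> {A \<in> \<Union>\<Gamma>. norm A \<le> C}" by (meson infinite_iff_countable_subset)
  have car: "X \<in> \<Gamma> \<Longrightarrow> X \<in> carrier PSL" for X using subgroup.subset[OF \<Gamma>] by blast
  have "\<forall>n. f n \<in> cball 0 C" using f(2) by auto
  then obtain M r where M: "strict_mono r" "(f \<circ> r) \<longlonglongrightarrow> M" using compact_cball[of "0 :: real^2^2" C] unfolding compact_def by metis
  define g where "g = f \<circ> r"
  have gin: "\<exists>X\<in>\<Gamma>. g n \<in> X" for n using f(2) by (auto simp: g_def)
  have inj: "inj g" unfolding g_def using f(1) M(1) by (simp add: inj_compose strict_mono_imp_inj_on)
  have det: "det (g n) = 1" for n using gin[of n] cl_of_mem(1) car by blast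
  have lim: "g \<longlonglongrightarrow> M" using M(2) by (simp add: g_def)
  have lc: "(\<lambda>n. g n $ i $ j) \<longlonglongrightarrow> M $ i $ j" for i j by (intro tendsto_vec_nth lim)
  have "(\<lambda>n. det (g n)) \<longlonglongrightarrow> det M" unfolding det_2 by (intro tendsto_intros lc)
  then have dM: "det M = 1" unfolding det by (simp add: LIMSEQ_const_iff)
  define h where "h n = g n ** matrix_inv (g (Suc n))" for n
  have lc': "(\<lambda>n. g (Suc n) $ i $ j) \<longlonglongrightarrow> M $ i $ j" for i j by (rule LIMSEQ_Suc[OF lc])
  have "(\<lambda>n. h n $ i $ j) \<longlonglongrightarrow> (M ** matrix_inv M) $ i $ j" for i j
    unfolding h_def matrix_inv_2[OF det] matrix_inv_2[OF dM] matrix_matrix_mult_def trace2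
    by (simp add: sum_2 mat_def) (intro conjI impI tendsto_intros lc lc')
  then have hl: "h \<longlonglongrightarrow> mat 1" unfolding matrix_inv_SL(1)[OF dM] by (intro vec_tendstoI)
  have one: "\<one>\<^bsub>PSL\<^esub> \<in> \<Gamma>" using \<Gamma> by (rule subgroup.one_closed)
  then have "openin (subtopology PSL_topology \<Gamma>) {\<one>\<^bsub>PSL\<^esub>}" unfolding disc by simp
  then obtain U where U: "openin PSL_topology U" "{\<one>\<^bsub>PSL\<^esub>} = U \<inter> \<Gamma>" by (auto simp: openin_subtopology)
  have "openin (top_of_set (carrier SL)) {x \<in> carrier SL. cl x \<in> U}"
    using U(1) unfolding PSL_topology_def openin_quotient_topology cl_def by simp
  then obtain W where W: "open W" "{x \<in> carrier SL. cl x \<in> U} = carrier SL \<inter> W" by (auto simp: openin_open)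
  have "mat 1 \<in> W"
  proof -
    have "\<one>\<^bsub>PSL\<^esub> \<in> U \<inter> \<Gamma>" unfolding U(2)[symmetric] by simp
    then have "mat 1 \<in> {x \<in> carrier SL. cl x \<in> U}" by (simp add: PSL_one)
    then show ?thesis unfolding W(2) by simp
  qed
  then have "eventually (\<lambda>n. h n \<in> W) sequentially" using hl W(1) topological_tendstoD by blast
  then obtain N where N: "\<And>n. n \<ge> N \<Longrightarrow> h n \<in> W" by (auto simp: eventually_sequentially)
  have step: "g n = - g (Suc n)" if n: "n \<ge> N" for n
  proof -
    obtain X Y where XY: "X \<in> \<Gamma>" "g n \<in> X" "Y \<in> \<Gamma>" "g (Suc n) \<in> Y" using gin by metis
    have hX: "h n \<in> X \<otimes>\<^bsub>PSL\<^esub> inv\<^bsub>PSL\<^esub> Y" unfolding h_def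
      by (intro PSL_mem_mult PSL_mem_inv car XY group.inv_closed[OF group_PSL])
    have XG: "X \<otimes>\<^bsub>PSL\<^esub> inv\<^bsub>PSL\<^esub> Y \<in> \<Gamma>" using XY \<Gamma> by (intro subgroup.m_closed subgroup.m_inv_closed)
    have dh: "det (h n) = 1" using cl_of_mem(1)[OF car[OF XG] hX] .
    have "h n \<in> carrier SL \<inter> W" using N[OF n] dh by simp
    then have "cl (h n) \<in> U" unfolding W(2)[symmetric] by simp
    then have "cl (h n) \<in> U \<inter> \<Gamma>" using cl_of_mem(2)[OF car[OF XG] hX] XG by simp
    then have "cl (h n) = cl (mat 1)" unfolding U(2)[symmetric] PSL_one by simp
    then have "h n \<in> cl (mat 1)" using mem_cl[OF dh] by simp
    then have "h n = mat 1 \<or> h n = - mat 1" by (simp add: cl_eq)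
    moreover have "g n = h n ** g (Suc n)" unfolding h_def by (simp only: matrix_mul_assoc[symmetric] matrix_inv_SL(2)[OF det] matrix_mul_rid)
    ultimately have "g n = g (Suc n) \<or> g n = - g (Suc n)" by auto
    moreover have "g n \<noteq> g (Suc n)" using inj by (simp add: inj_eq)
    ultimately show ?thesis by blast
  qed
  \<comment> \<open>Distinct consecutive terms differ by the sign, and two changes of sign
    cancel.\<close>
  have "g N = g (Suc (Suc N))" using step[of N] step[of "Suc N"] by simp
  then show False using inj by (simp add: inj_eq)
qed

text \<open>Induction over \<open>generate\<close> runs through elements of \<open>PSL\<close>,
  while the premises concern matrices. As \<open>P\<close> is invariant under negation, it may be
  checked on one lift of each element.\<close>

lemma generate_lifts_induct:
  fixes S0 :: "(real^2^2) set set"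
  assumes S0: "S0 \<subseteq> carrier PSL" and X: "X \<in> generate PSL S0" and A: "A \<in> X"
    and P: "P (mat 1)" "\<And>A. A \<in> \<Union>S0 \<Longrightarrow> P A"
    "\<And>A B. A \<in> \<Union>(generate PSL S0) \<Longrightarrow> B \<in> \<Union>(generate PSL S0) \<Longrightarrow> P A \<Longrightarrow> P B \<Longrightarrow> P (A ** B)"
    "\<And>A. A \<in> \<Union>(generate PSL S0) \<Longrightarrow> P A \<Longrightarrow> P (matrix_inv A)"
    "\<And>A. A \<in> \<Union>(generate PSL S0) \<Longrightarrow> P A \<Longrightarrow> P (- A)"
  shows "P A"
proof -
  have sg: "subgroup (generate PSL S0) PSL" by (rule group.generate_is_subgroup[OF group_PSL S0])
  have car: "Y \<in> generate PSL S0 \<Longrightarrow> Y \<in> carrier PSL" for Y using subgroup.subset[OF sg] by blast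
  have lift: "P B" if Y: "Y \<in> generate PSL S0" and B: "B \<in> Y" and D: "D \<in> Y" "P D" for Y B D
  proof -
    have "B = D \<or> B = - D" by (rule PSL_mem_eq[OF car[OF Y] D(1) B])
    then show ?thesis using D P(5) Y by blast
  qed
  have "\<forall>A\<in>X. P A" using X
  proof (induction rule: generate.induct)
    case one
    have "mat 1 \<in> \<one>\<^bsub>PSL\<^esub>" by (simp add: PSL_one mem_cl)
    then show ?case using lift[OF generate.one _ _ P(1)] by blast
  next
    case (incl Y)
    then show ?case using P(2) by blast
  next
    case (inv Y)
    have Y: "Y \<in> carrier PSL" "Y \<in> generate PSL S0" using inv S0 generate.incl by auto
    define D where "D = psl_lift Y"
    have D: "D \<in> Y" unfolding D_def by (rule psl_lift_mem[OF Y(1)])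
    have "P (matrix_inv D)" using P(2,4) D Y inv by blast
    then show ?case using lift[OF generate.inv[OF inv] _ PSL_mem_inv[OF Y(1) D]] by blast
  next
    case (eng Y Z)
    have YZ: "Y \<in> carrier PSL" "Z \<in> carrier PSL" using eng car by auto
    define D where "D = psl_lift Y"
    define E where "E = psl_lift Z"
    have D: "D \<in> Y" "E \<in> Z" unfolding D_def E_def by (rule psl_lift_mem[OF YZ(1)], rule psl_lift_mem[OF YZ(2)])
    have "P (D ** E)" using P(3) D eng by blast
    then show ?case using lift[OF generate.eng[OF eng(1,2)] _ PSL_mem_mult[OF YZ(1) D(1) YZ(2) D(2)]] by blast
  qed
  then show ?thesis using A by blast
qed

lemma pt_uminus: "pt (- v) = pt v"
  using pt_scale[of "-1" v] by simp

lemma disc_act_lift: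
  assumes "X \<in> carrier PSL" "A \<in> X" "v \<noteq> 0"
  shows "disc_act X (pt v) = pt (A *v v)"
proof -
  have "A = psl_lift X \<or> A = - psl_lift X" by (rule PSL_mem_eq[OF assms(1) psl_lift_mem[OF assms(1)] assms(2)])
  then have "pt (A *v v) = pt (psl_lift X *v v)" by (elim disjE) (simp_all add: pt_uminus)
  then show ?thesis unfolding disc_act_pt[OF assms(3)] by (rule sym)
qed

lemma fuchsian_sl2_group:
  assumes "fuchsian \<Gamma>" and S0: "finite S0" "S0 \<subseteq> carrier PSL" "\<Gamma> = generate PSL S0"
  shows "sl2_group (\<Union>\<Gamma>) (\<Union>S0)"
proof -
  have sg: "subgroup \<Gamma> PSL" and disc: "subtopology PSL_topology \<Gamma> = discrete_topology \<Gamma>" and ne: "\<not> elementary \<Gamma>"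
    using assms(1) by (auto simp: fuchsian_def)
  have car: "X \<in> \<Gamma> \<Longrightarrow> X \<in> carrier PSL" for X using subgroup.subset[OF sg] by blast
  show ?thesis
  proof
    fix A assume "A \<in> \<Union>\<Gamma>"
    then obtain X where X: "X \<in> \<Gamma>" "A \<in> X" by blast
    show "det A = 1" by (rule cl_of_mem(1)[OF car[OF X(1)] X(2)])
    show "matrix_inv A \<in> \<Union>\<Gamma>" using PSL_mem_inv[OF car[OF X(1)] X(2)] subgroup.m_inv_closed[OF sg X(1)] by blast
    show "- A \<in> \<Union>\<Gamma>" using uminus_mem_PSL[OF car[OF X(1)] X(2)] X(1) by blast
    fix B assume "B \<in> \<Union>\<Gamma>"
    then obtain Y where Y: "Y \<in> \<Gamma>" "B \<in> Y" by blast
    show "A ** B \<in> \<Union>\<Gamma>"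
      using PSL_mem_mult[OF car[OF X(1)] X(2) car[OF Y(1)] Y(2)] subgroup.m_closed[OF sg X(1) Y(1)] by blast
  next
    show "mat 1 \<in> \<Union>\<Gamma>" using subgroup.one_closed[OF sg] mem_cl[of "mat 1 :: real^2^2"] by (auto simp: PSL_one)
    show "finite {A \<in> \<Union>\<Gamma>. norm A \<le> C}" for C by (rule discrete_finite[OF sg disc])
    show "finite (\<Union>S0)" using S0 finite_PSL_elem by blast
    show "\<Union>S0 \<subseteq> \<Union>\<Gamma>" unfolding S0(3) by (intro Union_mono subsetI) (rule generate.incl)
  next
    fix v :: "real^2" and L :: "(real^2) set"
    assume v: "v \<noteq> 0" and L: "finite L" "0 \<notin> L"
    have "pt v \<in> cball 0 1" using norm_pt[OF v] by simp
    \<comment> \<open>Non-elementarity at the boundary point \<open>pt v\<close>: its orbit is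
      infinite and so leaves the finite set of points represented by \<open>L\<close>.\<close>
    then have "infinite ((\<lambda>g. disc_act g (pt v)) ` \<Gamma>)" using ne by (auto simp: elementary_def)
    then have "\<not> (\<lambda>g. disc_act g (pt v)) ` \<Gamma> \<subseteq> pt ` L" using L(1) finite_subset by blast
    then obtain X where X: "X \<in> \<Gamma>" "disc_act X (pt v) \<notin> pt ` L" by blast
    define A where "A = psl_lift X"
    have A: "A \<in> X" unfolding A_def by (rule psl_lift_mem[OF car[OF X(1)]])
    have "pt (A *v v) \<notin> pt ` L" using X(2) disc_act_lift[OF car[OF X(1)] A v] by simp
    moreover have "A *v v \<noteq> 0"
    proof
      assume "A *v v = 0"
      then have "matrix_inv A *v (A *v v) = 0" by simp
      then show False using v matrix_inv_SL(2)[OF cl_of_mem(1)[OF car[OF X(1)] A]] by (simp add: matrix_vector_mul_assoc)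
    qed
    ultimately have "det2 (A *v v) w \<noteq> 0" if "w \<in> L" for w
      using pt_eq_iff[of "A *v v" w] that L(2) by (metis imageI)
    then show "\<exists>g\<in>\<Union>\<Gamma>. \<forall>w\<in>L. det2 (g *v v) w \<noteq> 0" using A X(1) by blast
  next
    fix A and P :: "real^2^2 \<Rightarrow> bool"
    assume A: "A \<in> \<Union>\<Gamma>" and P: "P (mat 1)" "\<And>A. A \<in> \<Union>S0 \<Longrightarrow> P A"
      "\<And>A B. A \<in> \<Union>\<Gamma> \<Longrightarrow> B \<in> \<Union>\<Gamma> \<Longrightarrow> P A \<Longrightarrow> P B \<Longrightarrow> P (A ** B)"
      "\<And>A. A \<in> \<Union>\<Gamma> \<Longrightarrow> P A \<Longrightarrow> P (matrix_inv A)" "\<And>A. A \<in> \<Union>\<Gamma> \<Longrightarrow> P A \<Longrightarrow> P (- A)"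
    obtain X where X: "X \<in> generate PSL S0" "A \<in> X" using A unfolding S0(3) by (rule UnionE)
    show "P A" by (rule generate_lifts_induct[where P = P, OF S0(2) X P[unfolded S0(3)]])
  qed
qed

text \<open>The images of the base point under the powers of \<open>A\<close> converge to the
  attracting fixed point, and they differ from it because they lie inside the disc. Dividing by
  \<open>l ^ n\<close> gives numerator and denominator a limit.\<close>

lemma fixed_point_limit_set:
  assumes G: "sl2_group (\<Union>\<Gamma>) S" and car: "\<Gamma> \<subseteq> carrier PSL" and A: "A \<in> \<Union>\<Gamma>" and e: "eigpair A a b l"
  shows "pt a \<in> limit_set \<Gamma>"
proof -
  interpret sl2_group "\<Union>\<Gamma>" S by (rule G)
  have l: "l \<noteq> 0" "\<bar>l\<bar> > 1" "A *v a = l *\<^sub>R a" "A *v b = (1 / l) *\<^sub>R b" and d: "det2 a b \<noteq> 0" using e by (auto simp: eigpair_def)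
  have a: "a \<noteq> 0" "b \<noteq> 0" using d by auto
  have "\<exists>B\<in>\<Union>\<Gamma>. B *v a = l ^ n *\<^sub>R a \<and> B *v b = (1 / l) ^ n *\<^sub>R b" for n
  proof (induction n)
    case 0
    then show ?case by (intro bexI[OF _ one]) simp
  next
    case (Suc n)
    then obtain B where B: "B \<in> \<Union>\<Gamma>" "B *v a = l ^ n *\<^sub>R a" "B *v b = (1 / l) ^ n *\<^sub>R b" by blast
    have "(A ** B) *v a = l ^ Suc n *\<^sub>R a" "(A ** B) *v b = (1 / l) ^ Suc n *\<^sub>R b"
      unfolding matrix_vector_mul_assoc[symmetric] B matrix_vector_mult_scaleR l by simp_all
    then show ?case using mult[OF A B(1)] by blast
  qed
  then obtain B where B: "\<And>n. B n \<in> \<Union>\<Gamma>" "\<And>n. B n *v a = l ^ n *\<^sub>R a" "\<And>n. B n *v b = (1 / l) ^ n *\<^sub>R b" by metis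
  define X where "X n = cl (B n)" for n
  have X: "X n \<in> \<Gamma>" for n
  proof -
    obtain Y where Y: "Y \<in> \<Gamma>" "B n \<in> Y" using B(1) by blast
    then show ?thesis using cl_of_mem(2)[of Y "B n"] car unfolding X_def by auto
  qed
  define M where "M n = psl_lift (X n)" for n
  have detB: "det (B n) = 1" for n by (rule det1[OF B(1)])
  have XC: "X n \<in> carrier PSL" for n using X car by blast
  have BX: "B n \<in> X n" for n unfolding X_def by (rule mem_cl[OF detB])
  have MB: "M n = B n \<or> M n = - B n" for n
    unfolding M_def by (rule PSL_mem_eq[OF XC BX psl_lift_mem[OF XC]])
  have detM: "det (psl_lift (X n)) = 1" for n by (rule cl_of_mem(1)[OF XC psl_lift_mem[OF XC]])
  define lam where "lam v = Complex (v $ 1) (- v $ 2)" for v :: "real^2"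
  define lam' where "lam' v = Complex (v $ 1) (v $ 2)" for v :: "real^2"
  define u :: "real^2" where "u = axis 1 1"
  define v :: "real^2" where "v = axis 2 1"
  have col: "(N *v u) $ i = N $ i $ 1" "(N *v v) $ i = N $ i $ 2" for N :: "real^2^2" and i
    by (simp_all add: u_def v_def matrix_vector_mult_def sum_2 axis_def)
  have d0: "disc_act (X n) 0 = (\<i> * lam (B n *v u) + lam (B n *v v)) / (\<i> * lam' (B n *v u) + lam' (B n *v v))" for n
  proof (cases "M n = B n")
    case True
    then show ?thesis unfolding disc_act_0 M_def[symmetric] lam_def lam'_def col by simp
  next
    case False
    then have "M n = - B n" using MB by blast
    then have "disc_act (X n) 0 = (- (\<i> * lam (B n *v u) + lam (B n *v v))) / (- (\<i> * lam' (B n *v u) + lam' (B n *v v)))"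
      unfolding disc_act_0 M_def[symmetric] lam_def lam'_def col
      by (intro arg_cong2[where f = "(/)"]) (simp_all add: complex_eq_iff)
    then show ?thesis by (simp only: minus_divide_divide)
  qed
  have Bw: "(1 / l) ^ n *\<^sub>R (B n *v w) = (det2 w b / det2 a b) *\<^sub>R a + ((1 / l)\<^sup>2 ^ n * (det2 a w / det2 a b)) *\<^sub>R b" for w n
  proof -
    define k where "k = (1 / l) ^ n"
    have kl: "k * l ^ n = 1" "k * k = (1 / l)\<^sup>2 ^ n"
      using l(1) by (simp_all only: k_def power2_eq_square power_mult_distrib[symmetric]) simp_all
    have "det2 a b *\<^sub>R (B n *v w) = B n *v (det2 w b *\<^sub>R a + det2 a w *\<^sub>R b)"
      unfolding det2_expansion[of a b w, symmetric] matrix_vector_mult_scaleR ..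
    also have "\<dots> = det2 w b *\<^sub>R (l ^ n *\<^sub>R a) + det2 a w *\<^sub>R (k *\<^sub>R b)"
      by (simp only: matrix_vector_right_distrib matrix_vector_mult_scaleR B k_def)
    finally have "(k / det2 a b) *\<^sub>R (det2 a b *\<^sub>R (B n *v w)) =
        (k / det2 a b) *\<^sub>R (det2 w b *\<^sub>R (l ^ n *\<^sub>R a) + det2 a w *\<^sub>R (k *\<^sub>R b))" by (simp only:)
    also have "\<dots> = ((k * l ^ n) * det2 w b / det2 a b) *\<^sub>R a + ((k * k) * (det2 a w / det2 a b)) *\<^sub>R b"
      by (simp add: scaleR_add_right mult_ac)
    also have "(k / det2 a b) *\<^sub>R (det2 a b *\<^sub>R (B n *v w)) = k *\<^sub>R (B n *v w)" using d by simp
    finally show ?thesis unfolding kl k_def[symmetric] by simp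
  qed
  have "\<bar>(1 / l)\<^sup>2\<bar> < 1" using l by (simp add: abs_square_less_1)
  then have p0: "(\<lambda>n. (1 / l)\<^sup>2 ^ n) \<longlonglongrightarrow> 0" by (intro LIMSEQ_power_zero) simp
  have lw: "(\<lambda>n. (1 / l) ^ n *\<^sub>R (B n *v w)) \<longlonglongrightarrow> (det2 w b / det2 a b) *\<^sub>R a" for w
  proof -
    have "(\<lambda>n. (det2 w b / det2 a b) *\<^sub>R a + ((1 / l)\<^sup>2 ^ n * (det2 a w / det2 a b)) *\<^sub>R b)
       \<longlonglongrightarrow> (det2 w b / det2 a b) *\<^sub>R a + (0 * (det2 a w / det2 a b)) *\<^sub>R b"
      by (intro tendsto_intros p0)
    then show ?thesis unfolding Bw by simp
  qed
  \<comment> \<open>The common factor of numerator and denominator in the limit; it could vanish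
    only for \<open>b = 0\<close>.\<close>
  define s where "s = \<i> * complex_of_real (det2 u b / det2 a b) + complex_of_real (det2 v b / det2 a b)"
  have s: "s \<noteq> 0"
  proof
    assume "s = 0"
    then have "det2 u b = 0" "det2 v b = 0" using d by (auto simp: s_def complex_eq_iff)
    then have "b = 0" by (simp add: u_def v_def det2_def axis_def vec_eq_iff forall_2)
    then show False using a by simp
  qed
  have ls: "lam (c *\<^sub>R w) = complex_of_real c * lam w" "lam' (c *\<^sub>R w) = complex_of_real c * lam' w" for c w
    by (simp_all add: lam_def lam'_def complex_eq_iff)
  have d1: "disc_act (X n) 0 = (\<i> * lam ((1 / l) ^ n *\<^sub>R (B n *v u)) + lam ((1 / l) ^ n *\<^sub>R (B n *v v))) /
      (\<i> * lam' ((1 / l) ^ n *\<^sub>R (B n *v u)) + lam' ((1 / l) ^ n *\<^sub>R (B n *v v)))" for n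
  proof -
    define c where "c = complex_of_real ((1 / l) ^ n)"
    have c: "c \<noteq> 0" using l(1) by (simp add: c_def)
    have "disc_act (X n) 0 = (c * (\<i> * lam (B n *v u) + lam (B n *v v))) / (c * (\<i> * lam' (B n *v u) + lam' (B n *v v)))"
      unfolding d0 using c by simp
    then show ?thesis unfolding ls c_def[symmetric] by (simp only: distrib_left mult.left_commute[of c])
  qed
  have la: "lam' a \<noteq> 0" using Complex_nz[OF a(1)] by (simp add: lam'_def)
  have L0: "\<i> * lam' ((det2 u b / det2 a b) *\<^sub>R a) + lam' ((det2 v b / det2 a b) *\<^sub>R a) = s * lam' a"
    "\<i> * lam ((det2 u b / det2 a b) *\<^sub>R a) + lam ((det2 v b / det2 a b) *\<^sub>R a) = s * lam a"
    unfolding ls s_def by (simp_all add: algebra_simps)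
  have "(\<lambda>n. lam ((1 / l) ^ n *\<^sub>R (B n *v w))) \<longlonglongrightarrow> lam ((det2 w b / det2 a b) *\<^sub>R a)"
    "(\<lambda>n. lam' ((1 / l) ^ n *\<^sub>R (B n *v w))) \<longlonglongrightarrow> lam' ((det2 w b / det2 a b) *\<^sub>R a)" for w
    unfolding lam_def lam'_def by (intro tendsto_intros tendsto_vec_nth lw)+
  then have "(\<lambda>n. disc_act (X n) 0) \<longlonglongrightarrow> (s * lam a) / (s * lam' a)"
    unfolding d1 L0[symmetric] by (intro tendsto_intros) (use s la in \<open>auto simp: L0\<close>)
  then have lim: "(\<lambda>n. disc_act (X n) 0) \<longlonglongrightarrow> pt a" using s by (simp add: pt_def lam_def lam'_def)
  have "disc_act (X n) 0 \<noteq> pt a" for n using norm_disc_act_0[OF detM[of n]] norm_pt[OF a(1)] by auto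
  then have "pt a islimpt (\<lambda>g. disc_act g 0) ` \<Gamma>"
    unfolding islimpt_sequential using lim X by (intro exI[of _ "\<lambda>n. disc_act (X n) 0"]) auto
  then show ?thesis using norm_pt[OF a(1)] by (simp add: limit_set_def)
qed

subsection \<open>Counting functions\<close>

text \<open>Markov's inequality for the counting measure. It turns convergence of the exponential
  series into a bound on orbit counts.\<close>

lemma summable_on_card_bound:
  fixes g :: "'a \<Rightarrow> real"
  assumes g: "g summable_on X" "\<And>x. x \<in> X \<Longrightarrow> g x \<ge> 0" and Y: "Y \<subseteq> X" "\<And>x. x \<in> Y \<Longrightarrow> g x \<ge> \<epsilon>" and \<epsilon>: "\<epsilon> > 0"
  shows "finite Y \<and> real (card Y) * \<epsilon> \<le> infsum g X"
proof -
  have b: "real (card Z) * \<epsilon> \<le> infsum g X" if Z: "finite Z" "Z \<subseteq> Y" for Z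
  proof -
    have "real (card Z) * \<epsilon> \<le> sum g Z" using Z Y(2) sum_bounded_below[of Z \<epsilon> g] by auto
    also have "\<dots> \<le> infsum g X" by (rule finite_sum_le_infsum) (use g Z Y in auto)
    finally show ?thesis .
  qed
  have "finite Y"
  proof (rule ccontr)
    assume "infinite Y"
    then obtain Z where Z: "finite Z" "card Z = nat \<lceil>infsum g X / \<epsilon>\<rceil> + 1" "Z \<subseteq> Y" using infinite_arbitrarily_large by blast
    have "infsum g X / \<epsilon> < real (card Z)" unfolding Z(2) by linarith
    then show False using b[OF Z(1,3)] \<epsilon> by (simp add: field_simps)
  qed
  then show ?thesis using b by blast
qed

text \<open>The sum is cut into layers by the integer part of \<open>f\<close>. The
  \<open>k\<close>-th layer contributes at most a constant times \<open>exp ((s2 - s) * k)\<close>,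
  and \<open>s2 < s\<close> makes this a convergent geometric series.\<close>

lemma summable_on_exp_of_growth:
  fixes f :: "'a \<Rightarrow> real"
  assumes f: "\<And>x. x \<in> X \<Longrightarrow> f x \<ge> 0" and s: "0 < s2" "s2 < s" and D: "D \<ge> 0"
    and g: "\<And>T. T \<ge> 0 \<Longrightarrow> finite {x \<in> X. f x \<le> T} \<and> real (card {x \<in> X. f x \<le> T}) \<le> D * exp (s2 * T)"
  shows "(\<lambda>x. exp (- s * f x)) summable_on X"
proof (rule nonneg_bounded_partial_sums_imp_summable_on)
  show "exp (- s * f x) \<ge> 0" for x by simp
  define q where "q = exp (s2 - s)"
  have q: "0 < q" "q < 1" using s by (auto simp: q_def)
  have "(\<Sum>x\<in>F. exp (- s * f x)) \<le> D * exp s2 / (1 - q)" if F: "finite F" "F \<subseteq> X" for F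
  proof -
    define n where "n x = nat \<lfloor>f x\<rfloor>" for x
    have n: "real (n x) \<le> f x" "f x \<le> real (n x) + 1" if "x \<in> X" for x
      using f[OF that] by (auto simp: n_def le_floor_iff)
    define m where "m = Suc (Max (insert 0 (n ` F)))"
    have "n ` F \<subseteq> {..<m}" using F(1) by (auto simp: m_def less_Suc_eq_le)
    then have "(\<Sum>x\<in>F. exp (- s * f x)) = (\<Sum>k<m. \<Sum>x\<in>{x. x \<in> F \<and> n x = k}. exp (- s * f x))"
      using F(1) by (intro sum.group[symmetric]) auto
    also have "\<dots> \<le> (\<Sum>k<m. D * exp s2 * q ^ k)"
    proof (rule sum_mono)
      fix k
      have "(\<Sum>x\<in>{x. x \<in> F \<and> n x = k}. exp (- s * f x)) \<le> (\<Sum>x\<in>{x. x \<in> F \<and> n x = k}. exp (- s * real k))"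
      proof (rule sum_mono)
        fix x assume "x \<in> {x. x \<in> F \<and> n x = k}"
        then have "real k \<le> f x" using n F(2) by auto
        then show "exp (- s * f x) \<le> exp (- s * real k)" using s by simp
      qed
      also have "\<dots> = real (card {x. x \<in> F \<and> n x = k}) * exp (- s * real k)" by simp
      also have "\<dots> \<le> (D * exp (s2 * (real k + 1))) * exp (- s * real k)"
      proof (rule mult_right_mono)
        have "{x. x \<in> F \<and> n x = k} \<subseteq> {x \<in> X. f x \<le> real k + 1}" using n F(2) by auto
        then have "card {x. x \<in> F \<and> n x = k} \<le> card {x \<in> X. f x \<le> real k + 1}" using g[of "real k + 1"] by (intro card_mono) auto
        then show "real (card {x. x \<in> F \<and> n x = k}) \<le> D * exp (s2 * (real k + 1))" using g[of "real k + 1"] by linarith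
      qed simp
      also have "\<dots> = D * exp (s2 * (real k + 1) + - s * real k)" by (simp only: exp_add mult.assoc)
      also have "s2 * (real k + 1) + - s * real k = s2 + real k * (s2 - s)" by (simp add: algebra_simps)
      also have "D * exp (s2 + real k * (s2 - s)) = D * exp s2 * q ^ k" by (simp add: exp_add exp_of_nat_mult q_def)
      finally show "(\<Sum>x\<in>{x. x \<in> F \<and> n x = k}. exp (- s * f x)) \<le> D * exp s2 * q ^ k" .
    qed
    also have "\<dots> = D * exp s2 * (\<Sum>k<m. q ^ k)" by (simp add: sum_distrib_left)
    also have "\<dots> \<le> D * exp s2 * (1 / (1 - q))"
    proof (rule mult_left_mono)
      have "(\<Sum>k<m. q ^ k) = (1 - q ^ m) / (1 - q)" using q by (simp add: sum_gp_strict)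
      then show "(\<Sum>k<m. q ^ k) \<le> 1 / (1 - q)" using q by (simp add: divide_right_mono)
      show "0 \<le> D * exp s2" using D by simp
    qed
    finally show ?thesis by simp
  qed
  then show "eventually (\<lambda>F. (\<Sum>x\<in>F. exp (- s * f x)) \<le> D * exp s2 / (1 - q)) (finite_subsets_at_top X)"
    by (intro eventually_finite_subsets_at_top_weakI)
qed

lemma log_card_le:
  assumes "finite S" "real (card S) \<le> exp y"
  shows "log_card S \<le> ereal y"
proof (cases "S = {}")
  case False
  then have "real (card S) > 0" using assms(1) by (simp add: card_gt_0_iff)
  then have "ln (real (card S)) \<le> ln (exp y)" using assms(2) by (subst ln_le_cancel_iff) auto
  then have "ln (real (card S)) \<le> y" by simp
  then show ?thesis using assms(1) False by (simp add: log_card_def)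
qed (simp add: log_card_def)

text \<open>Nonemptiness makes the logarithm nonnegative and so yields \<open>y > 0\<close>; for the
  empty set it would be \<open>-\<infinity>\<close>.\<close>

lemma log_card_less:
  assumes "S \<noteq> {}" "T > 0" "log_card S / ereal T < ereal y"
  shows "finite S" "y > 0" "real (card S) \<le> exp (y * T)"
proof -
  show fin: "finite S"
  proof (rule ccontr)
    assume "infinite S"
    then show False using assms by (simp add: log_card_def)
  qed
  have c: "real (card S) \<ge> 1" using fin assms(1) by (simp add: Suc_leI card_gt_0_iff)
  have l: "ln (real (card S)) / T < y" using assms fin by (simp add: log_card_def)
  then have l2: "ln (real (card S)) < y * T" using assms(2) by (simp add: field_simps)
  have "ln (real (card S)) / T \<ge> 0" using c assms(2) by simp
  then show "y > 0" using l by linarith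
  show "real (card S) \<le> exp (y * T)" proof -
    have "real (card S) = exp (ln (real (card S)))" using c by simp
    also have "\<dots> \<le> exp (y * T)" using l2 by simp
    finally show ?thesis .
  qed
qed

text \<open>The counting argument in the abstract: \<open>X\<close> is the group, \<open>H\<close>
  and \<open>Sp\<close> are its hyperbolic and separated elements, \<open>cls\<close> is the
  conjugacy class and the \<open>\<tau> i\<close> are right multiplications. The entropy is bounded
  by choosing one separated element in each class. The converse counts all separated elements of a
  class, and any increase of the exponent absorbs the factor
  \<open>N * (1 + \<nu> y)\<close>.\<close>

lemma exponents_agree:
  fixes X H Sp :: "'a set" and \<kappa> \<nu> :: "'a \<Rightarrow> real" and cls :: "'a \<Rightarrow> 'b" and \<tau> :: "'i \<Rightarrow> 'a \<Rightarrow> 'a"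
  assumes inf: "infinite X" and sub: "Sp \<subseteq> H" "H \<subseteq> X" and \<kappa>0: "\<And>x. x \<in> X \<Longrightarrow> \<kappa> x \<ge> 0" and C: "C \<ge> 0"
    and near: "\<And>x. x \<in> Sp \<Longrightarrow> \<bar>\<kappa> x - \<nu> x\<bar> \<le> C"
    and rep: "\<And>x. x \<in> H \<Longrightarrow> \<exists>y\<in>Sp. cls y = cls x \<and> \<nu> y = \<nu> x"
    and F: "finite F" "\<And>i. i \<in> F \<Longrightarrow> inj_on (\<tau> i) X" "\<And>x. x \<in> X \<Longrightarrow> \<exists>i\<in>F. \<tau> i x \<in> Sp \<and> \<kappa> (\<tau> i x) \<le> \<kappa> x + C"
    and mult: "N \<ge> 0" "\<And>y. y \<in> Sp \<Longrightarrow> finite {z \<in> Sp. cls z = cls y} \<and> real (card {z \<in> Sp. cls z = cls y}) \<le> N * (1 + \<nu> y)"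
  shows "Inf (ereal ` {s. (\<lambda>x. exp (- s * \<kappa> x)) summable_on X}) =
    Limsup at_top (\<lambda>T::real. log_card (cls ` {x \<in> H. \<nu> x \<le> T}) / ereal T)"
proof (rule antisym)
  let ?Cl = "\<lambda>T. cls ` {x \<in> H. \<nu> x \<le> T}"
  let ?h = "Limsup at_top (\<lambda>T::real. log_card (?Cl T) / ereal T)"
  show "?h \<le> Inf (ereal ` {s. (\<lambda>x. exp (- s * \<kappa> x)) summable_on X})"
  proof (rule Inf_greatest)
    fix z assume "z \<in> ereal ` {s. (\<lambda>x. exp (- s * \<kappa> x)) summable_on X}"
    then obtain s where z: "z = ereal s" and sm: "(\<lambda>x. exp (- s * \<kappa> x)) summable_on X" by blast
    \<comment> \<open>Otherwise all terms would be at least 1, and \<open>X\<close> is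
      infinite.\<close>
    have s: "s > 0"
    proof (rule ccontr)
      assume "\<not> s > 0"
      then have "exp (- s * \<kappa> x) \<ge> 1" if "x \<in> X" for x using \<kappa>0[OF that] by (simp add: mult_nonpos_nonneg)
      then have "finite X" using summable_on_card_bound[OF sm _ subset_refl, of 1] by simp
      then show False using inf by simp
    qed
    define M where "M = max 1 (infsum (\<lambda>x. exp (- s * \<kappa> x)) X)"
    have B: "finite {x \<in> X. \<kappa> x \<le> T} \<and> real (card {x \<in> X. \<kappa> x \<le> T}) \<le> M * exp (s * T)" for T
    proof -
      have "finite {x \<in> X. \<kappa> x \<le> T} \<and> real (card {x \<in> X. \<kappa> x \<le> T}) * exp (- s * T) \<le> infsum (\<lambda>x. exp (- s * \<kappa> x)) X"
        by (rule summable_on_card_bound[OF sm]) (use s in auto)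
      then have "finite {x \<in> X. \<kappa> x \<le> T}" "real (card {x \<in> X. \<kappa> x \<le> T}) * exp (- s * T) \<le> M" by (auto simp: M_def)
      then show ?thesis by (simp add: exp_minus field_simps)
    qed
    define k where "k = ln M + s * C"
    have le: "log_card (?Cl T) / ereal T \<le> ereal (k / T + s)" if T: "T > 0" for T
    proof -
      have sb: "?Cl T \<subseteq> cls ` {x \<in> X. \<kappa> x \<le> T + C}"
      proof
        fix c assume "c \<in> ?Cl T"
        then obtain x where x: "x \<in> H" "\<nu> x \<le> T" "c = cls x" by blast
        then obtain y where y: "y \<in> Sp" "cls y = cls x" "\<nu> y = \<nu> x" using rep by blast
        have "\<kappa> y \<le> T + C" using near[OF y(1)] x y by linarith
        then show "c \<in> cls ` {x \<in> X. \<kappa> x \<le> T + C}" using x y sub by (intro image_eqI[of _ _ y]) auto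
      qed
      have fi: "finite (cls ` {x \<in> X. \<kappa> x \<le> T + C})" using B[of "T + C"] by simp
      have "card (?Cl T) \<le> card (cls ` {x \<in> X. \<kappa> x \<le> T + C})" by (rule card_mono[OF fi sb])
      also have "\<dots> \<le> card {x \<in> X. \<kappa> x \<le> T + C}" using B[of "T + C"] by (intro card_image_le) simp
      finally have "real (card (?Cl T)) \<le> M * exp (s * (T + C))" using B[of "T + C"] by linarith
      also have "\<dots> = exp (k + s * T)"
      proof -
        have "M > 0" by (simp add: M_def)
        then have "M * exp (s * (T + C)) = exp (ln M + s * (T + C))" by (simp add: exp_add)
        then show ?thesis by (simp add: k_def algebra_simps)
      qed
      finally have "log_card (?Cl T) \<le> ereal (k + s * T)" by (rule log_card_le[OF finite_subset[OF sb fi]])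
      then have "log_card (?Cl T) / ereal T \<le> ereal (k + s * T) / ereal T" using T by (intro ereal_divide_right_mono) simp_all
      then show ?thesis using T by (simp add: field_simps)
    qed
    have "?h \<le> Limsup at_top (\<lambda>T::real. ereal (k / T + s))"
      by (rule Limsup_mono) (use le in \<open>auto intro!: eventually_mono[OF eventually_gt_at_top[of 0]]\<close>)
    also have "\<dots> = ereal s"
    proof (rule lim_imp_Limsup)
      have "((\<lambda>T::real. k / T + s) \<longlongrightarrow> 0 + s) at_top"
        by (intro tendsto_add real_tendsto_divide_at_top[OF tendsto_const filterlim_ident] tendsto_const)
      then show "((\<lambda>T::real. ereal (k / T + s)) \<longlongrightarrow> ereal s) at_top" by (simp add: lim_ereal)
    qed simp
    finally show "?h \<le> z" unfolding z .
  qed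
  show "Inf (ereal ` {s. (\<lambda>x. exp (- s * \<kappa> x)) summable_on X}) \<le> ?h"
  proof (rule dense_ge)
    fix z assume "?h < z"
    then obtain s where s: "?h < ereal s" "ereal s < z" using ereal_dense2 by blast
    obtain s1 where s1: "?h < ereal s1" "ereal s1 < ereal s" using ereal_dense2[OF s(1)] by blast
    obtain T0 where T0: "\<And>T. T \<ge> T0 \<Longrightarrow> log_card (?Cl T) / ereal T < ereal s1"
      using Limsup_lessD[OF s1(1)] by (auto simp: eventually_at_top_linorder)
    obtain x0 where "x0 \<in> X" using inf by fastforce
    then obtain x1 where x1: "x1 \<in> H" using F(3) sub by blast
    \<comment> \<open>From \<open>\<nu> x1\<close> on the set of classes is nonempty, so its
      logarithm is not \<open>-\<infinity>\<close>; this also gives \<open>s1 > 0\<close>.\<close>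
    define T1 where "T1 = max 1 (max T0 (\<nu> x1))"
    have T1: "T1 \<ge> 1" "T1 \<ge> T0" "T1 \<ge> \<nu> x1" by (auto simp: T1_def)
    have Cl: "finite (?Cl T) \<and> s1 > 0 \<and> real (card (?Cl T)) \<le> exp (s1 * T)" if "T \<ge> T1" for T
    proof -
      have "cls x1 \<in> ?Cl T" using x1 T1(3) that by auto
      then have "?Cl T \<noteq> {}" by blast
      then show ?thesis using log_card_less[of "?Cl T" T s1] T0[of T] T1(1,2) that by auto
    qed
    have s1p: "s1 > 0" using Cl[OF order_refl] by blast
    have Z: "finite {z \<in> Sp. \<kappa> z \<le> U} \<and> real (card {z \<in> Sp. \<kappa> z \<le> U}) \<le> exp (s1 * (U + C)) * (N * (1 + (U + C)))"
      if U: "U + C \<ge> T1" for U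
    proof -
      let ?Zc = "\<lambda>c. {z \<in> Sp. cls z = c \<and> \<kappa> z \<le> U}"
      have zc: "finite (?Zc c) \<and> real (card (?Zc c)) \<le> N * (1 + (U + C))" for c
      proof (cases "?Zc c = {}")
        case True
        have "N * (1 + (U + C)) \<ge> 0" using mult(1) U T1 by simp
        then show ?thesis unfolding True by simp
      next
        case False
        then obtain y where y: "y \<in> Sp" "cls y = c" "\<kappa> y \<le> U" by blast
        have "?Zc c \<subseteq> {z \<in> Sp. cls z = cls y}" using y(2) by auto
        then have "finite (?Zc c)" "card (?Zc c) \<le> card {z \<in> Sp. cls z = cls y}"
          using mult(2)[OF y(1)] by (auto intro: finite_subset card_mono)
        moreover have "N * (1 + \<nu> y) \<le> N * (1 + (U + C))"
          using near[OF y(1)] y(3) mult(1) by (intro mult_left_mono) linarith+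
        ultimately show ?thesis using mult(2)[OF y(1)] by linarith
      qed
      have eq: "{z \<in> Sp. \<kappa> z \<le> U} = (\<Union>c\<in>?Cl (U + C). ?Zc c)"
      proof (intro equalityI subsetI)
        fix z assume z: "z \<in> {z \<in> Sp. \<kappa> z \<le> U}"
        then have "\<nu> z \<le> U + C" using near[of z] by auto
        then show "z \<in> (\<Union>c\<in>?Cl (U + C). ?Zc c)" using z sub by (intro UN_I[of "cls z"]) auto
      qed blast
      have "real (card {z \<in> Sp. \<kappa> z \<le> U}) \<le> (\<Sum>c\<in>?Cl (U + C). real (card (?Zc c)))"
        unfolding eq of_nat_sum[symmetric] of_nat_le_iff using Cl[OF U] by (intro card_UN_le) simp
      also have "\<dots> \<le> (\<Sum>c\<in>?Cl (U + C). N * (1 + (U + C)))" by (rule sum_mono) (use zc in blast)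
      also have "\<dots> = real (card (?Cl (U + C))) * (N * (1 + (U + C)))" by simp
      also have "\<dots> \<le> exp (s1 * (U + C)) * (N * (1 + (U + C)))"
        using Cl[OF U] mult(1) U T1 by (intro mult_right_mono) auto
      finally show ?thesis unfolding eq using Cl[OF U] zc by (intro conjI finite_UN_I) auto
    qed
    \<comment> \<open>The step from \<open>s1\<close> to \<open>s2\<close> absorbs the linear
      factor, the step from \<open>s2\<close> to \<open>s\<close> makes the series converge.\<close>
    define s2 where "s2 = (s1 + s) / 2"
    have s2: "s1 < s2" "s2 < s" using s1(2) by (auto simp: s2_def)
    define \<epsilon> where "\<epsilon> = s2 - s1"
    have \<epsilon>: "\<epsilon> > 0" using s2 by (simp add: \<epsilon>_def)
    have lin: "1 + W \<le> (1 + 1 / \<epsilon>) * exp (\<epsilon> * W)" if "W \<ge> 0" for W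
    proof -
      have "1 + W \<le> (1 + 1 / \<epsilon>) * (1 + \<epsilon> * W)" using \<epsilon> that by (simp add: field_simps)
      also have "\<dots> \<le> (1 + 1 / \<epsilon>) * exp (\<epsilon> * W)" using \<epsilon> by (intro mult_left_mono exp_ge_add_one_self) simp
      finally show ?thesis .
    qed
    define D where "D = real (card F) * (N * (1 + 1 / \<epsilon>)) * exp (s2 * (T1 + 2 * C))"
    have grow: "finite {x \<in> X. \<kappa> x \<le> T} \<and> real (card {x \<in> X. \<kappa> x \<le> T}) \<le> D * exp (s2 * T)" if T: "T \<ge> 0" for T
    proof -
      \<comment> \<open>Adding \<open>T1\<close> brings \<open>U + C\<close> into the range of
        \<open>Z\<close> for every \<open>T \<ge> 0\<close>, at the cost of a constant factor in
        \<open>D\<close>; the \<open>C\<close> pays for applying \<open>\<tau> i\<close>.\<close>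
      define U where "U = T + T1 + C"
      define W where "W = U + C"
      have W: "W \<ge> T1" "W \<ge> 0" "W = T + (T1 + 2 * C)" using T T1 C by (auto simp: U_def W_def)
      let ?Z = "{z \<in> Sp. \<kappa> z \<le> U}"
      let ?A = "\<lambda>i. {x \<in> X. \<tau> i x \<in> ?Z}"
      have Zf: "finite ?Z" "real (card ?Z) \<le> exp (s1 * W) * (N * (1 + W))" using Z[of U] W by (auto simp: W_def)
      have A: "finite (?A i)" "card (?A i) \<le> card ?Z" if i: "i \<in> F" for i
      proof -
        have inj: "inj_on (\<tau> i) (?A i)" using F(2)[OF i] by (rule inj_on_subset) blast
        have im: "\<tau> i ` ?A i \<subseteq> ?Z" by blast
        show "finite (?A i)" using finite_imageD[OF finite_subset[OF im Zf(1)] inj] .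
        show "card (?A i) \<le> card ?Z" by (rule card_inj_on_le[OF inj im Zf(1)])
      qed
      have sb: "{x \<in> X. \<kappa> x \<le> T} \<subseteq> (\<Union>i\<in>F. ?A i)"
      proof
        fix x assume x: "x \<in> {x \<in> X. \<kappa> x \<le> T}"
        then obtain i where i: "i \<in> F" "\<tau> i x \<in> Sp" "\<kappa> (\<tau> i x) \<le> \<kappa> x + C" using F(3) by blast
        then have "\<kappa> (\<tau> i x) \<le> U" using x T1 by (simp add: U_def)
        then show "x \<in> (\<Union>i\<in>F. ?A i)" using i x by blast
      qed
      have fin: "finite (\<Union>i\<in>F. ?A i)" using F(1) A(1) by blast
      have "card {x \<in> X. \<kappa> x \<le> T} \<le> card (\<Union>i\<in>F. ?A i)" by (rule card_mono[OF fin sb])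
      also have "\<dots> \<le> (\<Sum>i\<in>F. card (?A i))" by (rule card_UN_le[OF F(1)])
      also have "\<dots> \<le> (\<Sum>i\<in>F. card ?Z)" by (rule sum_mono[OF A(2)])
      finally have "card {x \<in> X. \<kappa> x \<le> T} \<le> card F * card ?Z" by simp
      then have "real (card {x \<in> X. \<kappa> x \<le> T}) \<le> real (card F * card ?Z)" by (simp only: of_nat_le_iff)
      also have "\<dots> \<le> real (card F) * (exp (s1 * W) * (N * (1 + W)))" using Zf(2) by (simp add: mult_left_mono)
      also have "\<dots> \<le> real (card F) * (exp (s1 * W) * (N * ((1 + 1 / \<epsilon>) * exp (\<epsilon> * W))))"
        using lin[OF W(2)] mult(1) by (intro mult_left_mono) auto
      also have "\<dots> = real (card F) * (N * (1 + 1 / \<epsilon>)) * (exp (s1 * W) * exp (\<epsilon> * W))" by (simp only: mult_ac)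
      also have "exp (s1 * W) * exp (\<epsilon> * W) = exp (s2 * W)" unfolding exp_add[symmetric] by (simp add: \<epsilon>_def algebra_simps)
      also have "s2 * W = s2 * (T1 + 2 * C) + s2 * T" unfolding W(3) by (simp add: algebra_simps)
      finally have "real (card {x \<in> X. \<kappa> x \<le> T}) \<le> D * exp (s2 * T)" by (simp only: D_def exp_add mult.assoc)
      then show ?thesis using finite_subset[OF sb fin] by blast
    qed
    have "D \<ge> 0" using mult(1) \<epsilon> by (simp add: D_def)
    then have "(\<lambda>x. exp (- s * \<kappa> x)) summable_on X"
      by (intro summable_on_exp_of_growth[of X \<kappa> s2 s D] \<kappa>0 s2(2) grow) (use s1p s2(1) in simp_all)
    then have "Inf (ereal ` {s. (\<lambda>x. exp (- s * \<kappa> x)) summable_on X}) \<le> ereal s" by (intro Inf_lower) blast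
    then show "Inf (ereal ` {s. (\<lambda>x. exp (- s * \<kappa> x)) summable_on X}) \<le> z" using s(2) by simp
  qed
qed

subsection \<open>The two exponents of a Hitchin representation\<close>

lemma hitchin_rep_of_hitchin:
  fixes \<xi> :: "complex \<Rightarrow> 'n::finite flag"
  assumes fu: "fuchsian \<Gamma>" and S0: "finite S0" "S0 \<subseteq> carrier PSL" "\<Gamma> = generate PSL S0"
    and \<rho>: "\<rho> \<in> hom (PSL\<lparr>carrier := \<Gamma>\<rparr>) PSL"
    and cont: "continuous_map (top_of_set (limit_set \<Gamma>)) flag_topology \<xi>"
    and pos: "positive_map (limit_set \<Gamma>) \<xi>"
    and equiv: "\<forall>g\<in>\<Gamma>. \<forall>x\<in>limit_set \<Gamma>. \<xi> (disc_act g x) = flag_act (psl_lift (\<rho> g)) (\<xi> x)"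
  shows "hitchin_rep (\<Union>\<Gamma>) (\<Union>S0) {v. v \<noteq> 0 \<and> pt v \<in> limit_set \<Gamma>} (\<lambda>v. \<xi> (pt v)) (\<lambda>A. psl_lift (\<rho> (cl A)))"
proof -
  have sl2: "sl2_group (\<Union>\<Gamma>) (\<Union>S0)" by (rule fuchsian_sl2_group[OF fu S0])
  have sg: "subgroup \<Gamma> PSL" using fu by (simp add: fuchsian_def)
  have car: "\<Gamma> \<subseteq> carrier PSL" by (rule subgroup.subset[OF sg])
  have \<Gamma>cl: "cl A \<in> \<Gamma> \<and> A \<in> cl A" if A: "A \<in> \<Union>\<Gamma>" for A
  proof -
    obtain X where X: "X \<in> \<Gamma>" "A \<in> X" using A by blast
    then show ?thesis using cl_of_mem[of X A] car mem_cl[of A] by auto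
  qed
  let ?L = "{v. v \<noteq> 0 \<and> pt v \<in> limit_set \<Gamma>}"
  show ?thesis
  proof (intro hitchin_rep.intro hitchin_rep_axioms.intro sl2 flag_curve.intro)
    show "0 \<notin> ?L" by simp
    show "c *\<^sub>R v \<in> ?L \<and> \<xi> (pt (c *\<^sub>R v)) = \<xi> (pt v)" if "v \<in> ?L" "c \<noteq> 0" for v c using that by (simp add: pt_scale)
    show "y \<in> ?L" if x: "\<And>m. x m \<in> ?L" "x \<longlonglongrightarrow> y" "y \<noteq> 0" for x :: "nat \<Rightarrow> real^2" and y
    proof -
      have "closed (limit_set \<Gamma>)"
      proof -
        have "limit_set \<Gamma> = sphere 0 1 \<inter> {x. x islimpt (\<lambda>g. disc_act g 0) ` \<Gamma>}" by (auto simp: limit_set_def)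
        then show ?thesis by (simp add: closed_Int closed_limpts)
      qed
      then have "pt y \<in> limit_set \<Gamma>"
        by (rule closed_sequentially[of _ "\<lambda>m. pt (x m)"]) (use x tendsto_pt in auto)
      then show ?thesis using x by simp
    qed
    show "u \<in> \<xi> (pt y) k" if "\<And>m. x m \<in> ?L" "y \<in> ?L" "x \<longlonglongrightarrow> y" "\<And>m. z m \<in> \<xi> (pt (x m)) k" "z \<longlonglongrightarrow> u"
      for x :: "nat \<Rightarrow> real^2" and y z u k
      by (rule flag_map_closed_graph[OF cont, of "\<lambda>m. pt (x m)" "pt y" z]) (use that tendsto_pt in auto)
    show "positive_tuple (map (\<lambda>v. \<xi> (pt v)) vs)"
      if "2 \<le> length vs" "set vs \<subseteq> ?L" "sorted_wrt (\<lambda>v w. det2 v w < 0) vs" for vs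
    proof -
      have "cyclically_ordered (map pt vs)" using that by (intro cyclically_ordered_pt) auto
      moreover have "set (map pt vs) \<subseteq> limit_set \<Gamma>" "length (map pt vs) \<ge> 2" using that by auto
      ultimately have "positive_tuple (map \<xi> (map pt vs))" using pos unfolding positive_map_def by blast
      then show ?thesis by (simp add: comp_def)
    qed
    fix A assume A: "A \<in> \<Union>\<Gamma>"
    have "\<rho> (cl A) \<in> carrier PSL" using \<rho> \<Gamma>cl[OF A] by (auto simp: hom_def Pi_iff)
    then show "det (psl_lift (\<rho> (cl A))) = 1" using cl_of_mem(1) psl_lift_mem by blast
    show "\<xi> (pt (A *v v)) = flag_act (psl_lift (\<rho> (cl A))) (\<xi> (pt v))" if v: "v \<in> ?L" for v
    proof -
      have "pt (A *v v) = disc_act (cl A) (pt v)" by (rule disc_act_lift[symmetric]) (use \<Gamma>cl[OF A] v car in auto)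
      then show ?thesis using equiv \<Gamma>cl[OF A] v by auto
    qed
    show "a \<in> ?L" if "eigpair A a b l" for a b l
      using fixed_point_limit_set[OF sl2 car A that] that by (auto simp: eigpair_def)
  qed
qed

section \<open>Conjugation invariance and kernel of the representation\<close>

lemma eigpair_uminus: "eigpair M a b l \<Longrightarrow> eigpair (- M) a b (- l)"
  by (simp add: eigpair_def)

context hitchin_rep
begin

lemma sep_uminus: "sep K M \<Longrightarrow> sep K (- M)"
  unfolding sep_def using eigpair_uminus by blast

lemma R_diagonal:
  assumes \<eta>: "\<eta> \<in> G" and e: "eigpair \<eta> a b l"
  obtains P Q D where "R \<eta> ** P = P ** diagm D" "P ** Q = mat 1" "det (diagm D :: real^'n^'n) = 1"
proof -
  have ab: "a \<in> L" "b \<in> L" "det2 a b \<noteq> 0" using fixed_pair[OF \<eta> e] fixed_subset e by (auto simp: eigpair_def)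
  then obtain \<beta> where \<beta>: "compatible \<beta> (\<zeta> a) (\<zeta> b)" using pair(3) by blast
  obtain ev where ev: "\<forall>i<CARD('n). R \<eta> *v \<beta> i = ev i *\<^sub>R \<beta> i \<and> ev i \<noteq> 0" using R_eigenbasis[OF \<eta> e \<beta>] by blast
  have ob: "ordered_basis \<beta>" using \<beta> by (simp add: compatible_def)
  have AP: "R \<eta> ** colmat \<beta> = colmat \<beta> ** diagm (\<lambda>i. ev (nidx i))" by (rule colmat_diag(1)[OF ob]) (use ev in blast)
  have "\<exists>Q. colmat \<beta> ** Q = mat 1" by (rule colmat_diag(2)[where A = "R \<eta>", OF ob]) (use ev in blast)
  then obtain Q where Q: "colmat \<beta> ** Q = mat 1" by metis
  have "det (colmat \<beta>) * det (diagm (\<lambda>i. ev (nidx i)) :: real^'n^'n) = det (R \<eta>) * det (colmat \<beta>)" unfolding det_mul[symmetric] AP ..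
  moreover have "det (colmat \<beta>) * det Q = 1" unfolding det_mul[symmetric] Q by simp
  then have "det (colmat \<beta>) \<noteq> 0" by auto
  ultimately have "det (diagm (\<lambda>i. ev (nidx i)) :: real^'n^'n) = 1" using R_det[OF \<eta>] by simp
  then show thesis using that AP Q by blast
qed

text \<open>Conjugation moves the eigenbasis by \<open>B\<close>. The sign, present because lifts
  are multiplicative only up to sign, does not change the moduli.\<close>

lemma eigenvalue_moduli_R_conj:
  fixes A B B' :: "real^'n^'n"
  assumes \<eta>: "\<eta> \<in> G" and e: "eigpair \<eta> a b l" and B: "B' ** B = mat 1" "B ** B' = mat 1"
    and A: "A = B ** R \<eta> ** B' \<or> A = - (B ** R \<eta> ** B')"
  shows "eigenvalue_moduli A = eigenvalue_moduli (R \<eta>)"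
proof -
  obtain P Q D where d: "R \<eta> ** P = P ** diagm D" "P ** Q = mat 1" "det (diagm D :: real^'n^'n) = 1" by (rule R_diagonal[OF \<eta> e])
  have 1: "eigenvalue_moduli (R \<eta>) = decr_list (\<lambda>i. \<bar>D i\<bar>)" by (rule eigenvalue_moduli_similar[OF d(1,2)])
  have "(B ** R \<eta> ** B') ** (B ** P) = B ** (R \<eta> ** ((B' ** B) ** P))" by (simp only: matrix_mul_assoc)
  also have "\<dots> = (B ** P) ** diagm D" unfolding B(1) matrix_mul_lid d(1) by (simp only: matrix_mul_assoc)
  finally have BP: "(B ** R \<eta> ** B') ** (B ** P) = (B ** P) ** diagm D" .
  have "(B ** P) ** (Q ** B') = B ** ((P ** Q) ** B')" by (simp only: matrix_mul_assoc)
  also have "\<dots> = mat 1" unfolding d(2) matrix_mul_lid B(2) ..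
  finally have BQ: "(B ** P) ** (Q ** B') = mat 1" .
  show ?thesis
  proof (cases "A = B ** R \<eta> ** B'")
    case True
    then have "A ** (B ** P) = (B ** P) ** diagm D" using BP by simp
    then show ?thesis using eigenvalue_moduli_similar[OF _ BQ] 1 by simp
  next
    case False
    then have "A = - (B ** R \<eta> ** B')" using A by blast
    moreover have "(diagm (\<lambda>i. - D i) :: real^'n^'n) = - diagm D" by (simp add: vec_eq_iff diagm_def)
    ultimately have "A ** (B ** P) = (B ** P) ** diagm (\<lambda>i. - D i)" using BP by simp
    then show ?thesis using eigenvalue_moduli_similar[OF _ BQ] 1 by fastforce
  qed
qed

lemma sum_ln_eigenvalue_moduli:
  assumes \<eta>: "\<eta> \<in> G" and e: "eigpair \<eta> a b l"
  shows "(\<Sum>k<CARD('n). ln (eigenvalue_moduli (R \<eta>) ! k)) = 0"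
proof -
  obtain P Q D where d: "R \<eta> ** P = P ** diagm D" "P ** Q = mat 1" "det (diagm D :: real^'n^'n) = 1" by (rule R_diagonal[OF \<eta> e])
  have "eigenvalue_moduli (R \<eta>) = singular_values (diagm D :: real^'n^'n)"
    unfolding eigenvalue_moduli_similar[OF d(1,2)] singular_values_diagm ..
  then show ?thesis using sum_ln_singular_values[of "diagm D :: real^'n^'n"] d(3) by simp
qed

text \<open>If \<open>R C\<close> is a sign, then \<open>\<zeta>\<close> takes the same value at
  \<open>y\<close> and \<open>C *v y\<close>. Were these different boundary points, a flag would be
  transverse to itself, which is impossible in dimension at least 2. So \<open>C\<close> fixes three
  boundary points and is scalar.\<close>

lemma R_trivial:
  assumes C: "C \<in> G" and R: "R C = mat 1 \<or> R C = - mat 1" and d: "CARD('n) \<ge> 2"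
  shows "C = mat 1 \<or> C = - mat 1"
proof -
  have fx0: "det2 (C *v y) y = 0" if y: "y \<in> fixed_vectors" for y
  proof (rule ccontr)
    assume nz: "det2 (C *v y) y \<noteq> 0"
    have yL: "y \<in> L" "C *v y \<in> L" using y fixed_act[OF y C] fixed_subset by auto
    have z: "\<zeta> (C *v y) = flag_act (R C) (\<zeta> y)" by (rule equivariant[OF C yL(1)])
    have sub: "subspace (\<zeta> y i)" for i using fixed_flag[OF y] by (simp add: flags_def)
    have "flag_act (R C) (\<zeta> y) i = \<zeta> y i" for i
      using R
    proof
      assume "R C = - mat 1"
      then have "flag_act (R C) (\<zeta> y) i = uminus ` \<zeta> y i" by (simp add: flag_act_def)
      also have "\<dots> = \<zeta> y i" using subspace_neg[OF sub[of i]] by (auto intro!: image_eqI[where x = "- x" for x])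
      finally show ?thesis .
    qed (simp add: flag_act_def)
    then have same: "\<zeta> (C *v y) = \<zeta> y" unfolding z by blast
    obtain \<beta> where "compatible \<beta> (\<zeta> (C *v y)) (\<zeta> y)" using pair(3)[OF yL(2,1) nz] by blast
    then have "\<zeta> y 1 \<inter> \<zeta> y (CARD('n) - 1) = {0}" using d by (simp add: compatible_def transverse_def same)
    moreover have "\<zeta> y 1 \<subseteq> \<zeta> y (CARD('n) - 1)" using fixed_flag[OF y] d by (simp add: flags_def mono_def)
    ultimately have "\<zeta> y 1 = {0}" using subspace_0[OF sub] by blast
    moreover have "dim (\<zeta> y 1) = 1" using fixed_flag[OF y] d by (simp add: flags_def)
    ultimately show False by simp
  qed
  obtain P where P: "finite P" "P \<subseteq> fixed_vectors" "card P = 3" "\<forall>x\<in>P. \<forall>y\<in>P. x \<noteq> y \<longrightarrow> det2 x y \<noteq> 0"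
    using many_fixed_vectors[of 3] by blast
  then obtain x y z where xyz: "P = {x, y, z}" "x \<noteq> y" "x \<noteq> z" "y \<noteq> z" by (auto simp: card_3_iff)
  have D: "det2 x y \<noteq> 0" "det2 x z \<noteq> 0" "det2 z y \<noteq> 0" using P(4) xyz by auto
  have fx: "det2 x (C *v x) = 0" "det2 y (C *v y) = 0" "det2 (C *v z) z = 0"
    using fx0 P(2) xyz(1) det2_swap[of x "C *v x"] det2_swap[of y "C *v y"] by auto
  have "x \<noteq> 0" "y \<noteq> 0" using D by auto
  then obtain p q where p: "C *v x = p *\<^sub>R x" and q: "C *v y = q *\<^sub>R y" using det2_0_parallel fx(1,2) by metis
  have zz: "det2 x y *\<^sub>R z = det2 z y *\<^sub>R x + det2 x z *\<^sub>R y" by (rule det2_expansion)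
  have "det2 x y *\<^sub>R (C *v z) = C *v (det2 z y *\<^sub>R x + det2 x z *\<^sub>R y)" unfolding zz[symmetric] matrix_vector_mult_scaleR ..
  also have "\<dots> = (det2 z y * p) *\<^sub>R x + (det2 x z * q) *\<^sub>R y" by (simp add: matrix_vector_right_distrib matrix_vector_mult_scaleR p q)
  finally have Cz: "det2 x y *\<^sub>R (C *v z) = (det2 z y * p) *\<^sub>R x + (det2 x z * q) *\<^sub>R y" .
  have "det2 (det2 x y *\<^sub>R (C *v z)) (det2 x y *\<^sub>R z) = 0" using fx(3) by simp
  then have "(det2 z y * det2 x z * det2 x y) * (p - q) = 0"
    unfolding Cz unfolding zz using det2_swap[of y x] by (simp add: algebra_simps)
  then have pq: "q = p" using D by simp
  have Cv: "C *v v = p *\<^sub>R v" for v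
  proof -
    obtain s t where v: "v = s *\<^sub>R x + t *\<^sub>R y" using det2_basis[OF D(1)] by metis
    show ?thesis unfolding v by (simp add: matrix_vector_right_distrib matrix_vector_mult_scaleR p q pq algebra_simps)
  qed
  then have "C *v v = (p *\<^sub>R mat 1) *v v" for v by (simp add: scaleR_matrix_vector_assoc[symmetric])
  then have Cp: "C = p *\<^sub>R mat 1" by (simp add: matrix_eq)
  have "p * p = 1" using det1[OF C] unfolding Cp by (simp add: det_2 mat_def)
  then have "p = 1 \<or> p = - 1" by (simp add: square_eq_1_iff)
  then show ?thesis unfolding Cp by auto
qed

end

section \<open>The functional on Cartan and Jordan projections\<close>

locale psl_rep = hitchin_rep "\<Union>\<Gamma>" S L \<zeta> "\<lambda>A. psl_lift (\<rho> (cl A))"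
  for \<Gamma> :: "(real^2^2) set set" and S L and \<zeta> :: "real^2 \<Rightarrow> 'n::finite flag" and \<rho> :: "(real^2^2) set \<Rightarrow> (real^'n^'n) set" +
  fixes \<phi> :: "(nat \<Rightarrow> real) \<Rightarrow> real" and c :: "nat \<Rightarrow> real"
  assumes sg: "subgroup \<Gamma> PSL" and \<rho>: "\<rho> \<in> hom (PSL\<lparr>carrier := \<Gamma>\<rparr>) PSL"
    and c: "j < CARD('n) - 1 \<Longrightarrow> c j \<ge> 0"
    and \<phi>: "A \<in> cartan_subspace CARD('n) \<Longrightarrow> \<phi> A = (\<Sum>j<CARD('n) - 1. c j * simple_root j A)"
    and \<phi>_nz: "\<exists>A\<in>cartan_subspace CARD('n). \<phi> A \<noteq> 0"
begin

abbreviation R :: "real^2^2 \<Rightarrow> real^'n^'n" where "R A \<equiv> psl_lift (\<rho> (cl A))"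

lemma car: "X \<in> \<Gamma> \<Longrightarrow> X \<in> carrier PSL"
  using subgroup.subset[OF sg] by blast

lemma lift: "X \<in> \<Gamma> \<Longrightarrow> psl_lift X \<in> X" "X \<in> \<Gamma> \<Longrightarrow> psl_lift X \<in> \<Union>\<Gamma>" "X \<in> \<Gamma> \<Longrightarrow> cl (psl_lift X) = X"
  using psl_lift_mem[OF car] cl_of_mem(2)[OF car, of X "psl_lift X"] by auto

lemma cl_mem: "X \<in> \<Gamma> \<Longrightarrow> A \<in> X \<Longrightarrow> cl A = X"
  using cl_of_mem(2)[OF car] by metis

lemma cl_G: "A \<in> \<Union>\<Gamma> \<Longrightarrow> cl A \<in> \<Gamma>" "A \<in> \<Union>\<Gamma> \<Longrightarrow> A \<in> cl A"
  using cl_mem by auto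

lemma rho_car: "X \<in> \<Gamma> \<Longrightarrow> \<rho> X \<in> carrier PSL"
  using \<rho> by (auto simp: hom_def Pi_iff)

lemma rho_mult: "X \<in> \<Gamma> \<Longrightarrow> Y \<in> \<Gamma> \<Longrightarrow> \<rho> (X \<otimes>\<^bsub>PSL\<^esub> Y) = \<rho> X \<otimes>\<^bsub>PSL\<^esub> \<rho> Y"
  using \<rho> by (auto simp: hom_def)

lemma cl_mult: "A \<in> \<Union>\<Gamma> \<Longrightarrow> B \<in> \<Union>\<Gamma> \<Longrightarrow> cl (A ** B) = cl A \<otimes>\<^bsub>PSL\<^esub> cl B"
  using PSL_mult[of A B] det1 by simp

lemma R_mem: "A \<in> \<Union>\<Gamma> \<Longrightarrow> R A \<in> \<rho> (cl A)"
  by (rule psl_lift_mem[OF rho_car[OF cl_G(1)]])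

lemma R_mult:
  assumes "A \<in> \<Union>\<Gamma>" "B \<in> \<Union>\<Gamma>"
  shows "R (A ** B) = R A ** R B \<or> R (A ** B) = - (R A ** R B)"
proof -
  have "R A ** R B \<in> \<rho> (cl (A ** B))"
    unfolding cl_mult[OF assms] rho_mult[OF cl_G(1)[OF assms(1)] cl_G(1)[OF assms(2)]]
    by (intro PSL_mem_mult rho_car cl_G R_mem assms)
  then show ?thesis by (rule PSL_mem_eq[OF rho_car[OF cl_G(1)[OF mult[OF assms]]] _ R_mem[OF mult[OF assms]]])
qed

lemma sep_lift: "X \<in> \<Gamma> \<Longrightarrow> A \<in> X \<Longrightarrow> sep K A \<Longrightarrow> sep K (psl_lift X)"
  using PSL_mem_eq[OF car _ lift(1), of X A] sep_uminus by auto

text \<open>With all coefficients 0 the functional would vanish on the Cartan subspace. The index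
  found here is the one used to count conjugates, and its existence forces dimension at least
  2.\<close>

lemma positive_coefficient: "\<exists>j. Suc j < CARD('n) \<and> c j > 0"
proof (rule ccontr)
  assume "\<not> ?thesis"
  then have "c j = 0" if "j < CARD('n) - 1" for j using c[OF that] that by (metis less_diff_conv less_eq_real_def Suc_eq_plus1)
  then have "\<phi> A = 0" if "A \<in> cartan_subspace CARD('n)" for A unfolding \<phi>[OF that] by simp
  then show False using \<phi>_nz by blast
qed

text \<open>The critical exponent sums over the image of \<open>\<rho>\<close>, whereas the entropy
  counts classes of \<open>\<Gamma>\<close>; injectivity lets both be computed on
  \<open>\<Gamma>\<close>.\<close>

lemma rho_inj: "inj_on \<rho> \<Gamma>"
proof
  fix X Y assume XY: "X \<in> \<Gamma>" "Y \<in> \<Gamma>" "\<rho> X = \<rho> Y"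
  let ?A = "psl_lift X" let ?B = "psl_lift Y"
  define D where "D = ?A ** matrix_inv ?B"
  have A: "?A \<in> \<Union>\<Gamma>" "?B \<in> \<Union>\<Gamma>" using lift XY by auto
  have D: "D \<in> \<Union>\<Gamma>" unfolding D_def by (intro mult minv A)
  have DB: "D ** ?B = ?A" unfolding D_def by (simp only: matrix_mul_assoc[symmetric] inv_mult(2)[OF A(2)] matrix_mul_rid)
  have "cl D \<otimes>\<^bsub>PSL\<^esub> Y = X" using cl_mult[OF D A(2)] lift(3) XY by (simp add: DB)
  then have "\<rho> (cl D) \<otimes>\<^bsub>PSL\<^esub> \<rho> Y = \<rho> Y" using rho_mult[OF cl_G(1)[OF D] XY(2)] XY(3) by simp
  then have "\<rho> (cl D) = \<one>\<^bsub>PSL\<^esub>"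
    using group.l_cancel_one[OF group_PSL rho_car[OF XY(2)] rho_car[OF cl_G(1)[OF D]]]
      group.r_cancel_one[OF group_PSL rho_car[OF XY(2)] rho_car[OF cl_G(1)[OF D]]] by blast
  then have "R D \<in> cl (mat 1)" using R_mem[OF D] by (simp add: PSL_one)
  then have "R D = mat 1 \<or> R D = - mat 1" by (simp add: cl_eq)
  moreover have "CARD('n) \<ge> 2" using positive_coefficient by auto
  ultimately have "D = mat 1 \<or> D = - mat 1" by (rule R_trivial[OF D])
  then have "?A = ?B \<or> ?A = - ?B" using DB by auto
  then have "?A \<in> Y" using lift(1)[OF XY(2)] uminus_mem_PSL[OF car[OF XY(2)]] by auto
  then show "X = Y" by (rule PSL_disjoint[OF car[OF XY(1)] car[OF XY(2)] lift(1)[OF XY(1)]])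
qed

lemma cartan_proj_subspace: "X \<in> \<Gamma> \<Longrightarrow> cartan_proj (\<rho> X) \<in> cartan_subspace CARD('n)"
proof -
  assume X: "X \<in> \<Gamma>"
  have "det (psl_lift (\<rho> X)) = 1" using R_det[OF lift(2)[OF X]] lift(3)[OF X] by simp
  then show ?thesis using sum_ln_singular_values[of "psl_lift (\<rho> X)"] by (simp add: cartan_subspace_def cartan_proj_def)
qed

lemma jordan_proj_subspace: "X \<in> \<Gamma> \<Longrightarrow> eigpair (psl_lift X) a b l \<Longrightarrow> jordan_proj (\<rho> X) \<in> cartan_subspace CARD('n)"
  using sum_ln_eigenvalue_moduli[OF lift(2)[of X], of a b l] lift(3)[of X] by (simp add: cartan_subspace_def jordan_proj_def)

lemma eigenvalue_moduli_decreasing: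
  assumes "\<eta> \<in> \<Union>\<Gamma>" "eigpair \<eta> a b l" "Suc k < CARD('n)"
  shows "ln (eigenvalue_moduli (R \<eta>) ! Suc k) \<le> ln (eigenvalue_moduli (R \<eta>) ! k)"
proof -
  obtain P Q D where d: "R \<eta> ** P = P ** diagm D" "P ** Q = mat 1" "det (diagm D :: real^'n^'n) = 1" by (rule R_diagonal[OF assms(1,2)])
  have "eigenvalue_moduli (R \<eta>) = singular_values (diagm D :: real^'n^'n)"
    unfolding eigenvalue_moduli_similar[OF d(1,2)] singular_values_diagm ..
  then show ?thesis
    using singular_values_pos[of "diagm D :: real^'n^'n"] singular_values_mono[of k "Suc k" "diagm D :: real^'n^'n"] d(3) assms(3) by simp
qed

text \<open>Each simple root is a difference of two coordinates, whence the factor 2.\<close>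

lemma phi_close:
  assumes x: "x \<in> cartan_subspace CARD('n)" and y: "y \<in> cartan_subspace CARD('n)"
    and B: "\<And>k. k < CARD('n) \<Longrightarrow> \<bar>x k - y k\<bar> \<le> B"
  shows "\<bar>\<phi> x - \<phi> y\<bar> \<le> (\<Sum>j<CARD('n) - 1. c j) * (2 * B)"
proof -
  have "\<phi> x - \<phi> y = (\<Sum>j<CARD('n) - 1. c j * (simple_root j x - simple_root j y))"
    unfolding \<phi>[OF x] \<phi>[OF y] by (simp add: sum_subtractf right_diff_distrib)
  also have "\<bar>\<dots>\<bar> \<le> (\<Sum>j<CARD('n) - 1. c j * (2 * B))"
  proof (rule order_trans[OF sum_abs sum_mono])
    fix j assume "j \<in> {..<CARD('n) - 1}"
    then have j: "j < CARD('n) - 1" "j < CARD('n)" "Suc j < CARD('n)" by auto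
    have "\<bar>simple_root j x - simple_root j y\<bar> \<le> 2 * B" using B[OF j(2)] B[OF j(3)] by (auto simp: simple_root_def)
    then show "\<bar>c j * (simple_root j x - simple_root j y)\<bar> \<le> c j * (2 * B)"
      using c[OF j(1)] by (simp add: abs_mult mult_left_mono)
  qed
  also have "\<dots> = (\<Sum>j<CARD('n) - 1. c j) * (2 * B)" by (rule sum_distrib_right[symmetric])
  finally show ?thesis .
qed

lemma cartan_nonneg: "X \<in> \<Gamma> \<Longrightarrow> \<phi> (cartan_proj (\<rho> X)) \<ge> 0"
proof -
  assume X: "X \<in> \<Gamma>"
  have d: "det (psl_lift (\<rho> X)) \<noteq> 0" using R_det[OF lift(2)[OF X]] lift(3)[OF X] by simp
  show ?thesis unfolding \<phi>[OF cartan_proj_subspace[OF X]]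
  proof (rule sum_nonneg)
    fix j assume "j \<in> {..<CARD('n) - 1}"
    then have j: "j < CARD('n) - 1" "Suc j < CARD('n)" by auto
    then have "simple_root j (cartan_proj (\<rho> X)) \<ge> 0"
      using singular_values_pos[OF d] singular_values_mono[of j "Suc j" "psl_lift (\<rho> X)"] by (simp add: simple_root_def cartan_proj_def)
    then show "0 \<le> c j * simple_root j (cartan_proj (\<rho> X))" using c[OF j(1)] by simp
  qed
qed

text \<open>The other summands of the functional are nonnegative because the moduli decrease. This
  is how a bound by one root becomes a bound by \<open>\<phi>\<close>.\<close>

lemma jordan_root_le:
  assumes X: "X \<in> \<Gamma>" and e: "eigpair (psl_lift X) a b l" and j: "Suc j < CARD('n)"
  shows "c j * (ln (eigenvalue_moduli (R (psl_lift X)) ! j) - ln (eigenvalue_moduli (R (psl_lift X)) ! Suc j)) \<le> \<phi> (jordan_proj (\<rho> X))"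
proof -
  let ?x = "jordan_proj (\<rho> X)"
  have r: "simple_root i ?x = ln (eigenvalue_moduli (R (psl_lift X)) ! i) - ln (eigenvalue_moduli (R (psl_lift X)) ! Suc i)"
    if "Suc i < CARD('n)" for i using that lift(3)[OF X] by (simp add: simple_root_def jordan_proj_def)
  have "c j * simple_root j ?x \<le> (\<Sum>i<CARD('n) - 1. c i * simple_root i ?x)"
  proof (rule member_le_sum)
    show "j \<in> {..<CARD('n) - 1}" using j by auto
    fix i assume "i \<in> {..<CARD('n) - 1} - {j}"
    then have "i < CARD('n) - 1" "Suc i < CARD('n)" by auto
    then show "0 \<le> c i * simple_root i ?x"
      using c eigenvalue_moduli_decreasing[OF lift(2)[OF X] e] r by simp
  qed simp
  then show ?thesis unfolding \<phi>[OF jordan_proj_subspace[OF X e]] r[OF j] .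
qed

lemma hyperbolic_iff: "X \<in> \<Gamma> \<Longrightarrow> hyperbolic X \<longleftrightarrow> (\<exists>a b l. eigpair (psl_lift X) a b l)"
  unfolding hyperbolic_def using eigpair_hyperbolic hyperbolic_eigpair[OF det1[OF lift(2)]] by blast

lemma conj_class_conj:
  assumes "X \<in> \<Gamma>" "g \<in> \<Gamma>"
  shows "conj_class \<Gamma> (g \<otimes>\<^bsub>PSL\<^esub> X \<otimes>\<^bsub>PSL\<^esub> inv\<^bsub>PSL\<^esub> g) = conj_class \<Gamma> X"
proof -
  interpret P: group "PSL :: (real^2^2) set monoid" by (rule group_PSL)
  have 1: "h \<otimes>\<^bsub>PSL\<^esub> (g \<otimes>\<^bsub>PSL\<^esub> Y \<otimes>\<^bsub>PSL\<^esub> inv\<^bsub>PSL\<^esub> g) \<otimes>\<^bsub>PSL\<^esub> inv\<^bsub>PSL\<^esub> h =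
      (h \<otimes>\<^bsub>PSL\<^esub> g) \<otimes>\<^bsub>PSL\<^esub> Y \<otimes>\<^bsub>PSL\<^esub> inv\<^bsub>PSL\<^esub> (h \<otimes>\<^bsub>PSL\<^esub> g)"
    if "h \<in> carrier PSL" "g \<in> carrier PSL" "Y \<in> carrier PSL" for h g Y :: "(real^2^2) set"
    using that by (simp add: P.m_assoc P.inv_mult_group)
  have sub: "conj_class \<Gamma> (g \<otimes>\<^bsub>PSL\<^esub> Y \<otimes>\<^bsub>PSL\<^esub> inv\<^bsub>PSL\<^esub> g) \<subseteq> conj_class \<Gamma> Y" if "Y \<in> \<Gamma>" "g \<in> \<Gamma>" for g Y
  proof
    fix Z assume "Z \<in> conj_class \<Gamma> (g \<otimes>\<^bsub>PSL\<^esub> Y \<otimes>\<^bsub>PSL\<^esub> inv\<^bsub>PSL\<^esub> g)"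
    then obtain h where h: "h \<in> \<Gamma>" "Z = h \<otimes>\<^bsub>PSL\<^esub> (g \<otimes>\<^bsub>PSL\<^esub> Y \<otimes>\<^bsub>PSL\<^esub> inv\<^bsub>PSL\<^esub> g) \<otimes>\<^bsub>PSL\<^esub> inv\<^bsub>PSL\<^esub> h"
      by (auto simp: conj_class_def)
    then have "Z = (h \<otimes>\<^bsub>PSL\<^esub> g) \<otimes>\<^bsub>PSL\<^esub> Y \<otimes>\<^bsub>PSL\<^esub> inv\<^bsub>PSL\<^esub> (h \<otimes>\<^bsub>PSL\<^esub> g)" using 1 that car by simp
    moreover have "h \<otimes>\<^bsub>PSL\<^esub> g \<in> \<Gamma>" by (rule subgroup.m_closed[OF sg h(1) that(2)])
    ultimately show "Z \<in> conj_class \<Gamma> Y" unfolding conj_class_def by blast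
  qed
  let ?Y = "g \<otimes>\<^bsub>PSL\<^esub> X \<otimes>\<^bsub>PSL\<^esub> inv\<^bsub>PSL\<^esub> g"
  have g': "inv\<^bsub>PSL\<^esub> g \<in> \<Gamma>" by (rule subgroup.m_inv_closed[OF sg assms(2)])
  then have Y: "?Y \<in> \<Gamma>" using assms sg by (intro subgroup.m_closed)
  have "inv\<^bsub>PSL\<^esub> g \<otimes>\<^bsub>PSL\<^esub> ?Y \<otimes>\<^bsub>PSL\<^esub> inv\<^bsub>PSL\<^esub> (inv\<^bsub>PSL\<^esub> g) = X"
    unfolding 1[OF car[OF g'] car[OF assms(2)] car[OF assms(1)]] using car assms by simp
  then have "conj_class \<Gamma> X \<subseteq> conj_class \<Gamma> ?Y" using sub[OF Y g'] by simp
  then show ?thesis using sub[OF assms] by blast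
qed

lemma jordan_proj_conj:
  assumes X: "X \<in> \<Gamma>" "hyperbolic X" and g: "g \<in> \<Gamma>"
  shows "jordan_proj (\<rho> (g \<otimes>\<^bsub>PSL\<^esub> X \<otimes>\<^bsub>PSL\<^esub> inv\<^bsub>PSL\<^esub> g)) = jordan_proj (\<rho> X)"
proof -
  interpret P: group "PSL :: (real^2^2) set monoid" by (rule group_PSL)
  interpret Q: group "PSL :: (real^'n^'n) set monoid" by (rule group_PSL)
  let ?Y = "g \<otimes>\<^bsub>PSL\<^esub> X \<otimes>\<^bsub>PSL\<^esub> inv\<^bsub>PSL\<^esub> g"
  have Y: "?Y \<in> \<Gamma>" using X g sg by (intro subgroup.m_closed subgroup.m_inv_closed)
  have "?Y \<otimes>\<^bsub>PSL\<^esub> g = g \<otimes>\<^bsub>PSL\<^esub> X" using car X g by (simp add: P.m_assoc)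
  then have "\<rho> g \<otimes>\<^bsub>PSL\<^esub> \<rho> X = \<rho> ?Y \<otimes>\<^bsub>PSL\<^esub> \<rho> g" using rho_mult[OF Y g] rho_mult[OF g X(1)] by simp
  then have rY: "\<rho> ?Y = \<rho> g \<otimes>\<^bsub>PSL\<^esub> \<rho> X \<otimes>\<^bsub>PSL\<^esub> inv\<^bsub>PSL\<^esub> (\<rho> g)"
    using rho_car X(1) g Y by (subst Q.inv_solve_right) auto
  define B where "B = psl_lift (\<rho> g)"
  have B: "B \<in> \<rho> g" unfolding B_def by (rule psl_lift_mem[OF rho_car[OF g]])
  have dB: "det B = 1" by (rule cl_of_mem(1)[OF rho_car[OF g] B])
  have RX: "R (psl_lift X) = psl_lift (\<rho> X)" by (simp add: lift(3)[OF X(1)])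
  have "B ** R (psl_lift X) ** matrix_inv B \<in> \<rho> ?Y"
    unfolding rY RX using rho_car X(1) g B by (intro PSL_mem_mult PSL_mem_inv psl_lift_mem Q.m_closed Q.inv_closed) auto
  then have "psl_lift (\<rho> ?Y) = B ** R (psl_lift X) ** matrix_inv B \<or> psl_lift (\<rho> ?Y) = - (B ** R (psl_lift X) ** matrix_inv B)"
    by (rule PSL_mem_eq[OF rho_car[OF Y] _ psl_lift_mem[OF rho_car[OF Y]]])
  moreover obtain a b l where "eigpair (psl_lift X) a b l" using X hyperbolic_iff by blast
  ultimately have "eigenvalue_moduli (psl_lift (\<rho> ?Y)) = eigenvalue_moduli (R (psl_lift X))"
    using eigenvalue_moduli_R_conj[OF lift(2)[OF X(1)] _ matrix_inv_SL(2,1)[OF dB]] by blast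
  then show ?thesis unfolding RX by (simp add: jordan_proj_def fun_eq_iff)
qed

theorem exponent_eq_entropy: "critical_exponent \<phi> \<Gamma> \<rho> = entropy \<phi> \<Gamma> \<rho>"
proof -
  interpret P: group "PSL :: (real^2^2) set monoid" by (rule group_PSL)
  let ?\<kappa> = "\<lambda>X. \<phi> (cartan_proj (\<rho> X))" and ?\<nu> = "\<lambda>X. \<phi> (jordan_proj (\<rho> X))"
  let ?H = "{g \<in> \<Gamma>. hyperbolic g}"
  obtain F K1 where F: "finite F" "F \<subseteq> \<Union>\<Gamma>" "\<forall>g\<in>\<Union>\<Gamma>. \<exists>f\<in>F. sep K1 (g ** f)" using finite_hyperbolizing by blast
  obtain K2 where K2: "\<forall>M\<in>\<Union>\<Gamma>. (\<exists>a b l. eigpair M a b l) \<longrightarrow> (\<exists>g\<in>\<Union>\<Gamma>. sep K2 (g ** M ** matrix_inv g))"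
    using hyperbolic_conj_separated by blast
  define K where "K = max K1 K2"
  have sepK: "sep K1 M \<Longrightarrow> sep K M" "sep K2 M \<Longrightarrow> sep K M" for M by (auto simp: K_def intro: sep_mono)
  let ?Sp = "{g \<in> \<Gamma>. sep K (psl_lift g)}"
  have SpH: "?Sp \<subseteq> ?H" using hyperbolic_iff by (auto simp: sep_def)
  obtain C1 where C1: "C1 \<ge> 1" "\<forall>\<eta>\<in>\<Union>\<Gamma>. sep K \<eta> \<longrightarrow> (\<forall>k<CARD('n).
     \<bar>ln (singular_values (R \<eta>) ! k) - ln (eigenvalue_moduli (R \<eta>) ! k)\<bar> \<le> 2 * ln C1)"
    using singular_values_near_eigenvalue_moduli by blast
  have "\<exists>C. C \<ge> 1 \<and> bilip C (R f)" if "f \<in> F" for f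
    using R_inverse[of f] that F(2) by (intro invertible_bilip[of _ "matrix_inv (R f)"]) auto
  then obtain Cf where Cf: "\<And>f. f \<in> F \<Longrightarrow> Cf f \<ge> 1 \<and> bilip (Cf f) (R f)" by metis
  define C2 where "C2 = Max (insert 1 (Cf ` F))"
  have C2: "C2 \<ge> 1" unfolding C2_def using F(1) by (intro Max_ge) auto
  have C2f: "bilip C2 (R f)" if "f \<in> F" for f
  proof -
    have "Cf f \<le> C2" unfolding C2_def using F(1) that by (intro Max_ge) auto
    then show "bilip C2 (R f)" using Cf[OF that] bilip_mono by blast
  qed
  define M where "M = (\<Sum>j<CARD('n) - 1. c j)"
  have M: "M \<ge> 0" unfolding M_def using c by (intro sum_nonneg) auto
  \<comment> \<open>The bound of \<open>phi_close\<close> for a coordinatewise error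
    \<open>2 * ln (max C1 C2)\<close>: \<open>C1\<close> is the distortion of the eigenbases,
    \<open>C2\<close> that of the finitely many right multipliers.\<close>
  define C where "C = M * (2 * (2 * ln (max C1 C2)))"
  have lnC: "2 * ln C1 \<le> 2 * ln (max C1 C2)" "2 * ln C2 \<le> 2 * ln (max C1 C2)" "ln (max C1 C2) \<ge> 0" using C1(1) C2 by auto
  have C0: "C \<ge> 0" unfolding C_def using M lnC(3) by simp
  obtain j where j: "Suc j < CARD('n)" "c j > 0" using positive_coefficient by blast
  obtain N where N: "N \<ge> 0" "\<forall>\<eta>\<in>\<Union>\<Gamma>. sep K \<eta> \<longrightarrow>
     finite {r. \<exists>h\<in>\<Union>\<Gamma>. r = h ** \<eta> ** matrix_inv h \<and> sep K r} \<and>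
     real (card {r. \<exists>h\<in>\<Union>\<Gamma>. r = h ** \<eta> ** matrix_inv h \<and> sep K r}) \<le>
       N * (1 + (ln (eigenvalue_moduli (R \<eta>) ! j) - ln (eigenvalue_moduli (R \<eta>) ! Suc j)))"
    using separated_conjugates_bound[OF j(1)] by blast
  have "infinite \<Gamma>"
  proof
    assume "finite \<Gamma>"
    then have "finite (\<Union>\<Gamma>)" using finite_PSL_elem car by blast
    then show False using infinite_G by blast
  qed
  moreover have "\<bar>?\<kappa> X - ?\<nu> X\<bar> \<le> C" if X: "X \<in> ?Sp" for X
  proof -
    have X1: "X \<in> \<Gamma>" "sep K (psl_lift X)" using X by auto
    obtain a b l where e: "eigpair (psl_lift X) a b l" using X1(2) by (auto simp: sep_def)
    show ?thesis unfolding C_def M_def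
    proof (rule phi_close[OF cartan_proj_subspace[OF X1(1)] jordan_proj_subspace[OF X1(1) e]])
      fix k assume k: "k < CARD('n)"
      have "\<bar>ln (singular_values (R (psl_lift X)) ! k) - ln (eigenvalue_moduli (R (psl_lift X)) ! k)\<bar> \<le> 2 * ln C1"
        using C1(2) lift(2)[OF X1(1)] X1(2) k by blast
      then have "\<bar>cartan_proj (\<rho> X) k - jordan_proj (\<rho> X) k\<bar> \<le> 2 * ln C1"
        using k by (simp add: cartan_proj_def jordan_proj_def lift(3)[OF X1(1)])
      then show "\<bar>cartan_proj (\<rho> X) k - jordan_proj (\<rho> X) k\<bar> \<le> 2 * ln (max C1 C2)" using lnC(1) by linarith
    qed
  qed
  moreover have "\<exists>Y\<in>?Sp. conj_class \<Gamma> Y = conj_class \<Gamma> X \<and> ?\<nu> Y = ?\<nu> X" if X: "X \<in> ?H" for X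
  proof -
    have X1: "X \<in> \<Gamma>" "hyperbolic X" using X by auto
    obtain h where h: "h \<in> \<Union>\<Gamma>" "sep K2 (h ** psl_lift X ** matrix_inv h)"
      using K2 lift(2)[OF X1(1)] hyperbolic_iff[OF X1(1)] X1(2) by blast
    define g where "g = cl h"
    have g: "g \<in> \<Gamma>" "h \<in> g" unfolding g_def by (rule cl_G[OF h(1)])+
    let ?Y = "g \<otimes>\<^bsub>PSL\<^esub> X \<otimes>\<^bsub>PSL\<^esub> inv\<^bsub>PSL\<^esub> g"
    have Y: "?Y \<in> \<Gamma>" using X1 g sg by (intro subgroup.m_closed subgroup.m_inv_closed)
    have "h ** psl_lift X ** matrix_inv h \<in> ?Y"
      using car g X1 lift(1) by (intro PSL_mem_mult PSL_mem_inv P.m_closed P.inv_closed) auto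
    then have "sep K (psl_lift ?Y)" by (rule sep_lift[OF Y _ sepK(2)[OF h(2)]])
    then show ?thesis using Y conj_class_conj[OF X1(1) g(1)] jordan_proj_conj[OF X1 g(1)] by (intro bexI[of _ ?Y]) auto
  qed
  moreover have "inj_on (\<lambda>X. X \<otimes>\<^bsub>PSL\<^esub> cl f) \<Gamma>" if f: "f \<in> F" for f
  proof (rule inj_onI)
    fix X Y assume "X \<in> \<Gamma>" "Y \<in> \<Gamma>" "X \<otimes>\<^bsub>PSL\<^esub> cl f = Y \<otimes>\<^bsub>PSL\<^esub> cl f"
    moreover have "cl f \<in> carrier PSL" using cl_G(1) car F(2) f by blast
    ultimately show "X = Y" using car P.right_cancel by metis
  qed
  moreover have "\<exists>f\<in>F. X \<otimes>\<^bsub>PSL\<^esub> cl f \<in> ?Sp \<and> ?\<kappa> (X \<otimes>\<^bsub>PSL\<^esub> cl f) \<le> ?\<kappa> X + C" if X: "X \<in> \<Gamma>" for X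
  proof -
    let ?A = "psl_lift X"
    obtain f where f: "f \<in> F" "sep K1 (?A ** f)" using F(3) lift(2)[OF X] by blast
    have fG: "f \<in> \<Union>\<Gamma>" using f F(2) by blast
    let ?Y = "X \<otimes>\<^bsub>PSL\<^esub> cl f"
    have Y: "?Y \<in> \<Gamma>" by (rule subgroup.m_closed[OF sg X cl_G(1)[OF fG]])
    have AY: "?A ** f \<in> ?Y" using car X lift(1) cl_G[OF fG] by (intro PSL_mem_mult) auto
    have s: "sep K (psl_lift ?Y)" by (rule sep_lift[OF Y AY sepK(1)[OF f(2)]])
    have RY: "psl_lift (\<rho> ?Y) = R (?A ** f)" using cl_mem[OF Y AY] by simp
    have "singular_values (R (?A ** f)) = singular_values (R ?A ** R f)"
      using R_mult[OF lift(2)[OF X] fG] by (elim disjE) simp_all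
    \<comment> \<open>Right multiplication by \<open>R f\<close> is treated as two-sided
      multiplication with left factor \<open>mat 1\<close>.\<close>
    moreover have "bilip C2 (mat 1 :: real^'n^'n)"
    proof -
      have "norm x \<le> C2 * norm x" for x :: "real^'n" using C2 by (simp add: mult_le_cancel_right1)
      then show ?thesis by (simp add: bilip_def)
    qed
    ultimately have close: "\<bar>ln (singular_values (R (?A ** f)) ! k) - ln (singular_values (R ?A) ! k)\<bar> \<le> 2 * ln C2" if "k < CARD('n)" for k
      using ln_singular_values_close[OF that _ _ C2f[OF f(1)] C2, of "R ?A" "mat 1"] R_det[OF lift(2)[OF X]] by simp
    have "\<bar>?\<kappa> ?Y - ?\<kappa> X\<bar> \<le> C" unfolding C_def M_def
    proof (rule phi_close[OF cartan_proj_subspace[OF Y] cartan_proj_subspace[OF X]])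
      fix k assume k: "k < CARD('n)"
      have "\<bar>cartan_proj (\<rho> ?Y) k - cartan_proj (\<rho> X) k\<bar> \<le> 2 * ln C2"
        using close[OF k] k unfolding cartan_proj_def RY by (simp add: lift(3)[OF X])
      then show "\<bar>cartan_proj (\<rho> ?Y) k - cartan_proj (\<rho> X) k\<bar> \<le> 2 * ln (max C1 C2)" using lnC(2) by linarith
    qed
    then have "?\<kappa> ?Y \<le> ?\<kappa> X + C" by linarith
    then show ?thesis using f(1) Y s by (intro bexI[of _ f]) auto
  qed
  moreover have "finite {Z \<in> ?Sp. conj_class \<Gamma> Z = conj_class \<Gamma> Y} \<and>
      real (card {Z \<in> ?Sp. conj_class \<Gamma> Z = conj_class \<Gamma> Y}) \<le> (N * (1 + 1 / c j)) * (1 + ?\<nu> Y)" if Y: "Y \<in> ?Sp" for Y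
  proof -
    have Y1: "Y \<in> \<Gamma>" "sep K (psl_lift Y)" using Y by auto
    let ?\<eta> = "psl_lift Y"
    let ?E = "{r. \<exists>h\<in>\<Union>\<Gamma>. r = h ** ?\<eta> ** matrix_inv h \<and> sep K r}"
    let ?q = "ln (eigenvalue_moduli (R ?\<eta>) ! j) - ln (eigenvalue_moduli (R ?\<eta>) ! Suc j)"
    have E: "finite ?E" "real (card ?E) \<le> N * (1 + ?q)" using N(2) lift(2)[OF Y1(1)] Y1(2) by blast+
    have sub: "{Z \<in> ?Sp. conj_class \<Gamma> Z = conj_class \<Gamma> Y} \<subseteq> cl ` ?E"
    proof
      fix Z assume "Z \<in> {Z \<in> ?Sp. conj_class \<Gamma> Z = conj_class \<Gamma> Y}"
      then have Z: "Z \<in> \<Gamma>" "sep K (psl_lift Z)" "conj_class \<Gamma> Z = conj_class \<Gamma> Y" by auto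
      have "\<one>\<^bsub>PSL\<^esub> \<otimes>\<^bsub>PSL\<^esub> Z \<otimes>\<^bsub>PSL\<^esub> inv\<^bsub>PSL\<^esub> \<one>\<^bsub>PSL\<^esub> = Z" using car[OF Z(1)] by simp
      then have "Z \<in> conj_class \<Gamma> Z" unfolding conj_class_def using subgroup.one_closed[OF sg] by force
      then obtain g where g: "g \<in> \<Gamma>" "Z = g \<otimes>\<^bsub>PSL\<^esub> Y \<otimes>\<^bsub>PSL\<^esub> inv\<^bsub>PSL\<^esub> g" unfolding Z(3) by (auto simp: conj_class_def)
      define r where "r = psl_lift g ** ?\<eta> ** matrix_inv (psl_lift g)"
      have rZ: "r \<in> Z" unfolding r_def g(2)
        using car g(1) Y1(1) lift(1) by (intro PSL_mem_mult PSL_mem_inv P.m_closed P.inv_closed) auto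
      have "r = psl_lift Z \<or> r = - psl_lift Z" by (rule PSL_mem_eq[OF car[OF Z(1)] lift(1)[OF Z(1)] rZ])
      then have "sep K r" using Z(2) sep_uminus by auto
      then have "r \<in> ?E" using lift(2)[OF g(1)] unfolding r_def by blast
      then show "Z \<in> cl ` ?E" using cl_mem[OF Z(1) rZ] by blast
    qed
    have "card {Z \<in> ?Sp. conj_class \<Gamma> Z = conj_class \<Gamma> Y} \<le> card (cl ` ?E)" using E(1) by (intro card_mono[OF _ sub]) simp
    also have "\<dots> \<le> card ?E" by (rule card_image_le[OF E(1)])
    finally have le: "real (card {Z \<in> ?Sp. conj_class \<Gamma> Z = conj_class \<Gamma> Y}) \<le> N * (1 + ?q)" using E(2) by linarith
    obtain a b l where e: "eigpair ?\<eta> a b l" using Y1(2) by (auto simp: sep_def)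
    have q: "c j * ?q \<le> ?\<nu> Y" by (rule jordan_root_le[OF Y1(1) e j(1)])
    have "?q \<ge> 0" using eigenvalue_moduli_decreasing[OF lift(2)[OF Y1(1)] e j(1)] by simp
    then have \<nu>0: "?\<nu> Y \<ge> 0" using q j(2) by (meson less_imp_le mult_nonneg_nonneg order_trans)
    have "?q \<le> ?\<nu> Y / c j" using q j(2) by (simp add: pos_le_divide_eq mult.commute)
    then have "1 + ?q \<le> 1 + ?\<nu> Y / c j" by (rule add_left_mono)
    also have "\<dots> \<le> (1 + 1 / c j) * (1 + ?\<nu> Y)" using j(2) \<nu>0 by (simp add: distrib_left distrib_right)
    finally have "N * (1 + ?q) \<le> N * ((1 + 1 / c j) * (1 + ?\<nu> Y))" using N(1) by (rule mult_left_mono)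
    then show ?thesis using le finite_subset[OF sub] E(1) by (simp add: mult.assoc)
  qed
  moreover have "N * (1 + 1 / c j) \<ge> 0" using N(1) j(2) by simp
  ultimately have main: "Inf (ereal ` {s. (\<lambda>X. exp (- s * ?\<kappa> X)) summable_on \<Gamma>}) =
      Limsup at_top (\<lambda>T::real. log_card (conj_class \<Gamma> ` {X \<in> ?H. ?\<nu> X \<le> T}) / ereal T)"
    using SpH C0 F(1) cartan_nonneg
    by (intro exponents_agree[where Sp = ?Sp and C = C and F = F and \<tau> = "\<lambda>f X. X \<otimes>\<^bsub>PSL\<^esub> cl f" and N = "N * (1 + 1 / c j)"]) auto
  have "(\<lambda>g. exp (- s * \<phi> (cartan_proj g))) summable_on \<rho> ` \<Gamma> \<longleftrightarrow> (\<lambda>X. exp (- s * ?\<kappa> X)) summable_on \<Gamma>" for s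
    by (simp add: summable_on_reindex[OF rho_inj] comp_def)
  moreover have "{X \<in> ?H. ?\<nu> X \<le> T} = {g \<in> \<Gamma>. hyperbolic g \<and> \<phi> (jordan_proj (\<rho> g)) \<le> T}" for T by auto
  ultimately show ?thesis using main by (simp only: critical_exponent_def entropy_def)
qed

end

theorem proposition1p8:
  fixes \<Gamma> :: "(real^2^2) set set"
    and \<rho> :: "(real^2^2) set \<Rightarrow> (real^'d^'d) set"
    and \<phi> :: "(nat \<Rightarrow> real) \<Rightarrow> real"
  assumes "fuchsian \<Gamma>" and "geometrically_finite \<Gamma>"
    and "\<phi> \<in> positive_functionals CARD('d)"
    and "hitchin \<Gamma> \<rho>"
  shows "critical_exponent \<phi> \<Gamma> \<rho> = entropy \<phi> \<Gamma> \<rho>"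
proof -
  obtain S0 where S0: "finite S0" "S0 \<subseteq> carrier PSL" "\<Gamma> = generate PSL S0"
    using assms(2) by (auto simp: geometrically_finite_def)
  obtain \<xi> :: "complex \<Rightarrow> 'd flag" where \<rho>: "\<rho> \<in> hom (PSL\<lparr>carrier := \<Gamma>\<rparr>) PSL"
    and \<xi>: "continuous_map (top_of_set (limit_set \<Gamma>)) flag_topology \<xi>" "positive_map (limit_set \<Gamma>) \<xi>"
      "\<forall>g\<in>\<Gamma>. \<forall>x\<in>limit_set \<Gamma>. \<xi> (disc_act g x) = flag_act (psl_lift (\<rho> g)) (\<xi> x)"
    using assms(4) by (auto simp: hitchin_def)
  obtain c where c: "\<forall>j<CARD('d) - 1. c j \<ge> 0"
      "\<forall>A\<in>cartan_subspace CARD('d). \<phi> A = (\<Sum>j<CARD('d) - 1. c j * simple_root j A)"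
      "\<exists>A\<in>cartan_subspace CARD('d). \<phi> A \<noteq> 0"
    using assms(3) unfolding positive_functionals_def by blast
  have sg: "subgroup \<Gamma> PSL" using assms(1) by (simp add: fuchsian_def)
  interpret psl_rep \<Gamma> "\<Union>S0" "{v. v \<noteq> 0 \<and> pt v \<in> limit_set \<Gamma>}" "\<lambda>v. \<xi> (pt v)" \<rho> \<phi> c
    by (intro psl_rep.intro psl_rep_axioms.intro hitchin_rep_of_hitchin[OF assms(1) S0 \<rho> \<xi>] sg \<rho>) (use c in auto)
  show ?thesis by (rule exponent_eq_entropy)
qed

end
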